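(* Let $\pi\colon E\to X$ be a smooth fiber bundle (of finite dimensional manifolds). Then the family $(\mathsf{J}^i(\pi),\pi_{i,j},\pi_{i,\infty})$, indexed by $i\le j$ in $\mathbb{Z}_{\ge-1}$, is a smooth projective representation of the locally $\mathbb{R}$-ringed space $(\mathsf{J}^\infty(\pi),\mathcal{C}^\infty_\pi)$. In particular, equipped with the corresponding pfd structure, $(\mathsf{J}^\infty(\pi),\mathcal{C}^\infty_\pi)$ is canonically a smooth profinite dimensional manifold (called the manifold of $\infty$-jets given by $\pi$).
   Context: Jets. For $p\in X$ and $k\in\mathbb{N}$, two local smooth sections of $\pi$ around $p$ are $k$-equivalent at $p$ if in fibered charts of $\pi$ all their partial derivatives at $p$ of orders $0,\dots,k$ agree; $\mathsf{j}^k_p\psi$ is the class of $\psi$ and $\mathsf{J}^k(\pi)$ the set of all $k$-jets with its standard manifold structure (coordinates: base coordinates and all partial derivatives up to order $k$). $\mathsf{J}^0(\pi)=E$, $\mathsf{J}^{-1}(\pi):=X$, $\mathsf{j}^{-1}_p\psi:=p$. For $i\le j$, $\pi_{i,j}\colon\mathsf{J}^j(\pi)\to\mathsf{J}^i(\pi)$, $\mathsf{j}^j_p\psi\mapsto\mathsf{j}^i_p\psi$ (so $\pi_{-1,0}=\pi$). Two local sections are $\infty$-equivalent at $p$ if they agree at $p$ together with all partial derivatives of all orders in fibered charts; $\mathsf{j}^\infty_p\psi$ is the corresponding class and $\mathsf{J}^\infty(\pi)=\bigcup_{p\in X}\{\mathsf{j}^\infty_p\psi\mid\psi\text{ a local smooth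 section around }p\}$. For $i\in\mathbb{Z}_{\ge-1}$ let $\pi_{i,\infty}\colon\mathsf{J}^\infty(\pi)\to\mathsf{J}^i(\pi)$, $\mathsf{j}^\infty_p\psi\mapsto\mathsf{j}^i_p\psi$. $\mathsf{J}^\infty(\pi)$ carries the initial topology with respect to all $\pi_{i,\infty}$. $\mathcal{C}^\infty_\pi$ is the sheaf whose sections over an open $U$ are the continuous $f\colon U\to\mathbb{R}$ such that for every $x\in U$ there are $i\in\mathbb{Z}_{\ge-1}$, an open $U_i\subset\mathsf{J}^i(\pi)$ and $f_i\in\mathcal{C}^\infty(U_i)$ with $x\in\pi_{i,\infty}^{-1}(U_i)\subset U$ and $f=f_i\circ\pi_{i,\infty}$ on $\pi_{i,\infty}^{-1}(U_i)$. Profinite dimensional manifolds. A smooth projective system is a family $(M_i,\mu_{ij})$ (indexed by $\mathbb{N}$ or a set order-isomorphic to it, such as $\mathbb{Z}_{\ge-1}$) of manifolds and surjective submersions $\mu_{ij}\colon M_j\to M_i$, $i\le j$, with $\mu_{ii}=\mathrm{id}$ and $\mu_{ij}\circ\mu_{jk}=\mu_{ik}$. A smooth projective representation of a commutative locally $\mathbb{R}$-ringed space $(M,\mathcal{C}^\infty_M)$ is a smooth projective system $(M_i,\mu_{ij})$ together with continuous maps $\mu_i\colon M\to M_i$ such that (i) the topological space $M$ with the maps $\mu_i$ is a projective limit of $(M_i,\mu_{ij})$ in the category of topological spaces; (ii) for open $U\subset M$, $\mathcal{C}^\infty_M(U)$ is the set of continuous $f\colon U\to\mathbb{R}$ such that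 for every $p\in U$ there are $i$, an open $U_i\subset M_i$ and $f_i\in\mathcal{C}^\infty(U_i)$ with $p\in\mu_i^{-1}(U_i)\subset U$ and $f=f_i\circ\mu_i$ on $\mu_i^{-1}(U_i)$. Two representations $(M_i,\mu_{ij},\mu_i)$, $(M'_a,\mu'_{ab},\mu'_a)$ are equivalent if there are strictly increasing maps $\varphi,\psi$ of the index sets and surjective submersions $F_a\colon M_{\varphi(a)}\to M'_a$, $G_i\colon M'_{\psi(i)}\to M_i$ commuting with the transition maps such that $G_i\circ F_{\psi(i)}=\mu_{i\,\varphi(\psi(i))}$, $F_a\circ G_{\varphi(a)}=\mu'_{a\,\psi(\varphi(a))}$, $\mu_i=G_i\circ\mu'_{\psi(i)}$, $\mu'_a=F_a\circ\mu_{\varphi(a)}$. An equivalence class of representations is a pfd structure; a profinite dimensional manifold is a commutative locally $\mathbb{R}$-ringed space with a pfd structure. *)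

theory Defs
  imports "HOL-Analysis.Analysis" "HOL-Library.Extended_Nat" "HOL-Algebra.Ideal" "HOL-Algebra.Module"
begin

section \<open>Smooth functions on open subsets of Cartesian space\<close>

text \<open>
  The space of real \<open>n\<close>-tuples is the library's \<^const>\<open>Euclidean_space\<close>: the functions
  \<open>x :: nat \<Rightarrow> real\<close> with \<open>x i = 0\<close> for all \<open>i \<ge> n\<close>. In this way Cartesian spaces of all
  dimensions live on a single type, which is needed because the dimension of the jet
  manifolds grows with the order.
\<close>

definition partial_deriv :: "nat \<Rightarrow> ((nat \<Rightarrow> real) \<Rightarrow> real) \<Rightarrow> (nat \<Rightarrow> real) \<Rightarrow> real" where
  "partial_deriv i f x = deriv (\<lambda>t. f (x(i := t))) (x i)"

text \<open>\<open>iterated_partial [i\<^sub>1, \<dots>, i\<^sub>r] f\<close> is the derivative of order \<open>r\<close> in the directions \<open>i\<^sub>1, \<dots>, i\<^sub>r\<close>.\<close>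

definition iterated_partial :: "nat list \<Rightarrow> ((nat \<Rightarrow> real) \<Rightarrow> real) \<Rightarrow> (nat \<Rightarrow> real) \<Rightarrow> real" where
  "iterated_partial I f = foldr partial_deriv I f"

definition smooth_real_on :: "nat \<Rightarrow> (nat \<Rightarrow> real) set \<Rightarrow> ((nat \<Rightarrow> real) \<Rightarrow> real) \<Rightarrow> bool" where
  "smooth_real_on n S f \<longleftrightarrow>
     (\<forall>I. set I \<subseteq> {..<n} \<longrightarrow>
        continuous_map (subtopology (Euclidean_space n) S) euclideanreal (iterated_partial I f) \<and>
        (\<forall>i<n. \<forall>x\<in>S. (\<lambda>t. iterated_partial I f (x(i := t))) field_differentiable at (x i)))"


section \<open>Finite dimensional manifolds\<close>

type_synonym 'p chart = "'p set \<times> ('p \<Rightarrow> nat \<Rightarrow> real)"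

record 'p manifold =
  mdim :: nat
  mtop :: "'p topology"
  atlas :: "'p chart set"

abbreviation points :: "'p manifold \<Rightarrow> 'p set" where
  "points M \<equiv> topspace (mtop M)"

definition topological_chart :: "'p manifold \<Rightarrow> 'p chart \<Rightarrow> bool" where
  "topological_chart M = (\<lambda>(U, \<phi>).
     openin (mtop M) U \<and> openin (Euclidean_space (mdim M)) (\<phi> ` U) \<and>
     homeomorphic_map (subtopology (mtop M) U) (subtopology (Euclidean_space (mdim M)) (\<phi> ` U)) \<phi>)"

definition smooth_transition :: "nat \<Rightarrow> 'p chart \<Rightarrow> 'p chart \<Rightarrow> bool" where
  "smooth_transition n = (\<lambda>(U, \<phi>) (V, \<psi>).
     \<forall>i<n. smooth_real_on n (\<phi> ` (U \<inter> V)) (\<lambda>x. \<psi> (inv_into U \<phi> x) i))"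

definition compatible_charts :: "nat \<Rightarrow> 'p chart \<Rightarrow> 'p chart \<Rightarrow> bool" where
  "compatible_charts n c d \<longleftrightarrow> smooth_transition n c d \<and> smooth_transition n d c"

definition smooth_manifold :: "'p manifold \<Rightarrow> bool" where
  "smooth_manifold M \<longleftrightarrow>
     Hausdorff_space (mtop M) \<and> second_countable (mtop M) \<and>
     (\<forall>c\<in>atlas M. topological_chart M c) \<and>
     \<Union> (fst ` atlas M) = points M \<and>
     (\<forall>c\<in>atlas M. \<forall>d\<in>atlas M. compatible_charts (mdim M) c d)"

text \<open>The maximal atlas, i.e. all charts of the smooth structure defined by \<open>atlas M\<close>.\<close>

definition charts :: "'p manifold \<Rightarrow> 'p chart set" where
  "charts M = {c. topological_chart M c \<and> (\<forall>d\<in>atlas M. compatible_charts (mdim M) c d)}"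

definition open_submanifold :: "'p manifold \<Rightarrow> 'p set \<Rightarrow> 'p manifold" where
  "open_submanifold M U =
     \<lparr>mdim = mdim M, mtop = subtopology (mtop M) U, atlas = {(V \<inter> U, \<phi>) | V \<phi>. (V, \<phi>) \<in> atlas M}\<rparr>"

definition product_manifold :: "'p manifold \<Rightarrow> 'q manifold \<Rightarrow> ('p \<times> 'q) manifold" where
  "product_manifold M N =
     \<lparr>mdim = mdim M + mdim N,
      mtop = prod_topology (mtop M) (mtop N),
      atlas = {(U \<times> V, \<lambda>(x, y) i. if i < mdim M then \<phi> x i else \<psi> y (i - mdim M)) | U \<phi> V \<psi>.
                 (U, \<phi>) \<in> atlas M \<and> (V, \<psi>) \<in> atlas N}\<rparr>"

text \<open>The manifold obtained from \<open>M\<close> by renaming its points along an injective function.\<close>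

definition transport_manifold :: "('p \<Rightarrow> 'q) \<Rightarrow> 'p manifold \<Rightarrow> 'q manifold" where
  "transport_manifold h M =
     \<lparr>mdim = mdim M,
      mtop = pullback_topology (h ` points M) (inv_into UNIV h) (mtop M),
      atlas = {(h ` U, \<phi> \<circ> inv_into UNIV h) | U \<phi>. (U, \<phi>) \<in> atlas M}\<rparr>"

text \<open>The elements of \<open>C\<^sup>\<infinity>(U)\<close> for an open subset \<open>U\<close> of \<open>M\<close>.\<close>

definition smooth_function_on :: "'p manifold \<Rightarrow> 'p set \<Rightarrow> ('p \<Rightarrow> real) \<Rightarrow> bool" where
  "smooth_function_on M U f \<longleftrightarrow>
     (\<forall>(V, \<phi>)\<in>charts M. smooth_real_on (mdim M) (\<phi> ` (V \<inter> U)) (\<lambda>x. f (inv_into V \<phi> x)))"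

definition smooth_map :: "'p manifold \<Rightarrow> 'q manifold \<Rightarrow> ('p \<Rightarrow> 'q) \<Rightarrow> bool" where
  "smooth_map M N f \<longleftrightarrow>
     continuous_map (mtop M) (mtop N) f \<and>
     (\<forall>(U, \<phi>)\<in>charts M. \<forall>(V, \<psi>)\<in>charts N. \<forall>i<mdim N.
        smooth_real_on (mdim M) (\<phi> ` (U \<inter> f -` V)) (\<lambda>x. \<psi> (f (inv_into U \<phi> x)) i))"

definition diffeomorphism :: "'p manifold \<Rightarrow> 'q manifold \<Rightarrow> ('p \<Rightarrow> 'q) \<Rightarrow> bool" where
  "diffeomorphism M N f \<longleftrightarrow>
     smooth_map M N f \<and>
     (\<exists>g. smooth_map N M g \<and> (\<forall>x\<in>points M. g (f x) = x) \<and> (\<forall>y\<in>points N. f (g y) = y))"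

text \<open>A smooth map is a submersion if its differential, i.e. the Jacobian matrix in charts, is
  surjective at every point.\<close>

definition submersion :: "'p manifold \<Rightarrow> 'q manifold \<Rightarrow> ('p \<Rightarrow> 'q) \<Rightarrow> bool" where
  "submersion M N f \<longleftrightarrow>
     smooth_map M N f \<and>
     (\<forall>(U, \<phi>)\<in>charts M. \<forall>(V, \<psi>)\<in>charts N. \<forall>p\<in>U \<inter> f -` V.
        \<forall>w::nat \<Rightarrow> real. \<exists>v::nat \<Rightarrow> real. \<forall>i<mdim N.
          (\<Sum>j<mdim M. partial_deriv j (\<lambda>x. \<psi> (f (inv_into U \<phi> x)) i) (\<phi> p) * v j) = w i)"

definition surjective_submersion :: "'p manifold \<Rightarrow> 'q manifold \<Rightarrow> ('p \<Rightarrow> 'q) \<Rightarrow> bool" where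
  "surjective_submersion M N f \<longleftrightarrow> submersion M N f \<and> f ` points M = points N"


section \<open>Smooth fiber bundles, local sections and jets\<close>

definition smooth_fiber_bundle ::
    "'e manifold \<Rightarrow> 'x manifold \<Rightarrow> 'f manifold \<Rightarrow> ('e \<Rightarrow> 'x) \<Rightarrow> bool" where
  "smooth_fiber_bundle E X F \<pi> \<longleftrightarrow>
     smooth_manifold E \<and> smooth_manifold X \<and> smooth_manifold F \<and>
     smooth_map E X \<pi> \<and> \<pi> ` points E = points X \<and>
     (\<forall>p\<in>points X. \<exists>U \<tau>. openin (mtop X) U \<and> p \<in> U \<and>
        diffeomorphism (open_submanifold E (points E \<inter> \<pi> -` U))
                       (product_manifold (open_submanifold X U) F) \<tau> \<and>
        (\<forall>e\<in>points E \<inter> \<pi> -` U. fst (\<tau> e) = \<pi> e))"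

text \<open>A fibered chart \<open>(U, u, V, v)\<close>: the first \<open>dim X\<close> coordinates of \<open>v\<close> are the base
  coordinates \<open>u \<circ> \<pi>\<close>, the remaining ones are the fiber coordinates.\<close>

type_synonym ('x, 'e) fchart = "'x set \<times> ('x \<Rightarrow> nat \<Rightarrow> real) \<times> 'e set \<times> ('e \<Rightarrow> nat \<Rightarrow> real)"

definition fibered_charts ::
    "'e manifold \<Rightarrow> 'x manifold \<Rightarrow> ('e \<Rightarrow> 'x) \<Rightarrow> ('x, 'e) fchart set" where
  "fibered_charts E X \<pi> = {(U, u, V, v).
     (U, u) \<in> charts X \<and> (V, v) \<in> charts E \<and> \<pi> ` V \<subseteq> U \<and>
     (\<forall>e\<in>V. \<forall>i<mdim X. v e i = u (\<pi> e) i)}"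

text \<open>A local section is stored together with its open domain.\<close>

type_synonym ('x, 'e) lsection = "'x set \<times> ('x \<Rightarrow> 'e)"

definition sections_around ::
    "'e manifold \<Rightarrow> 'x manifold \<Rightarrow> ('e \<Rightarrow> 'x) \<Rightarrow> 'x \<Rightarrow> ('x, 'e) lsection set" where
  "sections_around E X \<pi> p = {(W, s).
     openin (mtop X) W \<and> p \<in> W \<and> s \<in> extensional W \<and>
     smooth_map (open_submanifold X W) E s \<and> (\<forall>x\<in>W. \<pi> (s x) = x)}"

text \<open>\<open>section_coord m c s a\<close> is the \<open>a\<close>-th fiber coordinate of the section \<open>s\<close> as a function of the
  \<open>m\<close> base coordinates.\<close>

definition section_coord ::
    "nat \<Rightarrow> ('x, 'e) fchart \<Rightarrow> ('x, 'e) lsection \<Rightarrow> nat \<Rightarrow> (nat \<Rightarrow> real) \<Rightarrow> real" where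
  "section_coord m = (\<lambda>(U, u, V, v) (W, s) a x. v (s (inv_into U u x)) (m + a))"

definition fiber_dim :: "'e manifold \<Rightarrow> 'x manifold \<Rightarrow> nat" where
  "fiber_dim E X = mdim E - mdim X"

definition jet_equivalent ::
    "'e manifold \<Rightarrow> 'x manifold \<Rightarrow> ('e \<Rightarrow> 'x) \<Rightarrow> enat \<Rightarrow> 'x \<Rightarrow>
     ('x, 'e) lsection \<Rightarrow> ('x, 'e) lsection \<Rightarrow> bool" where
  "jet_equivalent E X \<pi> k p s t \<longleftrightarrow>
     snd s p = snd t p \<and>
     (\<forall>(U, u, V, v)\<in>fibered_charts E X \<pi>. snd s p \<in> V \<longrightarrow>
        (\<forall>I a. set I \<subseteq> {..<mdim X} \<and> enat (length I) \<le> k \<and> a < fiber_dim E X \<longrightarrow>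
           iterated_partial I (section_coord (mdim X) (U, u, V, v) s a) (u p) =
           iterated_partial I (section_coord (mdim X) (U, u, V, v) t a) (u p)))"

text \<open>The class of a section under \<open>k\<close>-equivalence at \<open>p\<close>, with its base point \<open>p\<close> recorded.\<close>

type_synonym ('x, 'e) jet_class = "'x \<times> ('x, 'e) lsection set"

definition jet_class ::
    "'e manifold \<Rightarrow> 'x manifold \<Rightarrow> ('e \<Rightarrow> 'x) \<Rightarrow> enat \<Rightarrow> 'x \<Rightarrow> ('x, 'e) lsection \<Rightarrow> ('x, 'e) jet_class"
  where
  "jet_class E X \<pi> k p s = (p, {t \<in> sections_around E X \<pi> p. jet_equivalent E X \<pi> k p s t})"

text \<open>The jet spaces of all orders \<open>\<ge> -1\<close> live on one type. The constructors \<open>Base\<close> and \<open>Total\<close>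
  implement the conventions that the jet spaces of orders \<open>-1\<close> and \<open>0\<close> are \<open>X\<close> and \<open>E\<close>.\<close>

datatype ('x, 'e) jet = Base 'x | Total 'e | Jet "('x, 'e) jet_class"

definition jet_at ::
    "'e manifold \<Rightarrow> 'x manifold \<Rightarrow> ('e \<Rightarrow> 'x) \<Rightarrow> int \<Rightarrow> 'x \<Rightarrow> ('x, 'e) lsection \<Rightarrow> ('x, 'e) jet" where
  "jet_at E X \<pi> k p s =
     (if k < 0 then Base p
      else if k = 0 then Total (snd s p)
      else Jet (jet_class E X \<pi> (enat (nat k)) p s))"

text \<open>The maps sending the \<open>j\<close>-jet (the \<open>\<infinity>\<close>-jet) of a section at \<open>p\<close> to its \<open>i\<close>-jet at \<open>p\<close>.\<close>

definition jet_projection ::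
    "'e manifold \<Rightarrow> 'x manifold \<Rightarrow> ('e \<Rightarrow> 'x) \<Rightarrow> int \<Rightarrow> int \<Rightarrow> ('x, 'e) jet \<Rightarrow> ('x, 'e) jet" where
  "jet_projection E X \<pi> i j z =
     (let (p, s) = (SOME (p, s). p \<in> points X \<and> s \<in> sections_around E X \<pi> p \<and> z = jet_at E X \<pi> j p s)
      in jet_at E X \<pi> i p s)"

definition infinite_jet_projection ::
    "'e manifold \<Rightarrow> 'x manifold \<Rightarrow> ('e \<Rightarrow> 'x) \<Rightarrow> int \<Rightarrow> ('x, 'e) jet_class \<Rightarrow> ('x, 'e) jet" where
  "infinite_jet_projection E X \<pi> i z =
     (let (p, s) = (SOME (p, s). p \<in> points X \<and> s \<in> sections_around E X \<pi> p \<and> z = jet_class E X \<pi> \<infinity> p s)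
      in jet_at E X \<pi> i p s)"


section \<open>The manifolds of finite order jets\<close>

text \<open>Multi-indices of order \<open>r\<close> in \<open>m\<close> variables are encoded as sorted lists of directions, so that
  every mixed partial derivative is counted once. The fiber coordinates \<open>u\<^sup>a\<^sub>I\<close> of a jet of order \<open>k\<close>
  are enumerated by increasing order of \<open>I\<close>.\<close>

definition multi_indices :: "nat \<Rightarrow> nat \<Rightarrow> nat list list" where
  "multi_indices m r = filter sorted (List.n_lists r [0..<m])"

definition jet_coord_list :: "nat \<Rightarrow> nat \<Rightarrow> nat \<Rightarrow> (nat list \<times> nat) list" where
  "jet_coord_list m n k = [(I, a). r \<leftarrow> [0..<Suc k], I \<leftarrow> multi_indices m r, a \<leftarrow> [0..<n]]"

definition jet_dim :: "'e manifold \<Rightarrow> 'x manifold \<Rightarrow> nat \<Rightarrow> nat" where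
  "jet_dim E X k = mdim X + length (jet_coord_list (mdim X) (fiber_dim E X) k)"

definition jet_chart_domain ::
    "'e manifold \<Rightarrow> 'x manifold \<Rightarrow> ('e \<Rightarrow> 'x) \<Rightarrow> nat \<Rightarrow> ('x, 'e) fchart \<Rightarrow> ('x, 'e) jet set" where
  "jet_chart_domain E X \<pi> k = (\<lambda>(U, u, V, v).
     {jet_at E X \<pi> (int k) p s | p s. p \<in> points X \<and> s \<in> sections_around E X \<pi> p \<and> snd s p \<in> V})"

definition jet_chart_map ::
    "'e manifold \<Rightarrow> 'x manifold \<Rightarrow> ('e \<Rightarrow> 'x) \<Rightarrow> nat \<Rightarrow> ('x, 'e) fchart \<Rightarrow> ('x, 'e) jet \<Rightarrow> nat \<Rightarrow> real" where
  "jet_chart_map E X \<pi> k = (\<lambda>(U, u, V, v) z.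
     let (p, s) = (SOME (p, s). p \<in> points X \<and> s \<in> sections_around E X \<pi> p \<and> z = jet_at E X \<pi> (int k) p s)
     in (\<lambda>i. if i < mdim X then u p i
             else if i < jet_dim E X k then
               (let (I, a) = jet_coord_list (mdim X) (fiber_dim E X) k ! (i - mdim X)
                in iterated_partial I (section_coord (mdim X) (U, u, V, v) s a) (u p))
             else 0))"

definition jet_atlas ::
    "'e manifold \<Rightarrow> 'x manifold \<Rightarrow> ('e \<Rightarrow> 'x) \<Rightarrow> nat \<Rightarrow> ('x, 'e) jet chart set" where
  "jet_atlas E X \<pi> k =
     {(jet_chart_domain E X \<pi> k c, jet_chart_map E X \<pi> k c) | c. c \<in> fibered_charts E X \<pi>}"

definition atlas_topology :: "nat \<Rightarrow> 'p chart set \<Rightarrow> 'p topology" where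
  "atlas_topology n A =
     topology_generated_by {{x \<in> U. \<phi> x \<in> W} | U \<phi> W. (U, \<phi>) \<in> A \<and> openin (Euclidean_space n) W}"

definition jet_manifold ::
    "'e manifold \<Rightarrow> 'x manifold \<Rightarrow> ('e \<Rightarrow> 'x) \<Rightarrow> int \<Rightarrow> ('x, 'e) jet manifold" where
  "jet_manifold E X \<pi> k =
     (if k < 0 then transport_manifold Base X
      else if k = 0 then transport_manifold Total E
      else \<lparr>mdim = jet_dim E X (nat k),
            mtop = atlas_topology (jet_dim E X (nat k)) (jet_atlas E X \<pi> (nat k)),
            atlas = jet_atlas E X \<pi> (nat k)\<rparr>)"


section \<open>Locally ringed spaces over the real numbers\<close>

definition real_field :: "real ring" where
  "real_field = \<lparr>carrier = UNIV, mult = (*), one = 1, zero = 0, add = (+)\<rparr>"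

record ('p, 's) ringed_space =
  space_top :: "'p topology"
  sections :: "'p set \<Rightarrow> (real, 's) module"
  restr :: "'p set \<Rightarrow> 'p set \<Rightarrow> 's \<Rightarrow> 's"

definition presheaf_of_algebras :: "('p, 's) ringed_space \<Rightarrow> bool" where
  "presheaf_of_algebras M \<longleftrightarrow>
     (\<forall>U. openin (space_top M) U \<longrightarrow> Module.algebra real_field (sections M U)) \<and>
     (\<forall>U V. openin (space_top M) U \<and> openin (space_top M) V \<and> V \<subseteq> U \<longrightarrow>
        restr M U V \<in> ring_hom (sections M U) (sections M V) \<and>
        (\<forall>c. \<forall>s\<in>carrier (sections M U).
           restr M U V (c \<odot>\<^bsub>sections M U\<^esub> s) = c \<odot>\<^bsub>sections M V\<^esub> restr M U V s)) \<and>
     (\<forall>U. openin (space_top M) U \<longrightarrow> (\<forall>s\<in>carrier (sections M U). restr M U U s = s)) \<and>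
     (\<forall>U V W. openin (space_top M) U \<and> openin (space_top M) V \<and> openin (space_top M) W \<and>
        W \<subseteq> V \<and> V \<subseteq> U \<longrightarrow>
        (\<forall>s\<in>carrier (sections M U). restr M V W (restr M U V s) = restr M U W s))"

definition sheaf_of_algebras :: "('p, 's) ringed_space \<Rightarrow> bool" where
  "sheaf_of_algebras M \<longleftrightarrow>
     presheaf_of_algebras M \<and>
     (\<forall>\<U> s. (\<forall>U\<in>\<U>. openin (space_top M) U \<and> s U \<in> carrier (sections M U)) \<and>
        (\<forall>U\<in>\<U>. \<forall>V\<in>\<U>. restr M U (U \<inter> V) (s U) = restr M V (U \<inter> V) (s V)) \<longrightarrow>
        (\<exists>!t. t \<in> carrier (sections M (\<Union>\<U>)) \<and> (\<forall>U\<in>\<U>. restr M (\<Union>\<U>) U t = s U)))"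

definition local_sections_at :: "('p, 's) ringed_space \<Rightarrow> 'p \<Rightarrow> ('p set \<times> 's) set" where
  "local_sections_at M p =
     {(U, s). openin (space_top M) U \<and> p \<in> U \<and> s \<in> carrier (sections M U)}"

definition germ :: "('p, 's) ringed_space \<Rightarrow> 'p \<Rightarrow> 'p set \<Rightarrow> 's \<Rightarrow> ('p set \<times> 's) set" where
  "germ M p U s =
     {(V, t) \<in> local_sections_at M p.
        \<exists>W. openin (space_top M) W \<and> p \<in> W \<and> W \<subseteq> U \<inter> V \<and> restr M U W s = restr M V W t}"

text \<open>In the operations of the stalk all members of the union coincide, since the result does not
  depend on the representatives.\<close>

definition stalk :: "('p, 's) ringed_space \<Rightarrow> 'p \<Rightarrow> ('p set \<times> 's) set ring" where
  "stalk M p =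
     \<lparr>carrier = {germ M p U s | U s. (U, s) \<in> local_sections_at M p},
      mult = (\<lambda>A B. \<Union>(U, s)\<in>A. \<Union>(V, t)\<in>B.
        germ M p (U \<inter> V) (restr M U (U \<inter> V) s \<otimes>\<^bsub>sections M (U \<inter> V)\<^esub> restr M V (U \<inter> V) t)),
      one = germ M p (topspace (space_top M)) \<one>\<^bsub>sections M (topspace (space_top M))\<^esub>,
      zero = germ M p (topspace (space_top M)) \<zero>\<^bsub>sections M (topspace (space_top M))\<^esub>,
      add = (\<lambda>A B. \<Union>(U, s)\<in>A. \<Union>(V, t)\<in>B.
        germ M p (U \<inter> V) (restr M U (U \<inter> V) s \<oplus>\<^bsub>sections M (U \<inter> V)\<^esub> restr M V (U \<inter> V) t))\<rparr>"

definition local_ring :: "('a, 'b) ring_scheme \<Rightarrow> bool" where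
  "local_ring R \<longleftrightarrow> cring R \<and> (\<exists>!I. maximalideal I R)"

definition locally_ringed_space :: "('p, 's) ringed_space \<Rightarrow> bool" where
  "locally_ringed_space M \<longleftrightarrow>
     sheaf_of_algebras M \<and> (\<forall>p\<in>topspace (space_top M). local_ring (stalk M p))"

text \<open>Functions on \<open>U\<close> are represented by elements of \<^term>\<open>extensional U\<close>.\<close>

definition function_algebra :: "'p set \<Rightarrow> ('p \<Rightarrow> real) set \<Rightarrow> (real, 'p \<Rightarrow> real) module" where
  "function_algebra U A =
     \<lparr>carrier = A,
      mult = (\<lambda>f g. \<lambda>x\<in>U. f x * g x), one = (\<lambda>x\<in>U. 1),
      zero = (\<lambda>x\<in>U. 0), add = (\<lambda>f g. \<lambda>x\<in>U. f x + g x),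
      smult = (\<lambda>c f. \<lambda>x\<in>U. c * f x)\<rparr>"


section \<open>Profinite dimensional manifolds\<close>

record ('i, 'm, 'p) projective_rep =
  index :: "'i set"
  level :: "'i \<Rightarrow> 'm manifold"
  trans_map :: "'i \<Rightarrow> 'i \<Rightarrow> 'm \<Rightarrow> 'm"
  proj_map :: "'i \<Rightarrow> 'p \<Rightarrow> 'm"

definition order_isomorphic_to_nat :: "'i::linorder set \<Rightarrow> bool" where
  "order_isomorphic_to_nat I \<longleftrightarrow> (\<exists>f::nat \<Rightarrow> 'i. strict_mono f \<and> range f = I)"

definition smooth_projective_system ::
    "'i::linorder set \<Rightarrow> ('i \<Rightarrow> 'm manifold) \<Rightarrow> ('i \<Rightarrow> 'i \<Rightarrow> 'm \<Rightarrow> 'm) \<Rightarrow> bool" where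
  "smooth_projective_system I M \<mu> \<longleftrightarrow>
     order_isomorphic_to_nat I \<and>
     (\<forall>i\<in>I. smooth_manifold (M i)) \<and>
     (\<forall>i\<in>I. \<forall>j\<in>I. i \<le> j \<longrightarrow> surjective_submersion (M j) (M i) (\<mu> i j)) \<and>
     (\<forall>i\<in>I. \<forall>x\<in>points (M i). \<mu> i i x = x) \<and>
     (\<forall>i\<in>I. \<forall>j\<in>I. \<forall>k\<in>I. i \<le> j \<and> j \<le> k \<longrightarrow> (\<forall>x\<in>points (M k). \<mu> i j (\<mu> j k x) = \<mu> i k x))"

definition projective_cone ::
    "'i::linorder set \<Rightarrow> ('i \<Rightarrow> 'm topology) \<Rightarrow> ('i \<Rightarrow> 'i \<Rightarrow> 'm \<Rightarrow> 'm) \<Rightarrow>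
     'z topology \<Rightarrow> ('i \<Rightarrow> 'z \<Rightarrow> 'm) \<Rightarrow> bool" where
  "projective_cone I T \<mu> Z \<nu> \<longleftrightarrow>
     (\<forall>i\<in>I. continuous_map Z (T i) (\<nu> i)) \<and>
     (\<forall>i\<in>I. \<forall>j\<in>I. i \<le> j \<longrightarrow> (\<forall>z\<in>topspace Z. \<mu> i j (\<nu> j z) = \<nu> i z))"

definition mediating_map ::
    "'i::linorder set \<Rightarrow> 'p topology \<Rightarrow> ('i \<Rightarrow> 'p \<Rightarrow> 'm) \<Rightarrow>
     'z topology \<Rightarrow> ('i \<Rightarrow> 'z \<Rightarrow> 'm) \<Rightarrow> ('z \<Rightarrow> 'p) \<Rightarrow> bool" where
  "mediating_map I P \<mu>p Z \<nu> h \<longleftrightarrow>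
     h \<in> extensional (topspace Z) \<and> continuous_map Z P h \<and>
     (\<forall>i\<in>I. \<forall>z\<in>topspace Z. \<mu>p i (h z) = \<nu> i z)"

text \<open>The universal property of a projective limit in the category of topological spaces. A
  definition cannot quantify over the types on which the test spaces \<open>Z\<close> live; the type
  \<^typ>\<open>'i \<Rightarrow> 'm\<close> of the standard projective limit inside the product suffices, as shown by the lemma
  \<open>projective_limit_universal\<close> below.\<close>

definition projective_limit ::
    "'i::linorder set \<Rightarrow> ('i \<Rightarrow> 'm topology) \<Rightarrow> ('i \<Rightarrow> 'i \<Rightarrow> 'm \<Rightarrow> 'm) \<Rightarrow>
     'p topology \<Rightarrow> ('i \<Rightarrow> 'p \<Rightarrow> 'm) \<Rightarrow> bool" where
  "projective_limit I T \<mu> P \<mu>p \<longleftrightarrow>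
     projective_cone I T \<mu> P \<mu>p \<and>
     (\<forall>(Z::('i \<Rightarrow> 'm) topology) \<nu>. projective_cone I T \<mu> Z \<nu> \<longrightarrow> (\<exists>!h. mediating_map I P \<mu>p Z \<nu> h))"

lemma projective_limit_universal:
  fixes Z :: "'z topology" and I :: "'i::linorder set" and T :: "'i \<Rightarrow> 'm topology"
  assumes lim: "projective_limit I T \<mu> P \<mu>p" and cone: "projective_cone I T \<mu> Z \<nu>"
  shows "\<exists>!h. mediating_map I P \<mu>p Z \<nu> h"
proof -
  define L where "L = subtopology (product_topology T I)
    {x. \<forall>i\<in>I. \<forall>j\<in>I. i \<le> j \<longrightarrow> \<mu> i j (x j) = x i}"
  have "projective_cone I T \<mu> L (\<lambda>i x. x i)"
    unfolding projective_cone_def L_def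
    by (auto intro!: continuous_map_from_subtopology)
  then obtain h where h: "mediating_map I P \<mu>p L (\<lambda>i x. x i) h"
    using lim unfolding projective_limit_def by blast
  define k where "k = (\<lambda>z. \<lambda>i\<in>I. \<nu> i z)"
  have "continuous_map Z (product_topology T I) k"
  proof -
    have "continuous_map Z (T i) (\<lambda>z. k z i)" if "i \<in> I" for i
      using cone that by (auto simp: projective_cone_def k_def)
    then show ?thesis
      by (auto simp: continuous_map_componentwise k_def)
  qed
  then have k: "continuous_map Z L k"
    using cone unfolding L_def projective_cone_def
    by (auto simp: continuous_map_in_subtopology k_def)
  have kL: "k z \<in> topspace L" if "z \<in> topspace Z" for z
    using k that by (auto simp: continuous_map_def)
  have "mediating_map I P \<mu>p Z \<nu> (restrict (h \<circ> k) (topspace Z))"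
    unfolding mediating_map_def
  proof (intro conjI ballI)
    have "continuous_map Z P (h \<circ> k)"
      using k h continuous_map_compose unfolding mediating_map_def by blast
    then show "continuous_map Z P (restrict (h \<circ> k) (topspace Z))"
      by (rule continuous_map_eq) simp
    fix i z assume "i \<in> I" "z \<in> topspace Z"
    then show "\<mu>p i (restrict (h \<circ> k) (topspace Z) z) = \<nu> i z"
      using h kL[of z] by (simp add: mediating_map_def k_def)
  qed simp
  moreover have "f = g" if f: "mediating_map I P \<mu>p Z \<nu> f" and g: "mediating_map I P \<mu>p Z \<nu> g" for f g
  proof (rule extensionalityI)
    show "f \<in> extensional (topspace Z)" "g \<in> extensional (topspace Z)"
      using f g by (auto simp: mediating_map_def)
    fix z assume z: "z \<in> topspace Z"
    let ?D = "discrete_topology {undefined :: 'i \<Rightarrow> 'm}"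
    let ?n = "\<lambda>i (_::'i \<Rightarrow> 'm). \<nu> i z"
    have "projective_cone I T \<mu> ?D ?n"
      using cone z by (auto simp: projective_cone_def continuous_map_def)
    moreover have "mediating_map I P \<mu>p ?D ?n (\<lambda>_\<in>{undefined}. f z)"
      using f z by (auto simp: mediating_map_def continuous_map_def)
    moreover have "mediating_map I P \<mu>p ?D ?n (\<lambda>_\<in>{undefined}. g z)"
      using g z by (auto simp: mediating_map_def continuous_map_def)
    ultimately have "(\<lambda>_\<in>{undefined :: 'i \<Rightarrow> 'm}. f z) = (\<lambda>_\<in>{undefined}. g z)"
      using lim unfolding projective_limit_def by blast
    from fun_cong[OF this, of undefined] show "f z = g z" by simp
  qed
  ultimately show ?thesis by blast
qed

text \<open>The continuous functions on an open \<open>U\<close> that locally factor smoothly through some level.\<close>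

definition locally_level_smooth ::
    "'p topology \<Rightarrow> 'i set \<Rightarrow> ('i \<Rightarrow> 'm manifold) \<Rightarrow> ('i \<Rightarrow> 'p \<Rightarrow> 'm) \<Rightarrow> 'p set \<Rightarrow> ('p \<Rightarrow> real) set" where
  "locally_level_smooth P I M \<mu>p U =
     {f \<in> extensional U. continuous_map (subtopology P U) euclideanreal f \<and>
        (\<forall>x\<in>U. \<exists>i\<in>I. \<exists>Ui fi. openin (mtop (M i)) Ui \<and> smooth_function_on (M i) Ui fi \<and>
           x \<in> topspace P \<inter> \<mu>p i -` Ui \<and> topspace P \<inter> \<mu>p i -` Ui \<subseteq> U \<and>
           (\<forall>y\<in>topspace P \<inter> \<mu>p i -` Ui. f y = fi (\<mu>p i y)))}"

definition smooth_projective_representation ::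
    "('p, 'p \<Rightarrow> real) ringed_space \<Rightarrow> ('i::linorder, 'm, 'p) projective_rep \<Rightarrow> bool" where
  "smooth_projective_representation M R \<longleftrightarrow>
     locally_ringed_space M \<and>
     smooth_projective_system (index R) (level R) (trans_map R) \<and>
     projective_limit (index R) (\<lambda>i. mtop (level R i)) (trans_map R) (space_top M) (proj_map R) \<and>
     (\<forall>U. openin (space_top M) U \<longrightarrow>
        sections M U =
          function_algebra U (locally_level_smooth (space_top M) (index R) (level R) (proj_map R) U)) \<and>
     (\<forall>U V. openin (space_top M) U \<and> openin (space_top M) V \<and> V \<subseteq> U \<longrightarrow>
        (\<forall>f\<in>carrier (sections M U). restr M U V f = restrict f V))"

definition equivalent_representations ::
    "'p set \<Rightarrow> ('i::linorder, 'm, 'p) projective_rep \<Rightarrow> ('a::linorder, 'n, 'p) projective_rep \<Rightarrow> bool" where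
  "equivalent_representations P R R' \<longleftrightarrow>
     (\<exists>\<phi> \<psi> F G.
        \<phi> \<in> index R' \<rightarrow> index R \<and> strict_mono_on (index R') \<phi> \<and>
        \<psi> \<in> index R \<rightarrow> index R' \<and> strict_mono_on (index R) \<psi> \<and>
        (\<forall>a\<in>index R'. surjective_submersion (level R (\<phi> a)) (level R' a) (F a)) \<and>
        (\<forall>i\<in>index R. surjective_submersion (level R' (\<psi> i)) (level R i) (G i)) \<and>
        (\<forall>a\<in>index R'. \<forall>b\<in>index R'. a \<le> b \<longrightarrow> (\<forall>x\<in>points (level R (\<phi> b)).
           F a (trans_map R (\<phi> a) (\<phi> b) x) = trans_map R' a b (F b x))) \<and>
        (\<forall>i\<in>index R. \<forall>j\<in>index R. i \<le> j \<longrightarrow> (\<forall>x\<in>points (level R' (\<psi> j)).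
           G i (trans_map R' (\<psi> i) (\<psi> j) x) = trans_map R i j (G j x))) \<and>
        (\<forall>i\<in>index R. \<forall>x\<in>points (level R (\<phi> (\<psi> i))).
           G i (F (\<psi> i) x) = trans_map R i (\<phi> (\<psi> i)) x) \<and>
        (\<forall>a\<in>index R'. \<forall>x\<in>points (level R' (\<psi> (\<phi> a))).
           F a (G (\<phi> a) x) = trans_map R' a (\<psi> (\<phi> a)) x) \<and>
        (\<forall>i\<in>index R. \<forall>p\<in>P. proj_map R i p = G i (proj_map R' (\<psi> i) p)) \<and>
        (\<forall>a\<in>index R'. \<forall>p\<in>P. proj_map R' a p = F a (proj_map R (\<phi> a) p)))"

definition representations ::
    "('p, 'p \<Rightarrow> real) ringed_space \<Rightarrow> ('i::linorder, 'm, 'p) projective_rep set" where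
  "representations M = {R. smooth_projective_representation M R}"

definition representation_equivalence ::
    "('p, 'p \<Rightarrow> real) ringed_space \<Rightarrow>
     (('i::linorder, 'm, 'p) projective_rep \<times> ('i, 'm, 'p) projective_rep) set" where
  "representation_equivalence M =
     {(R, R'). R \<in> representations M \<and> R' \<in> representations M \<and>
        equivalent_representations (topspace (space_top M)) R R'}"

definition pfd_structures ::
    "('p, 'p \<Rightarrow> real) ringed_space \<Rightarrow> ('i::linorder, 'm, 'p) projective_rep set set" where
  "pfd_structures M = representations M // representation_equivalence M"

definition pfd_manifold ::
    "('p, 'p \<Rightarrow> real) ringed_space \<Rightarrow> ('i::linorder, 'm, 'p) projective_rep set \<Rightarrow> bool" where
  "pfd_manifold M S \<longleftrightarrow> locally_ringed_space M \<and> S \<in> pfd_structures M"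


section \<open>The space of infinite jets\<close>

definition initial_topology :: "'p set \<Rightarrow> 'i set \<Rightarrow> ('i \<Rightarrow> 'q topology) \<Rightarrow> ('i \<Rightarrow> 'p \<Rightarrow> 'q) \<Rightarrow> 'p topology" where
  "initial_topology S I T f =
     topology_generated_by (insert S {{x \<in> S. f i x \<in> V} | i V. i \<in> I \<and> openin (T i) V})"

definition infinite_jets :: "'e manifold \<Rightarrow> 'x manifold \<Rightarrow> ('e \<Rightarrow> 'x) \<Rightarrow> ('x, 'e) jet_class set" where
  "infinite_jets E X \<pi> = (\<Union>p\<in>points X. jet_class E X \<pi> \<infinity> p ` sections_around E X \<pi> p)"

definition infinite_jet_topology ::
    "'e manifold \<Rightarrow> 'x manifold \<Rightarrow> ('e \<Rightarrow> 'x) \<Rightarrow> ('x, 'e) jet_class topology" where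
  "infinite_jet_topology E X \<pi> =
     initial_topology (infinite_jets E X \<pi>) {-1..} (\<lambda>i. mtop (jet_manifold E X \<pi> i))
       (infinite_jet_projection E X \<pi>)"

definition infinite_jet_space ::
    "'e manifold \<Rightarrow> 'x manifold \<Rightarrow> ('e \<Rightarrow> 'x) \<Rightarrow>
     (('x, 'e) jet_class, ('x, 'e) jet_class \<Rightarrow> real) ringed_space" where
  "infinite_jet_space E X \<pi> =
     \<lparr>space_top = infinite_jet_topology E X \<pi>,
      sections = (\<lambda>U. function_algebra U
        (locally_level_smooth (infinite_jet_topology E X \<pi>) {-1..} (jet_manifold E X \<pi>)
           (infinite_jet_projection E X \<pi>) U)),
      restr = (\<lambda>U V f. restrict f V)\<rparr>"

definition jet_representation ::
    "'e manifold \<Rightarrow> 'x manifold \<Rightarrow> ('e \<Rightarrow> 'x) \<Rightarrow> (int, ('x, 'e) jet, ('x, 'e) jet_class) projective_rep" where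
  "jet_representation E X \<pi> =
     \<lparr>index = {-1..},
      level = jet_manifold E X \<pi>,
      trans_map = jet_projection E X \<pi>,
      proj_map = infinite_jet_projection E X \<pi>\<rparr>"

end

theory Submission
  imports Defs
begin

text \<open>
  The jet spaces of finite order form a tower of smooth manifolds, and the space of infinite jets is
  its limit.

  Everything is computed in fibered charts, which exist around every point of \<open>E\<close> because products of
  charts can be pulled back along local trivialisations (\<open>fibered_chart_exists\<close>). Agreement of
  derivatives up to order \<open>k\<close> is preserved by composition with smooth maps; hence two sections have the
  same \<open>k\<close>-jet as soon as their derivatives agree in one fibered chart (\<open>jet_equivalent_iff\<close>). So one
  fibered chart provides coordinates on the jets of sections through its domain. Every coordinate
  vector occurs, as the jet of a section with polynomial coordinates (\<open>jet_from_coords\<close>), and a change of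
  charts is smooth, since it consists of derivatives, with respect to the base point, of a function that
  is smooth in the base point and the coefficients of the polynomials jointly (\<open>jet_transition_smooth\<close>).
  In these coordinates the projections between jet spaces forget the last coordinates. Freezing the
  forgotten coordinates gives smooth local right inverses, so that the projections are submersions
  (\<open>jet_projection_local_section\<close>, \<open>submersionI\<close>).

  An infinite jet is determined by its finite order jets by definition. That every compatible family of
  finite order jets belongs to an infinite jet is the point where analysis is needed: some section must
  have all the prescribed derivatives at one point. This is Borel's lemma (\<open>borel_lemma\<close>), whose proof
  sums up Taylor monomials that are cut off on rapidly shrinking cubes. As the topology is the
  initial one, the bijection with compatible families makes the space of infinite jets the projective
  limit (\<open>projective_limit_infinite\<close>).

  Since the levels are directed, the preimages of open sets of single levels are a basis of the
  topology (\<open>infinite_jet_basis\<close>), and finitely many local functions of finite order can be moved to a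
  common level. So the structure sheaf is described by a condition on germs that is stable under sums,
  products and, where the value is not zero, reciprocals (\<open>locally_level_smooth_iff\<close>). For any sheaf
  of functions of this kind the germs that vanish at a point are the unique maximal ideal of the stalk
  (\<open>locally_ringed\<close>).
\<close>

section \<open>Calculus on open subsets of Cartesian space\<close>

abbreviation cart :: "nat \<Rightarrow> (nat \<Rightarrow> real) set" where
  "cart n \<equiv> topspace (Euclidean_space n)"

abbreviation cart_open :: "nat \<Rightarrow> (nat \<Rightarrow> real) set \<Rightarrow> bool" where
  "cart_open n S \<equiv> openin (Euclidean_space n) S"

lemma Euclidean_space_eq: "Euclidean_space n = top_of_set (cart n)"
  by (metis Euclidean_space_def euclidean_product_topology topspace_Euclidean_space)

lemma cart_iff: "x \<in> cart n \<longleftrightarrow> (\<forall>i\<ge>n. x i = 0)"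
  by (simp add: topspace_Euclidean_space)

lemma cart_open_iff: "cart_open n S \<longleftrightarrow> (\<exists>T. open T \<and> S = T \<inter> cart n)"
  by (subst Euclidean_space_eq) (auto simp: openin_open)

lemma cart_open_subset: "cart_open n S \<Longrightarrow> S \<subseteq> cart n"
  by (rule openin_subset)

lemma cart_upd: "x \<in> cart n \<Longrightarrow> i < n \<Longrightarrow> x(i := t) \<in> cart n"
  by (auto simp: cart_iff)

lemma continuous_map_cart_iff:
  assumes "S \<subseteq> cart n"
  shows "continuous_map (subtopology (Euclidean_space n) S) euclideanreal f \<longleftrightarrow> continuous_on S f"
  using assms by (subst Euclidean_space_eq) (simp add: subtopology_subtopology inf.absorb2)

text \<open>The topology of \<open>cart n\<close> is that of the maximum norm, although it is induced from an infinite product: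
  a basic open set restricts finitely many coordinates, and those from \<open>n\<close> on vanish.\<close>

lemma cart_open_box:
  assumes "cart_open n S" "x \<in> S"
  obtains e where "e > 0" "\<And>y. y \<in> cart n \<Longrightarrow> (\<And>i. i < n \<Longrightarrow> \<bar>y i - x i\<bar> < e) \<Longrightarrow> y \<in> S"
proof -
  obtain T where T: "open T" "S = T \<inter> cart n" using assms(1) cart_open_iff by blast
  have "openin (product_topology (\<lambda>i. euclidean) UNIV) T"
    using T(1) by (simp add: euclidean_product_topology)
  moreover have "x \<in> T" using assms(2) T(2) by simp
  ultimately have "\<exists>X. x \<in> (\<Pi>\<^sub>E i\<in>UNIV. X i) \<and> (\<forall>i. openin euclidean (X i)) \<and>
      finite {i. X i \<noteq> topspace euclidean} \<and> (\<Pi>\<^sub>E i\<in>UNIV. X i) \<subseteq> T"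
    by (rule product_topology_open_contains_basis)
  then
  obtain X where X: "x \<in> (\<Pi>\<^sub>E i\<in>UNIV. X i)" "\<And>i. open (X i)" "(\<Pi>\<^sub>E i\<in>UNIV. X i) \<subseteq> T"
    by auto
  have "\<exists>e>0. \<forall>t. \<bar>t - x i\<bar> < e \<longrightarrow> t \<in> X i" for i
    using X(1) X(2)[of i] by (metis PiE_mem UNIV_I open_dist dist_real_def)
  then obtain d where d: "\<And>i. d i > 0" "\<And>i t. \<bar>t - x i\<bar> < d i \<Longrightarrow> t \<in> X i" by metis
  define e where "e = Min (insert 1 (d ` {..<n}))"
  have "e > 0" unfolding e_def using d(1) by (subst Min_gr_iff) auto
  moreover have "y \<in> S" if y: "y \<in> cart n" "\<And>i. i < n \<Longrightarrow> \<bar>y i - x i\<bar> < e" for y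
  proof -
    have "y i \<in> X i" for i
    proof (cases "i < n")
      case True
      then have "e \<le> d i" unfolding e_def by (intro Min_le) auto
      then show ?thesis using y(2)[OF True] d(2) by force
    next
      case False
      have "x \<in> cart n" using assms cart_open_subset by blast
      then have "y i = x i" using False y(1) by (simp add: cart_iff)
      then show ?thesis using d(1)[of i] d(2)[of "x i" i] by simp
    qed
    then have "y \<in> T" using X(3) by auto
    then show ?thesis using y(1) T(2) by simp
  qed
  ultimately show ?thesis using that by blast
qed

lemma eventually_in_cart_open:
  assumes "cart_open n S" "x \<in> S" "\<forall>\<^sub>F t in F. y t \<in> cart n"
    and "\<And>i. i < n \<Longrightarrow> ((\<lambda>t. y t i) \<longlongrightarrow> x i) F"
  shows "\<forall>\<^sub>F t in F. y t \<in> S"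
proof -
  obtain e where e: "e > 0" "\<And>z. z \<in> cart n \<Longrightarrow> (\<And>i. i < n \<Longrightarrow> \<bar>z i - x i\<bar> < e) \<Longrightarrow> z \<in> S"
    using cart_open_box[OF assms(1,2)] by blast
  have "\<forall>\<^sub>F t in F. \<forall>i\<in>{..<n}. \<bar>y t i - x i\<bar> < e"
    using assms(4) e(1) by (intro eventually_ball_finite) (auto simp: tendsto_iff dist_real_def)
  with assms(3) show ?thesis by eventually_elim (use e(2) in auto)
qed

text \<open>In the product topology on \<open>nat \<Rightarrow> real\<close> convergence is coordinatewise. On \<open>cart n\<close> only finitely
  many coordinates have to be controlled.\<close>

lemma tendsto_cart:
  fixes f :: "(nat \<Rightarrow> real) \<Rightarrow> 'a::topological_space"
  assumes "cart_open n S" "x \<in> S" "continuous_on S f" "\<forall>\<^sub>F t in F. y t \<in> cart n"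
    and "\<And>i. i < n \<Longrightarrow> ((\<lambda>t. y t i) \<longlongrightarrow> x i) F"
  shows "((\<lambda>t. f (y t)) \<longlongrightarrow> f x) F"
proof (rule topological_tendstoI)
  fix U assume U: "open U" "f x \<in> U"
  have "openin (top_of_set S) (S \<inter> f -` U)"
    using assms(3) U(1) by (rule continuous_openin_preimage_gen)
  moreover have "openin (top_of_set (cart n)) S"
    using assms(1) Euclidean_space_eq by metis
  ultimately have "openin (top_of_set (cart n)) (S \<inter> f -` U)" by (rule openin_trans)
  then have "cart_open n (S \<inter> f -` U)" using Euclidean_space_eq by metis
  then have "\<forall>\<^sub>F t in F. y t \<in> S \<inter> f -` U"
    by (rule eventually_in_cart_open) (fact assms(4,5) | use assms(2) U(2) in blast)+
  then show "\<forall>\<^sub>F t in F. f (y t) \<in> U" by eventually_elim auto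
qed

lemma eventually_upd_in_open:
  assumes "cart_open n S" "x \<in> S" "i < n"
  shows "\<forall>\<^sub>F t in nhds (x i). x(i := t) \<in> S"
proof (rule eventually_in_cart_open[OF assms(1,2)])
  have "x \<in> cart n" using assms cart_open_subset by blast
  then show "\<forall>\<^sub>F t in nhds (x i). x(i := t) \<in> cart n"
    using assms(3) by (simp add: cart_upd)
  show "((\<lambda>t. (x(i := t)) j) \<longlongrightarrow> x j) (nhds (x i))" for j
    by (cases "j = i") (simp_all add: filterlim_ident)
qed

lemma partial_deriv_cong:
  assumes "cart_open n S" "x \<in> S" "i < n" "\<And>y. y \<in> S \<Longrightarrow> f y = g y"
  shows "partial_deriv i f x = partial_deriv i g x"
proof -
  have "\<forall>\<^sub>F t in nhds (x i). f (x(i := t)) = g (x(i := t))"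
    using eventually_upd_in_open[OF assms(1-3)] by eventually_elim (rule assms(4))
  then show ?thesis unfolding partial_deriv_def by (rule deriv_cong_ev) simp
qed

lemma iterated_partial_Nil [simp]: "iterated_partial [] f = f"
  by (simp add: iterated_partial_def)

lemma iterated_partial_Cons: "iterated_partial (i # I) f = partial_deriv i (iterated_partial I f)"
  by (simp add: iterated_partial_def)

lemma iterated_partial_append: "iterated_partial (I @ J) f = iterated_partial I (iterated_partial J f)"
  by (simp add: iterated_partial_def)

lemma iterated_partial_cong:
  assumes "cart_open n S" "set I \<subseteq> {..<n}" "\<And>y. y \<in> S \<Longrightarrow> f y = g y" "x \<in> S"
  shows "iterated_partial I f x = iterated_partial I g x"
  using assms(2,4)
proof (induction I arbitrary: x)
  case Nil
  then show ?case using assms(3) by simp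
next
  case (Cons i I)
  then show ?case unfolding iterated_partial_Cons
    by (intro partial_deriv_cong[OF assms(1)]) auto
qed

lemma has_partial_deriv:
  assumes "(\<lambda>t. f (x(i := t))) field_differentiable at (x i)"
  shows "((\<lambda>t. f (x(i := t))) has_real_derivative partial_deriv i f x) (at (x i))"
  using assms unfolding partial_deriv_def by (rule field_differentiable_derivI)

text \<open>Along a coordinate line the base point of the line is irrelevant; the mean value theorem needs the
  derivative at all points of the line.\<close>

lemma has_partial_deriv_upd:
  assumes "(\<lambda>t. f (x(i := t))) field_differentiable at s" 
  shows "((\<lambda>t. f (x(i := t))) has_real_derivative partial_deriv i f (x(i := s))) (at s)"
  using has_partial_deriv[of f "x(i := s)" i] assms by simp

lemma partial_deriv_eqI:
  "((\<lambda>t. f (x(i := t))) has_real_derivative d) (at (x i)) \<Longrightarrow> partial_deriv i f x = d"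
  unfolding partial_deriv_def by (rule DERIV_imp_deriv)

text \<open>Smoothness is handled through the classes \<open>C\<^sup>k\<close>, because closure properties can then be
  proved by induction on \<open>k\<close>: the product and chain rules express a partial derivative by
  functions of which only \<open>C\<^sup>k\<^sup>-\<^sup>1\<close> is known.\<close>

fun Ck_on :: "nat \<Rightarrow> nat \<Rightarrow> (nat \<Rightarrow> real) set \<Rightarrow> ((nat \<Rightarrow> real) \<Rightarrow> real) \<Rightarrow> bool" where
  "Ck_on 0 n S f \<longleftrightarrow> continuous_on S f"
| "Ck_on (Suc k) n S f \<longleftrightarrow> continuous_on S f \<and>
     (\<forall>i<n. (\<forall>x\<in>S. (\<lambda>t. f (x(i := t))) field_differentiable at (x i)) \<and>
            Ck_on k n S (partial_deriv i f))"

lemma Ck_on_continuous: "Ck_on k n S f \<Longrightarrow> continuous_on S f"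
  by (cases k) auto

lemma Ck_on_Suc_imp: "Ck_on (Suc k) n S f \<Longrightarrow> Ck_on k n S f"
  by (induction k arbitrary: f) auto

lemma Ck_on_mono: "Ck_on k n S f \<Longrightarrow> j \<le> k \<Longrightarrow> Ck_on j n S f"
  by (induction k) (auto simp: le_Suc_eq simp del: Ck_on.simps dest: Ck_on_Suc_imp)

lemma Ck_on_iterated:
  "Ck_on k n S f \<longleftrightarrow> (\<forall>I. set I \<subseteq> {..<n} \<and> length I \<le> k \<longrightarrow>
     continuous_on S (iterated_partial I f) \<and>
     (length I < k \<longrightarrow> (\<forall>i<n. \<forall>x\<in>S. (\<lambda>t. iterated_partial I f (x(i := t))) field_differentiable at (x i))))"
proof (induction k arbitrary: f)
  case 0
  then show ?case by auto
next
  case (Suc k)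
  let ?P = "\<lambda>k f I. set I \<subseteq> {..<n} \<and> length I \<le> k \<longrightarrow> continuous_on S (iterated_partial I f) \<and>
     (length I < k \<longrightarrow> (\<forall>i<n. \<forall>x\<in>S. (\<lambda>t. iterated_partial I f (x(i := t))) field_differentiable at (x i)))"
  have "(\<forall>I. Q I) \<longleftrightarrow> Q [] \<and> (\<forall>I i. Q (I @ [i]))" for Q :: "nat list \<Rightarrow> bool"
    by (metis rev_exhaust)
  from this[of "?P (Suc k) f"]
  have "(\<forall>I. ?P (Suc k) f I) \<longleftrightarrow> ?P (Suc k) f [] \<and> (\<forall>I i. ?P (Suc k) f (I @ [i]))" .
  also have "\<dots> \<longleftrightarrow> Ck_on (Suc k) n S f"
    unfolding Ck_on.simps Suc iterated_partial_append
    by (auto simp: iterated_partial_Cons)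
  finally show ?case by (rule sym)
qed

lemma smooth_real_on_iff_Ck:
  assumes "S \<subseteq> cart n"
  shows "smooth_real_on n S f \<longleftrightarrow> (\<forall>k. Ck_on k n S f)"
  unfolding smooth_real_on_def Ck_on_iterated continuous_map_cart_iff[OF assms]
  by (meson le_less_trans lessI less_imp_le order_refl)

lemma Ck_on_cong:
  assumes "cart_open n S" "\<And>x. x \<in> S \<Longrightarrow> f x = g x" "Ck_on k n S f"
  shows "Ck_on k n S g"
  using assms(2,3)
proof (induction k arbitrary: f g)
  case 0
  then show ?case using continuous_on_cong[OF refl, of S f g] by simp
next
  case (Suc k)
  have "continuous_on S g" using Suc.prems continuous_on_cong[OF refl, of S f g] by simp
  moreover have "(\<lambda>t. g (x(i := t))) field_differentiable at (x i)" if ix: "i < n" "x \<in> S" for i x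
  proof -
    have "\<forall>\<^sub>F t in nhds (x i). f (x(i := t)) = g (x(i := t))"
      using eventually_upd_in_open[OF assms(1) ix(2,1)] by eventually_elim (rule Suc.prems)
    note eq = DERIV_cong_ev[OF refl this refl]
    have "(\<lambda>t. f (x(i := t))) field_differentiable at (x i)"
      using Suc.prems(2) ix unfolding Ck_on.simps by blast
    then show ?thesis unfolding field_differentiable_def by (simp only: eq)
  qed
  moreover have "Ck_on k n S (partial_deriv i g)" if "i < n" for i
  proof (rule Suc.IH)
    show "partial_deriv i f x = partial_deriv i g x" if "x \<in> S" for x
      by (rule partial_deriv_cong[OF assms(1) that \<open>i < n\<close>]) (rule Suc.prems(1))
    show "Ck_on k n S (partial_deriv i f)" using Suc.prems(2) that by simp
  qed
  ultimately show ?case by auto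
qed

lemma Ck_on_subset: "Ck_on k n S f \<Longrightarrow> T \<subseteq> S \<Longrightarrow> Ck_on k n T f"
  by (induction k arbitrary: f) (auto intro: continuous_on_subset)

lemma continuous_on_cart_local:
  fixes f :: "(nat \<Rightarrow> real) \<Rightarrow> 'a::topological_space"
  assumes "S \<subseteq> cart n" "\<And>x. x \<in> S \<Longrightarrow> \<exists>T. cart_open n T \<and> x \<in> T \<and> continuous_on T f"
  shows "continuous_on S f"
  unfolding continuous_on_eq_continuous_within
proof
  fix x assume x: "x \<in> S"
  obtain T where T: "cart_open n T" "x \<in> T" "continuous_on T f" using assms(2)[OF x] by blast
  obtain T' where T': "open T'" "T = T' \<inter> cart n" using T(1) cart_open_iff by blast
  have "continuous (at x within T) f" using T by (simp add: continuous_on_eq_continuous_within)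
  moreover have "at x within T = at x within cart n"
    using T' T(2) by (intro at_within_nhd[where S=T']) auto
  ultimately show "continuous (at x within S) f"
    using assms(1) continuous_within_subset by metis
qed

lemma Ck_on_local:
  assumes "S \<subseteq> cart n" "\<And>x. x \<in> S \<Longrightarrow> \<exists>T. cart_open n T \<and> x \<in> T \<and> Ck_on k n T f"
  shows "Ck_on k n S f"
  using assms(2)
proof (induction k arbitrary: f)
  case 0
  then show ?case using continuous_on_cart_local[OF assms(1), of f] by simp
next
  case (Suc k)
  have "continuous_on S f" using continuous_on_cart_local[OF assms(1)] Suc.prems
    by (metis Ck_on.simps(2))
  moreover have "Ck_on k n S (partial_deriv i f)" if "i < n" for i
    using Suc.prems that by (intro Suc.IH) (metis Ck_on.simps(2))
  moreover have "(\<lambda>t. f (x(i := t))) field_differentiable at (x i)" if "i < n" "x \<in> S" for i x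
    using Suc.prems[OF that(2)] that by auto
  ultimately show ?case by simp
qed

lemma Ck_on_const: "Ck_on k n S (\<lambda>x. c)"
proof (induction k arbitrary: c)
  case (Suc k)
  have "partial_deriv i (\<lambda>x. c) = (\<lambda>x. 0)" for i
    by (auto simp: partial_deriv_def)
  with Suc show ?case by auto
qed auto

lemma continuous_on_coord: "continuous_on S (\<lambda>x::nat \<Rightarrow> real. x i)"
  by (rule continuous_on_product_then_coordinatewise) (rule continuous_on_id)

lemma cart_open_cube: "cart_open n {x \<in> cart n. \<forall>i\<in>{..<n}. \<bar>x i - a i\<bar> < e}"
proof -
  have o: "open {x::nat \<Rightarrow> real. \<bar>x i - a i\<bar> < e}" for i
    by (intro open_Collect_less continuous_on_rabs continuous_on_diff continuous_on_coord continuous_on_const)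
  have "open (\<Inter>i\<in>{..<n}. {x::nat \<Rightarrow> real. \<bar>x i - a i\<bar> < e})"
    by (rule open_INT) (use o in auto)
  then show ?thesis unfolding cart_open_iff
    by (intro exI[of _ "\<Inter>i\<in>{..<n}. {x::nat \<Rightarrow> real. \<bar>x i - a i\<bar> < e}"]) auto
qed

lemma Ck_on_coord: "Ck_on k n S (\<lambda>x. x i)"
proof (cases k)
  case (Suc k')
  have "partial_deriv j (\<lambda>x. x i) = (\<lambda>x. if i = j then 1 else 0)" for j
    by (auto simp: partial_deriv_def)
  moreover have "(\<lambda>t. (x(j := t)) i) field_differentiable at a" for x :: "nat \<Rightarrow> real" and j a
    by (cases "i = j") auto
  ultimately show ?thesis using Suc by (auto simp: Ck_on_const continuous_on_coord)
qed (simp add: continuous_on_coord)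

text \<open>The induction step for all closure properties: it suffices to guess the partial derivatives and to
  know that the guesses are in the class of order \<open>k\<close>.\<close>

lemma Ck_on_SucI:
  assumes "cart_open n S" "continuous_on S f"
    and "\<And>i x. i < n \<Longrightarrow> x \<in> S \<Longrightarrow> ((\<lambda>t. f (x(i := t))) has_real_derivative d i x) (at (x i))"
    and "\<And>i. i < n \<Longrightarrow> Ck_on k n S (d i)"
  shows "Ck_on (Suc k) n S f"
proof -
  have "Ck_on k n S (partial_deriv i f)" if "i < n" for i
    by (rule Ck_on_cong[OF assms(1) _ assms(4)[OF that]]) (rule sym, rule partial_deriv_eqI[OF assms(3)[OF that]])
  then show ?thesis using assms(2,3) by (auto simp: field_differentiable_def)
qed

lemma Ck_on_add:
  fixes f g :: "(nat \<Rightarrow> real) \<Rightarrow> real"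
  assumes "cart_open n S" shows "Ck_on k n S f \<Longrightarrow> Ck_on k n S g \<Longrightarrow> Ck_on k n S (\<lambda>x. f x + g x)"
proof (induction k arbitrary: f g)
  case (Suc k)
  show ?case
  proof (rule Ck_on_SucI[OF assms])
    show "((\<lambda>t. f (x(i := t)) + g (x(i := t))) has_real_derivative
             partial_deriv i f x + partial_deriv i g x) (at (x i))" if "i < n" "x \<in> S" for i x
      using Suc.prems that by (intro DERIV_add has_partial_deriv) auto
    show "Ck_on k n S (\<lambda>x. partial_deriv i f x + partial_deriv i g x)" if "i < n" for i
      using Suc.prems that by (intro Suc.IH) auto
  qed (use Suc.prems in \<open>auto intro: continuous_intros\<close>)
qed (auto intro: continuous_intros)

lemma Ck_on_mult:
  fixes f g :: "(nat \<Rightarrow> real) \<Rightarrow> real"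
  assumes "cart_open n S" shows "Ck_on k n S f \<Longrightarrow> Ck_on k n S g \<Longrightarrow> Ck_on k n S (\<lambda>x. f x * g x)"
proof (induction k arbitrary: f g)
  case (Suc k)
  show ?case
  proof (rule Ck_on_SucI[OF assms])
    show "((\<lambda>t. f (x(i := t)) * g (x(i := t))) has_real_derivative
             partial_deriv i f x * g x + partial_deriv i g x * f x) (at (x i))" if "i < n" "x \<in> S" for i x
      using DERIV_mult[OF has_partial_deriv[of f x i] has_partial_deriv[of g x i]] Suc.prems that by simp
    show "Ck_on k n S (\<lambda>x. partial_deriv i f x * g x + partial_deriv i g x * f x)" if "i < n" for i
      using Suc.prems(1,2)[THEN Ck_on_Suc_imp] Suc.prems that
      by (intro Ck_on_add[OF assms] Suc.IH) auto
  qed (use Suc.prems in \<open>auto intro: continuous_intros\<close>)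
qed (auto intro: continuous_intros)

lemma Ck_on_inverse:
  fixes f :: "(nat \<Rightarrow> real) \<Rightarrow> real"
  assumes "cart_open n S" "\<And>x. x \<in> S \<Longrightarrow> f x \<noteq> 0"
  shows "Ck_on k n S f \<Longrightarrow> Ck_on k n S (\<lambda>x. inverse (f x))"
proof (induction k)
  case (Suc k)
  show ?case
  proof (rule Ck_on_SucI[OF assms(1)])
    show "((\<lambda>t. inverse (f (x(i := t)))) has_real_derivative
             (-1) * (inverse (f x) * partial_deriv i f x * inverse (f x))) (at (x i))" if "i < n" "x \<in> S" for i x
      using DERIV_inverse_fun[OF has_partial_deriv[of f x i]] assms(2)[OF that(2)] Suc.prems that
      by (simp add: mult_ac)
    show "Ck_on k n S (\<lambda>x. (-1) * (inverse (f x) * partial_deriv i f x * inverse (f x)))" if "i < n" for i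
      using Suc.prems that Suc.IH[OF Ck_on_Suc_imp[OF Suc.prems]]
      by (intro Ck_on_mult[OF assms(1)] Ck_on_const) auto
  qed (use Suc.prems assms(2) in \<open>auto intro: continuous_intros\<close>)
qed (use assms(2) in \<open>auto intro: continuous_intros\<close>)

lemma Ck_on_sum:
  assumes "cart_open n S" "\<And>j. j \<in> A \<Longrightarrow> Ck_on k n S (f j)"
  shows "Ck_on k n S (\<lambda>x. \<Sum>j\<in>A. f j x)"
  using assms(2) by (induction A rule: infinite_finite_induct) (auto intro: Ck_on_const Ck_on_add[OF assms(1)])

subsection \<open>The chain rule\<close>

text \<open>The mean value theorem without a case distinction on the order of the end points.\<close>

lemma mvt_symmetric:
  fixes g :: "real \<Rightarrow> real"
  assumes "\<And>s. \<bar>s - a\<bar> \<le> \<bar>b - a\<bar> \<Longrightarrow> (g has_real_derivative g' s) (at s)"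
  shows "\<exists>\<xi>. \<bar>\<xi> - a\<bar> \<le> \<bar>b - a\<bar> \<and> g b - g a = (b - a) * g' \<xi>"
proof -
  consider "a < b" | "b < a" | "a = b" by linarith
  then show ?thesis
  proof cases
    case 1
    then obtain z where "a < z" "z < b" "g b - g a = (b - a) * g' z"
      using MVT2[of a b g g'] assms by fastforce
    then show ?thesis by (intro exI[of _ z]) auto
  next
    case 2
    then obtain z where "b < z" "z < a" "g a - g b = (a - b) * g' z"
      using MVT2[of b a g g'] assms by fastforce
    then show ?thesis by (intro exI[of _ z]) (auto simp: algebra_simps)
  qed auto
qed

text \<open>A curve is followed by changing one coordinate after the other. Each change is an increment
  of \<open>f\<close> along a coordinate direction, to which the mean value theorem applies; continuity of the
  partial derivatives absorbs the intermediate points.\<close>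

lemma chain_rule_curve:
  assumes S: "cart_open n S"
    and f: "\<And>i x. i < n \<Longrightarrow> x \<in> S \<Longrightarrow> (\<lambda>t. f (x(i := t))) field_differentiable at (x i)"
    and cont: "\<And>i. i < n \<Longrightarrow> continuous_on S (partial_deriv i f)"
    and c0: "c t0 \<in> S" and ev: "\<forall>\<^sub>F t in nhds t0. c t \<in> cart n"
    and c: "\<And>i. i < n \<Longrightarrow> ((\<lambda>t. c t i) has_real_derivative c' i) (at t0)"
  shows "((\<lambda>t. f (c t)) has_real_derivative (\<Sum>i<n. partial_deriv i f (c t0) * c' i)) (at t0)"
proof -
  obtain e where e: "e > 0" "\<And>y. y \<in> cart n \<Longrightarrow> (\<And>i. i < n \<Longrightarrow> \<bar>y i - c t0 i\<bar> < e) \<Longrightarrow> y \<in> S"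
    using cart_open_box[OF S c0] by blast
  have c0E: "c t0 \<in> cart n" using S c0 cart_open_subset by blast
  have lim: "((\<lambda>t. c t i) \<longlongrightarrow> c t0 i) (at t0)" if "i < n" for i
    using DERIV_isCont[OF c[OF that]] by (simp add: isCont_def)
  have near: "\<forall>\<^sub>F t in at t0. \<forall>i\<in>{..<n}. \<bar>c t i - c t0 i\<bar> < e"
    using lim e(1) by (intro eventually_ball_finite) (auto simp: tendsto_iff dist_real_def)
  define z where "z = (\<lambda>k t j. if j < k then c t j else c t0 j)"
  have zS: "z (Suc k) t = (z k t)(k := c t k)" "z k t = (z k t)(k := c t0 k)" for k t
    by (auto simp: z_def fun_eq_iff)
  have zE: "z k t \<in> cart n" if "k \<le> n" for k t
    using c0E that by (auto simp: z_def cart_iff)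
  have "((\<lambda>t. f (z k t)) has_real_derivative (\<Sum>i<k. partial_deriv i f (c t0) * c' i)) (at t0)"
    if "k \<le> n" for k
    using that
  proof (induction k)
    case 0
    then show ?case by (simp add: z_def)
  next
    case (Suc k)
    then have kn: "k < n" by simp
    let ?P = "\<lambda>t \<xi>. \<bar>\<xi> - c t0 k\<bar> \<le> \<bar>c t k - c t0 k\<bar> \<and>
        f (z (Suc k) t) - f (z k t) = (c t k - c t0 k) * partial_deriv k f ((z k t)(k := \<xi>))"
    have "\<exists>\<xi>. ?P t \<xi>" if t: "\<forall>i\<in>{..<n}. \<bar>c t i - c t0 i\<bar> < e" for t
    proof -
      have "((\<lambda>s. f ((z k t)(k := s))) has_real_derivative partial_deriv k f ((z k t)(k := s))) (at s)"
        if s: "\<bar>s - c t0 k\<bar> \<le> \<bar>c t k - c t0 k\<bar>" for s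
      proof (rule has_partial_deriv_upd)
        have "(z k t)(k := s) \<in> S"
        proof (rule e(2))
          show "(z k t)(k := s) \<in> cart n" using zE[of k t] kn by (intro cart_upd) auto
          show "\<bar>((z k t)(k := s)) i - c t0 i\<bar> < e" if "i < n" for i
            using t s kn e(1) that by (auto simp: z_def intro: le_less_trans)
        qed
        from f[OF kn this] show "(\<lambda>s. f ((z k t)(k := s))) field_differentiable at s" by simp
      qed
      from mvt_symmetric[OF this] obtain \<xi> where "\<bar>\<xi> - c t0 k\<bar> \<le> \<bar>c t k - c t0 k\<bar>"
        "f ((z k t)(k := c t k)) - f ((z k t)(k := c t0 k)) =
           (c t k - c t0 k) * partial_deriv k f ((z k t)(k := \<xi>))" by blast
      moreover have "(z k t)(k := c t0 k) = z k t" by (rule zS(2)[symmetric])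
      ultimately show ?thesis by (metis zS(1))
    qed
    then obtain \<xi> where \<xi>: "\<forall>t. (\<forall>i\<in>{..<n}. \<bar>c t i - c t0 i\<bar> < e) \<longrightarrow> ?P t (\<xi> t)" by metis
    have ev\<xi>: "\<forall>\<^sub>F t in at t0. ?P t (\<xi> t)" using near by eventually_elim (use \<xi> in blast)
    have "((\<lambda>t. \<bar>c t k - c t0 k\<bar>) \<longlongrightarrow> 0) (at t0)"
      using lim[OF kn] by (simp add: LIM_zero_iff tendsto_rabs_zero_iff)
    moreover have "\<forall>\<^sub>F t in at t0. norm (\<xi> t - c t0 k) \<le> \<bar>c t k - c t0 k\<bar>"
      using ev\<xi> by eventually_elim simp
    ultimately have "((\<lambda>t. \<xi> t - c t0 k) \<longlongrightarrow> 0) (at t0)" by (rule Lim_null_comparison[rotated])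
    then have lim\<xi>: "(\<xi> \<longlongrightarrow> c t0 k) (at t0)" by (simp add: LIM_zero_iff)
    have lp: "((\<lambda>t. partial_deriv k f ((z k t)(k := \<xi> t))) \<longlongrightarrow> partial_deriv k f (c t0)) (at t0)"
    proof (rule tendsto_cart[OF S c0 cont[OF kn]])
      show "\<forall>\<^sub>F t in at t0. (z k t)(k := \<xi> t) \<in> cart n" using zE kn by (simp add: cart_upd)
      show "((\<lambda>t. ((z k t)(k := \<xi> t)) i) \<longlongrightarrow> c t0 i) (at t0)" if "i < n" for i
        using lim[OF that] lim\<xi> by (cases "i = k"; cases "i < k") (simp_all add: z_def)
    qed
    have lq: "((\<lambda>t. (c t k - c t0 k) / (t - t0)) \<longlongrightarrow> c' k) (at t0)"
      using c[OF kn] by (simp add: has_field_derivative_iff)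
    have "((\<lambda>t. (f (z (Suc k) t) - f (z k t)) / (t - t0)) \<longlongrightarrow> partial_deriv k f (c t0) * c' k) (at t0)"
      by (rule Lim_transform_eventually[OF tendsto_mult[OF lp lq]])
        (use ev\<xi> in \<open>auto elim!: eventually_mono\<close>)
    moreover have "z (Suc k) t0 = z k t0" by (auto simp: z_def)
    ultimately have "((\<lambda>t. f (z (Suc k) t) - f (z k t)) has_real_derivative partial_deriv k f (c t0) * c' k) (at t0)"
      by (simp add: has_field_derivative_iff)
    from DERIV_add[OF this Suc.IH] kn show ?case by (simp add: add.commute)
  qed
  from this[of n] have "((\<lambda>t. f (z n t)) has_real_derivative (\<Sum>i<n. partial_deriv i f (c t0) * c' i)) (at t0)"
    by simp
  moreover have "\<forall>\<^sub>F t in nhds t0. f (z n t) = f (c t)"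
    using ev
  proof eventually_elim
    case (elim t)
    then have "z n t = c t" using c0E by (auto simp: z_def cart_iff fun_eq_iff)
    then show ?case by simp
  qed
  ultimately show ?thesis by (simp add: DERIV_cong_ev)
qed

lemma chain_rule:
  assumes "cart_open n S" "cart_open N T" "\<And>x. x \<in> S \<Longrightarrow> g x \<in> T"
    and "Ck_on (Suc 0) N T f" "\<And>j. j < N \<Longrightarrow> Ck_on (Suc 0) n S (\<lambda>x. g x j)"
    and "x \<in> S" "i < n"
  shows "((\<lambda>t. f (g (x(i := t)))) has_real_derivative
          (\<Sum>j<N. partial_deriv j f (g x) * partial_deriv i (\<lambda>x. g x j) x)) (at (x i))"
proof -
  have "((\<lambda>t. f (g (x(i := t)))) has_real_derivative
          (\<Sum>j<N. partial_deriv j f (g (x(i := x i))) * partial_deriv i (\<lambda>x. g x j) x)) (at (x i))"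
  proof (rule chain_rule_curve[OF assms(2)])
    show "\<forall>\<^sub>F t in nhds (x i). g (x(i := t)) \<in> cart N"
      using eventually_upd_in_open[OF assms(1,6,7)]
      by eventually_elim (use assms(2,3) cart_open_subset in blast)
    show "((\<lambda>t. g (x(i := t)) j) has_real_derivative partial_deriv i (\<lambda>x. g x j) x) (at (x i))" if "j < N" for j
      using assms(5)[OF that] assms(6,7) by (intro has_partial_deriv) auto
    show "(\<lambda>t. f (y(j := t))) field_differentiable at (y j)" if "j < N" "y \<in> T" for j y
      using assms(4) that unfolding Ck_on.simps by blast
  qed (use assms in auto)
  then show ?thesis by simp
qed

lemma continuous_on_vector:
  assumes "\<And>x. x \<in> S \<Longrightarrow> g x \<in> cart N" "\<And>j. j < N \<Longrightarrow> continuous_on S (\<lambda>x. g x j)"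
  shows "continuous_on S g"
proof (rule continuous_on_coordinatewise_then_product)
  fix j show "continuous_on S (\<lambda>x. g x j)"
  proof (cases "j < N")
    case False
    then have "continuous_on S (\<lambda>x. g x j) = continuous_on S (\<lambda>x. 0::real)"
      using assms(1) by (intro continuous_on_cong) (auto simp: cart_iff)
    then show ?thesis by simp
  qed (use assms in auto)
qed

text \<open>By the chain rule, the partial derivatives of a composition are sums of products of functions
  \<open>partial_deriv j f \<circ> g\<close> and derivatives of \<open>g\<close>, to which the induction hypothesis applies.\<close>

lemma Ck_on_compose:
  assumes "cart_open n S" "cart_open N T" "\<And>x. x \<in> S \<Longrightarrow> g x \<in> T"
  shows "Ck_on k N T f \<Longrightarrow> (\<And>j. j < N \<Longrightarrow> Ck_on k n S (\<lambda>x. g x j)) \<Longrightarrow> Ck_on k n S (\<lambda>x. f (g x))"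
proof (induction k arbitrary: f)
  case 0
  have "continuous_on S g"
    using 0 assms(3) cart_open_subset[OF assms(2)] by (intro continuous_on_vector[of _ _ N]) auto
  moreover have "g ` S \<subseteq> T" using assms(3) by auto
  ultimately have "continuous_on S (f \<circ> g)" using 0(1) continuous_on_compose continuous_on_subset
    by (metis Ck_on.simps(1))
  then show ?case by (simp add: o_def)
next
  case (Suc k)
  have le: "Suc 0 \<le> Suc k" by simp
  have d: "((\<lambda>t. f (g (x(i := t)))) has_real_derivative
      (\<Sum>j<N. partial_deriv j f (g x) * partial_deriv i (\<lambda>x. g x j) x)) (at (x i))"
    if "i < n" "x \<in> S" for i x
    using that by (intro chain_rule[OF assms] Ck_on_mono[OF Suc.prems(1) le] Ck_on_mono[OF Suc.prems(2) le])
  have IH: "Ck_on k n S (\<lambda>x. h (g x))" if "Ck_on k N T h" for h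
    by (rule Suc.IH[OF that]) (rule Ck_on_Suc_imp[OF Suc.prems(2)])
  show ?case
  proof (rule Ck_on_SucI[OF assms(1)])
    show "continuous_on S (\<lambda>x. f (g x))"
      using IH[OF Ck_on_Suc_imp[OF Suc.prems(1)]] by (rule Ck_on_continuous)
    show "Ck_on k n S (\<lambda>x. \<Sum>j<N. partial_deriv j f (g x) * partial_deriv i (\<lambda>x. g x j) x)" if "i < n" for i
      using Suc.prems that by (intro Ck_on_sum[OF assms(1)] Ck_on_mult[OF assms(1)] IH) auto
  qed (rule d)
qed

subsection \<open>Smooth functions\<close>

text \<open>From here on, closure properties of smooth functions are read off from those of the classes
  \<open>Ck_on k\<close>.\<close>

lemma smooth_real_on_Ck: "cart_open n S \<Longrightarrow> smooth_real_on n S f \<longleftrightarrow> (\<forall>k. Ck_on k n S f)"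
  by (rule smooth_real_on_iff_Ck) (rule cart_open_subset)

lemma smooth_real_on_cong:
  assumes "cart_open n S" "\<And>x. x \<in> S \<Longrightarrow> f x = g x" "smooth_real_on n S f"
  shows "smooth_real_on n S g"
  using assms Ck_on_cong[OF assms(1,2)] by (simp add: smooth_real_on_Ck)

lemma smooth_real_on_subset:
  assumes "S \<subseteq> cart n" "smooth_real_on n S f" "T \<subseteq> S"
  shows "smooth_real_on n T f"
proof -
  have "T \<subseteq> cart n" using assms(1,3) by (rule order_trans[rotated])
  from smooth_real_on_iff_Ck[OF this] show ?thesis
    using Ck_on_subset[OF _ assms(3)] assms(2) smooth_real_on_iff_Ck[OF assms(1)] by blast
qed

text \<open>The sheaf property of smoothness, which allows to verify it in a neighbourhood of each point with a
  chart that is adapted to this point.\<close>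

lemma smooth_real_on_local:
  assumes "S \<subseteq> cart n" "\<And>x. x \<in> S \<Longrightarrow> \<exists>T. cart_open n T \<and> x \<in> T \<and> smooth_real_on n T f"
  shows "smooth_real_on n S f"
  unfolding smooth_real_on_iff_Ck[OF assms(1)]
proof
  fix k show "Ck_on k n S f"
  proof (rule Ck_on_local[OF assms(1)])
    fix x assume "x \<in> S"
    from assms(2)[OF this] obtain T where "cart_open n T" "x \<in> T" "smooth_real_on n T f" by blast
    then show "\<exists>T. cart_open n T \<and> x \<in> T \<and> Ck_on k n T f" using smooth_real_on_Ck[of n T f] by blast
  qed
qed

lemma smooth_real_on_const: "cart_open n S \<Longrightarrow> smooth_real_on n S (\<lambda>x. c)"
  by (simp add: smooth_real_on_Ck Ck_on_const)

lemma smooth_real_on_coord: "cart_open n S \<Longrightarrow> smooth_real_on n S (\<lambda>x. x i)"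
  by (simp add: smooth_real_on_Ck Ck_on_coord)

lemma smooth_real_on_add:
  "cart_open n S \<Longrightarrow> smooth_real_on n S f \<Longrightarrow> smooth_real_on n S g \<Longrightarrow> smooth_real_on n S (\<lambda>x. f x + g x)"
  by (simp add: smooth_real_on_Ck Ck_on_add)

lemma smooth_real_on_mult:
  "cart_open n S \<Longrightarrow> smooth_real_on n S f \<Longrightarrow> smooth_real_on n S g \<Longrightarrow> smooth_real_on n S (\<lambda>x. f x * g x)"
  by (simp add: smooth_real_on_Ck Ck_on_mult)

lemma smooth_real_on_diff:
  assumes "cart_open n S" "smooth_real_on n S f" "smooth_real_on n S g"
  shows "smooth_real_on n S (\<lambda>x. f x - g x)"
  using smooth_real_on_add[OF assms(1,2) smooth_real_on_mult[OF assms(1) smooth_real_on_const[OF assms(1), of "-1"] assms(3)]]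
  by simp

lemma smooth_real_on_inverse:
  "cart_open n S \<Longrightarrow> (\<And>x. x \<in> S \<Longrightarrow> f x \<noteq> 0) \<Longrightarrow> smooth_real_on n S f \<Longrightarrow> smooth_real_on n S (\<lambda>x. inverse (f x))"
  by (simp add: smooth_real_on_Ck Ck_on_inverse)

lemma smooth_real_on_sum:
  "cart_open n S \<Longrightarrow> (\<And>j. j \<in> A \<Longrightarrow> smooth_real_on n S (f j)) \<Longrightarrow> smooth_real_on n S (\<lambda>x. \<Sum>j\<in>A. f j x)"
  by (simp add: smooth_real_on_Ck Ck_on_sum)

lemma smooth_real_on_prod:
  assumes "cart_open n S" "\<And>j. j \<in> A \<Longrightarrow> smooth_real_on n S (f j)"
  shows "smooth_real_on n S (\<lambda>x. \<Prod>j\<in>A. f j x)"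
  using assms(2)
  by (induction A rule: infinite_finite_induct)
    (auto intro: smooth_real_on_const[OF assms(1)] smooth_real_on_mult[OF assms(1)])

lemma smooth_real_on_compose:
  assumes "cart_open n S" "cart_open N T" "\<And>x. x \<in> S \<Longrightarrow> g x \<in> T"
    and "smooth_real_on N T f" "\<And>j. j < N \<Longrightarrow> smooth_real_on n S (\<lambda>x. g x j)"
  shows "smooth_real_on n S (\<lambda>x. f (g x))"
  unfolding smooth_real_on_Ck[OF assms(1)]
proof
  fix k
  show "Ck_on k n S (\<lambda>x. f (g x))"
  proof (rule Ck_on_compose[OF assms(1-3)])
    show "Ck_on k N T f" using assms(4) smooth_real_on_Ck[OF assms(2)] by blast
    show "Ck_on k n S (\<lambda>x. g x j)" if "j < N" for j
      using assms(5)[OF that] smooth_real_on_Ck[OF assms(1)] by blast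
  qed
qed

lemma smooth_real_on_iterated:
  "smooth_real_on n S f \<Longrightarrow> set I \<subseteq> {..<n} \<Longrightarrow> smooth_real_on n S (iterated_partial I f)"
  unfolding smooth_real_on_def iterated_partial_append[symmetric] by auto

lemma smooth_real_on_partial:
  "smooth_real_on n S f \<Longrightarrow> i < n \<Longrightarrow> smooth_real_on n S (partial_deriv i f)"
  using smooth_real_on_iterated[of n S f "[i]"] by (simp add: iterated_partial_Cons)

lemma smooth_has_partial_deriv:
  assumes "smooth_real_on n S f" "x \<in> S" "i < n"
  shows "((\<lambda>t. f (x(i := t))) has_real_derivative partial_deriv i f x) (at (x i))"
  using assms unfolding smooth_real_on_def
  by (intro has_partial_deriv) (metis empty_set empty_subsetI iterated_partial_Nil)

lemma smooth_real_on_continuous: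
  "S \<subseteq> cart n \<Longrightarrow> smooth_real_on n S f \<Longrightarrow> continuous_on S f"
  using smooth_real_on_iff_Ck Ck_on_continuous by blast

lemma continuous_smooth_vector:
  assumes "cart_open n S" "\<And>x. x \<in> S \<Longrightarrow> g x \<in> cart N" "\<And>j. j < N \<Longrightarrow> smooth_real_on n S (\<lambda>x. g x j)"
  shows "continuous_on S g"
  using assms smooth_real_on_continuous[OF cart_open_subset[OF assms(1)]] by (intro continuous_on_vector) auto

lemma cart_open_preimage:
  assumes "cart_open n S" "continuous_on S g" "\<And>x. x \<in> S \<Longrightarrow> g x \<in> cart N" "cart_open N T"
  shows "cart_open n (S \<inter> g -` T)"
proof -
  obtain T' where T': "open T'" "T = T' \<inter> cart N" using assms(4) cart_open_iff by blast
  have "openin (top_of_set S) (S \<inter> g -` T')"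
    using assms(2) T'(1) by (rule continuous_openin_preimage_gen)
  moreover have "openin (top_of_set (cart n)) S" using assms(1) Euclidean_space_eq by metis
  ultimately have "openin (top_of_set (cart n)) (S \<inter> g -` T')" by (rule openin_trans)
  moreover have "S \<inter> g -` T' = S \<inter> g -` T" using T' assms(3) by auto
  ultimately show ?thesis using Euclidean_space_eq by metis
qed

lemma smooth_chain_rule:
  assumes "cart_open n S" "cart_open N T" "\<And>x. x \<in> S \<Longrightarrow> g x \<in> T"
    and "smooth_real_on N T f" "\<And>j. j < N \<Longrightarrow> smooth_real_on n S (\<lambda>x. g x j)"
    and "x \<in> S" "i < n"
  shows "partial_deriv i (\<lambda>x. f (g x)) x = (\<Sum>j<N. partial_deriv j f (g x) * partial_deriv i (\<lambda>x. g x j) x)"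
proof (intro partial_deriv_eqI chain_rule[OF assms(1-3)])
  show "Ck_on (Suc 0) N T f" using assms(4) smooth_real_on_Ck[OF assms(2)] by blast
  show "Ck_on (Suc 0) n S (\<lambda>x. g x j)" if "j < N" for j
    using assms(5)[OF that] smooth_real_on_Ck[OF assms(1)] by blast
qed (use assms(6,7) in auto)

lemma partial_deriv_coord: "partial_deriv i (\<lambda>x. x j) x = (if i = j then 1 else 0)"
  by (auto simp: partial_deriv_def)

lemma partial_deriv_mult:
  assumes "smooth_real_on n S f" "smooth_real_on n S g" "x \<in> S" "i < n"
  shows "partial_deriv i (\<lambda>x. f x * g x) x = partial_deriv i f x * g x + f x * partial_deriv i g x"
  using DERIV_mult[OF smooth_has_partial_deriv[OF assms(1,3,4)] smooth_has_partial_deriv[OF assms(2-4)]]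
  by (intro partial_deriv_eqI) (simp add: mult.commute)

lemma partial_deriv_add:
  assumes "smooth_real_on n S f" "smooth_real_on n S g" "x \<in> S" "i < n"
  shows "partial_deriv i (\<lambda>x. f x + g x) x = partial_deriv i f x + partial_deriv i g x"
  using DERIV_add[OF smooth_has_partial_deriv[OF assms(1,3,4)] smooth_has_partial_deriv[OF assms(2-4)]]
  by (intro partial_deriv_eqI) simp

text \<open>The chain rule for \<open>F \<circ> G = id\<close>, one entry of the product of the two Jacobians.\<close>

lemma jacobian_of_inverse:
  assumes S: "cart_open n S" and T: "cart_open N T"
    and G: "\<And>y. y \<in> T \<Longrightarrow> G y \<in> S" "\<And>j. j < n \<Longrightarrow> smooth_real_on N T (\<lambda>y. G y j)"
    and F: "smooth_real_on n S (\<lambda>x. F x i)"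
    and FG: "\<And>y. y \<in> T \<Longrightarrow> F (G y) i = y i" and "y \<in> T" "l < N"
  shows "(\<Sum>j<n. partial_deriv j (\<lambda>x. F x i) (G y) * partial_deriv l (\<lambda>y. G y j) y) = (if l = i then 1 else 0)"
proof -
  have "(\<Sum>j<n. partial_deriv j (\<lambda>x. F x i) (G y) * partial_deriv l (\<lambda>y. G y j) y)
      = partial_deriv l (\<lambda>y. F (G y) i) y"
    using smooth_chain_rule[OF T S G(1) F G(2) \<open>y \<in> T\<close> \<open>l < N\<close>] by simp
  also have "\<dots> = partial_deriv l (\<lambda>y. y i) y"
    by (rule partial_deriv_cong[OF T \<open>y \<in> T\<close> \<open>l < N\<close>]) (rule FG)
  finally show ?thesis by (simp add: partial_deriv_coord)
qed

text \<open>The Jacobian of the right inverse, applied to \<open>w\<close>, gives the preimage \<open>v\<close> of \<open>w\<close>.\<close>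

lemma jacobian_surjective:
  assumes S: "cart_open n S" and T: "cart_open N T"
    and G: "\<And>y. y \<in> T \<Longrightarrow> G y \<in> S" "\<And>j. j < n \<Longrightarrow> smooth_real_on N T (\<lambda>y. G y j)"
    and F: "\<And>i. i < N \<Longrightarrow> smooth_real_on n S (\<lambda>x. F x i)"
    and FG: "\<And>y i. y \<in> T \<Longrightarrow> i < N \<Longrightarrow> F (G y) i = y i" and y: "y \<in> T"
  shows "\<exists>v. \<forall>i<N. (\<Sum>j<n. partial_deriv j (\<lambda>x. F x i) (G y) * v j) = w i"
proof (intro exI[of _ "\<lambda>j. \<Sum>l<N. partial_deriv l (\<lambda>y. G y j) y * w l"] allI impI)
  fix i assume i: "i < N"
  have "(\<Sum>j<n. partial_deriv j (\<lambda>x. F x i) (G y) * (\<Sum>l<N. partial_deriv l (\<lambda>y. G y j) y * w l))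
     = (\<Sum>l<N. (\<Sum>j<n. partial_deriv j (\<lambda>x. F x i) (G y) * partial_deriv l (\<lambda>y. G y j) y) * w l)"
    unfolding sum_distrib_left sum_distrib_right mult.assoc by (rule sum.swap)
  also have "\<dots> = (\<Sum>l<N. (if l = i then 1 else 0) * w l)"
    by (intro sum.cong refl arg_cong2[of _ _ _ _ "(*)"] jacobian_of_inverse[OF S T G F FG y]) (use i in auto)
  also have "\<dots> = w i" using i by (simp add: if_distrib[of "\<lambda>c. c * _"] sum.delta cong: if_cong)
  finally show "(\<Sum>j<n. partial_deriv j (\<lambda>x. F x i) (G y) * (\<Sum>l<N. partial_deriv l (\<lambda>y. G y j) y * w l)) = w i" .
qed

text \<open>Both dimensions are the trace of a product of the two mutually inverse Jacobians, and the trace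
  of a product does not depend on the order of the factors.\<close>

lemma dimension_invariance:
  assumes S: "cart_open n S" and T: "cart_open N T"
    and F: "\<And>x. x \<in> S \<Longrightarrow> F x \<in> T" "\<And>i. i < N \<Longrightarrow> smooth_real_on n S (\<lambda>x. F x i)"
    and G: "\<And>y. y \<in> T \<Longrightarrow> G y \<in> S" "\<And>j. j < n \<Longrightarrow> smooth_real_on N T (\<lambda>y. G y j)"
    and FG: "\<And>y. y \<in> T \<Longrightarrow> F (G y) = y" and GF: "\<And>x. x \<in> S \<Longrightarrow> G (F x) = x" and x: "x \<in> S"
  shows "n = N"
proof -
  define A where "A i j = partial_deriv j (\<lambda>x. F x i) x" for i j
  define B where "B j i = partial_deriv i (\<lambda>y. G y j) (F x)" for j i
  have "(\<Sum>j<n. A i j * B j i) = 1" if "i < N" for i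
    using jacobian_of_inverse[OF S T G, of F i "F x" i] that FG GF F x by (simp add: A_def B_def)
  moreover have "(\<Sum>i<N. B j i * A i j) = 1" if "j < n" for j
    using jacobian_of_inverse[OF T S F, of G j x j] that FG GF G x by (simp add: A_def B_def)
  ultimately have "real N = (\<Sum>i<N. \<Sum>j<n. A i j * B j i)" "real n = (\<Sum>j<n. \<Sum>i<N. B j i * A i j)"
    by simp_all
  then have "real n = real N" by (subst (asm) sum.swap) (simp add: mult.commute)
  then show ?thesis by simp
qed

subsection \<open>Symmetry of iterated partial derivatives\<close>

text \<open>The mean value theorem, applied first in direction \<open>i\<close> and then in direction \<open>j\<close>, expresses the
  second difference by a mixed derivative at a nearby point. The second difference is symmetric in
  \<open>i\<close> and \<open>j\<close>, from which the symmetry of the mixed derivatives follows.\<close>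

lemma second_difference:
  assumes S: "cart_open n S" and f: "smooth_real_on n S f" and x: "x \<in> S" and ij: "i < n" "j < n" "i \<noteq> j"
  shows "\<exists>e>0. \<forall>h. 0 < h \<and> h < e \<longrightarrow> (\<exists>y\<in>cart n. (\<forall>l<n. \<bar>y l - x l\<bar> \<le> h) \<and>
    f (x(i := x i + h, j := x j + h)) - f (x(i := x i + h)) - (f (x(j := x j + h)) - f x)
      = h * (h * partial_deriv j (partial_deriv i f) y))"
proof -
  obtain e where e: "e > 0" "\<And>y. y \<in> cart n \<Longrightarrow> (\<And>i. i < n \<Longrightarrow> \<bar>y i - x i\<bar> < e) \<Longrightarrow> y \<in> S"
    using cart_open_box[OF S x] by blast
  have xE: "x \<in> cart n" using S x cart_open_subset by blast
  have "\<exists>y\<in>cart n. (\<forall>l<n. \<bar>y l - x l\<bar> \<le> h) \<and>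
    f (x(i := x i + h, j := x j + h)) - f (x(i := x i + h)) - (f (x(j := x j + h)) - f x)
      = h * (h * partial_deriv j (partial_deriv i f) y)" if h: "0 < h" "h < e" for h
  proof -
    have inS: "x(i := s, j := r) \<in> S" if "\<bar>s - x i\<bar> \<le> h" "\<bar>r - x j\<bar> \<le> h" for s r
      by (rule e(2)) (use that h xE ij in \<open>auto simp: cart_upd\<close>)
    have inS1: "x(i := s) \<in> S" if "\<bar>s - x i\<bar> \<le> h" for s
      by (rule e(2)) (use that h xE ij in \<open>auto simp: cart_upd\<close>)
    define g where "g s = f (x(i := s, j := x j + h)) - f (x(i := s))" for s
    have "(g has_real_derivative partial_deriv i f (x(i := s, j := x j + h)) - partial_deriv i f (x(i := s))) (at s)"
      if "\<bar>s - x i\<bar> \<le> \<bar>(x i + h) - x i\<bar>" for s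
      unfolding g_def
      using smooth_has_partial_deriv[OF f inS[of s "x j + h"] ij(1)] smooth_has_partial_deriv[OF f inS1[of s] ij(1)]
        that h ij by (intro DERIV_diff) (simp_all add: fun_upd_twist)
    from mvt_symmetric[of "x i" "x i + h" g, OF this]
    obtain \<xi> where \<xi>: "\<bar>\<xi> - x i\<bar> \<le> h" "g (x i + h) - g (x i) =
       h * (partial_deriv i f (x(i := \<xi>, j := x j + h)) - partial_deriv i f (x(i := \<xi>)))"
      using h by auto
    have "((\<lambda>r. partial_deriv i f (x(i := \<xi>, j := r))) has_real_derivative
        partial_deriv j (partial_deriv i f) (x(i := \<xi>, j := r))) (at r)"
      if "\<bar>r - x j\<bar> \<le> \<bar>(x j + h) - x j\<bar>" for r
      using smooth_has_partial_deriv[OF smooth_real_on_partial[OF f ij(1)] inS[OF \<xi>(1), of r] ij(2)] that h by simp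
    from mvt_symmetric[of "x j" "x j + h" "\<lambda>r. partial_deriv i f (x(i := \<xi>, j := r))", OF this]
    obtain \<eta> where \<eta>: "\<bar>\<eta> - x j\<bar> \<le> h" "partial_deriv i f (x(i := \<xi>, j := x j + h)) - partial_deriv i f (x(i := \<xi>, j := x j)) =
       h * partial_deriv j (partial_deriv i f) (x(i := \<xi>, j := \<eta>))"
      using h by auto
    have "x(i := \<xi>, j := x j) = x(i := \<xi>)" using ij by auto
    with \<xi> \<eta> have "g (x i + h) - g (x i) = h * (h * partial_deriv j (partial_deriv i f) (x(i := \<xi>, j := \<eta>)))"
      by simp
    moreover have "\<forall>l<n. \<bar>(x(i := \<xi>, j := \<eta>)) l - x l\<bar> \<le> h" using \<xi>(1) \<eta>(1) h by auto
    ultimately show ?thesis using cart_upd[OF cart_upd[OF xE ij(1)] ij(2)]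
      by (intro bexI[of _ "x(i := \<xi>, j := \<eta>)"]) (simp_all add: g_def)
  qed
  with e(1) show ?thesis by blast
qed

lemma tendsto_within_box:
  assumes "cart_open n S" "x \<in> S" "continuous_on S f" "e > 0"
    and "\<And>h. 0 < h \<Longrightarrow> h < e \<Longrightarrow> y h \<in> cart n \<and> (\<forall>l<n. \<bar>y h l - x l\<bar> \<le> h)"
  shows "((\<lambda>h. f (y h)) \<longlongrightarrow> (f x :: real)) (at_right (0::real))"
proof (rule tendsto_cart[OF assms(1-3)])
  have ev: "\<forall>\<^sub>F h in at_right (0::real). 0 < h \<and> h < e"
    using assms(4) eventually_at_right[of 0 e] by (auto intro!: exI[of _ e])
  then show "\<forall>\<^sub>F h in at_right 0. y h \<in> cart n" by eventually_elim (use assms(5) in blast)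
  fix i assume i: "i < n"
  have "\<forall>\<^sub>F h in at_right 0. norm (y h i - x i) \<le> h"
    using ev by eventually_elim (use assms(5) i in auto)
  then have "((\<lambda>h. y h i - x i) \<longlongrightarrow> 0) (at_right 0)"
    by (rule Lim_null_comparison) (simp add: filterlim_ident tendsto_ident_at)
  then show "((\<lambda>h. y h i) \<longlongrightarrow> x i) (at_right 0)" by (simp add: LIM_zero_iff)
qed

lemma partial_deriv_commute:
  assumes S: "cart_open n S" and f: "smooth_real_on n S f" and x: "x \<in> S" and ij: "i < n" "j < n"
  shows "partial_deriv i (partial_deriv j f) x = partial_deriv j (partial_deriv i f) x"
proof (cases "i = j")
  case ne: False
  let ?D = "\<lambda>h. f (x(i := x i + h, j := x j + h)) - f (x(i := x i + h)) - (f (x(j := x j + h)) - f x)"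
  obtain e1 where e1: "e1 > 0" "\<forall>h. 0 < h \<and> h < e1 \<longrightarrow> (\<exists>y\<in>cart n. (\<forall>l<n. \<bar>y l - x l\<bar> \<le> h) \<and>
    ?D h = h * (h * partial_deriv j (partial_deriv i f) y))"
    using second_difference[OF S f x ij ne] by blast
  then obtain y where y: "\<And>h. 0 < h \<Longrightarrow> h < e1 \<Longrightarrow> y h \<in> cart n \<and> (\<forall>l<n. \<bar>y h l - x l\<bar> \<le> h)"
    "\<And>h. 0 < h \<Longrightarrow> h < e1 \<Longrightarrow> ?D h = h * (h * partial_deriv j (partial_deriv i f) (y h))" by metis
  obtain e2 where e2: "e2 > 0" "\<forall>h. 0 < h \<and> h < e2 \<longrightarrow> (\<exists>y\<in>cart n. (\<forall>l<n. \<bar>y l - x l\<bar> \<le> h) \<and>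
    f (x(j := x j + h, i := x i + h)) - f (x(j := x j + h)) - (f (x(i := x i + h)) - f x)
      = h * (h * partial_deriv i (partial_deriv j f) y))"
    using second_difference[OF S f x ij(2,1)] ne by blast
  then obtain z where z: "\<And>h. 0 < h \<Longrightarrow> h < e2 \<Longrightarrow> z h \<in> cart n \<and> (\<forall>l<n. \<bar>z h l - x l\<bar> \<le> h)"
    "\<And>h. 0 < h \<Longrightarrow> h < e2 \<Longrightarrow> f (x(j := x j + h, i := x i + h)) - f (x(j := x j + h)) - (f (x(i := x i + h)) - f x)
      = h * (h * partial_deriv i (partial_deriv j f) (z h))" by metis
  have cont: "continuous_on S (partial_deriv j (partial_deriv i f))" "continuous_on S (partial_deriv i (partial_deriv j f))"
    using f ij by (simp_all add: smooth_real_on_continuous[OF cart_open_subset[OF S]] smooth_real_on_partial)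
  note ly = tendsto_within_box[OF S x cont(1) e1(1) y(1)]
  note lz = tendsto_within_box[OF S x cont(2) e2(1) z(1)]
  have "\<forall>\<^sub>F h in at_right (0::real). 0 < h \<and> h < min e1 e2"
    using e1(1) e2(1) eventually_at_right[of 0 "min e1 e2"] by (auto intro!: exI[of _ "min e1 e2"])
  then have "\<forall>\<^sub>F h in at_right 0. partial_deriv j (partial_deriv i f) (y h) = partial_deriv i (partial_deriv j f) (z h)"
  proof eventually_elim
    case (elim h)
    have "x(i := x i + h, j := x j + h) = x(j := x j + h, i := x i + h)" using ne by auto
    then have "h * (h * partial_deriv j (partial_deriv i f) (y h)) = h * (h * partial_deriv i (partial_deriv j f) (z h))"
      using y(2)[of h] z(2)[of h] elim by (simp add: algebra_simps)
    then show ?case using elim by simp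
  qed
  from Lim_transform_eventually[OF ly this] lz show ?thesis
    by (intro tendsto_unique[OF trivial_limit_at_right_real]) auto
qed simp

lemma iterated_partial_insort:
  assumes S: "cart_open n S" and f: "smooth_real_on n S f" and "i < n" "set I \<subseteq> {..<n}" "x \<in> S"
  shows "iterated_partial (insort i I) f x = iterated_partial (i # I) f x"
  using assms(4,5)
proof (induction I arbitrary: x)
  case (Cons j I)
  show ?case
  proof (cases "i \<le> j")
    case False
    then have "iterated_partial (insort i (j # I)) f x = partial_deriv j (iterated_partial (insort i I) f) x"
      by (simp add: iterated_partial_Cons)
    also have "\<dots> = partial_deriv j (partial_deriv i (iterated_partial I f)) x"
      using Cons by (intro partial_deriv_cong[OF S]) (auto simp: iterated_partial_Cons)
    also have "\<dots> = partial_deriv i (partial_deriv j (iterated_partial I f)) x"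
      using Cons.prems assms(3) by (intro partial_deriv_commute[OF S] smooth_real_on_iterated[OF f]) auto
    finally show ?thesis by (simp add: iterated_partial_Cons)
  qed simp
qed simp

text \<open>Multi-indices are encoded by sorted lists. By the symmetry of derivatives nothing is lost.\<close>

lemma iterated_partial_sort:
  assumes S: "cart_open n S" and f: "smooth_real_on n S f" and "set I \<subseteq> {..<n}" "x \<in> S"
  shows "iterated_partial (sort I) f x = iterated_partial I f x"
  using assms(3,4)
proof (induction I arbitrary: x)
  case (Cons i I)
  have "iterated_partial (sort (i # I)) f x = partial_deriv i (iterated_partial (sort I) f) x"
    using Cons.prems iterated_partial_insort[OF S f, of i "sort I" x] by (simp add: iterated_partial_Cons)
  also have "\<dots> = partial_deriv i (iterated_partial I f) x"
    using Cons by (intro partial_deriv_cong[OF S]) auto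
  finally show ?case by (simp add: iterated_partial_Cons)
qed simp

subsection \<open>Functions that agree to finite order at a point\<close>

text \<open>The recursion on \<open>k\<close> matches the chain rule; the description by iterated derivatives, which the
  definition of jets uses, is \<open>agree_iff_iterated\<close>.\<close>

fun agree :: "nat \<Rightarrow> nat \<Rightarrow> (nat \<Rightarrow> real) \<Rightarrow> ((nat \<Rightarrow> real) \<Rightarrow> real) \<Rightarrow> ((nat \<Rightarrow> real) \<Rightarrow> real) \<Rightarrow> bool" where
  "agree 0 n x f g \<longleftrightarrow> f x = g x"
| "agree (Suc k) n x f g \<longleftrightarrow> f x = g x \<and> (\<forall>i<n. agree k n x (partial_deriv i f) (partial_deriv i g))"

lemma agree_iff_iterated:
  "agree k n x f g \<longleftrightarrow>
     (\<forall>I. set I \<subseteq> {..<n} \<and> length I \<le> k \<longrightarrow> iterated_partial I f x = iterated_partial I g x)"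
proof (induction k arbitrary: f g)
  case (Suc k)
  have "(\<forall>I. Q I) \<longleftrightarrow> Q [] \<and> (\<forall>I i. Q (I @ [i]))" for Q :: "nat list \<Rightarrow> bool"
    by (metis rev_exhaust)
  from this[of "\<lambda>I. set I \<subseteq> {..<n} \<and> length I \<le> Suc k \<longrightarrow> iterated_partial I f x = iterated_partial I g x"]
  show ?case unfolding agree.simps Suc by (auto simp: iterated_partial_append iterated_partial_Cons)
qed simp

lemma agree_cong:
  assumes "cart_open n S" "x \<in> S" "\<And>y. y \<in> S \<Longrightarrow> f y = f' y" "\<And>y. y \<in> S \<Longrightarrow> g y = g' y"
  shows "agree k n x f g \<longleftrightarrow> agree k n x f' g'"
proof -
  have "iterated_partial I f x = iterated_partial I f' x \<and> iterated_partial I g x = iterated_partial I g' x"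
    if "set I \<subseteq> {..<n}" for I
    using iterated_partial_cong[OF assms(1) that] assms(2-4) by blast
  then show ?thesis unfolding agree_iff_iterated by auto
qed

lemma agree_mono: "agree k n x f g \<Longrightarrow> j \<le> k \<Longrightarrow> agree j n x f g"
  unfolding agree_iff_iterated by auto

lemma agree_refl [simp]: "agree k n x f f"
  unfolding agree_iff_iterated by auto

lemma agree_add:
  assumes S: "cart_open n S" "x \<in> S"
  shows "smooth_real_on n S f \<Longrightarrow> smooth_real_on n S f' \<Longrightarrow> smooth_real_on n S g \<Longrightarrow> smooth_real_on n S g' \<Longrightarrow>
    agree k n x f f' \<Longrightarrow> agree k n x g g' \<Longrightarrow> agree k n x (\<lambda>x. f x + g x) (\<lambda>x. f' x + g' x)"
proof (induction k arbitrary: f f' g g')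
  case (Suc k)
  have "agree k n x (partial_deriv i (\<lambda>x. f x + g x)) (partial_deriv i (\<lambda>x. f' x + g' x))" if i: "i < n" for i
  proof -
    have "agree k n x (\<lambda>x. partial_deriv i f x + partial_deriv i g x) (\<lambda>x. partial_deriv i f' x + partial_deriv i g' x)"
      using Suc.prems i by (intro Suc.IH smooth_real_on_partial) auto
    then show ?thesis
      by (rule iffD2[OF agree_cong[OF S], rotated 2])
        (rule partial_deriv_add[OF Suc.prems(1,3) _ i] partial_deriv_add[OF Suc.prems(2,4) _ i], assumption)+
  qed
  with Suc.prems show ?case by simp
qed simp

lemma agree_mult:
  assumes S: "cart_open n S" "x \<in> S"
  shows "smooth_real_on n S f \<Longrightarrow> smooth_real_on n S f' \<Longrightarrow> smooth_real_on n S g \<Longrightarrow> smooth_real_on n S g' \<Longrightarrow>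
    agree k n x f f' \<Longrightarrow> agree k n x g g' \<Longrightarrow> agree k n x (\<lambda>x. f x * g x) (\<lambda>x. f' x * g' x)"
proof (induction k arbitrary: f f' g g')
  case (Suc k)
  have "agree k n x (partial_deriv i (\<lambda>x. f x * g x)) (partial_deriv i (\<lambda>x. f' x * g' x))" if i: "i < n" for i
  proof -
    have le: "agree k n x f f'" "agree k n x g g'" 
      using Suc.prems(5,6) by (auto intro: agree_mono simp del: agree.simps)
    have "agree k n x (\<lambda>x. partial_deriv i f x * g x + f x * partial_deriv i g x)
        (\<lambda>x. partial_deriv i f' x * g' x + f' x * partial_deriv i g' x)"
      using Suc.prems i le by (intro agree_add[OF S] Suc.IH smooth_real_on_partial smooth_real_on_mult[OF S(1)]) auto
    then show ?thesis
      by (rule iffD2[OF agree_cong[OF S], rotated 2])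
        (rule partial_deriv_mult[OF Suc.prems(1,3) _ i] partial_deriv_mult[OF Suc.prems(2,4) _ i], assumption)+
  qed
  with Suc.prems show ?case by simp
qed simp

lemma agree_sum:
  assumes S: "cart_open n S" "x \<in> S" and "finite A"
    and "\<And>j. j \<in> A \<Longrightarrow> smooth_real_on n S (f j)" "\<And>j. j \<in> A \<Longrightarrow> smooth_real_on n S (g j)"
    and "\<And>j. j \<in> A \<Longrightarrow> agree k n x (f j) (g j)"
  shows "agree k n x (\<lambda>x. \<Sum>j\<in>A. f j x) (\<lambda>x. \<Sum>j\<in>A. g j x)"
  using assms(3-) by induction (auto intro!: agree_add[OF S] smooth_real_on_sum[OF S(1)])

text \<open>Derivatives up to order \<open>k\<close> of a composition depend only on the derivatives up to order \<open>k\<close> of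
  its constituents. By the chain rule the first derivatives are again sums of products of
  compositions, so that induction replaces the formula of Faa di Bruno.\<close>

lemma agree_compose:
  assumes S: "cart_open n S" "x \<in> S" and T: "cart_open N T"
    and g: "\<And>y. y \<in> S \<Longrightarrow> g y \<in> T" "\<And>j. j < N \<Longrightarrow> smooth_real_on n S (\<lambda>y. g y j)"
    and h: "\<And>y. y \<in> S \<Longrightarrow> h y \<in> T" "\<And>j. j < N \<Longrightarrow> smooth_real_on n S (\<lambda>y. h y j)"
    and gh: "g x = h x"
  shows "smooth_real_on N T f \<Longrightarrow> smooth_real_on N T f' \<Longrightarrow> agree k N (g x) f f' \<Longrightarrow>
    (\<And>j. j < N \<Longrightarrow> agree k n x (\<lambda>y. g y j) (\<lambda>y. h y j)) \<Longrightarrow>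
    agree k n x (\<lambda>y. f (g y)) (\<lambda>y. f' (h y))"
proof (induction k arbitrary: f f')
  case 0
  then show ?case using gh by simp
next
  case (Suc k)
  have "agree k n x (partial_deriv i (\<lambda>x. f (g x))) (partial_deriv i (\<lambda>x. f' (h x)))" if i: "i < n" for i
  proof -
    have "agree k n x (\<lambda>y. \<Sum>j<N. partial_deriv j f (g y) * partial_deriv i (\<lambda>x. g x j) y)
        (\<lambda>y. \<Sum>j<N. partial_deriv j f' (h y) * partial_deriv i (\<lambda>x. h x j) y)"
    proof (intro agree_sum[OF S] agree_mult[OF S])
      fix j assume "j \<in> {..<N}"
      then have j: "j < N" by simp
      show "agree k n x (\<lambda>y. partial_deriv j f (g y)) (\<lambda>y. partial_deriv j f' (h y))"
      proof (rule Suc.IH)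
        show "smooth_real_on N T (partial_deriv j f)" "smooth_real_on N T (partial_deriv j f')"
          using Suc.prems(1,2) j by (simp_all add: smooth_real_on_partial)
        show "agree k N (g x) (partial_deriv j f) (partial_deriv j f')" using Suc.prems(3) j by simp
        show "agree k n x (\<lambda>y. g y l) (\<lambda>y. h y l)" if "l < N" for l
          by (rule agree_mono[OF Suc.prems(4)[OF that]]) simp
      qed
      show "agree k n x (partial_deriv i (\<lambda>x. g x j)) (partial_deriv i (\<lambda>x. h x j))"
        using Suc.prems(4)[OF j] i by simp
      show "smooth_real_on n S (\<lambda>y. partial_deriv j f (g y))" "smooth_real_on n S (\<lambda>y. partial_deriv j f' (h y))"
        by (rule smooth_real_on_compose[OF S(1) T g(1) smooth_real_on_partial[OF Suc.prems(1) j] g(2)]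
            smooth_real_on_compose[OF S(1) T h(1) smooth_real_on_partial[OF Suc.prems(2) j] h(2)]; assumption)+
      show "smooth_real_on n S (partial_deriv i (\<lambda>x. g x j))" "smooth_real_on n S (partial_deriv i (\<lambda>x. h x j))"
        using i j g h by (auto intro!: smooth_real_on_partial)
      then show "smooth_real_on n S (\<lambda>y. partial_deriv j f (g y) * partial_deriv i (\<lambda>x. g x j) y)"
        "smooth_real_on n S (\<lambda>y. partial_deriv j f' (h y) * partial_deriv i (\<lambda>x. h x j) y)"
        using \<open>smooth_real_on n S (\<lambda>y. partial_deriv j f (g y))\<close> \<open>smooth_real_on n S (\<lambda>y. partial_deriv j f' (h y))\<close>
        by (simp_all add: smooth_real_on_mult[OF S(1)])
    qed simp
    moreover have "partial_deriv i (\<lambda>x. f (g x)) y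
        = (\<Sum>j<N. partial_deriv j f (g y) * partial_deriv i (\<lambda>x. g x j) y)" if "y \<in> S" for y
      by (rule smooth_chain_rule[OF S(1) T g(1) Suc.prems(1) g(2) that i])
    moreover have "partial_deriv i (\<lambda>x. f' (h x)) y
        = (\<Sum>j<N. partial_deriv j f' (h y) * partial_deriv i (\<lambda>x. h x j) y)" if "y \<in> S" for y
      by (rule smooth_chain_rule[OF S(1) T h(1) Suc.prems(2) h(2) that i])
    ultimately show ?thesis by (rule iffD2[OF agree_cong[OF S], rotated 2])
  qed
  with Suc.prems gh show ?case by simp
qed

section \<open>Charts and smooth maps\<close>

text \<open>Chart domains are open, so that both a chart and its inverse carry open sets to open sets of the
  ambient spaces. These two properties replace the homeomorphism between subspaces.\<close>

lemma topological_chartD: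
  assumes "topological_chart M (U, \<phi>)"
  shows "openin (mtop M) U" "U \<subseteq> points M" "cart_open (mdim M) (\<phi> ` U)" "inj_on \<phi> U"
    and "\<And>A. openin (mtop M) A \<Longrightarrow> cart_open (mdim M) (\<phi> ` (U \<inter> A))"
    and "\<And>W. cart_open (mdim M) W \<Longrightarrow> openin (mtop M) (U \<inter> \<phi> -` W)"
proof -
  have h: "homeomorphic_map (subtopology (mtop M) U) (subtopology (Euclidean_space (mdim M)) (\<phi> ` U)) \<phi>"
    and U: "openin (mtop M) U" and im: "cart_open (mdim M) (\<phi> ` U)"
    using assms by (auto simp: topological_chart_def)
  show "openin (mtop M) U" "cart_open (mdim M) (\<phi> ` U)" by fact+
  show UM: "U \<subseteq> points M" using U by (rule openin_subset)
  have tU: "topspace (subtopology (mtop M) U) = U" using UM by auto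
  show inj: "inj_on \<phi> U"
    using h tU unfolding homeomorphic_eq_everything_map by metis
  show "cart_open (mdim M) (\<phi> ` (U \<inter> A))" if "openin (mtop M) A" for A
  proof -
    have "openin (subtopology (mtop M) U) (U \<inter> A)" using that by (simp add: openin_subtopology_Int2)
    then have "openin (subtopology (Euclidean_space (mdim M)) (\<phi> ` U)) (\<phi> ` (U \<inter> A))"
      using h homeomorphic_imp_open_map open_map_def by blast
    then show ?thesis using im openin_trans_full by blast
  qed
  show "openin (mtop M) (U \<inter> \<phi> -` W)" if "cart_open (mdim M) W" for W
  proof -
    have c: "continuous_map (subtopology (mtop M) U) (subtopology (Euclidean_space (mdim M)) (\<phi> ` U)) \<phi>"
      using h homeomorphic_imp_continuous_map by blast
    then have "continuous_map (subtopology (mtop M) U) (Euclidean_space (mdim M)) \<phi>"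
      by (rule continuous_map_into_fulltopology)
    then have "openin (subtopology (mtop M) U) {x \<in> topspace (subtopology (mtop M) U). \<phi> x \<in> W}"
      using that by (rule openin_continuous_map_preimage)
    moreover have "{x \<in> topspace (subtopology (mtop M) U). \<phi> x \<in> W} = U \<inter> \<phi> -` W" using tU by auto
    ultimately show ?thesis using U openin_trans_full by metis
  qed
qed

lemma topological_chartI:
  assumes U: "openin (mtop M) U" and inj: "inj_on \<phi> U"
    and im: "\<And>A. openin (mtop M) A \<Longrightarrow> A \<subseteq> U \<Longrightarrow> cart_open (mdim M) (\<phi> ` A)"
    and pre: "\<And>W. cart_open (mdim M) W \<Longrightarrow> openin (mtop M) (U \<inter> \<phi> -` W)"
  shows "topological_chart M (U, \<phi>)"
proof -
  have imU: "cart_open (mdim M) (\<phi> ` U)" using im U by blast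
  have UM: "U \<subseteq> points M" using U by (rule openin_subset)
  have tU: "topspace (subtopology (mtop M) U) = U" using UM by auto
  have tI: "topspace (subtopology (Euclidean_space (mdim M)) (\<phi> ` U)) = \<phi> ` U"
    using imU cart_open_subset by (simp add: inf.absorb2)
  have "homeomorphic_map (subtopology (mtop M) U) (subtopology (Euclidean_space (mdim M)) (\<phi> ` U)) \<phi>"
  proof (rule bijective_open_imp_homeomorphic_map)
    have "continuous_map (subtopology (mtop M) U) (Euclidean_space (mdim M)) \<phi>"
      unfolding continuous_map_def tU
    proof (intro conjI allI impI)
      show "\<phi> \<in> U \<rightarrow> cart (mdim M)" using imU cart_open_subset by blast
      fix W assume W: "cart_open (mdim M) W"
      have "openin (subtopology (mtop M) U) (U \<inter> (U \<inter> \<phi> -` W))"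
        using pre[OF W] by (rule openin_subtopology_Int2)
      moreover have "U \<inter> (U \<inter> \<phi> -` W) = {x \<in> U. \<phi> x \<in> W}" by auto
      ultimately show "openin (subtopology (mtop M) U) {x \<in> U. \<phi> x \<in> W}" by simp
    qed
    then show "continuous_map (subtopology (mtop M) U) (subtopology (Euclidean_space (mdim M)) (\<phi> ` U)) \<phi>"
      by (rule continuous_map_into_subtopology) (use tU in auto)
    show "open_map (subtopology (mtop M) U) (subtopology (Euclidean_space (mdim M)) (\<phi> ` U)) \<phi>"
      unfolding open_map_def
    proof (intro allI impI)
      fix A assume "openin (subtopology (mtop M) U) A"
      then have A: "openin (mtop M) A" "A \<subseteq> U" using openin_open_subtopology[OF U] by auto
      then have "cart_open (mdim M) (\<phi> ` A)" by (rule im)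
      moreover have "\<phi> ` A \<subseteq> \<phi> ` U" using A(2) by auto
      ultimately show "openin (subtopology (Euclidean_space (mdim M)) (\<phi> ` U)) (\<phi> ` A)"
        using openin_open_subtopology[OF imU] by blast
    qed
    show "\<phi> ` topspace (subtopology (mtop M) U) = topspace (subtopology (Euclidean_space (mdim M)) (\<phi> ` U))"
      using tU tI by simp
    show "inj_on \<phi> (topspace (subtopology (mtop M) U))" using inj tU by simp
  qed
  with U imU show ?thesis by (simp add: topological_chart_def)
qed

lemma chart_topological: "c \<in> charts M \<Longrightarrow> topological_chart M c"
  by (simp add: charts_def)

lemmas chart_openin = topological_chartD(1)[OF chart_topological]
  and chart_subset = topological_chartD(2)[OF chart_topological]
  and chart_image_open = topological_chartD(3)[OF chart_topological]
  and chart_inj = topological_chartD(4)[OF chart_topological]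
  and chart_open_image = topological_chartD(5)[OF chart_topological]
  and chart_preimage_open = topological_chartD(6)[OF chart_topological]

lemma chart_inv:
  assumes "(U, \<phi>) \<in> charts M"
  shows "p \<in> U \<Longrightarrow> inv_into U \<phi> (\<phi> p) = p" "x \<in> \<phi> ` U \<Longrightarrow> inv_into U \<phi> x \<in> U"
    "x \<in> \<phi> ` U \<Longrightarrow> \<phi> (inv_into U \<phi> x) = x" "p \<in> U \<Longrightarrow> \<phi> p \<in> cart (mdim M)"
  using chart_inj[OF assms] cart_open_subset[OF chart_image_open[OF assms]]
  by (auto simp: inv_into_into f_inv_into_f)

lemma atlas_subset_charts: "smooth_manifold M \<Longrightarrow> atlas M \<subseteq> charts M"
  by (auto simp: smooth_manifold_def charts_def)

lemma atlas_covers: "smooth_manifold M \<Longrightarrow> p \<in> points M \<Longrightarrow> \<exists>U \<phi>. (U, \<phi>) \<in> atlas M \<and> p \<in> U"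
  unfolding smooth_manifold_def by (metis (no_types, lifting) UN_E prod.collapse)

lemma charts_cover: "smooth_manifold M \<Longrightarrow> p \<in> points M \<Longrightarrow> \<exists>U \<phi>. (U, \<phi>) \<in> charts M \<and> p \<in> U"
  using atlas_covers[of M p] atlas_subset_charts[of M] by (meson subsetD)

text \<open>Two charts that are compatible with the atlas are compatible with each other: near each point the
  transition factors through a chart of the atlas.\<close>

lemma charts_smooth_transition:
  assumes M: "smooth_manifold M" and c: "(U, \<phi>) \<in> charts M" and d: "(V, \<psi>) \<in> charts M"
  shows "smooth_transition (mdim M) (U, \<phi>) (V, \<psi>)"
  unfolding smooth_transition_def prod.case
proof (intro allI impI)
  let ?n = "mdim M"
  fix i assume i: "i < ?n"
  have A: "cart_open ?n (\<phi> ` (U \<inter> V))" using chart_open_image[OF c chart_openin[OF d]] .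
  show "smooth_real_on ?n (\<phi> ` (U \<inter> V)) (\<lambda>x. \<psi> (inv_into U \<phi> x) i)"
  proof (rule smooth_real_on_local[OF cart_open_subset[OF A]])
    fix x assume "x \<in> \<phi> ` (U \<inter> V)"
    then obtain p where p: "p \<in> U" "p \<in> V" "x = \<phi> p" by blast
    then have "p \<in> points M" using chart_subset[OF c] by blast
    then obtain W \<kappa> where e: "(W, \<kappa>) \<in> atlas M" "p \<in> W" using atlas_covers[OF M] by blast
    have e': "(W, \<kappa>) \<in> charts M" using e(1) atlas_subset_charts[OF M] by blast
    let ?T = "\<phi> ` (U \<inter> (V \<inter> W))"
    have T: "cart_open ?n ?T" using chart_open_image[OF c] chart_openin[OF d] chart_openin[OF e'] by blast
    have s1: "smooth_real_on ?n (\<phi> ` (U \<inter> W)) (\<lambda>x. \<kappa> (inv_into U \<phi> x) j)" if "j < ?n" for j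
      using c e(1) that unfolding charts_def compatible_charts_def smooth_transition_def by blast
    have s2: "smooth_real_on ?n (\<kappa> ` (W \<inter> V)) (\<lambda>x. \<psi> (inv_into W \<kappa> x) i)"
      using d e(1) i unfolding charts_def compatible_charts_def smooth_transition_def by blast
    have "smooth_real_on ?n ?T (\<lambda>x. \<psi> (inv_into W \<kappa> (\<kappa> (inv_into U \<phi> x))) i)"
    proof (rule smooth_real_on_compose[OF T _ _ s2])
      show "cart_open ?n (\<kappa> ` (W \<inter> V))" using chart_open_image[OF e' chart_openin[OF d]] .
      show "\<kappa> (inv_into U \<phi> x) \<in> \<kappa> ` (W \<inter> V)" if "x \<in> ?T" for x
        using that chart_inv(1)[OF c] by auto
      show "smooth_real_on ?n ?T (\<lambda>x. \<kappa> (inv_into U \<phi> x) j)" if "j < ?n" for j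
        by (rule smooth_real_on_subset[OF _ s1[OF that]])
          (use cart_open_subset[OF chart_open_image[OF c chart_openin[OF e']]] in auto)
    qed
    then have "smooth_real_on ?n ?T (\<lambda>x. \<psi> (inv_into U \<phi> x) i)"
      by (rule smooth_real_on_cong[OF T, rotated]) (use chart_inv(1)[OF c] chart_inv(1)[OF e'] in auto)
    then show "\<exists>T. cart_open ?n T \<and> x \<in> T \<and> smooth_real_on ?n T (\<lambda>x. \<psi> (inv_into U \<phi> x) i)"
      using T p e(2) by blast
  qed
qed

lemma transition_smooth:
  assumes "smooth_manifold M" "(U, \<phi>) \<in> charts M" "(V, \<psi>) \<in> charts M" "i < mdim M"
  shows "smooth_real_on (mdim M) (\<phi> ` (U \<inter> V)) (\<lambda>x. \<psi> (inv_into U \<phi> x) i)"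
  using charts_smooth_transition[OF assms(1-3)] assms(4) by (simp add: smooth_transition_def)

lemma chart_restrict:
  assumes "(U, \<phi>) \<in> charts M" "openin (mtop M) A" "smooth_manifold M"
  shows "(U \<inter> A, \<phi>) \<in> charts M"
proof -
  note inj = chart_inj[OF assms(1)]
  have inv: "inv_into (U \<inter> A) \<phi> x = inv_into U \<phi> x" if "x \<in> \<phi> ` (U \<inter> A)" for x
    using that inj by (auto simp: inv_into_f_eq inj_on_Int)
  have t: "topological_chart M (U \<inter> A, \<phi>)"
  proof (rule topological_chartI)
    show "openin (mtop M) (U \<inter> A)" using chart_openin[OF assms(1)] assms(2) by blast
    show "inj_on \<phi> (U \<inter> A)" using inj by (rule inj_on_subset) auto
    show "cart_open (mdim M) (\<phi> ` B)" if "openin (mtop M) B" "B \<subseteq> U \<inter> A" for B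
      using chart_open_image[OF assms(1) that(1)] that(2) by (metis Int_subset_iff inf.absorb_iff2)
    show "openin (mtop M) (U \<inter> A \<inter> \<phi> -` W)" if "cart_open (mdim M) W" for W
    proof -
      have "U \<inter> A \<inter> \<phi> -` W = (U \<inter> \<phi> -` W) \<inter> A" by auto
      then show ?thesis using chart_preimage_open[OF assms(1) that] assms(2) by (metis openin_Int)
    qed
  qed
  have "compatible_charts (mdim M) (U \<inter> A, \<phi>) (V, \<psi>)" if "(V, \<psi>) \<in> atlas M" for V \<psi>
  proof -
    have d: "(V, \<psi>) \<in> charts M" using that assms(3) atlas_subset_charts by blast
    have o1: "cart_open (mdim M) (\<phi> ` (U \<inter> A \<inter> V))"
      using topological_chartD(5)[OF t chart_openin[OF d]] .
    have "smooth_real_on (mdim M) (\<phi> ` (U \<inter> A \<inter> V)) (\<lambda>x. \<psi> (inv_into (U \<inter> A) \<phi> x) i)" if "i < mdim M" for i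
    proof (rule smooth_real_on_cong[OF o1])
      show "smooth_real_on (mdim M) (\<phi> ` (U \<inter> A \<inter> V)) (\<lambda>x. \<psi> (inv_into U \<phi> x) i)"
        by (rule smooth_real_on_subset[OF cart_open_subset[OF chart_open_image[OF assms(1) chart_openin[OF d]]]
            transition_smooth[OF assms(3,1) d that]]) auto
    qed (use inv in auto)
    moreover have "smooth_real_on (mdim M) (\<psi> ` (V \<inter> (U \<inter> A))) (\<lambda>x. \<phi> (inv_into V \<psi> x) i)" if "i < mdim M" for i
      by (rule smooth_real_on_subset[OF cart_open_subset[OF chart_open_image[OF d chart_openin[OF assms(1)]]]
            transition_smooth[OF assms(3) d assms(1) that]]) auto
    ultimately show ?thesis by (simp add: compatible_charts_def smooth_transition_def)
  qed
  with t show ?thesis by (auto simp: charts_def)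
qed

text \<open>Smoothness near a point, witnessed by one pair of charts. Everything about smooth maps is
  derived from this local notion.\<close>

definition smooth_at :: "'p manifold \<Rightarrow> 'q manifold \<Rightarrow> ('p \<Rightarrow> 'q) \<Rightarrow> 'p \<Rightarrow> bool" where
  "smooth_at M N f p \<longleftrightarrow> (\<exists>U \<phi> V \<psi> T. (U, \<phi>) \<in> charts M \<and> (V, \<psi>) \<in> charts N \<and> p \<in> U \<and>
     cart_open (mdim M) T \<and> \<phi> p \<in> T \<and> T \<subseteq> \<phi> ` U \<and> (\<forall>x\<in>T. f (inv_into U \<phi> x) \<in> V) \<and>
     (\<forall>i<mdim N. smooth_real_on (mdim M) T (\<lambda>x. \<psi> (f (inv_into U \<phi> x)) i)))"

lemma smooth_atI:
  assumes "(U, \<phi>) \<in> charts M" "(V, \<psi>) \<in> charts N" "p \<in> U" "cart_open (mdim M) T" "\<phi> p \<in> T" "T \<subseteq> \<phi> ` U"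
    "\<And>x. x \<in> T \<Longrightarrow> f (inv_into U \<phi> x) \<in> V"
    "\<And>i. i < mdim N \<Longrightarrow> smooth_real_on (mdim M) T (\<lambda>x. \<psi> (f (inv_into U \<phi> x)) i)"
  shows "smooth_at M N f p"
  unfolding smooth_at_def using assms by blast

text \<open>The choice of charts is irrelevant, because a change of charts composes the coordinate
  representation with smooth transition maps.\<close>

lemma smooth_at_charts:
  assumes M: "smooth_manifold M" and N: "smooth_manifold N" and f: "smooth_at M N f p"
    and c': "(U', \<phi>') \<in> charts M" "p \<in> U'" and d': "(V', \<psi>') \<in> charts N" "f p \<in> V'"
  obtains T where "cart_open (mdim M) T" "\<phi>' p \<in> T" "T \<subseteq> \<phi>' ` U'" "\<And>x. x \<in> T \<Longrightarrow> f (inv_into U' \<phi>' x) \<in> V'"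
    "\<And>i. i < mdim N \<Longrightarrow> smooth_real_on (mdim M) T (\<lambda>x. \<psi>' (f (inv_into U' \<phi>' x)) i)"
proof -
  let ?m = "mdim M" and ?n = "mdim N"
  obtain U \<phi> V \<psi> T where c: "(U, \<phi>) \<in> charts M" and d: "(V, \<psi>) \<in> charts N" and p: "p \<in> U"
    and T: "cart_open ?m T" "\<phi> p \<in> T" "T \<subseteq> \<phi> ` U" and fV: "\<And>x. x \<in> T \<Longrightarrow> f (inv_into U \<phi> x) \<in> V"
    and sm: "\<And>i. i < ?n \<Longrightarrow> smooth_real_on ?m T (\<lambda>x. \<psi> (f (inv_into U \<phi> x)) i)"
    using f unfolding smooth_at_def by blast
  define \<tau> where "\<tau> = (\<lambda>x. \<phi> (inv_into U' \<phi>' x))"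
  define A where "A = \<phi>' ` (U' \<inter> U)"
  have A: "cart_open ?m A" unfolding A_def by (rule chart_open_image[OF c'(1) chart_openin[OF c]])
  have \<tau>s: "smooth_real_on ?m A (\<lambda>x. \<tau> x i)" if "i < ?m" for i
    unfolding \<tau>_def A_def by (rule transition_smooth[OF M c'(1) c that])
  have \<tau>c: "\<tau> x \<in> cart ?m" if "x \<in> A" for x
    using that chart_inv[OF c'(1)] chart_inv(4)[OF c] by (auto simp: A_def \<tau>_def)
  define A1 where "A1 = A \<inter> \<tau> -` T"
  have A1: "cart_open ?m A1" unfolding A1_def
    by (rule cart_open_preimage[OF A continuous_smooth_vector[OF A \<tau>c \<tau>s] \<tau>c T(1)])
  have inv\<tau>: "inv_into U \<phi> (\<tau> x) = inv_into U' \<phi>' x" if "x \<in> A" for x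
    using that chart_inv(1)[OF c'(1)] chart_inv(1)[OF c] by (auto simp: A_def \<tau>_def)
  define r where "r = (\<lambda>x. \<psi> (f (inv_into U' \<phi>' x)))"
  have rs: "smooth_real_on ?m A1 (\<lambda>x. r x i)" if "i < ?n" for i
  proof (rule smooth_real_on_cong[OF A1])
    show "smooth_real_on ?m A1 (\<lambda>x. \<psi> (f (inv_into U \<phi> (\<tau> x))) i)"
    proof (rule smooth_real_on_compose[OF A1 T(1) _ sm[OF that]])
      show "smooth_real_on ?m A1 (\<lambda>x. \<tau> x j)" if "j < ?m" for j
        by (rule smooth_real_on_subset[OF cart_open_subset[OF A] \<tau>s[OF that]]) (auto simp: A1_def)
    qed (auto simp: A1_def)
  qed (use inv\<tau> in \<open>auto simp: A1_def r_def\<close>)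
  have rV: "f (inv_into U' \<phi>' x) \<in> V" if "x \<in> A1" for x
    using that fV inv\<tau> by (auto simp: A1_def) (metis)
  have rc: "r x \<in> cart ?n" if "x \<in> A1" for x
    unfolding r_def by (rule chart_inv(4)[OF d rV[OF that]])
  define T' where "T' = A1 \<inter> r -` (\<psi> ` (V \<inter> V'))"
  have oV: "cart_open ?n (\<psi> ` (V \<inter> V'))" by (rule chart_open_image[OF d chart_openin[OF d'(1)]])
  have T': "cart_open ?m T'" unfolding T'_def
    by (rule cart_open_preimage[OF A1 continuous_smooth_vector[OF A1 rc rs] rc oV])
  have inA1: "\<phi>' p \<in> A1" using p c'(2) T(2) chart_inv(1)[OF c'(1)] by (auto simp: A1_def A_def \<tau>_def)
  have fpV: "f p \<in> V" using rV[OF inA1] chart_inv(1)[OF c'(1) c'(2)] by simp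
  have V': "f (inv_into U' \<phi>' x) \<in> V'" if "x \<in> T'" for x
  proof -
    have "\<psi> (f (inv_into U' \<phi>' x)) \<in> \<psi> ` (V \<inter> V')" using that by (simp add: T'_def r_def)
    then obtain q where q: "q \<in> V" "q \<in> V'" "\<psi> (f (inv_into U' \<phi>' x)) = \<psi> q" by blast
    moreover have "f (inv_into U' \<phi>' x) \<in> V" using that rV by (auto simp: T'_def)
    ultimately show ?thesis using chart_inj[OF d] by (auto dest: inj_onD)
  qed
  show ?thesis
  proof (rule that[OF T'])
    show "\<phi>' p \<in> T'" using inA1 fpV d'(2) chart_inv(1)[OF c'(1) c'(2)] by (auto simp: T'_def r_def)
    show "T' \<subseteq> \<phi>' ` U'" by (auto simp: T'_def A1_def A_def)
    show "f (inv_into U' \<phi>' x) \<in> V'" if "x \<in> T'" for x using V'[OF that] .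
    fix i assume i: "i < ?n"
    show "smooth_real_on ?m T' (\<lambda>x. \<psi>' (f (inv_into U' \<phi>' x)) i)"
    proof (rule smooth_real_on_cong[OF T'])
      show "smooth_real_on ?m T' (\<lambda>x. \<psi>' (inv_into V \<psi> (r x)) i)"
      proof (rule smooth_real_on_compose[OF T' oV _ transition_smooth[OF N d d'(1) i]])
        show "smooth_real_on ?m T' (\<lambda>x. r x j)" if "j < ?n" for j
          by (rule smooth_real_on_subset[OF cart_open_subset[OF A1] rs[OF that]]) (auto simp: T'_def)
      qed (auto simp: T'_def)
      show "\<psi>' (inv_into V \<psi> (r x)) i = \<psi>' (f (inv_into U' \<phi>' x)) i" if "x \<in> T'" for x
        using that rV[of x] chart_inv(1)[OF d] by (auto simp: T'_def r_def)
    qed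
  qed
qed

lemma smooth_at_continuous:
  assumes f: "smooth_at M N f p" and "smooth_manifold M" "smooth_manifold N" and A: "openin (mtop N) A" "f p \<in> A"
  shows "\<exists>B. openin (mtop M) B \<and> p \<in> B \<and> f ` B \<subseteq> A"
proof -
  obtain U \<phi> V \<psi> T where c: "(U, \<phi>) \<in> charts M" and d: "(V, \<psi>) \<in> charts N" and p: "p \<in> U"
    and T: "cart_open (mdim M) T" "\<phi> p \<in> T" "T \<subseteq> \<phi> ` U" and fV: "\<And>x. x \<in> T \<Longrightarrow> f (inv_into U \<phi> x) \<in> V"
    and sm: "\<And>i. i < mdim N \<Longrightarrow> smooth_real_on (mdim M) T (\<lambda>x. \<psi> (f (inv_into U \<phi> x)) i)"
    using f unfolding smooth_at_def by blast
  let ?r = "\<lambda>x. \<psi> (f (inv_into U \<phi> x))"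
  have rc: "?r x \<in> cart (mdim N)" if "x \<in> T" for x by (rule chart_inv(4)[OF d fV[OF that]])
  have "cart_open (mdim M) (T \<inter> ?r -` (\<psi> ` (V \<inter> A)))"
    by (rule cart_open_preimage[OF T(1) continuous_smooth_vector[OF T(1) rc sm] rc chart_open_image[OF d A(1)]])
  then have "openin (mtop M) (U \<inter> \<phi> -` (T \<inter> ?r -` (\<psi> ` (V \<inter> A))))" by (rule chart_preimage_open[OF c])
  moreover have "f q \<in> A" if "q \<in> U" "\<phi> q \<in> T" "?r (\<phi> q) \<in> \<psi> ` (V \<inter> A)" for q
  proof -
    have "f q \<in> V" using fV[OF that(2)] chart_inv(1)[OF c that(1)] by simp
    moreover have "\<psi> (f q) \<in> \<psi> ` (V \<inter> A)" using that(3) chart_inv(1)[OF c that(1)] by simp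
    then obtain q' where "q' \<in> V" "q' \<in> A" "\<psi> (f q) = \<psi> q'" by blast
    ultimately show ?thesis using chart_inj[OF d] by (auto dest: inj_onD)
  qed
  moreover have "f p \<in> V" using fV[OF T(2)] chart_inv(1)[OF c p] by simp
  ultimately show ?thesis using p T(2) A(2) chart_inv(1)[OF c p]
    by (intro exI[of _ "U \<inter> \<phi> -` (T \<inter> ?r -` (\<psi> ` (V \<inter> A)))"]) auto
qed

lemma smooth_map_iff:
  assumes M: "smooth_manifold M" and N: "smooth_manifold N"
  shows "smooth_map M N f \<longleftrightarrow> (\<forall>p\<in>points M. smooth_at M N f p)"
proof
  assume f: "smooth_map M N f"
  show "\<forall>p\<in>points M. smooth_at M N f p"
  proof
    fix p assume p: "p \<in> points M"
    then obtain U \<phi> where c: "(U, \<phi>) \<in> charts M" "p \<in> U" using charts_cover[OF M] by blast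
    have cont: "continuous_map (mtop M) (mtop N) f" using f by (simp add: smooth_map_def)
    then have "f p \<in> points N" using p by (auto simp: continuous_map_def)
    then obtain V \<psi> where d: "(V, \<psi>) \<in> charts N" "f p \<in> V" using charts_cover[OF N] by blast
    have "openin (mtop M) {x \<in> points M. f x \<in> V}"
      using cont chart_openin[OF d(1)] by (rule openin_continuous_map_preimage)
    then have T: "cart_open (mdim M) (\<phi> ` (U \<inter> {x \<in> points M. f x \<in> V}))" by (rule chart_open_image[OF c(1)])
    moreover have "U \<inter> {x \<in> points M. f x \<in> V} = U \<inter> f -` V" using chart_subset[OF c(1)] by auto
    ultimately have T: "cart_open (mdim M) (\<phi> ` (U \<inter> f -` V))" by simp
    show "smooth_at M N f p"
    proof (rule smooth_atI[OF c(1) d(1) c(2) T])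
      show "f (inv_into U \<phi> x) \<in> V" if "x \<in> \<phi> ` (U \<inter> f -` V)" for x
        using that chart_inv(1)[OF c(1)] by auto
      show "smooth_real_on (mdim M) (\<phi> ` (U \<inter> f -` V)) (\<lambda>x. \<psi> (f (inv_into U \<phi> x)) i)" if "i < mdim N" for i
        using f c(1) d(1) that unfolding smooth_map_def by blast
    qed (use c d in auto)
  qed
next
  assume f: "\<forall>p\<in>points M. smooth_at M N f p"
  show "smooth_map M N f"
    unfolding smooth_map_def
  proof (intro conjI ballI)
    show "continuous_map (mtop M) (mtop N) f"
      unfolding continuous_map_def
    proof (intro conjI allI impI)
      show "f \<in> points M \<rightarrow> points N"
      proof
        fix p assume p: "p \<in> points M"
        then have "smooth_at M N f p" using f by blast
        then obtain U \<phi> V \<psi> T where *: "(U, \<phi>) \<in> charts M" "(V, \<psi>) \<in> charts N" "p \<in> U"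
          "\<phi> p \<in> T" "\<And>x. x \<in> T \<Longrightarrow> f (inv_into U \<phi> x) \<in> V"
          unfolding smooth_at_def by blast
        have "f p \<in> V" using *(5)[OF *(4)] chart_inv(1)[OF *(1,3)] by simp
        then show "f p \<in> points N" using chart_subset[OF *(2)] by blast
      qed
      fix A assume A: "openin (mtop N) A"
      show "openin (mtop M) {x \<in> points M. f x \<in> A}"
        unfolding openin_subopen[of _ "{x \<in> points M. f x \<in> A}"]
      proof
        fix p assume "p \<in> {x \<in> points M. f x \<in> A}"
        then obtain B where "openin (mtop M) B" "p \<in> B" "f ` B \<subseteq> A"
          using smooth_at_continuous[of M N f p A] f M N A by blast
        then show "\<exists>T. openin (mtop M) T \<and> p \<in> T \<and> T \<subseteq> {x \<in> points M. f x \<in> A}"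
          using openin_subset by blast
      qed
    qed
    have main: "smooth_real_on (mdim M) (\<phi> ` (U \<inter> f -` V)) (\<lambda>x. \<psi> (f (inv_into U \<phi> x)) i)"
      if c: "(U, \<phi>) \<in> charts M" and d: "(V, \<psi>) \<in> charts N" and i: "i < mdim N" for U \<phi> V \<psi> i
    proof (rule smooth_real_on_local)
      show "\<phi> ` (U \<inter> f -` V) \<subseteq> cart (mdim M)" using chart_inv(4)[OF c] by auto
      fix x assume "x \<in> \<phi> ` (U \<inter> f -` V)"
      then obtain p where p: "p \<in> U" "f p \<in> V" "x = \<phi> p" by auto
      then have "smooth_at M N f p" using f chart_subset[OF c] by blast
      from smooth_at_charts[OF M N this c p(1) d p(2)]
      show "\<exists>T. cart_open (mdim M) T \<and> x \<in> T \<and> smooth_real_on (mdim M) T (\<lambda>x. \<psi> (f (inv_into U \<phi> x)) i)"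
        using p(3) i by metis
    qed
    show "case c of (U, \<phi>) \<Rightarrow> \<forall>(V, \<psi>)\<in>charts N. \<forall>i<mdim N.
        smooth_real_on (mdim M) (\<phi> ` (U \<inter> f -` V)) (\<lambda>x. \<psi> (f (inv_into U \<phi> x)) i)"
      if "c \<in> charts M" for c
      using that main by (cases c) auto
  qed
qed

lemma smooth_at_cong:
  assumes f: "smooth_at M N f p" and A: "openin (mtop M) A" "p \<in> A" "\<And>q. q \<in> A \<Longrightarrow> f q = g q"
  shows "smooth_at M N g p"
proof -
  obtain U \<phi> V \<psi> T where c: "(U, \<phi>) \<in> charts M" "p \<in> U" and d: "(V, \<psi>) \<in> charts N"
    and T: "cart_open (mdim M) T" "\<phi> p \<in> T" "T \<subseteq> \<phi> ` U" "\<And>x. x \<in> T \<Longrightarrow> f (inv_into U \<phi> x) \<in> V"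
    and fs: "\<And>i. i < mdim N \<Longrightarrow> smooth_real_on (mdim M) T (\<lambda>x. \<psi> (f (inv_into U \<phi> x)) i)"
    using f unfolding smooth_at_def by blast
  let ?T = "T \<inter> \<phi> ` (U \<inter> A)"
  have T': "cart_open (mdim M) ?T" using T(1) chart_open_image[OF c(1) A(1)] by blast
  have eq: "f (inv_into U \<phi> x) = g (inv_into U \<phi> x)" if "x \<in> ?T" for x
    using that chart_inv(1)[OF c(1)] A(3) by auto
  show ?thesis
  proof (rule smooth_atI[OF c(1) d c(2) T'])
    show "g (inv_into U \<phi> x) \<in> V" if "x \<in> ?T" for x using eq[OF that] T(4)[of x] that by simp
    show "smooth_real_on (mdim M) ?T (\<lambda>x. \<psi> (g (inv_into U \<phi> x)) i)" if "i < mdim N" for i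
      by (rule smooth_real_on_cong[OF T' _ smooth_real_on_subset[OF cart_open_subset[OF T(1)] fs[OF that]]])
        (use eq in auto)
  qed (use T c A in auto)
qed

lemma smooth_at_id:
  assumes "smooth_manifold M" "p \<in> points M" shows "smooth_at M M (\<lambda>x. x) p"
proof -
  obtain U \<phi> where c: "(U, \<phi>) \<in> charts M" "p \<in> U" using charts_cover[OF assms] by blast
  show ?thesis
  proof (rule smooth_atI[OF c(1) c(1) c(2) chart_image_open[OF c(1)]])
    show "smooth_real_on (mdim M) (\<phi> ` U) (\<lambda>x. \<phi> (inv_into U \<phi> x) i)" for i
      by (rule smooth_real_on_cong[OF chart_image_open[OF c(1)] _ smooth_real_on_coord[OF chart_image_open[OF c(1)], of i]])
        (simp add: chart_inv(3)[OF c(1)])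
  qed (use c chart_inv(2)[OF c(1)] in auto)
qed

subsection \<open>Smooth real functions\<close>

definition smooth_fun_at :: "'p manifold \<Rightarrow> ('p \<Rightarrow> real) \<Rightarrow> 'p \<Rightarrow> bool" where
  "smooth_fun_at M f p \<longleftrightarrow> (\<exists>U \<phi> T. (U, \<phi>) \<in> charts M \<and> p \<in> U \<and> cart_open (mdim M) T \<and> \<phi> p \<in> T \<and>
     T \<subseteq> \<phi> ` U \<and> smooth_real_on (mdim M) T (\<lambda>x. f (inv_into U \<phi> x)))"

lemma smooth_fun_atI:
  assumes "(U, \<phi>) \<in> charts M" "p \<in> U" "cart_open (mdim M) T" "\<phi> p \<in> T" "T \<subseteq> \<phi> ` U"
    "smooth_real_on (mdim M) T (\<lambda>x. f (inv_into U \<phi> x))"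
  shows "smooth_fun_at M f p"
  unfolding smooth_fun_at_def using assms by blast

text \<open>This lemma contains the independence of charts of smooth functions as the case where \<open>f\<close> is the
  identity.\<close>

lemma smooth_fun_at_compose_chart:
  assumes M: "smooth_manifold M" and N: "smooth_manifold N" and f: "smooth_at M N f p"
    and g: "smooth_fun_at N g (f p)" and c: "(U, \<phi>) \<in> charts M" "p \<in> U"
  obtains T where "cart_open (mdim M) T" "\<phi> p \<in> T" "T \<subseteq> \<phi> ` U"
    "smooth_real_on (mdim M) T (\<lambda>x. g (f (inv_into U \<phi> x)))"
proof -
  obtain V \<psi> T2 where d: "(V, \<psi>) \<in> charts N" "f p \<in> V"
    and T2: "cart_open (mdim N) T2" "\<psi> (f p) \<in> T2" "T2 \<subseteq> \<psi> ` V"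
    and gs: "smooth_real_on (mdim N) T2 (\<lambda>y. g (inv_into V \<psi> y))"
    using g unfolding smooth_fun_at_def by blast
  obtain T where T: "cart_open (mdim M) T" "\<phi> p \<in> T" "T \<subseteq> \<phi> ` U" "\<And>x. x \<in> T \<Longrightarrow> f (inv_into U \<phi> x) \<in> V"
    and fs: "\<And>i. i < mdim N \<Longrightarrow> smooth_real_on (mdim M) T (\<lambda>x. \<psi> (f (inv_into U \<phi> x)) i)"
    using smooth_at_charts[OF M N f c d] by metis
  define F where "F = (\<lambda>x. \<psi> (f (inv_into U \<phi> x)))"
  have Fc: "F x \<in> cart (mdim N)" if "x \<in> T" for x unfolding F_def by (rule chart_inv(4)[OF d(1) T(4)[OF that]])
  have Fs: "smooth_real_on (mdim M) T (\<lambda>x. F x i)" if "i < mdim N" for i unfolding F_def by (rule fs[OF that])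
  define T' where "T' = T \<inter> F -` T2"
  have T': "cart_open (mdim M) T'" unfolding T'_def
    by (rule cart_open_preimage[OF T(1) continuous_smooth_vector[OF T(1) Fc Fs] Fc T2(1)])
  show ?thesis
  proof (rule that[OF T'])
    show "\<phi> p \<in> T'" using T(2) T2(2) chart_inv(1)[OF c] by (simp add: T'_def F_def)
    show "T' \<subseteq> \<phi> ` U" using T(3) by (auto simp: T'_def)
    show "smooth_real_on (mdim M) T' (\<lambda>x. g (f (inv_into U \<phi> x)))"
    proof (rule smooth_real_on_cong[OF T'])
      show "smooth_real_on (mdim M) T' (\<lambda>x. g (inv_into V \<psi> (F x)))"
      proof (rule smooth_real_on_compose[OF T' T2(1) _ gs])
        show "smooth_real_on (mdim M) T' (\<lambda>x. F x j)" if "j < mdim N" for j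
          by (rule smooth_real_on_subset[OF cart_open_subset[OF T(1)] Fs[OF that]]) (auto simp: T'_def)
      qed (auto simp: T'_def)
      show "g (inv_into V \<psi> (F x)) = g (f (inv_into U \<phi> x))" if "x \<in> T'" for x
        using that chart_inv(1)[OF d(1) T(4)[of x]] by (simp add: T'_def F_def)
    qed
  qed
qed

lemma smooth_fun_at_compose:
  assumes "smooth_manifold M" "smooth_manifold N" "smooth_at M N f p" "smooth_fun_at N g (f p)"
  shows "smooth_fun_at M (\<lambda>x. g (f x)) p"
proof -
  obtain U \<phi> where c: "(U, \<phi>) \<in> charts M" "p \<in> U" using assms(3) unfolding smooth_at_def by blast
  obtain T where "cart_open (mdim M) T" "\<phi> p \<in> T" "T \<subseteq> \<phi> ` U" "smooth_real_on (mdim M) T (\<lambda>x. g (f (inv_into U \<phi> x)))"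
    using smooth_fun_at_compose_chart[OF assms c] by metis
  with c show ?thesis by (rule smooth_fun_atI)
qed

lemma smooth_fun_at_points: "smooth_fun_at M f p \<Longrightarrow> p \<in> points M"
  unfolding smooth_fun_at_def using chart_subset by blast

lemma smooth_fun_at_chart:
  assumes M: "smooth_manifold M" and f: "smooth_fun_at M f p" and c: "(U, \<phi>) \<in> charts M" "p \<in> U"
  obtains T where "cart_open (mdim M) T" "\<phi> p \<in> T" "T \<subseteq> \<phi> ` U"
    "smooth_real_on (mdim M) T (\<lambda>x. f (inv_into U \<phi> x))"
  using smooth_fun_at_compose_chart[OF M M smooth_at_id[OF M smooth_fun_at_points[OF f]] f c] by blast

lemma smooth_function_on_iff:
  assumes M: "smooth_manifold M" and A: "openin (mtop M) A"
  shows "smooth_function_on M A f \<longleftrightarrow> (\<forall>p\<in>A. smooth_fun_at M f p)"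
proof
  assume f: "smooth_function_on M A f"
  show "\<forall>p\<in>A. smooth_fun_at M f p"
  proof
    fix p assume p: "p \<in> A"
    then have "p \<in> points M" using A openin_subset by blast
    then obtain U \<phi> where c: "(U, \<phi>) \<in> charts M" "p \<in> U" using charts_cover[OF M] by blast
    show "smooth_fun_at M f p"
    proof (rule smooth_fun_atI[OF c chart_open_image[OF c(1) A]])
      show "smooth_real_on (mdim M) (\<phi> ` (U \<inter> A)) (\<lambda>x. f (inv_into U \<phi> x))"
        using f c(1) unfolding smooth_function_on_def by blast
    qed (use c p in auto)
  qed
next
  assume f: "\<forall>p\<in>A. smooth_fun_at M f p"
  have "smooth_real_on (mdim M) (\<phi> ` (U \<inter> A)) (\<lambda>x. f (inv_into U \<phi> x))" if c: "(U, \<phi>) \<in> charts M" for U \<phi>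
  proof (rule smooth_real_on_local)
    show "\<phi> ` (U \<inter> A) \<subseteq> cart (mdim M)" using chart_inv(4)[OF c] by auto
    fix x assume "x \<in> \<phi> ` (U \<inter> A)"
    then obtain p where p: "p \<in> U" "p \<in> A" "x = \<phi> p" by auto
    obtain T where "cart_open (mdim M) T" "\<phi> p \<in> T" "T \<subseteq> \<phi> ` U" "smooth_real_on (mdim M) T (\<lambda>x. f (inv_into U \<phi> x))"
      using smooth_fun_at_chart[OF M bspec[OF f p(2)] c p(1)] by metis
    then show "\<exists>T. cart_open (mdim M) T \<and> x \<in> T \<and> smooth_real_on (mdim M) T (\<lambda>x. f (inv_into U \<phi> x))"
      using p(3) by blast
  qed
  then show "smooth_function_on M A f" unfolding smooth_function_on_def by auto
qed

lemma smooth_fun_at_const: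
  assumes "smooth_manifold M" "p \<in> points M" shows "smooth_fun_at M (\<lambda>x. a) p"
proof -
  obtain U \<phi> where c: "(U, \<phi>) \<in> charts M" "p \<in> U" using charts_cover[OF assms] by blast
  show ?thesis
    by (rule smooth_fun_atI[OF c chart_image_open[OF c(1)]])
      (use c smooth_real_on_const[OF chart_image_open[OF c(1)]] in auto)
qed

lemma smooth_fun_at_binary:
  assumes M: "smooth_manifold M" and f: "smooth_fun_at M f p" and g: "smooth_fun_at M g p"
    and op: "\<And>T a b. cart_open (mdim M) T \<Longrightarrow> smooth_real_on (mdim M) T a \<Longrightarrow> smooth_real_on (mdim M) T b \<Longrightarrow>
      smooth_real_on (mdim M) T (\<lambda>x. h (a x) (b x))"
  shows "smooth_fun_at M (\<lambda>x. h (f x) (g x)) p"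
proof -
  obtain U \<phi> T where c: "(U, \<phi>) \<in> charts M" "p \<in> U" and T: "cart_open (mdim M) T" "\<phi> p \<in> T" "T \<subseteq> \<phi> ` U"
    and fs: "smooth_real_on (mdim M) T (\<lambda>x. f (inv_into U \<phi> x))"
    using f unfolding smooth_fun_at_def by blast
  obtain T2 where T2: "cart_open (mdim M) T2" "\<phi> p \<in> T2" "T2 \<subseteq> \<phi> ` U"
    and gs: "smooth_real_on (mdim M) T2 (\<lambda>x. g (inv_into U \<phi> x))"
    using smooth_fun_at_chart[OF M g c] by metis
  have T': "cart_open (mdim M) (T \<inter> T2)" using T(1) T2(1) by blast
  show ?thesis
  proof (rule smooth_fun_atI[OF c T'])
    show "smooth_real_on (mdim M) (T \<inter> T2) (\<lambda>x. h (f (inv_into U \<phi> x)) (g (inv_into U \<phi> x)))"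
      by (rule op[OF T'])
        (rule smooth_real_on_subset[OF cart_open_subset[OF T(1)] fs] smooth_real_on_subset[OF cart_open_subset[OF T2(1)] gs]; simp)+
  qed (use T T2 in auto)
qed

lemma smooth_fun_at_add:
  assumes "smooth_manifold M" "smooth_fun_at M f p" "smooth_fun_at M g p"
  shows "smooth_fun_at M (\<lambda>x. f x + g x) p"
  using assms by (rule smooth_fun_at_binary) (rule smooth_real_on_add)

lemma smooth_fun_at_mult:
  assumes "smooth_manifold M" "smooth_fun_at M f p" "smooth_fun_at M g p"
  shows "smooth_fun_at M (\<lambda>x. f x * g x) p"
  using assms by (rule smooth_fun_at_binary) (rule smooth_real_on_mult)

lemma smooth_fun_at_inverse:
  assumes M: "smooth_manifold M" and f: "smooth_fun_at M f p" and nz: "f p \<noteq> 0"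
  shows "smooth_fun_at M (\<lambda>x. inverse (f x)) p"
proof -
  obtain U \<phi> T where c: "(U, \<phi>) \<in> charts M" "p \<in> U" and T: "cart_open (mdim M) T" "\<phi> p \<in> T" "T \<subseteq> \<phi> ` U"
    and fs: "smooth_real_on (mdim M) T (\<lambda>x. f (inv_into U \<phi> x))"
    using f unfolding smooth_fun_at_def by blast
  let ?r = "\<lambda>x. f (inv_into U \<phi> x)"
  have "openin (top_of_set T) (T \<inter> ?r -` (- {0}))"
    using smooth_real_on_continuous[OF cart_open_subset[OF T(1)] fs] by (rule continuous_openin_preimage_gen) (simp add: open_Compl)
  moreover have "openin (top_of_set (cart (mdim M))) T" using T(1) Euclidean_space_eq by metis
  ultimately have "openin (top_of_set (cart (mdim M))) (T \<inter> ?r -` (- {0}))" by (rule openin_trans)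
  then have T': "cart_open (mdim M) (T \<inter> ?r -` (- {0}))" using Euclidean_space_eq by metis
  show ?thesis
  proof (rule smooth_fun_atI[OF c T'])
    show "smooth_real_on (mdim M) (T \<inter> ?r -` (- {0})) (\<lambda>x. inverse (?r x))"
      by (rule smooth_real_on_inverse[OF T' _ smooth_real_on_subset[OF cart_open_subset[OF T(1)] fs]]) auto
  qed (use T nz chart_inv(1)[OF c] in auto)
qed

lemma smooth_fun_at_continuous:
  assumes M: "smooth_manifold M" and f: "smooth_fun_at M f p" and W: "open W" "f p \<in> W"
  shows "\<exists>B. openin (mtop M) B \<and> p \<in> B \<and> f ` B \<subseteq> W"
proof -
  obtain U \<phi> T where c: "(U, \<phi>) \<in> charts M" "p \<in> U" and T: "cart_open (mdim M) T" "\<phi> p \<in> T" "T \<subseteq> \<phi> ` U"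
    and fs: "smooth_real_on (mdim M) T (\<lambda>x. f (inv_into U \<phi> x))"
    using f unfolding smooth_fun_at_def by blast
  let ?r = "\<lambda>x. f (inv_into U \<phi> x)"
  have "openin (top_of_set T) (T \<inter> ?r -` W)"
    using smooth_real_on_continuous[OF cart_open_subset[OF T(1)] fs] W(1) by (rule continuous_openin_preimage_gen)
  moreover have "openin (top_of_set (cart (mdim M))) T" using T(1) Euclidean_space_eq by metis
  ultimately have "openin (top_of_set (cart (mdim M))) (T \<inter> ?r -` W)" by (rule openin_trans)
  then have "cart_open (mdim M) (T \<inter> ?r -` W)" using Euclidean_space_eq by metis
  then have "openin (mtop M) (U \<inter> \<phi> -` (T \<inter> ?r -` W))" by (rule chart_preimage_open[OF c(1)])
  moreover have "p \<in> U \<inter> \<phi> -` (T \<inter> ?r -` W)" "f ` (U \<inter> \<phi> -` (T \<inter> ?r -` W)) \<subseteq> W"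
    using c T(2) W(2) chart_inv(1)[OF c(1)] by auto
  ultimately show ?thesis by blast
qed

subsection \<open>Submersions\<close>

text \<open>A map with a smooth local right inverse through every point is a submersion: in charts, the
  Jacobian of the right inverse is a right inverse of the Jacobian.\<close>

lemma submersionI:
  assumes M: "smooth_manifold M" and N: "smooth_manifold N" and f: "smooth_map M N f"
    and g: "\<And>p. p \<in> points M \<Longrightarrow> \<exists>g B. smooth_at N M g (f p) \<and> g (f p) = p \<and>
      openin (mtop N) B \<and> f p \<in> B \<and> (\<forall>y\<in>B. f (g y) = y)"
  shows "submersion M N f"
  unfolding submersion_def
proof (intro conjI f)
  let ?m = "mdim M" and ?n = "mdim N"
  have "\<exists>v. \<forall>i<?n. (\<Sum>j<?m. partial_deriv j (\<lambda>x. \<psi> (f (inv_into U \<phi> x)) i) (\<phi> p) * v j) = w i"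
    if c: "(U, \<phi>) \<in> charts M" and d: "(V, \<psi>) \<in> charts N" and p: "p \<in> U" "f p \<in> V" for U \<phi> V \<psi> p and w :: "nat \<Rightarrow> real"
  proof -
    have "p \<in> points M" using p c chart_subset by blast
    then obtain g B where g: "smooth_at N M g (f p)" "g (f p) = p" and B: "openin (mtop N) B" "f p \<in> B" "\<And>y. y \<in> B \<Longrightarrow> f (g y) = y"
      using g by blast
    have gU: "g (f p) \<in> U" using g(2) p(1) by simp
    obtain T where T: "cart_open ?n T" "\<psi> (f p) \<in> T" "T \<subseteq> \<psi> ` V" and gT: "\<And>y. y \<in> T \<Longrightarrow> g (inv_into V \<psi> y) \<in> U"
      and gs: "\<And>i. i < ?m \<Longrightarrow> smooth_real_on ?n T (\<lambda>y. \<phi> (g (inv_into V \<psi> y)) i)"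
      using smooth_at_charts[OF N M g(1) d p(2) c gU] by metis
    have cont: "continuous_map (mtop M) (mtop N) f" using f by (simp add: smooth_map_def)
    have "openin (mtop M) {x \<in> points M. f x \<in> V}"
      using cont chart_openin[OF d] by (rule openin_continuous_map_preimage)
    then have "cart_open ?m (\<phi> ` (U \<inter> {x \<in> points M. f x \<in> V}))" by (rule chart_open_image[OF c(1)])
    moreover have "U \<inter> {x \<in> points M. f x \<in> V} = U \<inter> f -` V" using chart_subset[OF c] by auto
    ultimately have S: "cart_open ?m (\<phi> ` (U \<inter> f -` V))" by simp
    let ?T = "T \<inter> \<psi> ` (V \<inter> B)"
    have T': "cart_open ?n ?T" using T(1) chart_open_image[OF d B(1)] by blast
    have fg: "inv_into V \<psi> y \<in> V \<and> f (g (inv_into V \<psi> y)) = inv_into V \<psi> y" if "y \<in> ?T" for y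
      using that chart_inv(1)[OF d] B(3) by auto
    have "\<exists>v. \<forall>i<?n. (\<Sum>j<?m. partial_deriv j (\<lambda>x. \<psi> (f (inv_into U \<phi> x)) i) (\<phi> (g (inv_into V \<psi> (\<psi> (f p))))) * v j) = w i"
    proof (rule jacobian_surjective[OF S T', where F = "\<lambda>x. \<psi> (f (inv_into U \<phi> x))" and
          G = "\<lambda>y. \<phi> (g (inv_into V \<psi> y))" and y = "\<psi> (f p)"])
      show "\<phi> (g (inv_into V \<psi> y)) \<in> \<phi> ` (U \<inter> f -` V)" if "y \<in> ?T" for y
        using that fg[OF that] gT by auto
      show "smooth_real_on ?n ?T (\<lambda>y. \<phi> (g (inv_into V \<psi> y)) j)" if "j < ?m" for j
        by (rule smooth_real_on_subset[OF cart_open_subset[OF T(1)] gs[OF that]]) simp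
      show "smooth_real_on ?m (\<phi> ` (U \<inter> f -` V)) (\<lambda>x. \<psi> (f (inv_into U \<phi> x)) i)" if "i < ?n" for i
        using f c d that unfolding smooth_map_def by blast
      show "\<psi> (f (inv_into U \<phi> (\<phi> (g (inv_into V \<psi> y))))) i = y i" if "y \<in> ?T" for y i
        using that fg[OF that] gT chart_inv(1)[OF c, of "g (inv_into V \<psi> y)"] chart_inv(3)[OF d, of y] T(3) by auto
    qed (use T p B in auto)
    then show ?thesis using chart_inv(1)[OF d p(2)] g(2) by simp
  qed
  then show "\<forall>(U, \<phi>)\<in>charts M. \<forall>(V, \<psi>)\<in>charts N. \<forall>p\<in>U \<inter> f -` V. \<forall>w. \<exists>v. \<forall>i<?n.
      (\<Sum>j<?m. partial_deriv j (\<lambda>x. \<psi> (f (inv_into U \<phi> x)) i) (\<phi> p) * v j) = w i"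
    by (auto simp del: vimage_eq split_paired_All)
qed

subsection \<open>Open submanifolds\<close>

lemma open_submanifold_simps [simp]:
  "mdim (open_submanifold M A) = mdim M" "mtop (open_submanifold M A) = subtopology (mtop M) A"
  by (simp_all add: open_submanifold_def)

lemma charts_open_submanifold:
  assumes M: "smooth_manifold M" and A: "openin (mtop M) A"
  shows "(U, \<phi>) \<in> charts (open_submanifold M A) \<longleftrightarrow> (U, \<phi>) \<in> charts M \<and> U \<subseteq> A"
proof
  assume c: "(U, \<phi>) \<in> charts (open_submanifold M A)"
  then have t: "topological_chart (open_submanifold M A) (U, \<phi>)" by (rule chart_topological)
  have U: "openin (mtop M) U" "U \<subseteq> A"
    using topological_chartD(1)[OF t] openin_open_subtopology[OF A] by auto
  have t': "topological_chart M (U, \<phi>)"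
  proof (rule topological_chartI)
    show "inj_on \<phi> U" by (rule topological_chartD(4)[OF t])
    show "cart_open (mdim M) (\<phi> ` B)" if "openin (mtop M) B" "B \<subseteq> U" for B
    proof -
      have "openin (mtop (open_submanifold M A)) B" using that U(2) openin_open_subtopology[OF A] by auto
      from topological_chartD(5)[OF t this] show ?thesis using that(2) by (simp add: inf.absorb2)
    qed
    show "openin (mtop M) (U \<inter> \<phi> -` W)" if "cart_open (mdim M) W" for W
      using topological_chartD(6)[OF t, of W] that openin_open_subtopology[OF A] by simp
  qed (rule U)
  have "compatible_charts (mdim M) (U, \<phi>) (V, \<psi>)" if a: "(V, \<psi>) \<in> atlas M" for V \<psi>
  proof -
    have "(V \<inter> A, \<psi>) \<in> atlas (open_submanifold M A)" using a by (auto simp: open_submanifold_def)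
    then have k: "compatible_charts (mdim M) (U, \<phi>) (V \<inter> A, \<psi>)" using c by (auto simp: charts_def)
    have d: "(V, \<psi>) \<in> charts M" using a atlas_subset_charts[OF M] by blast
    have o: "cart_open (mdim M) (\<psi> ` (V \<inter> U))" by (rule chart_open_image[OF d U(1)])
    have eqs: "U \<inter> (V \<inter> A) = U \<inter> V" "V \<inter> A \<inter> U = V \<inter> U" using U(2) by auto
    have "inv_into (V \<inter> A) \<psi> x = inv_into V \<psi> x" if "x \<in> \<psi> ` (V \<inter> U)" for x
    proof -
      from that U(2) have "x \<in> \<psi> ` (V \<inter> A)" by blast
      then obtain q where q: "q \<in> V" "q \<in> A" "x = \<psi> q" by blast
      have "inv_into (V \<inter> A) \<psi> (\<psi> q) = q"
        using q(1,2) chart_inj[OF d] by (intro inv_into_f_f) (auto simp: inj_on_def)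
      with q chart_inv(1)[OF d q(1)] show ?thesis by simp
    qed
    note inv = this
    have "smooth_real_on (mdim M) (\<psi> ` (V \<inter> U)) (\<lambda>x. \<phi> (inv_into V \<psi> x) i)" if i: "i < mdim M" for i
    proof (rule smooth_real_on_cong[OF o])
      show "smooth_real_on (mdim M) (\<psi> ` (V \<inter> U)) (\<lambda>x. \<phi> (inv_into (V \<inter> A) \<psi> x) i)"
        using k i unfolding compatible_charts_def smooth_transition_def prod.case eqs by blast
    qed (simp add: inv)
    with k show ?thesis using eqs by (simp add: compatible_charts_def smooth_transition_def)
  qed
  with t' have "(U, \<phi>) \<in> charts M" by (auto simp: charts_def)
  with U(2) show "(U, \<phi>) \<in> charts M \<and> U \<subseteq> A" by simp
next
  assume "(U, \<phi>) \<in> charts M \<and> U \<subseteq> A"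
  then have c: "(U, \<phi>) \<in> charts M" and UA: "U \<subseteq> A" by auto
  have "topological_chart (open_submanifold M A) (U, \<phi>)"
  proof (rule topological_chartI)
    show "openin (mtop (open_submanifold M A)) U" using chart_openin[OF c] UA openin_open_subtopology[OF A] by simp
    show "inj_on \<phi> U" by (rule chart_inj[OF c])
    show "cart_open (mdim (open_submanifold M A)) (\<phi> ` B)" if "openin (mtop (open_submanifold M A)) B" "B \<subseteq> U" for B
      using chart_open_image[OF c, of B] that openin_open_subtopology[OF A] by (simp add: inf.absorb2)
    show "openin (mtop (open_submanifold M A)) (U \<inter> \<phi> -` W)" if "cart_open (mdim (open_submanifold M A)) W" for W
      using chart_preimage_open[OF c, of W] that openin_open_subtopology[OF A] UA by auto
  qed
  moreover have "compatible_charts (mdim M) (U, \<phi>) d" if "d \<in> atlas (open_submanifold M A)" for d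
  proof -
    from that obtain V \<psi> where d: "d = (V \<inter> A, \<psi>)" "(V, \<psi>) \<in> atlas M" by (auto simp: open_submanifold_def)
    then have "d \<in> charts M" using chart_restrict[OF _ A M] atlas_subset_charts[OF M] by auto
    then show ?thesis using c d(1) charts_smooth_transition[OF M] by (auto simp: compatible_charts_def)
  qed
  ultimately show "(U, \<phi>) \<in> charts (open_submanifold M A)" by (auto simp: charts_def)
qed

text \<open>An atlas that consists of charts is compatible automatically, since charts are compatible with the
  atlas.\<close>

lemma smooth_manifoldI:
  assumes "Hausdorff_space (mtop M)" "second_countable (mtop M)" "atlas M \<subseteq> charts M"
    "\<And>p. p \<in> points M \<Longrightarrow> \<exists>c\<in>atlas M. p \<in> fst c"
  shows "smooth_manifold M"
proof -
  have t: "topological_chart M c" if "c \<in> atlas M" for c using that assms(3) chart_topological by blast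
  have "\<Union> (fst ` atlas M) \<subseteq> points M" using t topological_chartD(2) by fastforce
  with assms t show ?thesis unfolding smooth_manifold_def charts_def by blast
qed

lemma smooth_manifold_open_submanifold:
  assumes M: "smooth_manifold M" and A: "openin (mtop M) A"
  shows "smooth_manifold (open_submanifold M A)"
proof (rule smooth_manifoldI)
  show "Hausdorff_space (mtop (open_submanifold M A))" "second_countable (mtop (open_submanifold M A))"
    using M by (auto simp: smooth_manifold_def Hausdorff_space_subtopology second_countable_subtopology)
  show "atlas (open_submanifold M A) \<subseteq> charts (open_submanifold M A)"
  proof
    fix d assume "d \<in> atlas (open_submanifold M A)"
    then obtain V \<psi> where d: "d = (V \<inter> A, \<psi>)" "(V, \<psi>) \<in> atlas M" by (auto simp: open_submanifold_def)
    then show "d \<in> charts (open_submanifold M A)"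
      using chart_restrict[OF _ A M] atlas_subset_charts[OF M] charts_open_submanifold[OF M A] by auto
  qed
  show "\<exists>c\<in>atlas (open_submanifold M A). p \<in> fst c" if p: "p \<in> points (open_submanifold M A)" for p
  proof -
    have "p \<in> points M" "p \<in> A" using p by auto
    then obtain V \<psi> where "(V, \<psi>) \<in> atlas M" "p \<in> V" using atlas_covers[OF M] by blast
    then show ?thesis using \<open>p \<in> A\<close> by (intro bexI[of _ "(V \<inter> A, \<psi>)"]) (auto simp: open_submanifold_def)
  qed
qed

lemma smooth_at_open_submanifold:
  assumes M: "smooth_manifold M" and A: "openin (mtop M) A" and p: "p \<in> A"
  shows "smooth_at (open_submanifold M A) N f p \<longleftrightarrow> smooth_at M N f p"
proof
  assume "smooth_at (open_submanifold M A) N f p"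
  then show "smooth_at M N f p"
    unfolding smooth_at_def charts_open_submanifold[OF M A] open_submanifold_simps by blast
next
  assume f: "smooth_at M N f p"
  obtain U \<phi> V \<psi> T where c: "(U, \<phi>) \<in> charts M" "p \<in> U" and d: "(V, \<psi>) \<in> charts N"
    and T: "cart_open (mdim M) T" "\<phi> p \<in> T" "T \<subseteq> \<phi> ` U" "\<And>x. x \<in> T \<Longrightarrow> f (inv_into U \<phi> x) \<in> V"
    and fs: "\<And>i. i < mdim N \<Longrightarrow> smooth_real_on (mdim M) T (\<lambda>x. \<psi> (f (inv_into U \<phi> x)) i)"
    using f unfolding smooth_at_def by blast
  let ?T = "T \<inter> \<phi> ` (U \<inter> A)"
  have c': "(U \<inter> A, \<phi>) \<in> charts (open_submanifold M A)"
    using charts_open_submanifold[OF M A] chart_restrict[OF c(1) A M] by blast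
  have T': "cart_open (mdim M) ?T" using T(1) chart_open_image[OF c(1) A] by blast
  have inv: "inv_into (U \<inter> A) \<phi> x = inv_into U \<phi> x" if "x \<in> ?T" for x
    using that chart_inv(1)[OF c'] chart_inv(1)[OF c(1)] by auto
  show "smooth_at (open_submanifold M A) N f p"
  proof (rule smooth_atI[OF c' d _ _])
    show "cart_open (mdim (open_submanifold M A)) ?T" using T' by simp
    show "f (inv_into (U \<inter> A) \<phi> x) \<in> V" if "x \<in> ?T" for x using inv[OF that] T(4) that by simp
    show "smooth_real_on (mdim (open_submanifold M A)) ?T (\<lambda>x. \<psi> (f (inv_into (U \<inter> A) \<phi> x)) i)" if "i < mdim N" for i
      unfolding open_submanifold_simps
      by (rule smooth_real_on_cong[OF T' _ smooth_real_on_subset[OF cart_open_subset[OF T(1)] fs[OF that]]])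
        (use inv in auto)
  qed (use T c p in auto)
qed

subsection \<open>Renaming the points of a manifold\<close>

lemma openin_transport:
  assumes "inj h"
  shows "openin (mtop (transport_manifold h M)) S \<longleftrightarrow> (\<exists>U. openin (mtop M) U \<and> S = h ` U)"
proof -
  have "inv_into UNIV h -` U \<inter> h ` points M = h ` U" if "openin (mtop M) U" for U
    using openin_subset[OF that] assms by (auto simp: inv_f_f)
  then show ?thesis unfolding transport_manifold_def by (auto simp: openin_pullback_topology) metis+
qed

lemma points_transport: "inj h \<Longrightarrow> points (transport_manifold h M) = h ` points M"
  unfolding transport_manifold_def by (auto simp: topspace_pullback_topology inv_f_f)

lemma mdim_transport [simp]: "mdim (transport_manifold h M) = mdim M"
  by (simp add: transport_manifold_def)

lemma inv_into_transport:
  assumes "inj h" "inj_on \<phi> U" "x \<in> \<phi> ` U"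
  shows "inv_into (h ` U) (\<phi> \<circ> inv_into UNIV h) x = h (inv_into U \<phi> x)"
proof -
  obtain q where q: "q \<in> U" "x = \<phi> q" using assms(3) by blast
  have "inj_on (\<phi> \<circ> inv_into UNIV h) (h ` U)"
    using assms(1,2) by (auto simp: inj_on_def inv_f_f)
  then have "inv_into (h ` U) (\<phi> \<circ> inv_into UNIV h) x = h q"
    using q assms(1) by (intro inv_into_f_eq) (auto simp: inv_f_f)
  then show ?thesis using q assms(2) by (simp add: inv_into_f_f)
qed

lemma chart_transport:
  assumes M: "smooth_manifold M" and h: "inj h" and c: "(U, \<phi>) \<in> charts M"
  shows "(h ` U, \<phi> \<circ> inv_into UNIV h) \<in> charts (transport_manifold h M)"
proof -
  let ?T = "transport_manifold h M"
  have comp: "(\<phi> \<circ> inv_into UNIV h) ` h ` B = \<phi> ` B" for \<phi> :: "'a \<Rightarrow> nat \<Rightarrow> real" and B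
    using h by (auto simp: image_image inv_f_f)
  have t: "topological_chart ?T (h ` U, \<phi> \<circ> inv_into UNIV h)"
  proof (rule topological_chartI)
    show "openin (mtop ?T) (h ` U)" using openin_transport[OF h] chart_openin[OF c] by blast
    show "inj_on (\<phi> \<circ> inv_into UNIV h) (h ` U)" using h chart_inj[OF c] by (auto simp: inj_on_def inv_f_f)
    show "cart_open (mdim ?T) ((\<phi> \<circ> inv_into UNIV h) ` B)" if B: "openin (mtop ?T) B" "B \<subseteq> h ` U" for B
    proof -
      obtain B' where B': "openin (mtop M) B'" "B = h ` B'" using B(1) openin_transport[OF h] by blast
      then have "B' \<subseteq> U" using B(2) h by (auto simp: inj_image_subset_iff)
      then show ?thesis using chart_open_image[OF c B'(1)] B'(2) comp by (simp add: inf.absorb2)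
    qed
    show "openin (mtop ?T) (h ` U \<inter> (\<phi> \<circ> inv_into UNIV h) -` W)" if "cart_open (mdim ?T) W" for W
    proof -
      have "h ` U \<inter> (\<phi> \<circ> inv_into UNIV h) -` W = h ` (U \<inter> \<phi> -` W)" using h by (auto simp: inv_f_f)
      moreover have "openin (mtop M) (U \<inter> \<phi> -` W)" using chart_preimage_open[OF c] that by simp
      ultimately show ?thesis using openin_transport[OF h] by blast
    qed
  qed
  have tr: "smooth_transition (mdim M) (h ` U, \<phi> \<circ> inv_into UNIV h) (h ` V, \<psi> \<circ> inv_into UNIV h)"
    if c: "(U, \<phi>) \<in> charts M" and d: "(V, \<psi>) \<in> charts M" for U \<phi> V \<psi>
  proof -
    have img: "(\<phi> \<circ> inv_into UNIV h) ` (h ` U \<inter> h ` V) = \<phi> ` (U \<inter> V)"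
      using comp[of \<phi> "U \<inter> V"] image_Int[OF h, of U V] by simp
    have "smooth_real_on (mdim M) (\<phi> ` (U \<inter> V)) (\<lambda>x. (\<psi> \<circ> inv_into UNIV h) (inv_into (h ` U) (\<phi> \<circ> inv_into UNIV h) x) i)"
      if "i < mdim M" for i
    proof (rule smooth_real_on_cong[OF chart_open_image[OF c chart_openin[OF d]] _ transition_smooth[OF M c d that]])
      fix x assume "x \<in> \<phi> ` (U \<inter> V)"
      then have "x \<in> \<phi> ` U" by blast
      from inv_into_transport[OF h chart_inj[OF c] this]
      show "\<psi> (inv_into U \<phi> x) i = (\<psi> \<circ> inv_into UNIV h) (inv_into (h ` U) (\<phi> \<circ> inv_into UNIV h) x) i"
        using h by (simp add: inv_f_f)
    qed
    then show ?thesis by (simp add: smooth_transition_def img del: o_apply)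
  qed
  have "compatible_charts (mdim M) (h ` U, \<phi> \<circ> inv_into UNIV h) d" if "d \<in> atlas ?T" for d
  proof -
    obtain V \<psi> where "d = (h ` V, \<psi> \<circ> inv_into UNIV h)" "(V, \<psi>) \<in> atlas M"
      using \<open>d \<in> atlas ?T\<close> by (auto simp: transport_manifold_def)
    then show ?thesis using tr c atlas_subset_charts[OF M] by (auto simp: compatible_charts_def)
  qed
  with t show ?thesis by (auto simp: charts_def)
qed

lemma smooth_manifold_transport:
  assumes M: "smooth_manifold M" and h: "inj h"
  shows "smooth_manifold (transport_manifold h M)"
proof (rule smooth_manifoldI)
  let ?T = "transport_manifold h M"
  show "Hausdorff_space (mtop ?T)"
    unfolding Hausdorff_space_def points_transport[OF h]
  proof (intro allI impI)
    fix x y assume "x \<in> h ` points M \<and> y \<in> h ` points M \<and> x \<noteq> y"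
    then obtain p q where pq: "p \<in> points M" "q \<in> points M" "p \<noteq> q" "x = h p" "y = h q" by blast
    moreover have "Hausdorff_space (mtop M)" using M by (simp add: smooth_manifold_def)
    ultimately obtain U V where UV: "openin (mtop M) U" "openin (mtop M) V" "p \<in> U" "q \<in> V" "disjnt U V"
      unfolding Hausdorff_space_def by blast
    have "h ` U \<inter> h ` V = h ` (U \<inter> V)" by (rule image_Int[OF h, symmetric])
    then have "disjnt (h ` U) (h ` V)" using UV(5) by (simp add: disjnt_def)
    moreover have "openin (mtop ?T) (h ` U)" "openin (mtop ?T) (h ` V)"
      using UV(1,2) unfolding openin_transport[OF h] by blast+
    ultimately show "\<exists>U V. openin (mtop ?T) U \<and> openin (mtop ?T) V \<and> x \<in> U \<and> y \<in> V \<and> disjnt U V"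
      using UV(3,4) pq(4,5) by blast
  qed
  have "second_countable (mtop M)" using M by (simp add: smooth_manifold_def)
  then obtain \<B> where \<B>: "countable \<B>" "\<forall>V\<in>\<B>. openin (mtop M) V"
    "\<forall>U x. openin (mtop M) U \<and> x \<in> U \<longrightarrow> (\<exists>V\<in>\<B>. x \<in> V \<and> V \<subseteq> U)" unfolding second_countable_def by blast
  show "second_countable (mtop ?T)"
    unfolding second_countable_def
  proof (intro exI[of _ "(`) h ` \<B>"] conjI allI impI ballI)
    show "countable ((`) h ` \<B>)" using \<B>(1) by simp
    show "openin (mtop ?T) V" if "V \<in> (`) h ` \<B>" for V
      using that \<B>(2) unfolding openin_transport[OF h] by blast
    fix U x assume "openin (mtop ?T) U \<and> x \<in> U"
    then obtain U' p where U': "openin (mtop M) U'" "U = h ` U'" "p \<in> U'" "x = h p"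
      unfolding openin_transport[OF h] by blast
    then obtain V where "V \<in> \<B>" "p \<in> V" "V \<subseteq> U'" using \<B>(3) by blast
    then show "\<exists>V\<in>(`) h ` \<B>. x \<in> V \<and> V \<subseteq> U" using U' by blast
  qed
  show "atlas ?T \<subseteq> charts ?T"
    using chart_transport[OF M h] atlas_subset_charts[OF M] by (auto simp: transport_manifold_def)
  show "\<exists>c\<in>atlas ?T. x \<in> fst c" if x: "x \<in> points ?T" for x
  proof -
    obtain p where "p \<in> points M" "x = h p" using x points_transport[OF h] by blast
    moreover from this obtain U \<phi> where "(U, \<phi>) \<in> atlas M" "p \<in> U" using atlas_covers[OF M] by blast
    ultimately show ?thesis
      by (intro bexI[of _ "(h ` U, \<phi> \<circ> inv_into UNIV h)"]) (auto simp: transport_manifold_def)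
  qed
qed

subsection \<open>Manifolds defined by an atlas\<close>

text \<open>Smooth transition maps are continuous. Therefore the sets that are open in all charts are closed
  under the operations that generate the topology, and contain its generators.\<close>

lemma openin_atlas_topology:
  assumes A: "\<And>U \<phi>. (U, \<phi>) \<in> A \<Longrightarrow> inj_on \<phi> U \<and> cart_open n (\<phi> ` U)"
    and tr: "\<And>U \<phi> V \<psi>. (U, \<phi>) \<in> A \<Longrightarrow> (V, \<psi>) \<in> A \<Longrightarrow>
      cart_open n (\<phi> ` (U \<inter> V)) \<and> smooth_transition n (U, \<phi>) (V, \<psi>)"
  shows "openin (atlas_topology n A) S \<longleftrightarrow> S \<subseteq> \<Union> (fst ` A) \<and> (\<forall>U \<phi>. (U, \<phi>) \<in> A \<longrightarrow> cart_open n (\<phi> ` (S \<inter> U)))"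
    (is "?L \<longleftrightarrow> ?R S")
proof
  assume ?L
  then have "generate_topology_on {{x \<in> U. \<phi> x \<in> W} |U \<phi> W. (U, \<phi>) \<in> A \<and> cart_open n W} S"
    unfolding atlas_topology_def by (rule openin_topology_generated_by)
  then show "?R S"
  proof (induction rule: generate_topology_on.induct)
    case Empty
    then show ?case by simp
  next
    case (Int a b)
    have "\<phi> ` (a \<inter> b \<inter> U) = \<phi> ` (a \<inter> U) \<inter> \<phi> ` (b \<inter> U)" if "(U, \<phi>) \<in> A" for U \<phi>
      using A[OF that] inj_on_image_Int[of \<phi> U "a \<inter> U" "b \<inter> U"]
      by (simp add: Int_ac)
    then have "cart_open n (\<phi> ` (a \<inter> b \<inter> U))" if "(U, \<phi>) \<in> A" for U \<phi>
      using that Int.IH openin_Int[of "Euclidean_space n" "\<phi> ` (a \<inter> U)" "\<phi> ` (b \<inter> U)"] by simp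
    moreover have "a \<inter> b \<subseteq> \<Union> (fst ` A)" using Int.IH by (meson le_infI1)
    ultimately show ?case by simp
  next
    case (UN K)
    have "cart_open n (\<phi> ` (\<Union>K \<inter> U))" if "(U, \<phi>) \<in> A" for U \<phi>
    proof -
      have "\<phi> ` (\<Union>K \<inter> U) = (\<Union>k\<in>K. \<phi> ` (k \<inter> U))" by auto
      moreover have "cart_open n (\<Union>k\<in>K. \<phi> ` (k \<inter> U))" using UN.IH that by (intro openin_Union) auto
      ultimately show ?thesis by simp
    qed
    moreover have "\<Union> K \<subseteq> \<Union> (fst ` A)" using UN.IH by (meson Sup_least)
    ultimately show ?case by simp
  next
    case (Basis s)
    then obtain U \<phi> W where s: "s = {x \<in> U. \<phi> x \<in> W}" "(U, \<phi>) \<in> A" "cart_open n W" by blast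
    have "cart_open n (\<psi> ` (s \<inter> V))" if d: "(V, \<psi>) \<in> A" for V \<psi>
    proof -
      let ?t = "\<lambda>y. \<phi> (inv_into V \<psi> y)"
      have o: "cart_open n (\<psi> ` (V \<inter> U))" using tr[OF d s(2)] by blast
      have inv: "inv_into V \<psi> (\<psi> q) = q" if "q \<in> V" for q using A[OF d] that by (simp add: inv_into_f_f)
      have c: "?t y \<in> cart n" if y: "y \<in> \<psi> ` (V \<inter> U)" for y
      proof -
        obtain q where "q \<in> V" "q \<in> U" "y = \<psi> q" using y by blast
        then show ?thesis using inv[of q] cart_open_subset[of n "\<phi> ` U"] A[OF s(2)] by auto
      qed
      have sm: "smooth_real_on n (\<psi> ` (V \<inter> U)) (\<lambda>y. ?t y i)" if "i < n" for i
        using tr[OF d s(2)] that by (simp add: smooth_transition_def)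
      have "cart_open n (\<psi> ` (V \<inter> U) \<inter> ?t -` W)"
        by (rule cart_open_preimage[OF o continuous_smooth_vector[OF o c sm] c s(3)])
      moreover have "\<psi> ` (V \<inter> U) \<inter> ?t -` W = \<psi> ` (s \<inter> V)" using inv unfolding s(1) by auto
      ultimately show ?thesis by simp
    qed
    with s show ?case by force
  qed
next
  assume R: "?R S"
  have "S = \<Union> {{x \<in> U. \<phi> x \<in> \<phi> ` (S \<inter> U)} |U \<phi>. (U, \<phi>) \<in> A}" (is "S = \<Union> ?B")
  proof
    show "S \<subseteq> \<Union> ?B"
    proof
      fix x assume x: "x \<in> S"
      then obtain c where "c \<in> A" "x \<in> fst c" using R by blast
      then obtain U \<phi> where "(U, \<phi>) \<in> A" "x \<in> U" by (cases c) simp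
      with x show "x \<in> \<Union> ?B" by blast
    qed
    show "\<Union> ?B \<subseteq> S" using A by (auto dest: inj_onD)
  qed
  moreover have "openin (atlas_topology n A) b" if "b \<in> ?B" for b
    unfolding atlas_topology_def by (rule topology_generated_by_Basis) (use that R in blast)
  ultimately show ?L by (metis (no_types, lifting) openin_Union)
qed

lemma atlas_topology_charts:
  assumes A: "\<And>U \<phi>. (U, \<phi>) \<in> A \<Longrightarrow> inj_on \<phi> U \<and> cart_open n (\<phi> ` U)"
    and tr: "\<And>U \<phi> V \<psi>. (U, \<phi>) \<in> A \<Longrightarrow> (V, \<psi>) \<in> A \<Longrightarrow>
      cart_open n (\<phi> ` (U \<inter> V)) \<and> smooth_transition n (U, \<phi>) (V, \<psi>)"
    and M: "M = \<lparr>mdim = n, mtop = atlas_topology n A, atlas = A\<rparr>"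
  shows "A \<subseteq> charts M"
proof -
  have o: "openin (atlas_topology n A) S \<longleftrightarrow> S \<subseteq> \<Union> (fst ` A) \<and> (\<forall>U \<phi>. (U, \<phi>) \<in> A \<longrightarrow> cart_open n (\<phi> ` (S \<inter> U)))" for S
    by (rule openin_atlas_topology) (erule A | erule (1) tr)+
  have t: "topological_chart M (U, \<phi>)" if c: "(U, \<phi>) \<in> A" for U \<phi>
  proof (rule topological_chartI)
    show "openin (mtop M) (U \<inter> \<phi> -` W)" if "cart_open (mdim M) W" for W
    proof -
      have "U \<inter> \<phi> -` W = {x \<in> U. \<phi> x \<in> W}" by auto
      then show ?thesis using c that unfolding M atlas_topology_def
        by (auto intro!: topology_generated_by_Basis)
    qed
    from this[of "cart n"] show "openin (mtop M) U"
      using A[OF c] cart_open_subset[of n "\<phi> ` U"] M by (auto simp: Int_absorb2 image_subset_iff_subset_vimage)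
    show "inj_on \<phi> U" using A[OF c] by blast
    show "cart_open (mdim M) (\<phi> ` B)" if "openin (mtop M) B" "B \<subseteq> U" for B
    proof -
      have "openin (atlas_topology n A) B" using that(1) M by simp
      then have "cart_open n (\<phi> ` (B \<inter> U))" using o c by blast
      then show ?thesis using that(2) M by (simp add: inf.absorb1)
    qed
  qed
  show ?thesis using t tr M by (auto simp: charts_def compatible_charts_def)
qed

text \<open>Each chart domain is homeomorphic to an open subset of a second countable space, and countably many
  countable bases of open subspaces form a countable basis.\<close>

lemma second_countable_charts:
  assumes C: "countable C" "\<And>c. c \<in> C \<Longrightarrow> topological_chart M c" "points M \<subseteq> \<Union> (fst ` C)"
  shows "second_countable (mtop M)"
proof -
  obtain B :: "(nat \<Rightarrow> real) set set" where B: "countable B" "topological_basis B"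
    using ex_countable_basis by blast
  let ?s = "\<lambda>((U, \<phi>), b). U \<inter> \<phi> -` (b \<inter> cart (mdim M))"
  show ?thesis unfolding second_countable_def
  proof (intro exI[of _ "?s ` (C \<times> B)"] conjI allI impI ballI)
    show "countable (?s ` (C \<times> B))" using C(1) B(1) by blast
    show "openin (mtop M) V" if "V \<in> ?s ` (C \<times> B)" for V
    proof -
      obtain U \<phi> b where V: "V = U \<inter> \<phi> -` (b \<inter> cart (mdim M))" "(U, \<phi>) \<in> C" "b \<in> B" using \<open>V \<in> _\<close> by auto
      have "open b" using B(2) V(3) by (rule topological_basis_open)
      then have "cart_open (mdim M) (b \<inter> cart (mdim M))" using cart_open_iff by blast
      then show ?thesis using topological_chartD(6)[OF C(2)[OF V(2)]] V(1) by blast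
    qed
    fix A x assume A: "openin (mtop M) A \<and> x \<in> A"
    then have "x \<in> points M" using openin_subset by blast
    then obtain c where "c \<in> C" "x \<in> fst c" using C(3) by blast
    then obtain U \<phi> where c: "(U, \<phi>) \<in> C" "x \<in> U" by (cases c) simp
    note t = C(2)[OF c(1)]
    obtain T where T: "open T" "\<phi> ` (U \<inter> A) = T \<inter> cart (mdim M)"
      using topological_chartD(5)[OF t conjunct1[OF A]] cart_open_iff by blast
    have "\<phi> x \<in> T" using T(2) c(2) A by blast
    then obtain b where b: "b \<in> B" "\<phi> x \<in> b" "b \<subseteq> T" using topological_basisE[OF B(2) T(1)] by blast
    have "x \<in> U \<inter> \<phi> -` (b \<inter> cart (mdim M))" using b c(2) T(2) A by blast
    moreover have "U \<inter> \<phi> -` (b \<inter> cart (mdim M)) \<subseteq> A"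
    proof
      fix q assume q: "q \<in> U \<inter> \<phi> -` (b \<inter> cart (mdim M))"
      then have "\<phi> q \<in> \<phi> ` (U \<inter> A)" using T(2) b(3) by blast
      then show "q \<in> A" using q topological_chartD(4)[OF t] by (auto dest: inj_onD)
    qed
    moreover have "U \<inter> \<phi> -` (b \<inter> cart (mdim M)) \<in> ?s ` (C \<times> B)" using c(1) b(1) by force
    ultimately show "\<exists>V\<in>?s ` (C \<times> B). x \<in> V \<and> V \<subseteq> A"
      by (intro bexI[where x = "U \<inter> \<phi> -` (b \<inter> cart (mdim M))"] conjI)
  qed
qed

subsection \<open>Joining and splitting tuples\<close>

text \<open>Cartesian spaces of all dimensions live on one type, with zeros beyond the dimension. Products are
  therefore obtained by shifting the second tuple, and projections by cutting off or shifting back.\<close>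

definition glue :: "nat \<Rightarrow> (nat \<Rightarrow> real) \<Rightarrow> (nat \<Rightarrow> real) \<Rightarrow> nat \<Rightarrow> real" where
  "glue m x y = (\<lambda>i. if i < m then x i else y (i - m))"

definition trunc :: "nat \<Rightarrow> (nat \<Rightarrow> real) \<Rightarrow> nat \<Rightarrow> real" where
  "trunc m z = (\<lambda>i. if i < m then z i else 0)"

definition shift :: "nat \<Rightarrow> (nat \<Rightarrow> real) \<Rightarrow> nat \<Rightarrow> real" where
  "shift m z = (\<lambda>i. z (i + m))"

lemma glue_trunc_shift [simp]: "glue m (trunc m z) (shift m z) = z"
  by (auto simp: glue_def trunc_def shift_def)

lemma trunc_glue [simp]: "x \<in> cart m \<Longrightarrow> trunc m (glue m x y) = x"
  by (auto simp: glue_def trunc_def cart_iff fun_eq_iff)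

lemma shift_glue [simp]: "shift m (glue m x y) = y"
  by (auto simp: glue_def shift_def)

lemma trunc_cart [simp]: "trunc m z \<in> cart m"
  by (simp add: trunc_def cart_iff)

lemma shift_cart: "z \<in> cart (m + k) \<Longrightarrow> shift m z \<in> cart k"
  by (simp add: shift_def cart_iff)

lemma glue_cart: "y \<in> cart k \<Longrightarrow> glue m x y \<in> cart (m + k)"
  by (auto simp: glue_def cart_iff)

lemma smooth_trunc: "cart_open n S \<Longrightarrow> smooth_real_on n S (\<lambda>z. trunc m z i)"
  by (cases "i < m") (simp_all add: trunc_def smooth_real_on_coord smooth_real_on_const)

lemma smooth_shift: "cart_open n S \<Longrightarrow> smooth_real_on n S (\<lambda>z. shift m z i)"
  by (simp add: shift_def smooth_real_on_coord)

lemma smooth_glue: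
  assumes "\<And>i. i < m \<Longrightarrow> smooth_real_on n S (\<lambda>x. f x i)" "\<And>i. i < k \<Longrightarrow> smooth_real_on n S (\<lambda>x. g x i)"
    and "i < m + k"
  shows "smooth_real_on n S (\<lambda>x. glue m (f x) (g x) i)"
  using assms by (cases "i < m") (simp_all add: glue_def)

lemma cart_open_trunc_vimage:
  assumes "cart_open n S" "cart_open m T" shows "cart_open n {z \<in> S. trunc m z \<in> T}"
proof -
  have "cart_open n (S \<inter> trunc m -` T)"
    by (rule cart_open_preimage[OF assms(1) continuous_smooth_vector[OF assms(1) trunc_cart smooth_trunc[OF assms(1)]] trunc_cart assms(2)])
  then show ?thesis by (simp add: vimage_def Int_def)
qed

lemma cart_open_shift_vimage:
  assumes "cart_open (m + k) S" "cart_open k T" shows "cart_open (m + k) {z \<in> S. shift m z \<in> T}"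
proof -
  have c: "shift m z \<in> cart k" if "z \<in> S" for z using that cart_open_subset[OF assms(1)] shift_cart by blast
  have "cart_open (m + k) (S \<inter> shift m -` T)"
    by (rule cart_open_preimage[OF assms(1) continuous_smooth_vector[OF assms(1) c smooth_shift[OF assms(1)]] c assms(2)])
  then show ?thesis by (simp add: vimage_def Int_def)
qed

subsection \<open>Charts of products\<close>

lemma product_manifold_simps [simp]:
  "mdim (product_manifold M N) = mdim M + mdim N"
  "mtop (product_manifold M N) = prod_topology (mtop M) (mtop N)"
  by (simp_all add: product_manifold_def)

lemma atlas_product_manifold:
  "atlas (product_manifold M N) =
     {(U \<times> V, \<lambda>(x, y). glue (mdim M) (\<phi> x) (\<psi> y)) |U \<phi> V \<psi>. (U, \<phi>) \<in> atlas M \<and> (V, \<psi>) \<in> atlas N}"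
  by (simp add: product_manifold_def glue_def)

lemma prod_chart_inv:
  assumes c: "(U, \<phi>) \<in> charts M" and d: "(V, \<psi>) \<in> charts N"
    and z: "z \<in> (\<lambda>(x, y). glue (mdim M) (\<phi> x) (\<psi> y)) ` (U \<times> V)"
  shows "inv_into (U \<times> V) (\<lambda>(x, y). glue (mdim M) (\<phi> x) (\<psi> y)) z
    = (inv_into U \<phi> (trunc (mdim M) z), inv_into V \<psi> (shift (mdim M) z))"
proof -
  let ?f = "\<lambda>(x, y). glue (mdim M) (\<phi> x) (\<psi> y)"
  have inj: "inj_on ?f (U \<times> V)"
  proof (rule inj_onI, clarsimp)
    fix a b a' b' assume *: "a \<in> U" "b \<in> V" "a' \<in> U" "b' \<in> V" "glue (mdim M) (\<phi> a) (\<psi> b) = glue (mdim M) (\<phi> a') (\<psi> b')"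
    from arg_cong[OF *(5), of "trunc (mdim M)"] arg_cong[OF *(5), of "shift (mdim M)"] *(1-4) chart_inv(4)[OF c]
    have "\<phi> a = \<phi> a'" "\<psi> b = \<psi> b'" by simp_all
    with *(1-4) chart_inj[OF c] chart_inj[OF d] show "a = a' \<and> b = b'" by (auto dest: inj_onD)
  qed
  obtain p q where pq: "p \<in> U" "q \<in> V" "z = glue (mdim M) (\<phi> p) (\<psi> q)" using z by auto
  then have "inv_into (U \<times> V) ?f z = (p, q)" using inj by (intro inv_into_f_eq) auto
  moreover have "inv_into U \<phi> (trunc (mdim M) z) = p" "inv_into V \<psi> (shift (mdim M) z) = q"
    using pq chart_inv(1)[OF c] chart_inv(1)[OF d] chart_inv(4)[OF c] by simp_all
  ultimately show ?thesis by simp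
qed

lemma prod_chart_image:
  assumes c: "(U, \<phi>) \<in> charts M" and d: "(V, \<psi>) \<in> charts N" and P: "P \<subseteq> U" and Q: "Q \<subseteq> V"
  shows "(\<lambda>(x, y). glue (mdim M) (\<phi> x) (\<psi> y)) ` (P \<times> Q) =
    {z \<in> cart (mdim M + mdim N). trunc (mdim M) z \<in> \<phi> ` P \<and> shift (mdim M) z \<in> \<psi> ` Q}"
proof safe
  fix p q assume pq: "p \<in> P" "q \<in> Q"
  then have e: "\<phi> p \<in> cart (mdim M)" "\<psi> q \<in> cart (mdim N)" using chart_inv(4)[OF c] chart_inv(4)[OF d] P Q by auto
  then show "glue (mdim M) (\<phi> p) (\<psi> q) \<in> cart (mdim M + mdim N)" by (rule_tac glue_cart)
  show "trunc (mdim M) (glue (mdim M) (\<phi> p) (\<psi> q)) \<in> \<phi> ` P" "shift (mdim M) (glue (mdim M) (\<phi> p) (\<psi> q)) \<in> \<psi> ` Q"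
    using e pq by auto
next
  fix z p q assume "trunc (mdim M) z = \<phi> p" "shift (mdim M) z = \<psi> q" "p \<in> P" "q \<in> Q"
  then have "z = (\<lambda>(x, y). glue (mdim M) (\<phi> x) (\<psi> y)) (p, q)" by (metis case_prod_conv glue_trunc_shift)
  with \<open>p \<in> P\<close> \<open>q \<in> Q\<close> show "z \<in> (\<lambda>(x, y). glue (mdim M) (\<phi> x) (\<psi> y)) ` (P \<times> Q)" by blast
qed

lemma prod_chart_image_open:
  assumes c: "(U, \<phi>) \<in> charts M" and d: "(V, \<psi>) \<in> charts N"
    and P: "openin (mtop M) P" "P \<subseteq> U" and Q: "openin (mtop N) Q" "Q \<subseteq> V"
  shows "cart_open (mdim M + mdim N) ((\<lambda>(x, y). glue (mdim M) (\<phi> x) (\<psi> y)) ` (P \<times> Q))"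
proof -
  have "cart_open (mdim M) (\<phi> ` P)" using chart_open_image[OF c P(1)] P(2) by (simp add: inf.absorb2)
  then have 1: "cart_open (mdim M + mdim N) {z \<in> cart (mdim M + mdim N). trunc (mdim M) z \<in> \<phi> ` P}"
    by (rule cart_open_trunc_vimage[OF openin_topspace])
  have "cart_open (mdim N) (\<psi> ` Q)" using chart_open_image[OF d Q(1)] Q(2) by (simp add: inf.absorb2)
  from cart_open_shift_vimage[OF 1 this] show ?thesis
    unfolding prod_chart_image[OF c d P(2) Q(2)] by (simp add: conj_assoc)
qed

lemma prod_charts_transition:
  assumes M: "smooth_manifold M" and N: "smooth_manifold N"
    and c: "(U, \<phi>) \<in> charts M" and d: "(V, \<psi>) \<in> charts N" and c': "(U', \<phi>') \<in> charts M" and d': "(V', \<psi>') \<in> charts N"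
  shows "smooth_transition (mdim M + mdim N) (U \<times> V, \<lambda>(x, y). glue (mdim M) (\<phi> x) (\<psi> y))
    (U' \<times> V', \<lambda>(x, y). glue (mdim M) (\<phi>' x) (\<psi>' y))"
proof -
  let ?m = "mdim M" and ?k = "mdim N"
  let ?f = "\<lambda>(x, y). glue ?m (\<phi> x) (\<psi> y)" and ?g = "\<lambda>(x, y). glue ?m (\<phi>' x) (\<psi>' y)"
  define S where "S = ?f ` ((U \<times> V) \<inter> (U' \<times> V'))"
  have eq: "(U \<times> V) \<inter> (U' \<times> V') = (U \<inter> U') \<times> (V \<inter> V')" by auto
  have S: "cart_open (?m + ?k) S" unfolding S_def eq
    by (rule prod_chart_image_open[OF c d]) (use chart_openin[OF c] chart_openin[OF c'] chart_openin[OF d] chart_openin[OF d'] in auto)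
  have S_img: "trunc ?m z \<in> \<phi> ` (U \<inter> U')" "shift ?m z \<in> \<psi> ` (V \<inter> V')" if "z \<in> S" for z
    using that unfolding S_def eq by (subst (asm) prod_chart_image[OF c d]; simp)+
  have 1: "smooth_real_on (?m + ?k) S (\<lambda>z. \<phi>' (inv_into U \<phi> (trunc ?m z)) i)" if "i < ?m" for i
    by (rule smooth_real_on_compose[OF S chart_open_image[OF c chart_openin[OF c']] _ transition_smooth[OF M c c' that]])
      (use S_img smooth_trunc[OF S] in auto)
  have 2: "smooth_real_on (?m + ?k) S (\<lambda>z. \<psi>' (inv_into V \<psi> (shift ?m z)) i)" if "i < ?k" for i
    by (rule smooth_real_on_compose[OF S chart_open_image[OF d chart_openin[OF d']] _ transition_smooth[OF N d d' that]])
      (use S_img smooth_shift[OF S] in auto)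
  have "smooth_real_on (?m + ?k) S (\<lambda>z. ?g (inv_into (U \<times> V) ?f z) i)" if i: "i < ?m + ?k" for i
  proof (rule smooth_real_on_cong[OF S _ smooth_glue[OF 1 2 i]])
    fix z assume "z \<in> S"
    then have "z \<in> ?f ` (U \<times> V)" unfolding S_def by blast
    from prod_chart_inv[OF c d this]
    show "glue ?m (\<phi>' (inv_into U \<phi> (trunc ?m z))) (\<psi>' (inv_into V \<psi> (shift ?m z))) i = ?g (inv_into (U \<times> V) ?f z) i"
      by simp
  qed
  then show ?thesis unfolding smooth_transition_def prod.case S_def by blast
qed

text \<open>The atlas of a product consists of the products of charts of the atlases. Trivialisations are
  composed with products of arbitrary charts, which have to be charts as well.\<close>

lemma prod_chart:
  assumes M: "smooth_manifold M" and N: "smooth_manifold N"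
    and c: "(U, \<phi>) \<in> charts M" and d: "(V, \<psi>) \<in> charts N"
  shows "(U \<times> V, \<lambda>(x, y). glue (mdim M) (\<phi> x) (\<psi> y)) \<in> charts (product_manifold M N)"
proof -
  let ?m = "mdim M" and ?k = "mdim N" and ?P = "product_manifold M N"
  let ?f = "\<lambda>(x, y). glue ?m (\<phi> x) (\<psi> y)"
  have "topological_chart ?P (U \<times> V, ?f)"
  proof (rule topological_chartI)
    show "openin (mtop ?P) (U \<times> V)" using chart_openin[OF c] chart_openin[OF d] by (simp add: openin_prod_Times_iff)
    show "inj_on ?f (U \<times> V)"
      by (rule inj_on_inverseI[where g = "\<lambda>z. (inv_into U \<phi> (trunc ?m z), inv_into V \<psi> (shift ?m z))"])
        (use chart_inv(1)[OF c] chart_inv(1)[OF d] chart_inv(4)[OF c] in auto)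
    show "cart_open (mdim ?P) (?f ` A)" if A: "openin (mtop ?P) A" "A \<subseteq> U \<times> V" for A
      unfolding openin_subopen[of _ "?f ` A"]
    proof
      fix z assume "z \<in> ?f ` A"
      then obtain a where "z = ?f a" "a \<in> A" by (rule imageE)
      moreover obtain p q where "a = (p, q)" by (rule prod.exhaust)
      ultimately have pq: "(p, q) \<in> A" "z = ?f (p, q)" by simp_all
      have "openin (prod_topology (mtop M) (mtop N)) A" using A(1) by simp
      with pq(1) obtain P Q where PQ: "openin (mtop M) P" "openin (mtop N) Q" "p \<in> P" "q \<in> Q" "P \<times> Q \<subseteq> A"
        unfolding openin_prod_topology_alt by meson
      then have "P \<subseteq> U" "Q \<subseteq> V" using A(2) PQ(3,4) by blast+
      then have "cart_open (mdim ?P) (?f ` (P \<times> Q))" using prod_chart_image_open[OF c d PQ(1) _ PQ(2)] by simp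
      moreover have "z \<in> ?f ` (P \<times> Q)" unfolding pq(2) using PQ(3,4) by (intro imageI) simp
      moreover have "?f ` (P \<times> Q) \<subseteq> ?f ` A" using PQ(5) by (rule image_mono)
      ultimately show "\<exists>T. cart_open (mdim ?P) T \<and> z \<in> T \<and> T \<subseteq> ?f ` A" by blast
    qed
    show "openin (mtop ?P) ((U \<times> V) \<inter> ?f -` W)" if W: "cart_open (mdim ?P) W" for W
      unfolding openin_subopen[of _ "(U \<times> V) \<inter> ?f -` W"]
    proof
      fix z assume "z \<in> (U \<times> V) \<inter> ?f -` W"
      then obtain p q where pq: "z = (p, q)" "p \<in> U" "q \<in> V" "glue ?m (\<phi> p) (\<psi> q) \<in> W" by auto
      obtain e where e: "e > 0" "\<And>y. y \<in> cart (?m + ?k) \<Longrightarrow>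
          (\<And>i. i < ?m + ?k \<Longrightarrow> \<bar>y i - glue ?m (\<phi> p) (\<psi> q) i\<bar> < e) \<Longrightarrow> y \<in> W"
        using cart_open_box[of "?m + ?k" W] W pq(4) by (metis product_manifold_simps(1))
      let ?A = "U \<inter> \<phi> -` {x \<in> cart ?m. \<forall>i\<in>{..<?m}. \<bar>x i - \<phi> p i\<bar> < e}"
      let ?B = "V \<inter> \<psi> -` {x \<in> cart ?k. \<forall>i\<in>{..<?k}. \<bar>x i - \<psi> q i\<bar> < e}"
      have "openin (mtop ?P) (?A \<times> ?B)"
        using chart_preimage_open[OF c cart_open_cube] chart_preimage_open[OF d cart_open_cube] by (simp add: openin_prod_Times_iff)
      moreover have "z \<in> ?A \<times> ?B" using pq e(1) chart_inv(4)[OF c] chart_inv(4)[OF d] by auto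
      moreover have "?A \<times> ?B \<subseteq> (U \<times> V) \<inter> ?f -` W"
      proof (rule subsetI)
        fix w assume "w \<in> ?A \<times> ?B"
        then obtain a b where w: "w = (a, b)" and ab: "a \<in> U" "b \<in> V" "\<phi> a \<in> cart ?m" "\<psi> b \<in> cart ?k"
          "\<forall>i\<in>{..<?m}. \<bar>\<phi> a i - \<phi> p i\<bar> < e" "\<forall>i\<in>{..<?k}. \<bar>\<psi> b i - \<psi> q i\<bar> < e" by auto
        have "glue ?m (\<phi> a) (\<psi> b) \<in> W"
        proof (rule e(2)[OF glue_cart[OF ab(4)]])
          fix i assume "i < ?m + ?k"
          then show "\<bar>glue ?m (\<phi> a) (\<psi> b) i - glue ?m (\<phi> p) (\<psi> q) i\<bar> < e"
            using ab(5,6) by (cases "i < ?m") (auto simp: glue_def)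
        qed
        then show "w \<in> (U \<times> V) \<inter> ?f -` W" using w ab by simp
      qed
      ultimately show "\<exists>T. openin (mtop ?P) T \<and> z \<in> T \<and> T \<subseteq> (U \<times> V) \<inter> ?f -` W" by blast
    qed
  qed
  moreover have "compatible_charts (mdim ?P) (U \<times> V, ?f) a" if a: "a \<in> atlas ?P" for a
  proof -
    obtain U' \<phi>' V' \<psi>' where "a = (U' \<times> V', \<lambda>(x, y). glue ?m (\<phi>' x) (\<psi>' y))" "(U', \<phi>') \<in> charts M" "(V', \<psi>') \<in> charts N"
      using a atlas_subset_charts[OF M] atlas_subset_charts[OF N] unfolding atlas_product_manifold by blast
    then show ?thesis using prod_charts_transition[OF M N] c d by (simp add: compatible_charts_def)
  qed
  ultimately show ?thesis by (simp add: charts_def)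
qed

subsection \<open>Charts pulled back along a diffeomorphism\<close>

text \<open>The domain of a chart of \<open>M\<close> has the dimension of \<open>M\<close> by definition, whereas the pulled back chart takes
  values in the space of dimension \<open>mdim N\<close>. So invariance of dimension under diffeomorphisms is
  needed, too.\<close>

lemma diffeo_chart:
  assumes M: "smooth_manifold M" and A: "openin (mtop M) A"
    and \<tau>: "diffeomorphism (open_submanifold M A) N \<tau>"
    and d: "(V, \<psi>) \<in> charts N" and p: "p \<in> A" "\<tau> p \<in> V"
  shows "mdim N = mdim M" "(A \<inter> \<tau> -` V, \<psi> \<circ> \<tau>) \<in> charts M"
proof -
  let ?M = "open_submanifold M A"
  obtain g where s\<tau>: "smooth_map ?M N \<tau>" and sg: "smooth_map N ?M g"
    and g\<tau>: "\<And>x. x \<in> points ?M \<Longrightarrow> g (\<tau> x) = x" and \<tau>g: "\<And>y. y \<in> points N \<Longrightarrow> \<tau> (g y) = y"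
    using \<tau> unfolding diffeomorphism_def by blast
  have pA: "points ?M = A" using openin_subset[OF A] by auto
  have c\<tau>: "continuous_map (mtop ?M) (mtop N) \<tau>" and cg: "continuous_map (mtop N) (mtop ?M) g"
    using s\<tau> sg by (auto simp: smooth_map_def)
  have gA: "g y \<in> A" if "y \<in> points N" for y
    using cg that pA by (auto simp: continuous_map_def)
  have g\<tau>: "g (\<tau> x) = x" if "x \<in> A" for x using g\<tau> that pA by blast
  have VN: "V \<subseteq> points N" by (rule chart_subset[OF d])
  have pre: "openin (mtop M) (A \<inter> \<tau> -` O')" if "openin (mtop N) O'" for O'
  proof -
    have "openin (mtop ?M) {x \<in> points ?M. \<tau> x \<in> O'}" using c\<tau> that by (rule openin_continuous_map_preimage)
    moreover have "{x \<in> points ?M. \<tau> x \<in> O'} = A \<inter> \<tau> -` O'" using pA by auto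
    ultimately show ?thesis using openin_open_subtopology[OF A] by simp
  qed
  have preg: "openin (mtop N) {y \<in> points N. g y \<in> B}" if "openin (mtop M) B" for B
  proof -
    have "openin (mtop ?M) (A \<inter> B)" using that by (simp add: openin_subtopology_Int2)
    from openin_continuous_map_preimage[OF cg this] have "openin (mtop N) {y \<in> points N. g y \<in> A \<inter> B}" .
    moreover have "{y \<in> points N. g y \<in> A \<inter> B} = {y \<in> points N. g y \<in> B}" using gA by auto
    ultimately show ?thesis by simp
  qed
  have oU: "cart_open (mdim M) (\<phi> ` (U \<inter> (A \<inter> \<tau> -` V)))"
    and oV: "cart_open (mdim N) (\<psi> ` (V \<inter> g -` U))" if c: "(U, \<phi>) \<in> charts M" for U \<phi>
  proof -
    show "cart_open (mdim M) (\<phi> ` (U \<inter> (A \<inter> \<tau> -` V)))"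
      by (rule chart_open_image[OF c pre[OF chart_openin[OF d]]])
    have "V \<inter> {y \<in> points N. g y \<in> U} = V \<inter> g -` U" using VN by auto
    then show "cart_open (mdim N) (\<psi> ` (V \<inter> g -` U))"
      using chart_open_image[OF d preg[OF chart_openin[OF c]]] by simp
  qed
  have rep\<tau>: "smooth_real_on (mdim M) (\<phi> ` (U \<inter> (A \<inter> \<tau> -` V))) (\<lambda>x. \<psi> (\<tau> (inv_into U \<phi> x)) i)"
    if c: "(U, \<phi>) \<in> charts M" and i: "i < mdim N" for U \<phi> i
  proof -
    have c': "(U \<inter> A, \<phi>) \<in> charts ?M"
      using charts_open_submanifold[OF M A] chart_restrict[OF c A M] by blast
    have "smooth_real_on (mdim ?M) (\<phi> ` ((U \<inter> A) \<inter> \<tau> -` V)) (\<lambda>x. \<psi> (\<tau> (inv_into (U \<inter> A) \<phi> x)) i)"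
      using s\<tau> c' d i unfolding smooth_map_def by blast
    then have "smooth_real_on (mdim M) (\<phi> ` (U \<inter> (A \<inter> \<tau> -` V))) (\<lambda>x. \<psi> (\<tau> (inv_into (U \<inter> A) \<phi> x)) i)"
      by (simp add: Int_assoc)
    then show "smooth_real_on (mdim M) (\<phi> ` (U \<inter> (A \<inter> \<tau> -` V))) (\<lambda>x. \<psi> (\<tau> (inv_into U \<phi> x)) i)"
      by (rule smooth_real_on_cong[OF oU[OF c], rotated]) (use chart_inv(1)[OF c] chart_inv(1)[OF c'] in auto)
  qed
  have repg: "smooth_real_on (mdim N) (\<psi> ` (V \<inter> g -` U)) (\<lambda>y. \<phi> (g (inv_into V \<psi> y)) j)"
    if c: "(U, \<phi>) \<in> charts M" and j: "j < mdim M" for U \<phi> j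
  proof -
    have c': "(U \<inter> A, \<phi>) \<in> charts ?M"
      using charts_open_submanifold[OF M A] chart_restrict[OF c A M] by blast
    have "smooth_real_on (mdim N) (\<psi> ` (V \<inter> g -` (U \<inter> A))) (\<lambda>y. \<phi> (g (inv_into V \<psi> y)) j)"
      using sg c' d j unfolding smooth_map_def open_submanifold_simps by blast
    moreover have "V \<inter> g -` (U \<inter> A) = V \<inter> g -` U" using VN gA by auto
    ultimately show "smooth_real_on (mdim N) (\<psi> ` (V \<inter> g -` U)) (\<lambda>y. \<phi> (g (inv_into V \<psi> y)) j)" by simp
  qed
  have pM: "p \<in> points M" using p(1) openin_subset[OF A] by blast
  obtain U0 \<phi>0 where c0: "(U0, \<phi>0) \<in> charts M" "p \<in> U0" using charts_cover[OF M pM] by blast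
  have "mdim M = mdim N"
  proof (rule dimension_invariance[OF oU[OF c0(1)] oV[OF c0(1)],
      where F = "\<lambda>x. \<psi> (\<tau> (inv_into U0 \<phi>0 x))" and G = "\<lambda>y. \<phi>0 (g (inv_into V \<psi> y))"])
    show "smooth_real_on (mdim M) (\<phi>0 ` (U0 \<inter> (A \<inter> \<tau> -` V))) (\<lambda>x. \<psi> (\<tau> (inv_into U0 \<phi>0 x)) i)" if "i < mdim N" for i
      by (rule rep\<tau>[OF c0(1) that])
    show "smooth_real_on (mdim N) (\<psi> ` (V \<inter> g -` U0)) (\<lambda>y. \<phi>0 (g (inv_into V \<psi> y)) j)" if "j < mdim M" for j
      by (rule repg[OF c0(1) that])
    show "\<phi>0 p \<in> \<phi>0 ` (U0 \<inter> (A \<inter> \<tau> -` V))" using c0(2) p by auto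
  qed (use chart_inv(1)[OF c0(1)] chart_inv(1)[OF d] g\<tau> \<tau>g gA VN in auto)
  then show dim: "mdim N = mdim M" by simp
  let ?W = "A \<inter> \<tau> -` V"
  have inj: "inj_on (\<psi> \<circ> \<tau>) ?W"
  proof (rule inj_onI)
    fix x y assume *: "x \<in> ?W" "y \<in> ?W" "(\<psi> \<circ> \<tau>) x = (\<psi> \<circ> \<tau>) y"
    then have "\<tau> x = \<tau> y" using chart_inj[OF d] by (auto dest: inj_onD)
    then show "x = y" using g\<tau> * by (metis IntD1)
  qed
  have img: "(\<psi> \<circ> \<tau>) ` (?W \<inter> B) = \<psi> ` (V \<inter> g -` B)" for B
  proof safe
    fix x assume "x \<in> A" "\<tau> x \<in> V" "x \<in> B"
    then show "(\<psi> \<circ> \<tau>) x \<in> \<psi> ` (V \<inter> g -` B)" using g\<tau> by auto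
  next
    fix y assume "y \<in> V" "g y \<in> B"
    then show "\<psi> y \<in> (\<psi> \<circ> \<tau>) ` (?W \<inter> B)" using \<tau>g[of y] gA[of y] VN by (intro image_eqI[of _ _ "g y"]) auto
  qed
  have inv: "inv_into ?W (\<psi> \<circ> \<tau>) x = g (inv_into V \<psi> x)" if "x \<in> \<psi> ` V" for x
  proof (rule inv_into_f_eq[OF inj])
    have "inv_into V \<psi> x \<in> V" by (rule chart_inv(2)[OF d that])
    then show "g (inv_into V \<psi> x) \<in> ?W" "(\<psi> \<circ> \<tau>) (g (inv_into V \<psi> x)) = x"
      using gA \<tau>g VN chart_inv(3)[OF d that] by auto
  qed
  have t: "topological_chart M (?W, \<psi> \<circ> \<tau>)"
  proof (rule topological_chartI[OF pre[OF chart_openin[OF d]] inj])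
    show "cart_open (mdim M) ((\<psi> \<circ> \<tau>) ` B)" if B: "openin (mtop M) B" "B \<subseteq> ?W" for B
    proof -
      have "(\<psi> \<circ> \<tau>) ` B = \<psi> ` (V \<inter> {y \<in> points N. g y \<in> B})"
        using img[of B] B(2) VN by (simp add: inf.absorb2) blast
      then show ?thesis using chart_open_image[OF d preg[OF B(1)]] dim by simp
    qed
    show "openin (mtop M) (?W \<inter> (\<psi> \<circ> \<tau>) -` O')" if "cart_open (mdim M) O'" for O'
    proof -
      have "?W \<inter> (\<psi> \<circ> \<tau>) -` O' = A \<inter> \<tau> -` (V \<inter> \<psi> -` O')" by auto
      then show ?thesis using pre[OF chart_preimage_open[OF d]] that dim by simp
    qed
  qed
  have "compatible_charts (mdim M) (?W, \<psi> \<circ> \<tau>) (U, \<phi>)" if a: "(U, \<phi>) \<in> atlas M" for U \<phi>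
  proof -
    have c: "(U, \<phi>) \<in> charts M" using a atlas_subset_charts[OF M] by blast
    have "smooth_real_on (mdim M) ((\<psi> \<circ> \<tau>) ` (?W \<inter> U)) (\<lambda>x. \<phi> (inv_into ?W (\<psi> \<circ> \<tau>) x) i)" if i: "i < mdim M" for i
    proof (rule smooth_real_on_cong)
      show "cart_open (mdim M) ((\<psi> \<circ> \<tau>) ` (?W \<inter> U))"
        unfolding img using oV[OF c] dim by simp
      show "smooth_real_on (mdim M) ((\<psi> \<circ> \<tau>) ` (?W \<inter> U)) (\<lambda>x. \<phi> (g (inv_into V \<psi> x)) i)"
        unfolding img using repg[OF c i] dim by simp
      show "\<phi> (g (inv_into V \<psi> x)) i = \<phi> (inv_into ?W (\<psi> \<circ> \<tau>) x) i" if "x \<in> (\<psi> \<circ> \<tau>) ` (?W \<inter> U)" for x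
        using that inv unfolding img by (metis IntD1 imageE imageI)
    qed
    moreover have "smooth_real_on (mdim M) (\<phi> ` (U \<inter> ?W)) (\<lambda>x. (\<psi> \<circ> \<tau>) (inv_into U \<phi> x) i)" if i: "i < mdim M" for i
      using rep\<tau>[OF c, of i] i dim by simp
    ultimately show ?thesis by (simp add: compatible_charts_def smooth_transition_def)
  qed
  with t show "(?W, \<psi> \<circ> \<tau>) \<in> charts M" by (auto simp: charts_def)
qed

subsection \<open>Fibered charts\<close>

text \<open>A chart of the product of a base chart and a chart of the typical fiber, pulled back along a local
  trivialisation, is a fibered chart.\<close>

lemma fibered_chart_exists:
  assumes "smooth_fiber_bundle E X F \<pi>" and e: "e \<in> points E"
  shows "mdim E = mdim X + mdim F" "\<exists>U u V v. (U, u, V, v) \<in> fibered_charts E X \<pi> \<and> e \<in> V"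
proof -
  have E: "smooth_manifold E" and X: "smooth_manifold X" and F: "smooth_manifold F"
    and \<pi>: "smooth_map E X \<pi>" "\<pi> ` points E = points X"
    using assms(1) by (auto simp: smooth_fiber_bundle_def)
  have "\<pi> e \<in> points X" using e \<pi>(2) by blast
  then obtain B \<tau> where B: "openin (mtop X) B" "\<pi> e \<in> B"
    and \<tau>: "diffeomorphism (open_submanifold E (points E \<inter> \<pi> -` B)) (product_manifold (open_submanifold X B) F) \<tau>"
    and f\<tau>: "\<And>e. e \<in> points E \<inter> \<pi> -` B \<Longrightarrow> fst (\<tau> e) = \<pi> e"
    using assms(1) unfolding smooth_fiber_bundle_def by (metis (no_types, lifting))
  let ?A = "points E \<inter> \<pi> -` B" and ?XB = "open_submanifold X B"
  have "continuous_map (mtop E) (mtop X) \<pi>" using \<pi>(1) by (simp add: smooth_map_def)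
  from openin_continuous_map_preimage[OF this B(1)] have A: "openin (mtop E) ?A" by (simp add: Int_def vimage_def)
  have XB: "smooth_manifold ?XB" using smooth_manifold_open_submanifold[OF X B(1)] .
  have eA: "e \<in> ?A" using e B(2) by simp
  have "\<tau> e \<in> points (product_manifold ?XB F)"
  proof -
    have "continuous_map (mtop (open_submanifold E ?A)) (mtop (product_manifold ?XB F)) \<tau>"
      using \<tau> by (simp add: diffeomorphism_def smooth_map_def)
    moreover have "e \<in> points (open_submanifold E ?A)" using eA by simp
    ultimately show ?thesis unfolding continuous_map_def by blast
  qed
  then have \<tau>e: "fst (\<tau> e) \<in> points ?XB" "snd (\<tau> e) \<in> points F" by (auto simp: mem_Times_iff)
  obtain U u where c: "(U, u) \<in> charts ?XB" "fst (\<tau> e) \<in> U" using charts_cover[OF XB \<tau>e(1)] by blast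
  obtain W w where d: "(W, w) \<in> charts F" "snd (\<tau> e) \<in> W" using charts_cover[OF F \<tau>e(2)] by blast
  have pc: "(U \<times> W, \<lambda>(x, y). glue (mdim ?XB) (u x) (w y)) \<in> charts (product_manifold ?XB F)"
    by (rule prod_chart[OF XB F c(1) d(1)])
  have "\<tau> e \<in> U \<times> W" using c(2) d(2) by (simp add: mem_Times_iff)
  note dc = diffeo_chart[OF E A \<tau> pc eA this]
  show "mdim E = mdim X + mdim F" using dc(1) by simp
  have cX: "(U, u) \<in> charts X" using c(1) charts_open_submanifold[OF X B(1)] by blast
  have "(U, u, ?A \<inter> \<tau> -` (U \<times> W), (\<lambda>(x, y). glue (mdim ?XB) (u x) (w y)) \<circ> \<tau>) \<in> fibered_charts E X \<pi>"
    unfolding fibered_charts_def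
  proof (clarsimp simp only: mem_Collect_eq prod.case, intro conjI cX dc(2))
    show "\<pi> ` (?A \<inter> \<tau> -` (U \<times> W)) \<subseteq> U" using f\<tau> by (force simp: mem_Times_iff)
    show "\<forall>e\<in>?A \<inter> \<tau> -` (U \<times> W). \<forall>i<mdim X. ((\<lambda>(x, y). glue (mdim ?XB) (u x) (w y)) \<circ> \<tau>) e i = u (\<pi> e) i"
      using f\<tau> by (auto simp: glue_def case_prod_unfold)
  qed
  moreover have "e \<in> ?A \<inter> \<tau> -` (U \<times> W)" using eA \<open>\<tau> e \<in> U \<times> W\<close> by simp
  ultimately show "\<exists>U u V v. (U, u, V, v) \<in> fibered_charts E X \<pi> \<and> e \<in> V" by blast
qed

section \<open>Functions with prescribed derivatives at a point\<close>

subsection \<open>Taylor monomials\<close>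

lemma smooth_real_on_power:
  "cart_open n S \<Longrightarrow> smooth_real_on n S f \<Longrightarrow> smooth_real_on n S (\<lambda>x. f x ^ k)"
  by (induction k) (auto intro: smooth_real_on_const smooth_real_on_mult)

lemma smooth_real_on_cmult:
  "cart_open n S \<Longrightarrow> smooth_real_on n S f \<Longrightarrow> smooth_real_on n S (\<lambda>x. c * f x)"
  by (rule smooth_real_on_mult[OF _ smooth_real_on_const])

lemma iterated_partial_linear:
  assumes S: "cart_open n S" and "finite A" and f: "\<And>j. j \<in> A \<Longrightarrow> smooth_real_on n S (f j)"
    and "set J \<subseteq> {..<n}" "x \<in> S"
  shows "iterated_partial J (\<lambda>x. \<Sum>j\<in>A. c j * f j x) x = (\<Sum>j\<in>A. c j * iterated_partial J (f j) x)"
  using assms(4,5)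
proof (induction J arbitrary: x)
  case (Cons i J)
  then have i: "i < n" and J: "set J \<subseteq> {..<n}" by auto
  have "iterated_partial (i # J) (\<lambda>x. \<Sum>j\<in>A. c j * f j x) x = partial_deriv i (\<lambda>x. \<Sum>j\<in>A. c j * iterated_partial J (f j) x) x"
    unfolding iterated_partial_Cons by (rule partial_deriv_cong[OF S Cons.prems(2) i]) (rule Cons.IH[OF J])
  also have "\<dots> = (\<Sum>j\<in>A. c j * partial_deriv i (iterated_partial J (f j)) x)"
  proof (rule partial_deriv_eqI, rule DERIV_sum)
    fix j assume j: "j \<in> A"
    show "((\<lambda>t. c j * iterated_partial J (f j) (x(i := t))) has_real_derivative
        c j * partial_deriv i (iterated_partial J (f j)) x) (at (x i))"
      by (rule DERIV_cmult, rule smooth_has_partial_deriv[OF smooth_real_on_iterated[OF f[OF j] J] Cons.prems(2) i])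
  qed
  finally show ?case by (simp add: iterated_partial_Cons)
qed simp

text \<open>The monomials are normalised by factorials, so that a partial derivative just lowers an
  exponent.\<close>

definition taylor_monomial :: "nat \<Rightarrow> (nat \<Rightarrow> real) \<Rightarrow> (nat \<Rightarrow> nat) \<Rightarrow> (nat \<Rightarrow> real) \<Rightarrow> real" where
  "taylor_monomial m x0 \<alpha> x = (\<Prod>i<m. (x i - x0 i) ^ \<alpha> i / fact (\<alpha> i))"

lemma smooth_taylor_monomial:
  assumes S: "cart_open n S" and "\<And>i. i < m \<Longrightarrow> smooth_real_on n S (\<lambda>z. f z i)" "\<And>i. i < m \<Longrightarrow> smooth_real_on n S (\<lambda>z. g z i)"
  shows "smooth_real_on n S (\<lambda>z. taylor_monomial m (g z) \<alpha> (f z))"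
proof -
  have "smooth_real_on n S (\<lambda>z. \<Prod>i\<in>{..<m}. inverse (fact (\<alpha> i)) * (f z i - g z i) ^ \<alpha> i)"
    using assms(2,3)
    by (intro smooth_real_on_prod[OF S] smooth_real_on_cmult[OF S] smooth_real_on_power[OF S] smooth_real_on_diff[OF S]) auto
  then show ?thesis by (simp add: taylor_monomial_def divide_inverse mult.commute)
qed

lemma partial_taylor_monomial:
  assumes i: "i < m"
  shows "partial_deriv i (taylor_monomial m x0 \<alpha>) x =
    (if \<alpha> i = 0 then 0 else taylor_monomial m x0 (\<alpha>(i := \<alpha> i - 1)) x)"
proof (rule partial_deriv_eqI)
  let ?R = "\<Prod>j\<in>{..<m} - {i}. (x j - x0 j) ^ \<alpha> j / fact (\<alpha> j)"
  have split: "taylor_monomial m x0 \<beta> y = (y i - x0 i) ^ \<beta> i / fact (\<beta> i) * (\<Prod>j\<in>{..<m} - {i}. (y j - x0 j) ^ \<beta> j / fact (\<beta> j))"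
    for \<beta> y unfolding taylor_monomial_def using i by (subst prod.remove[of _ i]) auto
  have 1: "taylor_monomial m x0 \<alpha> (x(i := t)) = (t - x0 i) ^ \<alpha> i / fact (\<alpha> i) * ?R" for t
    unfolding split by (auto intro!: prod.cong)
  have 2: "taylor_monomial m x0 (\<alpha>(i := k)) x = (x i - x0 i) ^ k / fact k * ?R" for k
    unfolding split by (auto intro!: prod.cong)
  have "((\<lambda>t. (t - x0 i) ^ \<alpha> i / fact (\<alpha> i) * ?R) has_real_derivative
      (of_nat (\<alpha> i) * (x i - x0 i) ^ (\<alpha> i - 1) / fact (\<alpha> i) * ?R)) (at (x i))"
    by (auto intro!: derivative_eq_intros)
  moreover have "of_nat (\<alpha> i) * (x i - x0 i) ^ (\<alpha> i - 1) / fact (\<alpha> i) * ?R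
      = (if \<alpha> i = 0 then 0 else taylor_monomial m x0 (\<alpha>(i := \<alpha> i - 1)) x)"
  proof (cases "\<alpha> i")
    case (Suc k)
    have "of_nat (Suc k) * c / fact (Suc k) = (c / fact k :: real)" for c
      by (simp add: fact_Suc del: of_nat_Suc)
    then show ?thesis unfolding 2 Suc by simp
  qed simp
  ultimately show "((\<lambda>t. taylor_monomial m x0 \<alpha> (x(i := t))) has_real_derivative
      (if \<alpha> i = 0 then 0 else taylor_monomial m x0 (\<alpha>(i := \<alpha> i - 1)) x)) (at (x i))"
    unfolding 1 by simp
qed

lemma iterated_taylor_monomial:
  assumes "set J \<subseteq> {..<m}"
  shows "iterated_partial J (taylor_monomial m x0 \<alpha>) =
    (if \<forall>i. count_list J i \<le> \<alpha> i then taylor_monomial m x0 (\<lambda>i. \<alpha> i - count_list J i) else (\<lambda>x. 0))"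
  using assms
proof (induction J)
  case (Cons i J)
  then have IH: "iterated_partial J (taylor_monomial m x0 \<alpha>) =
    (if \<forall>i. count_list J i \<le> \<alpha> i then taylor_monomial m x0 (\<lambda>i. \<alpha> i - count_list J i) else (\<lambda>x. 0))" by simp
  have i: "i < m" using Cons.prems by simp
  show ?case
  proof (cases "\<forall>i. count_list J i \<le> \<alpha> i")
    case True
    show ?thesis
    proof (cases "\<alpha> i - count_list J i = 0")
      case z: True
      then have "\<not> (\<forall>j. count_list (i # J) j \<le> \<alpha> j)" using True by (auto intro!: exI[of _ i])
      then show ?thesis using True z partial_taylor_monomial[OF i, of x0 "\<lambda>i. \<alpha> i - count_list J i"]
        unfolding iterated_partial_Cons IH by (auto simp: fun_eq_iff)
    next
      case nz: False
      then have le: "\<forall>j. count_list (i # J) j \<le> \<alpha> j" using True by auto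
      have upd: "(\<lambda>j. \<alpha> j - count_list J j)(i := \<alpha> i - count_list J i - 1) = (\<lambda>j. \<alpha> j - count_list (i # J) j)" by auto
      have "partial_deriv i (taylor_monomial m x0 (\<lambda>i. \<alpha> i - count_list J i))
          = taylor_monomial m x0 (\<lambda>j. \<alpha> j - count_list (i # J) j)"
        by (rule ext) (simp only: partial_taylor_monomial[OF i] nz upd if_False)
      with le True show ?thesis unfolding iterated_partial_Cons IH by simp
    qed
  next
    case False
    then have n: "\<not> (\<forall>j. count_list (i # J) j \<le> \<alpha> j)" by (metis add_leD1 count_list.simps(2))
    have z: "partial_deriv i (\<lambda>x. 0) = (\<lambda>x. 0)" by (simp add: partial_deriv_def fun_eq_iff)
    show ?thesis unfolding iterated_partial_Cons IH by (simp only: False n z if_False)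
  qed
qed (simp add: fun_eq_iff)

lemma taylor_monomial_center: "taylor_monomial m x0 \<alpha> x0 = (if \<forall>i<m. \<alpha> i = 0 then 1 else 0)"
proof (cases "\<forall>i<m. \<alpha> i = 0")
  case False
  then obtain i where "i < m" "\<alpha> i \<noteq> 0" by blast
  then have "\<exists>i\<in>{..<m}. (x0 i - x0 i) ^ \<alpha> i / fact (\<alpha> i) = 0" by auto
  then have "taylor_monomial m x0 \<alpha> x0 = 0" unfolding taylor_monomial_def by (subst prod_zero_iff) auto
  then show ?thesis using False by simp
qed (simp add: taylor_monomial_def)

text \<open>For sorted lists the multiplicities determine the list; hence the Taylor monomials are dual to the
  derivatives at the center.\<close>

lemma taylor_monomial_derivative:
  assumes I: "set I \<subseteq> {..<m}" "sorted I" and J: "set J \<subseteq> {..<m}" "sorted J"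
  shows "iterated_partial J (taylor_monomial m x0 (count_list I)) x0 = (if I = J then 1 else 0)"
proof -
  have "I = J" if "\<forall>i. count_list J i \<le> count_list I i" "\<forall>i<m. count_list I i - count_list J i = 0"
  proof -
    have "count_list I i = count_list J i" for i
    proof (cases "i < m")
      case False
      then have "i \<notin> set I" "i \<notin> set J" using I(1) J(1) by auto
      then show ?thesis by (simp add: count_list_0_iff)
    qed (use that in \<open>metis diff_is_0_eq le_antisym\<close>)
    then have "mset I = mset J" by (intro multiset_eqI) (simp add: count_mset)
    then show ?thesis using I(2) J(2) properties_for_sort by metis
  qed
  then show ?thesis
    unfolding iterated_taylor_monomial[OF J(1)] by (auto simp: taylor_monomial_center)
qed

subsection \<open>A smooth cutoff function\<close>

text \<open>The functions \<open>exp (- 1 / t) / t\<^sup>n\<close>, extended by \<open>0\<close>, are closed under differentiation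
  up to linear combinations; so they are all smooth as soon as they are all differentiable.\<close>

definition flat :: "nat \<Rightarrow> real \<Rightarrow> real" where
  "flat n t = (if t > 0 then inverse t ^ n * exp (- inverse t) else 0)"

lemma flat_tendsto_0: "(flat n \<longlongrightarrow> 0) (at 0)"
proof -
  have "((\<lambda>t. inverse t ^ n * exp (- inverse t)) \<longlongrightarrow> 0) (at_right (0::real))"
    using filterlim_compose[OF tendsto_power_div_exp_0 filterlim_inverse_at_top_right]
    by (simp add: exp_minus divide_inverse)
  then have "(flat n \<longlongrightarrow> 0) (at_right 0)"
    by (rule Lim_transform_eventually) (auto simp: flat_def eventually_at_right_field intro: exI[of _ 1])
  moreover have "(flat n \<longlongrightarrow> 0) (at_left 0)"
    by (rule Lim_transform_eventually[OF tendsto_const]) (auto simp: flat_def eventually_at_left_field intro: exI[of _ "-1"])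
  ultimately show ?thesis by (simp add: filterlim_at_split)
qed

text \<open>At \<open>0\<close> the difference quotient of \<open>flat n\<close> is \<open>flat (n + 1)\<close>, which tends to \<open>0\<close> because the
  exponential function dominates all powers.\<close>

lemma flat_has_derivative: "(flat n has_real_derivative flat (n + 2) t - of_nat n * flat (n + 1) t) (at t)"
proof -
  consider "t > 0" | "t < 0" | "t = 0" by linarith
  then show ?thesis
  proof cases
    case 1
    have ev: "\<forall>\<^sub>F s in nhds t. inverse s ^ n * exp (- inverse s) = flat n s"
      using eventually_nhds_in_open[of "{0<..}" t] 1 by (auto simp: flat_def elim!: eventually_mono)
    have "((\<lambda>s. inverse s ^ n * exp (- inverse s)) has_real_derivative
        of_nat n * inverse t ^ (n - 1) * (- (inverse t * inverse t)) * exp (- inverse t)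
        + inverse t ^ n * (exp (- inverse t) * (inverse t * inverse t))) (at t)"
      using 1 by (auto intro!: derivative_eq_intros)
    also have "of_nat n * inverse t ^ (n - 1) * (- (inverse t * inverse t)) * exp (- inverse t)
        + inverse t ^ n * (exp (- inverse t) * (inverse t * inverse t)) = flat (n + 2) t - of_nat n * flat (n + 1) t"
      using 1 by (cases n) (simp_all add: flat_def algebra_simps power2_eq_square)
    finally have "((\<lambda>s. inverse s ^ n * exp (- inverse s)) has_real_derivative flat (n + 2) t - of_nat n * flat (n + 1) t) (at t)" .
    then show ?thesis using DERIV_cong_ev[OF refl ev refl] by simp
  next
    case 2
    have ev: "\<forall>\<^sub>F s in nhds t. 0 = flat n s"
      using eventually_nhds_in_open[of "{..<0}" t] 2 by (auto simp: flat_def elim!: eventually_mono)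
    have "((\<lambda>s. 0) has_real_derivative flat (n + 2) t - of_nat n * flat (n + 1) t) (at t)"
      using 2 by (simp add: flat_def)
    then show ?thesis using DERIV_cong_ev[OF refl ev refl] by simp
  next
    case 3
    have "(flat n s - flat n 0) / (s - 0) = flat (Suc n) s" for s
      by (simp add: flat_def field_simps)
    then show ?thesis using flat_tendsto_0[of "Suc n"] 3
      by (simp add: has_field_derivative_iff flat_def[of _ 0] fun_eq_iff)
  qed
qed

lemma Ck_on_flat:
  assumes S: "cart_open m S" shows "Ck_on k m S f \<Longrightarrow> Ck_on k m S (\<lambda>x. flat n (f x))"
proof (induction k arbitrary: n)
  case 0
  have "continuous_on UNIV (flat n)" using flat_has_derivative DERIV_isCont continuous_at_imp_continuous_on by blast
  then have "continuous_on S (flat n \<circ> f)" using 0 continuous_on_compose[of S f "flat n"] continuous_on_subset by auto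
  then show ?case by (simp add: o_def)
next
  case (Suc k)
  have IH: "Ck_on k m S (\<lambda>x. flat n (f x))" for n by (rule Suc.IH[OF Ck_on_Suc_imp[OF Suc.prems]])
  show ?case
  proof (rule Ck_on_SucI[OF S Ck_on_continuous[OF IH]])
    fix i x assume ix: "i < m" "x \<in> S"
    have f: "((\<lambda>t. f (x(i := t))) has_real_derivative partial_deriv i f x) (at (x i))"
      using Suc.prems ix by (intro has_partial_deriv) auto
    have "(flat n has_real_derivative flat (n + 2) (f x) + (- of_nat n) * flat (n + 1) (f x)) (at (f (x(i := x i))))"
      using flat_has_derivative[of n "f x"] by simp
    from DERIV_chain2[OF this f]
    show "((\<lambda>t. flat n (f (x(i := t)))) has_real_derivative
      (flat (n + 2) (f x) + (- of_nat n) * flat (n + 1) (f x)) * partial_deriv i f x) (at (x i))" .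
  next
    fix i assume "i < m"
    then show "Ck_on k m S (\<lambda>x. (flat (n + 2) (f x) + (- of_nat n) * flat (n + 1) (f x)) * partial_deriv i f x)"
      using Suc.prems by (intro Ck_on_mult[OF S] Ck_on_add[OF S] IH Ck_on_const) auto
  qed
qed

lemma smooth_flat: "cart_open m S \<Longrightarrow> smooth_real_on m S f \<Longrightarrow> smooth_real_on m S (\<lambda>x. flat n (f x))"
  by (simp add: smooth_real_on_Ck Ck_on_flat)

text \<open>At least one of \<open>1 - t\<^sup>2\<close> and \<open>t\<^sup>2 - 1/4\<close> is positive, so that the denominator does not vanish.\<close>

definition bump :: "real \<Rightarrow> real" where
  "bump t = flat 0 (1 - t ^ 2) * inverse (flat 0 (1 - t ^ 2) + flat 0 (t ^ 2 - 1 / 4))"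

lemma flat_pos: "t > 0 \<Longrightarrow> flat n t > 0"
  by (simp add: flat_def)

lemma flat_nonneg: "flat n t \<ge> 0"
  by (simp add: flat_def)

lemma bump_denominator: "flat 0 (1 - t ^ 2) + flat 0 (t ^ 2 - 1 / 4) > 0"
proof (cases "1 - t ^ 2 > 0")
  case True
  then show ?thesis using flat_pos[of "1 - t^2" 0] flat_nonneg[of 0 "t^2 - 1/4"] by linarith
next
  case False
  then show ?thesis using flat_pos[of "t^2 - 1/4" 0] flat_nonneg[of 0 "1 - t^2"] by linarith
qed

lemma bump_eq_0: "\<bar>t\<bar> \<ge> 1 \<Longrightarrow> bump t = 0"
  using power_mono[of 1 "\<bar>t\<bar>" 2] by (simp add: bump_def flat_def)

lemma bump_eq_1: "\<bar>t\<bar> < 1 / 2 \<Longrightarrow> bump t = 1"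
proof -
  assume t: "\<bar>t\<bar> < 1 / 2"
  then have "t ^ 2 < 1 / 4" using power_strict_mono[of "\<bar>t\<bar>" "1/2" 2] by (simp add: power2_eq_square)
  then show ?thesis using bump_denominator[of t] by (simp add: bump_def flat_def[of _ "t^2 - 1/4"])
qed

lemma smooth_bump:
  assumes S: "cart_open m S" and f: "smooth_real_on m S f"
  shows "smooth_real_on m S (\<lambda>x. bump (f x))"
proof -
  have 1: "smooth_real_on m S (\<lambda>x. flat 0 (1 - f x ^ 2))" "smooth_real_on m S (\<lambda>x. flat 0 (f x ^ 2 - 1 / 4))"
    by (intro smooth_flat[OF S] smooth_real_on_diff[OF S] smooth_real_on_power[OF S] smooth_real_on_const[OF S] f)+
  have "flat 0 (1 - f x ^ 2) + flat 0 (f x ^ 2 - 1 / 4) \<noteq> 0" for x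
    using bump_denominator[of "f x"] by simp
  then show ?thesis unfolding bump_def
    by (intro smooth_real_on_mult[OF S] smooth_real_on_inverse[OF S] smooth_real_on_add[OF S] 1) auto
qed

subsection \<open>Series of smooth functions\<close>

text \<open>The bound on \<open>iterated_partial J (q r)\<close> holds only for \<open>r\<close> beyond the order of \<open>J\<close>. This leaves out
  finitely many terms, and the Weierstrass test still applies to each derivative separately.\<close>

lemma smooth_series:
  assumes q: "\<And>r. smooth_real_on m (cart m) (q r)"
    and bound: "\<And>J r x. set J \<subseteq> {..<m} \<Longrightarrow> length J < r \<Longrightarrow> x \<in> cart m \<Longrightarrow> \<bar>iterated_partial J (q r) x\<bar> \<le> (1 / 2) ^ r"
  shows "smooth_real_on m (cart m) (\<lambda>x. \<Sum>r. q r x)"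
    and "\<And>J x. set J \<subseteq> {..<m} \<Longrightarrow> x \<in> cart m \<Longrightarrow>
      iterated_partial J (\<lambda>x. \<Sum>r. q r x) x = (\<Sum>r. iterated_partial J (q r) x)"
proof -
  let ?g = "\<lambda>x. \<Sum>r. q r x"
  have oc: "cart_open m (cart m)" by simp
  have sum: "summable (\<lambda>r. (1 / 2 :: real) ^ r)" by (simp add: summable_geometric)
  have ul: "uniform_limit A (\<lambda>n y. \<Sum>r<n. iterated_partial J (q r) (c y)) (\<lambda>y. \<Sum>r. iterated_partial J (q r) (c y)) sequentially"
    if "set J \<subseteq> {..<m}" "\<And>y. y \<in> A \<Longrightarrow> c y \<in> cart m" for J and A :: "'a set" and c
  proof (rule Weierstrass_m_test_ev[OF _ sum])
    show "\<forall>\<^sub>F r in sequentially. \<forall>y\<in>A. norm (iterated_partial J (q r) (c y)) \<le> (1 / 2) ^ r"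
      using eventually_gt_at_top[of "length J"] by eventually_elim (use bound that in auto)
  qed
  have summ: "summable (\<lambda>r. iterated_partial J (q r) x)" if "set J \<subseteq> {..<m}" "x \<in> cart m" for J x
  proof (rule summable_comparison_test_ev[OF _ sum])
    show "\<forall>\<^sub>F r in sequentially. norm (iterated_partial J (q r) x) \<le> (1 / 2) ^ r"
      using eventually_gt_at_top[of "length J"] by eventually_elim (use bound that in auto)
  qed
  have der: "((\<lambda>t. \<Sum>r. iterated_partial J (q r) (x(i := t))) has_real_derivative
      (\<Sum>r. iterated_partial (i # J) (q r) x)) (at (x i))"
    if J: "set J \<subseteq> {..<m}" and i: "i < m" and x: "x \<in> cart m" for J i x
  proof -
    have xt: "x(i := t) \<in> cart m" for t by (rule cart_upd[OF x i])
    have iJ: "set (i # J) \<subseteq> {..<m}" using J i by simp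
    have "((\<lambda>t. \<Sum>r. iterated_partial J (q r) (x(i := t))) has_real_derivative
      (\<Sum>r. iterated_partial (i # J) (q r) (x(i := x i)))) (at (x i))"
    proof (rule has_field_derivative_series'(2)[where S = UNIV and f = "\<lambda>r t. iterated_partial J (q r) (x(i := t))"
          and f' = "\<lambda>r t. iterated_partial (i # J) (q r) (x(i := t))"])
      show "((\<lambda>t. iterated_partial J (q r) (x(i := t))) has_real_derivative iterated_partial (i # J) (q r) (x(i := t))) (at t within UNIV)" for r t
        using smooth_has_partial_deriv[OF smooth_real_on_iterated[OF q J] xt i, of r t] by (simp add: iterated_partial_Cons)
      show "uniformly_convergent_on UNIV (\<lambda>n t. \<Sum>r<n. iterated_partial (i # J) (q r) (x(i := t)))"
        using ul[OF iJ, of UNIV "\<lambda>t. x(i := t)"] xt unfolding uniformly_convergent_on_def by blast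
      show "summable (\<lambda>r. iterated_partial J (q r) (x(i := x i)))" by (rule summ[OF J xt])
    qed auto
    then show ?thesis by simp
  qed
  have eq: "iterated_partial J ?g x = (\<Sum>r. iterated_partial J (q r) x)" if "set J \<subseteq> {..<m}" "x \<in> cart m" for J x
    using that
  proof (induction J arbitrary: x)
    case (Cons i J)
    then have J: "set J \<subseteq> {..<m}" and i: "i < m" by auto
    have "iterated_partial (i # J) ?g x = partial_deriv i (\<lambda>x. \<Sum>r. iterated_partial J (q r) x) x"
      unfolding iterated_partial_Cons by (rule partial_deriv_cong[OF oc Cons.prems(2) i]) (rule Cons.IH[OF J])
    also have "\<dots> = (\<Sum>r. iterated_partial (i # J) (q r) x)"
      by (rule partial_deriv_eqI[OF der[OF J i Cons.prems(2)]])
    finally show ?case .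
  qed simp
  then show "\<And>J x. set J \<subseteq> {..<m} \<Longrightarrow> x \<in> cart m \<Longrightarrow> iterated_partial J ?g x = (\<Sum>r. iterated_partial J (q r) x)" .
  show "smooth_real_on m (cart m) ?g"
    unfolding smooth_real_on_def
  proof (intro allI impI conjI ballI)
    fix J assume J: "set J \<subseteq> {..<m}"
    have "continuous_on (cart m) (\<lambda>x. \<Sum>r. iterated_partial J (q r) x)"
    proof (rule uniform_limit_theorem[OF _ ul[OF J, of "cart m" "\<lambda>x. x"]])
      show "\<forall>\<^sub>F n in sequentially. continuous_on (cart m) (\<lambda>x. \<Sum>r<n. iterated_partial J (q r) x)"
        by (intro always_eventually allI continuous_on_sum smooth_real_on_continuous[OF order_refl] smooth_real_on_iterated[OF q J])
    qed auto
    then have "continuous_on (cart m) (iterated_partial J ?g)"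
      by (rule continuous_on_cong[THEN iffD1, OF refl, rotated]) (simp add: eq[OF J])
    then show "continuous_map (subtopology (Euclidean_space m) (cart m)) euclideanreal (iterated_partial J ?g)"
      using continuous_map_cart_iff[OF order_refl] by blast
    fix i x assume i: "i < m" and x: "x \<in> cart m"
    have "(\<lambda>t. iterated_partial J ?g (x(i := t))) = (\<lambda>t. \<Sum>r. iterated_partial J (q r) (x(i := t)))"
      by (rule ext) (rule eq[OF J cart_upd[OF x i]])
    then show "(\<lambda>t. iterated_partial J ?g (x(i := t))) field_differentiable at (x i)"
      using der[OF J i x] unfolding field_differentiable_def by auto
  qed
qed

lemma iterated_partial_affine:
  assumes f: "smooth_real_on m (cart m) f" and x0: "x0 \<in> cart m" and "set J \<subseteq> {..<m}" "x \<in> cart m"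
  shows "iterated_partial J (\<lambda>x. f (\<lambda>i. a * (x i - x0 i))) x = a ^ length J * iterated_partial J f (\<lambda>i. a * (x i - x0 i))"
  using assms(3,4)
proof (induction J arbitrary: x)
  case (Cons i J)
  then have J: "set J \<subseteq> {..<m}" and i: "i < m" by auto
  let ?A = "\<lambda>x i. a * (x i - x0 i)"
  have A: "?A x \<in> cart m" using Cons.prems(2) x0 by (simp add: cart_iff)
  have up: "?A (x(i := t)) = (?A x)(i := a * (t - x0 i))" for t by auto
  have oc: "cart_open m (cart m)" by simp
  have "iterated_partial (i # J) (\<lambda>x. f (?A x)) x = partial_deriv i (\<lambda>x. a ^ length J * iterated_partial J f (?A x)) x"
    unfolding iterated_partial_Cons by (rule partial_deriv_cong[OF oc Cons.prems(2) i]) (rule Cons.IH[OF J])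
  also have "\<dots> = a ^ length J * (partial_deriv i (iterated_partial J f) (?A x) * (a * (1 - 0)))"
  proof (rule partial_deriv_eqI, rule DERIV_cmult, unfold up)
    have 1: "((\<lambda>s. iterated_partial J f ((?A x)(i := s))) has_real_derivative partial_deriv i (iterated_partial J f) (?A x)) (at (a * (x i - x0 i)))"
      using smooth_has_partial_deriv[OF smooth_real_on_iterated[OF f J] A i] by simp
    have 2: "((\<lambda>t. a * (t - x0 i)) has_real_derivative a * (1 - 0)) (at (x i))"
      by (intro DERIV_cmult DERIV_diff DERIV_ident DERIV_const)
    show "((\<lambda>t. iterated_partial J f ((?A x)(i := a * (t - x0 i)))) has_real_derivative
      partial_deriv i (iterated_partial J f) (?A x) * (a * (1 - 0))) (at (x i))"
      by (rule DERIV_chain2[OF 1 2])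
  qed
  finally show ?case by (simp add: iterated_partial_Cons)
qed simp

text \<open>The function is supported in a cube, which is compact; outside, all derivatives vanish.\<close>

lemma bounded_derivative_compact_support:
  assumes f: "smooth_real_on m (cart m) f" and supp: "\<And>x i. i < m \<Longrightarrow> \<bar>x i\<bar> \<ge> 1 \<Longrightarrow> f x = 0" and J: "set J \<subseteq> {..<m}"
  shows "\<exists>B. \<forall>x\<in>cart m. \<bar>iterated_partial J f x\<bar> \<le> B"
proof -
  \<comment> \<open>The cube, a compact set by Tychonoff's theorem; coordinates from \<open>m\<close> on are \<open>0\<close>.\<close>
  let ?K = "\<Pi>\<^sub>E i\<in>UNIV. if i < m then {-1..1} else {0::real}"
  have "compactin (product_topology (\<lambda>i. euclidean) UNIV) ?K"
    unfolding compactin_PiE by auto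
  then have "compact ?K" by (simp add: euclidean_product_topology)
  moreover have KE: "?K \<subseteq> cart m"
  proof
    fix x assume "x \<in> ?K"
    then have "x i \<in> (if i < m then {-1..1} else {0})" for i by (rule PiE_mem) simp
    then show "x \<in> cart m" unfolding cart_iff by (metis leD singletonD)
  qed
  moreover have "continuous_on (cart m) (iterated_partial J f)"
    by (rule smooth_real_on_continuous[OF order_refl smooth_real_on_iterated[OF f J]])
  ultimately have "compact (iterated_partial J f ` ?K)" using compact_continuous_image continuous_on_subset by blast
  then obtain B where B: "\<And>x. x \<in> ?K \<Longrightarrow> \<bar>iterated_partial J f x\<bar> \<le> B"
    using compact_imp_bounded[of "iterated_partial J f ` ?K"] unfolding bounded_iff by auto
  have "\<bar>iterated_partial J f x\<bar> \<le> max B 0" if x: "x \<in> cart m" for x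
  proof (cases "x \<in> ?K")
    case True
    then show ?thesis using B[of x] by simp
  next
    case False
    then obtain i where i: "i < m" "\<bar>x i\<bar> > 1"
      using x by (fastforce simp: PiE_iff cart_iff split: if_splits)
    let ?S = "{y \<in> cart m. \<bar>y i\<bar> > 1}"
    have "open {y::nat \<Rightarrow> real. \<bar>y i\<bar> > 1}" by (intro open_Collect_less continuous_on_const continuous_on_rabs continuous_on_coord)
    then have S: "cart_open m ?S" unfolding cart_open_iff by (intro exI[of _ "{y. \<bar>y i\<bar> > 1}"]) auto
    have "iterated_partial J f x = iterated_partial J (\<lambda>x. 0) x"
      by (rule iterated_partial_cong[OF S J]) (use supp i x in force)+
    also have "iterated_partial J (\<lambda>x. 0) = (\<lambda>x. 0)"
      by (induction J) (auto simp: iterated_partial_Cons partial_deriv_def)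
    finally show ?thesis by simp
  qed
  then show ?thesis by blast
qed

text \<open>Borel's lemma. The part of order \<open>r\<close> of the formal Taylor series is cut off outside a cube
  whose size shrinks with \<open>r\<close>. Shrinking by a factor \<open>l \<ge> 1\<close> multiplies a derivative of order \<open>j < r\<close>
  of the homogeneous part by \<open>l\<^sup>j\<^sup>-\<^sup>r \<le> 1 / l\<close>; hence, if \<open>l\<close> is large, all these derivatives
  are below \<open>2\<^sup>-\<^sup>r\<close> and the series can be differentiated termwise.\<close>

theorem borel_lemma:
  assumes x0: "x0 \<in> cart m"
  shows "\<exists>g. smooth_real_on m (cart m) g \<and>
    (\<forall>J. set J \<subseteq> {..<m} \<and> sorted J \<longrightarrow> iterated_partial J g x0 = c J)"
proof -
  have oc: "cart_open m (cart m)" by simp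
  define A where "A r = {I. set I \<subseteq> {..<m} \<and> sorted I \<and> length I = r}" for r
  have fA: "finite (A r)" for r
    by (rule finite_subset[OF _ finite_lists_length_eq[of "{..<m}" r]]) (auto simp: A_def)
  define h where "h I x = taylor_monomial m (\<lambda>_. 0) (count_list I) x * (\<Prod>i<m. bump (x i))" for I x
  define H where "H r x = (\<Sum>I\<in>A r. c I * h I x)" for r x
  have hs: "smooth_real_on m (cart m) (h I)" for I
    unfolding h_def
    by (intro smooth_real_on_mult[OF oc] smooth_taylor_monomial[OF oc] smooth_real_on_prod[OF oc] smooth_bump[OF oc]
        smooth_real_on_coord[OF oc] smooth_real_on_const[OF oc])
  have Hs: "smooth_real_on m (cart m) (H r)" for r
    unfolding H_def by (intro smooth_real_on_sum[OF oc] smooth_real_on_cmult[OF oc] hs)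
  have supp: "H r x = 0" if "i < m" "\<bar>x i\<bar> \<ge> 1" for r x i
  proof -
    have "(\<Prod>i<m. bump (x i)) = 0" using that bump_eq_0 by (intro prod_zero) auto
    then show ?thesis unfolding H_def h_def by (simp only: mult_zero_right sum.neutral_const)
  qed
  have H0: "iterated_partial J (H r) (\<lambda>_. 0) = (if length J = r then c J else 0)"
    if J: "set J \<subseteq> {..<m}" "sorted J" for J r
  proof -
    let ?S = "{x \<in> cart m. \<forall>i\<in>{..<m}. \<bar>x i - 0\<bar> < 1 / 2}"
    have S: "cart_open m ?S" by (rule cart_open_cube)
    have 0: "(\<lambda>_. 0) \<in> ?S" by (simp add: cart_iff)
    have T: "smooth_real_on m ?S (taylor_monomial m (\<lambda>_. 0) (count_list I))" for I
      by (rule smooth_taylor_monomial[OF S smooth_real_on_coord[OF S] smooth_real_on_const[OF S]])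
    have "iterated_partial J (H r) (\<lambda>_. 0)
        = iterated_partial J (\<lambda>x. \<Sum>I\<in>A r. c I * taylor_monomial m (\<lambda>_. 0) (count_list I) x) (\<lambda>_. 0)"
    proof (rule iterated_partial_cong[OF S J(1) _ 0])
      fix y assume "y \<in> ?S"
      then have "(\<Prod>i<m. bump (y i)) = 1" by (intro prod.neutral) (auto intro: bump_eq_1)
      then show "H r y = (\<Sum>I\<in>A r. c I * taylor_monomial m (\<lambda>_. 0) (count_list I) y)" by (simp add: H_def h_def)
    qed
    also have "\<dots> = (\<Sum>I\<in>A r. c I * iterated_partial J (taylor_monomial m (\<lambda>_. 0) (count_list I)) (\<lambda>_. 0))"
      by (rule iterated_partial_linear[OF S fA T J(1) 0])
    also have "\<dots> = (\<Sum>I\<in>A r. c I * (if I = J then 1 else 0))"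
      by (intro sum.cong refl arg_cong2[of _ _ _ _ "(*)"] taylor_monomial_derivative) (use J in \<open>auto simp: A_def\<close>)
    also have "\<dots> = (if J \<in> A r then c J else 0)"
      using fA by (simp add: if_distrib[of "\<lambda>t. _ * t"] sum.delta cong: if_cong)
    finally show ?thesis using J by (simp add: A_def)
  qed
  define N where "N r = {J. set J \<subseteq> {..<m} \<and> length J \<le> r}" for r
  have fN: "finite (N r)" for r unfolding N_def by (rule finite_lists_length_le) simp
  have "\<exists>B. \<forall>J\<in>N r. \<forall>x\<in>cart m. \<bar>iterated_partial J (H r) x\<bar> \<le> B" for r
  proof -
    have "\<forall>J\<in>N r. \<exists>B. \<forall>x\<in>cart m. \<bar>iterated_partial J (H r) x\<bar> \<le> B"
      using bounded_derivative_compact_support[OF Hs supp] by (auto simp: N_def)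
    then obtain b where b: "\<forall>J\<in>N r. \<forall>x\<in>cart m. \<bar>iterated_partial J (H r) x\<bar> \<le> b J" by metis
    have "b J \<le> Max (b ` N r)" if "J \<in> N r" for J using that fN by simp
    then show ?thesis using b by (intro exI[of _ "Max (b ` N r)"]) force
  qed
  then obtain B where B: "\<And>r J x. J \<in> N r \<Longrightarrow> x \<in> cart m \<Longrightarrow> \<bar>iterated_partial J (H r) x\<bar> \<le> B r" by metis
  \<comment> \<open>The factor \<open>2 ^ r\<close> turns the bound \<open>B r / l r\<close> into \<open>2\<^sup>-\<^sup>r\<close>.\<close>
  define l where "l r = max 1 (2 ^ r * B r)" for r
  have l1: "l r \<ge> 1" and lB: "2 ^ r * B r \<le> l r" for r by (simp_all add: l_def)
  \<comment> \<open>The sum over a singleton brings \<open>q r\<close> into the form required by \<open>iterated_partial_linear\<close>.\<close>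
  define q where "q r x = (\<Sum>k\<in>{()}. inverse (l r ^ r) * H r (\<lambda>i. l r * (x i - x0 i)))" for r x
  have aff: "(\<lambda>i. l r * (x i - x0 i)) \<in> cart m" if "x \<in> cart m" for r x using that x0 by (simp add: cart_iff)
  have Has: "smooth_real_on m (cart m) (\<lambda>x. H r (\<lambda>i. l r * (x i - x0 i)))" for r
    by (rule smooth_real_on_compose[OF oc oc aff Hs])
      (rule smooth_real_on_cmult[OF oc] smooth_real_on_diff[OF oc] smooth_real_on_coord[OF oc] smooth_real_on_const[OF oc] | assumption)+
  have qs: "smooth_real_on m (cart m) (q r)" for r
    unfolding q_def by (intro smooth_real_on_sum[OF oc] smooth_real_on_cmult[OF oc] Has)
  have qd: "iterated_partial J (q r) x = inverse (l r ^ r) * (l r ^ length J * iterated_partial J (H r) (\<lambda>i. l r * (x i - x0 i)))"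
    if J: "set J \<subseteq> {..<m}" and x: "x \<in> cart m" for J r x
  proof -
    have "iterated_partial J (q r) x = (\<Sum>k\<in>{()}. inverse (l r ^ r) * iterated_partial J (\<lambda>x. H r (\<lambda>i. l r * (x i - x0 i))) x)"
      unfolding q_def by (rule iterated_partial_linear[OF oc _ Has J x]) simp
    then show ?thesis using iterated_partial_affine[OF Hs x0 J x] by simp
  qed
  have bound: "\<bar>iterated_partial J (q r) x\<bar> \<le> (1 / 2) ^ r"
    if J: "set J \<subseteq> {..<m}" "length J < r" and x: "x \<in> cart m" for J r x
  proof -
    let ?d = "\<bar>iterated_partial J (H r) (\<lambda>i. l r * (x i - x0 i))\<bar>"
    have d: "?d \<le> B r" by (rule B[OF _ aff[OF x]]) (use J in \<open>simp add: N_def\<close>)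
    have "l r ^ length J * l r \<le> l r ^ r"
      using power_increasing[of "Suc (length J)" r "l r"] J(2) l1[of r] by (simp add: mult.commute)
    have "\<bar>iterated_partial J (q r) x\<bar> = l r ^ length J / l r ^ r * ?d"
      unfolding qd[OF J(1) x] using l1[of r] by (simp add: abs_mult divide_inverse mult_ac)
    also have "\<dots> \<le> (1 / l r) * B r"
    proof (rule mult_mono)
      show "l r ^ length J / l r ^ r \<le> 1 / l r"
        using \<open>l r ^ length J * l r \<le> l r ^ r\<close> l1[of r] by (simp add: field_simps)
    qed (use d l1[of r] in auto)
    also have "\<dots> \<le> (1 / 2) ^ r"
      using lB[of r] l1[of r] by (simp add: field_simps power_divide)
    finally show ?thesis .
  qed
  note ser = smooth_series[OF qs bound]
  show ?thesis
  proof (intro exI[of _ "\<lambda>x. \<Sum>r. q r x"] conjI allI impI)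
    show "smooth_real_on m (cart m) (\<lambda>x. \<Sum>r. q r x)" by (rule ser(1))
    fix J assume J: "set J \<subseteq> {..<m} \<and> sorted J"
    have q0: "iterated_partial J (q r) x0 = (if r = length J then c J else 0)" for r
    proof -
      have "(\<lambda>i. l r * (x0 i - x0 i)) = (\<lambda>_. 0)" by simp
      then have "iterated_partial J (q r) x0 = inverse (l r ^ r) * (l r ^ length J * (if length J = r then c J else 0))"
        using qd[of J x0 r] J x0 H0[of J r] by simp
      then show ?thesis using l1[of r] by auto
    qed
    have "iterated_partial J (\<lambda>x. \<Sum>r. q r x) x0 = (\<Sum>r. if r = length J then c J else 0)"
      using ser(2)[of J x0] J x0 q0 by simp
    also have "\<dots> = c J" using sums_single[of "length J" "\<lambda>_. c J"] by (simp add: sums_iff)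
    finally show "iterated_partial J (\<lambda>x. \<Sum>r. q r x) x0 = c J" .
  qed
qed

section \<open>Jets of local sections\<close>

subsection \<open>The list of jet coordinates\<close>

lemma set_multi_indices: "set (multi_indices m r) = {I. set I \<subseteq> {..<m} \<and> sorted I \<and> length I = r}"
  by (auto simp: multi_indices_def set_n_lists)

lemma set_jet_coord_list:
  "set (jet_coord_list m n k) = {(I, a). set I \<subseteq> {..<m} \<and> sorted I \<and> length I \<le> k \<and> a < n}"
  by (auto simp: jet_coord_list_def set_multi_indices less_Suc_eq_le image_iff simp del: upt_Suc)

lemma jet_coord_list_Suc:
  "jet_coord_list m n (Suc k) = jet_coord_list m n k @ [(I, a). I \<leftarrow> multi_indices m (Suc k), a \<leftarrow> [0..<n]]"
  by (simp add: jet_coord_list_def)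

text \<open>The enumeration by increasing order makes the coordinates of a jet of lower order an initial segment
  of those of a jet of higher order, so that projections become truncations.\<close>

lemma jet_coord_list_prefix: "k \<le> l \<Longrightarrow> \<exists>ys. jet_coord_list m n l = jet_coord_list m n k @ ys"
proof (induction l)
  case (Suc l)
  then show ?case by (cases "k = Suc l") (auto simp: jet_coord_list_Suc le_Suc_eq)
qed auto

lemma jet_coord_list_0: "jet_coord_list m n 0 = map (Pair []) [0..<n]"
proof -
  have "multi_indices m 0 = [[]]" by (simp add: multi_indices_def)
  then show ?thesis by (simp add: jet_coord_list_def)
qed

lemma jet_coord_list_low: "a < n \<Longrightarrow> a < length (jet_coord_list m n k) \<and> jet_coord_list m n k ! a = ([], a)"
  using jet_coord_list_prefix[of 0 k m n] by (auto simp: jet_coord_list_0 nth_append)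

lemma distinct_pairs: "distinct xs \<Longrightarrow> distinct [(I, a). I \<leftarrow> xs, a \<leftarrow> [0..<n]]"
  by (induction xs) (auto simp: distinct_map inj_on_def)

text \<open>Each coordinate occurs once. This makes the coordinates of a jet independent of each other.\<close>

lemma distinct_jet_coord_list: "distinct (jet_coord_list m n k)"
proof (induction k)
  case 0
  then show ?case by (simp add: jet_coord_list_0 distinct_map inj_on_def)
next
  case (Suc k)
  have "distinct (multi_indices m (Suc k))" 
    unfolding multi_indices_def by (intro distinct_filter distinct_n_lists distinct_upt)
  moreover have "set (jet_coord_list m n k) \<inter> set [(I, a). I \<leftarrow> multi_indices m (Suc k), a \<leftarrow> [0..<n]] = {}"
    by (auto simp: set_jet_coord_list set_multi_indices)
  ultimately show ?case unfolding jet_coord_list_Suc using Suc distinct_pairs[of "multi_indices m (Suc k)" n]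
    by (simp only: distinct_append)
qed

lemma jet_coord_list_nth:
  assumes "j < length (jet_coord_list m n k)" "jet_coord_list m n k ! j = (I, a)"
  shows "set I \<subseteq> {..<m}" "sorted I" "length I \<le> k" "a < n"
proof -
  have "(I, a) \<in> set (jet_coord_list m n k)" using nth_mem[OF assms(1)] assms(2) by simp
  then show "set I \<subseteq> {..<m}" "sorted I" "length I \<le> k" "a < n" unfolding set_jet_coord_list by auto
qed

subsection \<open>Local sections in fibered charts\<close>

text \<open>The properties of a smooth fiber bundle on which the theory of jets depends. The typical fiber enters
  through fibered charts only. With \<open>dim_le\<close> the fiber dimension, a difference of natural numbers,
  has its intended value.\<close>

locale jet_bundle =
  fixes E :: "'e manifold" and X :: "'x manifold" and \<pi> :: "'e \<Rightarrow> 'x"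
  assumes E: "smooth_manifold E" and X: "smooth_manifold X" and proj: "smooth_map E X \<pi>"
    and dim_le: "points E \<noteq> {} \<Longrightarrow> mdim X \<le> mdim E"
    and fibered_chart: "\<And>e. e \<in> points E \<Longrightarrow> \<exists>U u V v. (U, u, V, v) \<in> fibered_charts E X \<pi> \<and> e \<in> V"
    and proj_surj: "\<pi> ` points E = points X"
begin

abbreviation "bdim \<equiv> mdim X"
abbreviation "fdim \<equiv> fiber_dim E X"
abbreviation "sec \<equiv> sections_around E X \<pi>"
abbreviation "fcharts \<equiv> fibered_charts E X \<pi>"
abbreviation "scoord \<equiv> section_coord bdim"

lemma scoord_simp: "scoord (U, u, V, v) s a x = v (snd s (inv_into U u x)) (bdim + a)"
  by (cases s) (simp add: section_coord_def)

lemma fchart: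
  assumes "(U, u, V, v) \<in> fcharts"
  shows "(U, u) \<in> charts X" "(V, v) \<in> charts E" "e \<in> V \<Longrightarrow> \<pi> e \<in> U" "e \<in> V \<Longrightarrow> trunc bdim (v e) = u (\<pi> e)"
    "e \<in> V \<Longrightarrow> mdim E = bdim + fdim"
proof -
  show c: "(U, u) \<in> charts X" and d: "(V, v) \<in> charts E" using assms by (auto simp: fibered_charts_def)
  show U: "\<pi> e \<in> U" if "e \<in> V" using assms that by (auto simp: fibered_charts_def)
  show "trunc bdim (v e) = u (\<pi> e)" if "e \<in> V"
    using assms that chart_inv(4)[OF c U[OF that]] by (auto simp: fibered_charts_def trunc_def cart_iff fun_eq_iff)
  show "mdim E = bdim + fdim" if "e \<in> V"
  proof -
    have "points E \<noteq> {}" using that chart_subset[OF d] by blast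
    from dim_le[OF this] show ?thesis by (simp add: fiber_dim_def)
  qed
qed

lemma sec:
  assumes "s \<in> sec p"
  shows "openin (mtop X) (fst s)" "p \<in> fst s" "snd s \<in> extensional (fst s)"
    "smooth_map (open_submanifold X (fst s)) E (snd s)" "q \<in> fst s \<Longrightarrow> \<pi> (snd s q) = q" "p \<in> points X"
proof -
  show *: "openin (mtop X) (fst s)" "p \<in> fst s" "snd s \<in> extensional (fst s)"
    "smooth_map (open_submanifold X (fst s)) E (snd s)" "q \<in> fst s \<Longrightarrow> \<pi> (snd s q) = q"
    using assms by (auto simp: sections_around_def)
  show "p \<in> points X" using openin_subset[OF *(1)] *(2) by blast
qed

lemma sec_proj: "s \<in> sec p \<Longrightarrow> \<pi> (snd s p) = p"
  using sec(2,5) by blast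

lemma sec_points:
  assumes "s \<in> sec p" shows "snd s p \<in> points E"
proof -
  have "continuous_map (subtopology (mtop X) (fst s)) (mtop E) (snd s)"
    using sec(4)[OF assms] by (simp add: smooth_map_def)
  moreover have "p \<in> topspace (subtopology (mtop X) (fst s))" using sec(2,6)[OF assms] by simp
  ultimately show ?thesis unfolding continuous_map_def by blast
qed

text \<open>On this set of base points the section \<open>s\<close> can be read in the fibered chart. The additional
  condition given by \<open>A\<close> serves to stay inside the domain of a second chart as well.\<close>

definition sdom :: "'x set \<times> ('x \<Rightarrow> nat \<Rightarrow> real) \<times> 'e set \<times> ('e \<Rightarrow> nat \<Rightarrow> real) \<Rightarrow> 'e set \<Rightarrow> ('x, 'e) lsection \<Rightarrow> 'x set" where
  "sdom = (\<lambda>(U, u, V, v) A s. {q \<in> U. q \<in> fst s \<and> snd s q \<in> V \<inter> A})"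

lemma sdom_simp: "sdom (U, u, V, v) A s = {q \<in> U. q \<in> fst s \<and> snd s q \<in> V \<inter> A}"
  by (simp add: sdom_def)

lemma sdom_open:
  assumes c: "(U, u, V, v) \<in> fcharts" and s: "s \<in> sec p" and A: "openin (mtop E) A"
  shows "openin (mtop X) (sdom (U, u, V, v) A s)"
proof -
  have "continuous_map (subtopology (mtop X) (fst s)) (mtop E) (snd s)"
    using sec(4)[OF s] by (simp add: smooth_map_def)
  moreover have "openin (mtop E) (V \<inter> A)" using chart_openin[OF fchart(2)[OF c]] A by blast
  ultimately have "openin (subtopology (mtop X) (fst s)) {q \<in> topspace (subtopology (mtop X) (fst s)). snd s q \<in> V \<inter> A}"
    by (rule openin_continuous_map_preimage)
  then have "openin (mtop X) {q \<in> topspace (subtopology (mtop X) (fst s)). snd s q \<in> V \<inter> A}"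
    using openin_trans_full[OF _ sec(1)[OF s]] by blast
  then have "openin (mtop X) (U \<inter> {q \<in> topspace (subtopology (mtop X) (fst s)). snd s q \<in> V \<inter> A})"
    using chart_openin[OF fchart(1)[OF c]] by blast
  moreover have "U \<inter> {q \<in> topspace (subtopology (mtop X) (fst s)). snd s q \<in> V \<inter> A} = sdom (U, u, V, v) A s"
    using chart_subset[OF fchart(1)[OF c]] by (auto simp: sdom_simp)
  ultimately show ?thesis by simp
qed

lemma sdom_image_open:
  assumes c: "(U, u, V, v) \<in> fcharts" and s: "s \<in> sec p" and A: "openin (mtop E) A"
  shows "cart_open bdim (u ` sdom (U, u, V, v) A s)"
proof -
  have "U \<inter> sdom (U, u, V, v) A s = sdom (U, u, V, v) A s" by (auto simp: sdom_simp)
  then show ?thesis using chart_open_image[OF fchart(1)[OF c] sdom_open[OF assms]] by simp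
qed

lemma sdom_mem:
  assumes c: "(U, u, V, v) \<in> fcharts" and s: "s \<in> sec p" and "snd s p \<in> V \<inter> A"
  shows "p \<in> sdom (U, u, V, v) A s"
  using assms fchart(3)[OF c, of "snd s p"] sec_proj[OF s] sec(2)[OF s] by (simp add: sdom_simp)

text \<open>In a fibered chart the first coordinates of a section are those of the base point. So the section is
  the graph of its fiber coordinates.\<close>

lemma section_in_chart:
  assumes c: "(U, u, V, v) \<in> fcharts" and s: "s \<in> sec p" and q: "q \<in> sdom (U, u, V, v) A s"
  shows "v (snd s q) = glue bdim (u q) (\<lambda>a. if a < fdim then scoord (U, u, V, v) s a (u q) else 0)"
proof -
  have q': "q \<in> U" "q \<in> fst s" "snd s q \<in> V" using q by (auto simp: sdom_simp)
  have "trunc bdim (v (snd s q)) = u q" using fchart(4)[OF c q'(3)] sec(5)[OF s q'(2)] by simp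
  moreover have "shift bdim (v (snd s q)) = (\<lambda>a. if a < fdim then scoord (U, u, V, v) s a (u q) else 0)"
  proof
    fix a
    have "v (snd s q) \<in> cart (bdim + fdim)" using chart_inv(4)[OF fchart(2)[OF c] q'(3)] fchart(5)[OF c q'(3)] by simp
    then show "shift bdim (v (snd s q)) a = (if a < fdim then scoord (U, u, V, v) s a (u q) else 0)"
      using chart_inv(1)[OF fchart(1)[OF c] q'(1)] by (auto simp: shift_def scoord_simp cart_iff add.commute)
  qed
  ultimately show ?thesis by (metis glue_trunc_shift)
qed

lemma smooth_scoord:
  assumes c: "(U, u, V, v) \<in> fcharts" and s: "s \<in> sec p" and A: "openin (mtop E) A" and a: "a < fdim"
  shows "smooth_real_on bdim (u ` sdom (U, u, V, v) A s) (scoord (U, u, V, v) s a)"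
proof (cases "sdom (U, u, V, v) A s = {}")
  case True
  then show ?thesis using smooth_real_on_iff_Ck[of "{}" bdim]
    by (simp add: smooth_real_on_def continuous_map_cart_iff)
next
  case False
  let ?W = "fst s"
  have cX: "(U, u) \<in> charts X" and cE: "(V, v) \<in> charts E" by (rule fchart[OF c])+
  have W: "openin (mtop X) ?W" by (rule sec[OF s])
  have c': "(U \<inter> ?W, u) \<in> charts X" by (rule chart_restrict[OF cX W X])
  then have c'': "(U \<inter> ?W, u) \<in> charts (open_submanifold X ?W)" using charts_open_submanifold[OF X W] by blast
  obtain e where "e \<in> V" using False by (auto simp: sdom_simp)
  then have "bdim + a < mdim E" using fchart(5)[OF c] a by simp
  then have "smooth_real_on (mdim (open_submanifold X ?W)) (u ` ((U \<inter> ?W) \<inter> snd s -` V)) (\<lambda>x. v (snd s (inv_into (U \<inter> ?W) u x)) (bdim + a))"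
    using sec(4)[OF s] c'' cE unfolding smooth_map_def by blast
  then have sm: "smooth_real_on bdim (u ` ((U \<inter> ?W) \<inter> snd s -` V)) (\<lambda>x. v (snd s (inv_into (U \<inter> ?W) u x)) (bdim + a))"
    by simp
  have sub: "u ` ((U \<inter> ?W) \<inter> snd s -` V) \<subseteq> cart bdim" using chart_inv(4)[OF cX] by auto
  have "smooth_real_on bdim (u ` sdom (U, u, V, v) A s) (\<lambda>x. v (snd s (inv_into (U \<inter> ?W) u x)) (bdim + a))"
    by (rule smooth_real_on_subset[OF sub sm]) (auto simp: sdom_simp)
  then show ?thesis
  proof (rule smooth_real_on_cong[OF sdom_image_open[OF c s A], rotated])
    fix x assume "x \<in> u ` sdom (U, u, V, v) A s"
    then obtain q where "q \<in> U" "q \<in> ?W" "x = u q" by (auto simp: sdom_simp)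
    then show "v (snd s (inv_into (U \<inter> ?W) u x)) (bdim + a) = scoord (U, u, V, v) s a x"
      using chart_inv(1)[OF cX] chart_inv(1)[OF c'] by (simp add: scoord_simp)
  qed
qed

text \<open>In another fibered chart, the coordinates of a section are obtained by composing with the two
  coordinate changes.\<close>

lemma scoord_change:
  assumes c: "(U, u, V, v) \<in> fcharts" and d: "(U', u', V', v') \<in> fcharts" and s: "s \<in> sec p"
    and q: "q \<in> U'" "q \<in> sdom (U, u, V, v) A s"
  shows "scoord (U', u', V', v') s a (u' q) =
    v' (inv_into V v (glue bdim (u (inv_into U' u' (u' q)))
      (\<lambda>b. if b < fdim then scoord (U, u, V, v) s b (u (inv_into U' u' (u' q))) else 0))) (bdim + a)"
proof -
  have inv: "inv_into U' u' (u' q) = q" by (rule chart_inv(1)[OF fchart(1)[OF d] q(1)])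
  have "snd s q \<in> V" using q(2) by (simp add: sdom_simp)
  then have "inv_into V v (v (snd s q)) = snd s q" by (rule chart_inv(1)[OF fchart(2)[OF c]])
  then show ?thesis unfolding inv section_in_chart[OF c s q(2), symmetric] by (simp add: scoord_simp inv)
qed

text \<open>In the second chart both sections are given by the same formula \<open>scoord_change\<close>, in which the
  coordinate changes do not depend on the section; composition preserves agreement to order \<open>k\<close>.\<close>

lemma agree_change_chart:
  assumes c: "(U, u, V, v) \<in> fcharts" and d: "(U', u', V', v') \<in> fcharts" and s: "s \<in> sec p" and t: "t \<in> sec p"
    and st: "snd s p = snd t p" and e: "snd s p \<in> V" "snd s p \<in> V'"
    and ag: "\<And>a. a < fdim \<Longrightarrow> agree k bdim (u p) (scoord (U, u, V, v) s a) (scoord (U, u, V, v) t a)" and a: "a < fdim"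
  shows "agree k bdim (u' p) (scoord (U', u', V', v') s a) (scoord (U', u', V', v') t a)"
proof -
  have cX: "(U, u) \<in> charts X" and cE: "(V, v) \<in> charts E" by (rule fchart[OF c])+
  have dX: "(U', u') \<in> charts X" and dE: "(V', v') \<in> charts E" by (rule fchart[OF d])+
  have dim: "mdim E = bdim + fdim" by (rule fchart(5)[OF c e(1)])
  note oV' = chart_openin[OF dE]
  define R where "R = sdom (U, u, V, v) V' s \<inter> sdom (U, u, V, v) V' t"
  have oR: "openin (mtop X) R" unfolding R_def using sdom_open[OF c s oV'] sdom_open[OF c t oV'] by blast
  have RU: "R \<subseteq> U" by (auto simp: R_def sdom_simp)
  have pR: "p \<in> R" unfolding R_def using sdom_mem[OF c s, of V'] sdom_mem[OF c t, of V'] st e by simp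
  have pU': "p \<in> U'" using fchart(3)[OF d e(2)] sec_proj[OF s] by simp
  define S where "S = u' ` (U' \<inter> R)"
  have S: "cart_open bdim S" unfolding S_def by (rule chart_open_image[OF dX oR])
  have pS: "u' p \<in> S" unfolding S_def using pR pU' by blast
  define T where "T = u ` R"
  have T: "cart_open bdim T" unfolding T_def using chart_open_image[OF cX oR] RU by (simp add: inf.absorb2)
  define \<theta> where "\<theta> = (\<lambda>x. u (inv_into U' u' x))"
  have \<theta>p: "\<theta> (u' p) = u p" unfolding \<theta>_def by (simp add: chart_inv(1)[OF dX pU'])
  have \<theta>T: "\<theta> x \<in> T" if "x \<in> S" for x
    using that chart_inv(1)[OF dX] by (auto simp: S_def T_def \<theta>_def)
  have \<theta>s: "smooth_real_on bdim S (\<lambda>x. \<theta> x i)" if "i < bdim" for i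
    unfolding \<theta>_def
    by (rule smooth_real_on_subset[OF _ transition_smooth[OF X dX cX that]])
      (use cart_open_subset[OF chart_open_image[OF dX chart_openin[OF cX]]] RU in \<open>auto simp: S_def\<close>)
  let ?sc = "scoord (U, u, V, v)"
  define \<Phi> where "\<Phi> = (\<lambda>s x. glue bdim (\<theta> x) (\<lambda>b. if b < fdim then ?sc s b (\<theta> x) else 0))"
  have scs: "smooth_real_on bdim T (?sc r b)" if "r = s \<or> r = t" "b < fdim" for r b
  proof -
    have r: "r \<in> sec p" using that s t by blast
    have sub: "u ` sdom (U, u, V, v) V' r \<subseteq> cart bdim" by (rule cart_open_subset[OF sdom_image_open[OF c r oV']])
    show ?thesis
      by (rule smooth_real_on_subset[OF sub smooth_scoord[OF c r oV' that(2)]])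
        (use that in \<open>auto simp: T_def R_def\<close>)
  qed
  have \<Phi>s: "smooth_real_on bdim S (\<lambda>x. \<Phi> r x i)" if "r = s \<or> r = t" "i < bdim + fdim" for r i
    unfolding \<Phi>_def
  proof (rule smooth_glue[OF \<theta>s _ that(2)])
    show "smooth_real_on bdim S (\<lambda>x. if b < fdim then ?sc r b (\<theta> x) else 0)" if b: "b < fdim" for b
      using smooth_real_on_compose[OF S T \<theta>T scs[OF \<open>r = s \<or> r = t\<close> b] \<theta>s] b by simp
  qed
  have \<Phi>v: "\<Phi> r (u' q) = v (snd r q)" if "r = s \<or> r = t" "q \<in> U'" "q \<in> R" for r q
  proof -
    have r: "r \<in> sec p" using that s t by blast
    have "q \<in> sdom (U, u, V, v) V' r" using that by (auto simp: R_def)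
    from section_in_chart[OF c r this] show ?thesis
      unfolding \<Phi>_def \<theta>_def chart_inv(1)[OF dX that(2)] by simp
  qed
  have \<Phi>V: "\<Phi> r x \<in> v ` (V \<inter> V')" if rt: "r = s \<or> r = t" and x: "x \<in> S" for r x
  proof -
    obtain q where q: "q \<in> U'" "q \<in> R" "x = u' q" using x unfolding S_def by blast
    moreover have "snd r q \<in> V \<inter> V'" using rt q(2) by (auto simp: R_def sdom_simp)
    ultimately show ?thesis using \<Phi>v[OF rt q(1,2)] by blast
  qed
  have H: "smooth_real_on (bdim + fdim) (v ` (V \<inter> V')) (\<lambda>y. v' (inv_into V v y) (bdim + a))"
    using transition_smooth[OF E cE dE, of "bdim + a"] a dim by simp
  have oVV: "cart_open (bdim + fdim) (v ` (V \<inter> V'))" using chart_open_image[OF cE oV'] dim by simp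
  have ag\<Phi>: "agree k bdim (u' p) (\<lambda>x. \<Phi> s x i) (\<lambda>x. \<Phi> t x i)" if i: "i < bdim + fdim" for i
  proof (cases "i < bdim")
    case True
    then show ?thesis by (simp add: \<Phi>_def glue_def)
  next
    case False
    then have b: "i - bdim < fdim" using i by simp
    have "agree k bdim (u' p) (\<lambda>x. ?sc s (i - bdim) (\<theta> x)) (\<lambda>x. ?sc t (i - bdim) (\<theta> x))"
    proof (rule agree_compose[OF S pS T \<theta>T \<theta>s \<theta>T \<theta>s refl])
      show "agree k bdim (\<theta> (u' p)) (?sc s (i - bdim)) (?sc t (i - bdim))" unfolding \<theta>p by (rule ag[OF b])
    qed (use scs b in auto)
    then show ?thesis using False b by (simp add: \<Phi>_def glue_def)
  qed
  have "\<Phi> s (u' p) = \<Phi> t (u' p)" using \<Phi>v pU' pR st by simp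
  from agree_compose[OF S pS oVV \<Phi>V \<Phi>s \<Phi>V \<Phi>s this H H agree_refl ag\<Phi>]
  have "agree k bdim (u' p) (\<lambda>x. v' (inv_into V v (\<Phi> s x)) (bdim + a)) (\<lambda>x. v' (inv_into V v (\<Phi> t x)) (bdim + a))"
    by blast
  moreover have "scoord (U', u', V', v') r a x = v' (inv_into V v (\<Phi> r x)) (bdim + a)" if rt: "r = s \<or> r = t" and x: "x \<in> S" for r x
  proof -
    have r: "r \<in> sec p" using rt s t by blast
    obtain q where q: "q \<in> U'" "q \<in> R" "x = u' q" using x unfolding S_def by blast
    have "q \<in> sdom (U, u, V, v) V' r" using q(2) rt by (auto simp: R_def)
    from scoord_change[OF c d r q(1) this] show ?thesis unfolding \<Phi>_def \<theta>_def q(3) .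
  qed
  ultimately show ?thesis using agree_cong[OF S pS, of "scoord (U', u', V', v') s a" _ "scoord (U', u', V', v') t a"]
    by (metis (no_types, lifting))
qed

subsection \<open>Jets are determined by their coordinates in one chart\<close>

text \<open>The definition of equivalence quantifies over all fibered charts. One chart suffices, because
  agreement to order \<open>k\<close> is invariant under changes of charts.\<close>

lemma jet_equivalent_iff:
  assumes c: "(U, u, V, v) \<in> fcharts" and s: "s \<in> sec p" and t: "t \<in> sec p" and e: "snd s p \<in> V"
  shows "jet_equivalent E X \<pi> (enat k) p s t \<longleftrightarrow> snd s p = snd t p \<and>
    (\<forall>a<fdim. agree k bdim (u p) (scoord (U, u, V, v) s a) (scoord (U, u, V, v) t a))" (is "?L \<longleftrightarrow> ?R")
proof
  assume ?L
  then have "\<forall>I a. set I \<subseteq> {..<bdim} \<and> enat (length I) \<le> enat k \<and> a < fdim \<longrightarrow>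
      iterated_partial I (scoord (U, u, V, v) s a) (u p) = iterated_partial I (scoord (U, u, V, v) t a) (u p)"
    and "snd s p = snd t p"
    using c e unfolding jet_equivalent_def by blast+
  then show ?R unfolding agree_iff_iterated by simp
next
  assume R: ?R
  have "iterated_partial I (scoord (U', u', V', v') s a) (u' p) = iterated_partial I (scoord (U', u', V', v') t a) (u' p)"
    if d: "(U', u', V', v') \<in> fcharts" and e': "snd s p \<in> V'" and "set I \<subseteq> {..<bdim}" "length I \<le> k" "a < fdim"
    for U' u' V' v' I a
    using agree_change_chart[OF c d s t _ e e' _ that(5), of k] R that(3,4) unfolding agree_iff_iterated by blast
  then show ?L using R unfolding jet_equivalent_def by auto
qed

lemma jet_equivalent_infinity: "jet_equivalent E X \<pi> \<infinity> p s t \<longleftrightarrow> (\<forall>k. jet_equivalent E X \<pi> (enat k) p s t)"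
  unfolding jet_equivalent_def by (auto split: prod.splits) blast

lemma jet_equivalent_refl: "jet_equivalent E X \<pi> k p s s"
  by (auto simp: jet_equivalent_def)

lemma jet_equivalent_sym: "jet_equivalent E X \<pi> k p s t \<Longrightarrow> jet_equivalent E X \<pi> k p t s"
  unfolding jet_equivalent_def by (auto split: prod.splits)

lemma jet_equivalent_trans:
  "jet_equivalent E X \<pi> k p s t \<Longrightarrow> jet_equivalent E X \<pi> k p t r \<Longrightarrow> jet_equivalent E X \<pi> k p s r"
  unfolding jet_equivalent_def by (auto split: prod.splits)

lemma jet_equivalent_mono: "jet_equivalent E X \<pi> k p s t \<Longrightarrow> l \<le> k \<Longrightarrow> jet_equivalent E X \<pi> l p s t"
  unfolding jet_equivalent_def by (auto split: prod.splits)

lemma jet_class_eq_iff: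
  assumes "s \<in> sec p" "t \<in> sec q"
  shows "jet_class E X \<pi> k p s = jet_class E X \<pi> k q t \<longleftrightarrow> p = q \<and> jet_equivalent E X \<pi> k p s t"
proof
  assume *: "jet_class E X \<pi> k p s = jet_class E X \<pi> k q t"
  then have pq: "p = q" by (simp add: jet_class_def)
  have "t \<in> snd (jet_class E X \<pi> k q t)" using assms jet_equivalent_refl by (simp add: jet_class_def)
  then show "p = q \<and> jet_equivalent E X \<pi> k p s t" using pq unfolding *[symmetric] by (simp add: jet_class_def)
next
  assume *: "p = q \<and> jet_equivalent E X \<pi> k p s t"
  then have "jet_equivalent E X \<pi> k p s r \<longleftrightarrow> jet_equivalent E X \<pi> k p t r" for r
    using jet_equivalent_sym jet_equivalent_trans by blast
  then show "jet_class E X \<pi> k p s = jet_class E X \<pi> k q t" using * by (simp add: jet_class_def)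
qed

lemma jet_at_eq_iff:
  assumes s: "s \<in> sec p" and t: "t \<in> sec q"
  shows "jet_at E X \<pi> (int k) p s = jet_at E X \<pi> (int k) q t \<longleftrightarrow> p = q \<and> jet_equivalent E X \<pi> (enat k) p s t"
proof (cases "k = 0")
  case True
  have "jet_equivalent E X \<pi> (enat 0) p s t \<longleftrightarrow> snd s p = snd t p" if "p = q"
  proof -
    obtain U u V v where c: "(U, u, V, v) \<in> fcharts" "snd s p \<in> V" using fibered_chart[OF sec_points[OF s]] by blast
    have "t \<in> sec p" using t that by simp
    from jet_equivalent_iff[OF c(1) s this c(2), of 0] show ?thesis
      using chart_inv(1)[OF fchart(1)[OF c(1)], of p] fchart(3)[OF c] sec_proj[OF s] by (auto simp: scoord_simp)
  qed
  moreover have "snd s p = snd t q \<Longrightarrow> p = q" using sec_proj[OF s] sec_proj[OF t] by metis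
  ultimately show ?thesis using True by (auto simp: jet_at_def)
next
  case False
  then show ?thesis using jet_class_eq_iff[OF s t] by (simp add: jet_at_def)
qed

lemma jet_at_value:
  assumes "s \<in> sec p" "t \<in> sec q" "jet_at E X \<pi> (int k) p s = jet_at E X \<pi> (int k) q t"
  shows "p = q" "snd s p = snd t q"
  using assms jet_at_eq_iff[OF assms(1,2)] by (auto simp: jet_equivalent_def)

text \<open>The chart map of the jet manifold before the choice of a representative: the point \<open>p\<close> and the
  section \<open>s\<close> are arguments. By \<open>jcoord_eq_iff\<close> the result depends on the jet only.\<close>

definition jcoord :: "nat \<Rightarrow> ('x, 'e) fchart \<Rightarrow> 'x \<Rightarrow> ('x, 'e) lsection \<Rightarrow> nat \<Rightarrow> real" where
  "jcoord k = (\<lambda>(U, u, V, v) p s i. if i < bdim then u p i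
     else if i < jet_dim E X k then
       (let (I, a) = jet_coord_list bdim fdim k ! (i - bdim) in iterated_partial I (scoord (U, u, V, v) s a) (u p))
     else 0)"

lemma jcoord_simps:
  "i < bdim \<Longrightarrow> jcoord k (U, u, V, v) p s i = u p i"
  "j < length (jet_coord_list bdim fdim k) \<Longrightarrow> jet_coord_list bdim fdim k ! j = (I, a) \<Longrightarrow>
    jcoord k (U, u, V, v) p s (bdim + j) = iterated_partial I (scoord (U, u, V, v) s a) (u p)"
  "jcoord k (U, u, V, v) p s \<in> cart (jet_dim E X k)"
  by (auto simp: jcoord_def jet_dim_def cart_iff)

text \<open>The coordinates of order \<open>0\<close> come first and are the coordinates of the value of the section.\<close>

lemma jcoord_low:
  assumes c: "(U, u, V, v) \<in> fcharts" and s: "s \<in> sec p" and e: "snd s p \<in> V"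
  shows "trunc (bdim + fdim) (jcoord k (U, u, V, v) p s) = v (snd s p)"
proof -
  have p: "p \<in> sdom (U, u, V, v) UNIV s" using sdom_mem[OF c s] e by simp
  have pU: "p \<in> U" using p by (simp add: sdom_simp)
  show ?thesis
  proof
    fix i
    have "jcoord k (U, u, V, v) p s i = glue bdim (u p) (\<lambda>a. if a < fdim then scoord (U, u, V, v) s a (u p) else 0) i"
      if i: "i < bdim + fdim"
    proof (cases "i < bdim")
      case True
      then show ?thesis by (simp add: jcoord_simps glue_def)
    next
      case False
      then have "i - bdim < fdim" using i by simp
      with jet_coord_list_low[OF this, of bdim k] False show ?thesis
        using jcoord_simps(2)[of "i - bdim" k "[]" "i - bdim" U u V v p s] by (simp add: glue_def)
    qed
    moreover have "glue bdim (u p) (\<lambda>a. if a < fdim then scoord (U, u, V, v) s a (u p) else 0) i = 0" if "\<not> i < bdim + fdim"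
      using that by (simp add: glue_def)
    ultimately show "trunc (bdim + fdim) (jcoord k (U, u, V, v) p s) i = v (snd s p) i"
      unfolding section_in_chart[OF c s p] by (simp add: trunc_def)
  qed
qed

lemma jcoord_eq_iff:
  assumes c: "(U, u, V, v) \<in> fcharts" and s: "s \<in> sec p" "snd s p \<in> V" and t: "t \<in> sec q" "snd t q \<in> V"
  shows "jcoord k (U, u, V, v) p s = jcoord k (U, u, V, v) q t \<longleftrightarrow> jet_at E X \<pi> (int k) p s = jet_at E X \<pi> (int k) q t"
proof
  assume eq: "jcoord k (U, u, V, v) p s = jcoord k (U, u, V, v) q t"
  have "v (snd s p) = v (snd t q)" using jcoord_low[OF c s, of k] jcoord_low[OF c t, of k] eq by simp
  then have st: "snd s p = snd t q" using chart_inj[OF fchart(2)[OF c]] s(2) t(2) by (auto dest: inj_onD)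
  then have pq: "p = q" using sec_proj[OF s(1)] sec_proj[OF t(1)] by metis
  have t': "t \<in> sec p" using t(1) pq by simp
  have oE: "openin (mtop E) (points E)" by simp
  have "agree k bdim (u p) (scoord (U, u, V, v) s a) (scoord (U, u, V, v) t a)" if a: "a < fdim" for a
    unfolding agree_iff_iterated
  proof (intro allI impI)
    fix I :: "nat list" assume I: "set I \<subseteq> {..<bdim} \<and> length I \<le> k"
    have "(sort I, a) \<in> set (jet_coord_list bdim fdim k)" using I a by (simp add: set_jet_coord_list)
    then obtain j where j: "j < length (jet_coord_list bdim fdim k)" "jet_coord_list bdim fdim k ! j = (sort I, a)"
      by (metis in_set_conv_nth)
    have eqs: "iterated_partial (sort I) (scoord (U, u, V, v) s a) (u p) = iterated_partial (sort I) (scoord (U, u, V, v) t a) (u p)"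
      using fun_cong[OF eq, of "bdim + j"] pq unfolding jcoord_simps(2)[OF j] by simp
    have srt: "iterated_partial (sort I) (scoord (U, u, V, v) r a) (u p) = iterated_partial I (scoord (U, u, V, v) r a) (u p)"
      if r: "r \<in> sec p" "snd r p \<in> V" for r
      by (rule iterated_partial_sort[OF sdom_image_open[OF c r(1) oE] smooth_scoord[OF c r(1) oE a]])
        (use I sdom_mem[OF c r(1)] r(2) chart_subset[OF fchart(2)[OF c]] in auto)
    show "iterated_partial I (scoord (U, u, V, v) s a) (u p) = iterated_partial I (scoord (U, u, V, v) t a) (u p)"
      using eqs srt[OF s] srt[OF t'] t(2) pq by simp
  qed
  then show "jet_at E X \<pi> (int k) p s = jet_at E X \<pi> (int k) q t"
    using jet_at_eq_iff[OF s(1) t(1)] jet_equivalent_iff[OF c s(1) t' s(2)] st pq by simp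
next
  assume "jet_at E X \<pi> (int k) p s = jet_at E X \<pi> (int k) q t"
  then have pq: "p = q" and eqv: "jet_equivalent E X \<pi> (enat k) p s t" using jet_at_eq_iff[OF s(1) t(1)] by auto
  have t': "t \<in> sec p" using t(1) pq by simp
  have ag: "\<forall>a<fdim. agree k bdim (u p) (scoord (U, u, V, v) s a) (scoord (U, u, V, v) t a)"
    using jet_equivalent_iff[OF c s(1) t' s(2)] eqv by blast
  show "jcoord k (U, u, V, v) p s = jcoord k (U, u, V, v) q t"
  proof
    fix i
    consider "i < bdim" | j where "i = bdim + j" "j < length (jet_coord_list bdim fdim k)" | "i \<ge> jet_dim E X k"
      using that unfolding jet_dim_def by (metis add.commute add_less_cancel_right le_add_diff_inverse2 not_less)
    then show "jcoord k (U, u, V, v) p s i = jcoord k (U, u, V, v) q t i"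
    proof cases
      case (2 j)
      obtain I a where Ia: "jet_coord_list bdim fdim k ! j = (I, a)" by fastforce
      from jet_coord_list_nth[OF 2(2) this] ag show ?thesis
        unfolding 2(1) jcoord_simps(2)[OF 2(2) Ia] pq[symmetric] agree_iff_iterated by blast
    qed (use pq jcoord_simps(3) in \<open>auto simp: jcoord_simps cart_iff\<close>)
  qed
qed

subsection \<open>Sections with given coordinate functions\<close>

text \<open>Given functions of the base coordinates are the fiber coordinates of a section as long as the
  resulting point lies in the image of the chart of \<open>E\<close>, which is an open condition.\<close>

lemma section_from_coords:
  assumes c: "(U, u, V, v) \<in> fcharts" and p: "p \<in> U"
    and g: "\<And>a. a < fdim \<Longrightarrow> smooth_real_on bdim (cart bdim) (g a)"
    and in_V: "glue bdim (u p) (\<lambda>a. if a < fdim then g a (u p) else 0) \<in> v ` V"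
  obtains s T where "s \<in> sec p" "snd s p \<in> V" "v (snd s p) = glue bdim (u p) (\<lambda>a. if a < fdim then g a (u p) else 0)"
    "cart_open bdim T" "u p \<in> T" "T \<subseteq> u ` U" "\<forall>x\<in>T. \<forall>a<fdim. scoord (U, u, V, v) s a x = g a x"
proof -
  have cX: "(U, u) \<in> charts X" and cE: "(V, v) \<in> charts E" by (rule fchart[OF c])+
  obtain e where "e \<in> V" using in_V by blast
  then have dim: "mdim E = bdim + fdim" by (rule fchart(5)[OF c])
  define \<Gamma> where "\<Gamma> x = glue bdim x (\<lambda>a. if a < fdim then g a x else 0)" for x
  have U: "cart_open bdim (u ` U)" by (rule chart_image_open[OF cX])
  have \<Gamma>c: "\<Gamma> x \<in> cart (mdim E)" for x
    unfolding \<Gamma>_def dim by (rule glue_cart) (simp add: cart_iff)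
  have gU: "smooth_real_on bdim (u ` U) (\<lambda>x. if a < fdim then g a x else 0)" if "a < fdim" for a
    using smooth_real_on_subset[OF order_refl g[OF that] cart_open_subset[OF U]] that by simp
  have \<Gamma>s: "smooth_real_on bdim (u ` U) (\<lambda>x. \<Gamma> x i)" if "i < mdim E" for i
    unfolding \<Gamma>_def by (rule smooth_glue[OF smooth_real_on_coord[OF U] gU]) (use that dim in auto)
  define T where "T = u ` U \<inter> \<Gamma> -` (v ` V)"
  have T: "cart_open bdim T" unfolding T_def
    by (rule cart_open_preimage[OF U continuous_smooth_vector[OF U \<Gamma>c \<Gamma>s] \<Gamma>c chart_image_open[OF cE]])
  define W where "W = U \<inter> u -` T"
  have W: "openin (mtop X) W" unfolding W_def by (rule chart_preimage_open[OF cX T])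
  define s where "s = restrict (\<lambda>q. inv_into V v (\<Gamma> (u q))) W"
  have pW: "p \<in> W" using p in_V by (simp add: W_def T_def \<Gamma>_def)
  have sq: "s q \<in> V" "v (s q) = \<Gamma> (u q)" if "q \<in> W" for q
  proof -
    have "\<Gamma> (u q) \<in> v ` V" using that by (simp add: W_def T_def)
    then show "s q \<in> V" "v (s q) = \<Gamma> (u q)" using chart_inv(2,3)[OF cE] that by (simp_all add: s_def)
  qed
  have \<pi>s: "\<pi> (s q) = q" if q: "q \<in> W" for q
  proof -
    have qU: "q \<in> U" using q by (simp add: W_def)
    have "u (\<pi> (s q)) = trunc bdim (\<Gamma> (u q))" using fchart(4)[OF c sq(1)[OF q]] sq(2)[OF q] by simp
    also have "\<dots> = u q" unfolding \<Gamma>_def by (rule trunc_glue) (rule chart_inv(4)[OF cX qU])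
    finally show ?thesis using chart_inj[OF cX] fchart(3)[OF c sq(1)[OF q]] qU by (auto dest: inj_onD)
  qed
  have inv: "u (inv_into U u x) = x" "inv_into U u x \<in> W" if "x \<in> T" for x
  proof -
    have "x \<in> u ` U" using that by (simp add: T_def)
    then show "u (inv_into U u x) = x" "inv_into U u x \<in> W" using chart_inv(2,3)[OF cX] that by (simp_all add: W_def)
  qed
  have "smooth_map (open_submanifold X W) E s"
    unfolding smooth_map_iff[OF smooth_manifold_open_submanifold[OF X W] E]
  proof
    fix q assume "q \<in> points (open_submanifold X W)"
    then have q: "q \<in> W" by simp
    have qU: "q \<in> U" using q by (simp add: W_def)
    have "smooth_at X E s q"
    proof (rule smooth_atI[OF cX cE qU T])
      show "u q \<in> T" "T \<subseteq> u ` U" using q by (simp_all add: W_def T_def)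
      show "s (inv_into U u x) \<in> V" if "x \<in> T" for x by (rule sq(1)[OF inv(2)[OF that]])
      show "smooth_real_on bdim T (\<lambda>x. v (s (inv_into U u x)) i)" if "i < mdim E" for i
      proof (rule smooth_real_on_cong[OF T])
        show "smooth_real_on bdim T (\<lambda>x. \<Gamma> x i)"
          by (rule smooth_real_on_subset[OF cart_open_subset[OF U] \<Gamma>s[OF that]]) (simp add: T_def)
        show "\<Gamma> x i = v (s (inv_into U u x)) i" if "x \<in> T" for x
          using sq(2)[OF inv(2)[OF that]] inv(1)[OF that] by simp
      qed
    qed
    then show "smooth_at (open_submanifold X W) E s q" using smooth_at_open_submanifold[OF X W q] by blast
  qed
  then have sec: "(W, s) \<in> sec p"
    using W pW \<pi>s by (simp add: sections_around_def s_def)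
  show ?thesis
  proof (rule that[OF sec _ _ T])
    show "snd (W, s) p \<in> V" "v (snd (W, s) p) = glue bdim (u p) (\<lambda>a. if a < fdim then g a (u p) else 0)"
      using sq[OF pW] by (simp_all add: \<Gamma>_def)
    show "u p \<in> T" "T \<subseteq> u ` U" using pW by (simp_all add: W_def T_def)
    show "\<forall>x\<in>T. \<forall>a<fdim. scoord (U, u, V, v) (W, s) a x = g a x"
      using sq(2)[OF inv(2)] inv(1) by (simp add: scoord_simp \<Gamma>_def glue_def)
  qed
qed

lemma section_through:
  assumes "e \<in> points E"
  obtains s where "s \<in> sec (\<pi> e)" "snd s (\<pi> e) = e"
proof -
  obtain U u V v where c: "(U, u, V, v) \<in> fcharts" and e: "e \<in> V" using fibered_chart[OF assms] by blast
  let ?g = "\<lambda>a x. v e (bdim + a)"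
  have cE: "(V, v) \<in> charts E" by (rule fchart[OF c])
  have ve: "glue bdim (u (\<pi> e)) (\<lambda>a. if a < fdim then ?g a (u (\<pi> e)) else 0) = v e"
  proof -
    have "v e \<in> cart (bdim + fdim)" using chart_inv(4)[OF cE e] fchart(5)[OF c e] by simp
    then have "\<forall>i\<ge>bdim + fdim. v e i = 0" unfolding cart_iff .
    then have "(if a < fdim then v e (bdim + a) else 0) = shift bdim (v e) a" for a
      by (cases "a < fdim") (simp_all add: shift_def add.commute)
    then have "(\<lambda>a. if a < fdim then v e (bdim + a) else 0) = shift bdim (v e)" by (rule ext)
    then show ?thesis using fchart(4)[OF c e] by (metis glue_trunc_shift)
  qed
  have "smooth_real_on bdim (cart bdim) (?g a)" for a by (rule smooth_real_on_const) simp
  moreover have "glue bdim (u (\<pi> e)) (\<lambda>a. if a < fdim then ?g a (u (\<pi> e)) else 0) \<in> v ` V"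
    unfolding ve using e by blast
  ultimately obtain s where s: "s \<in> sec (\<pi> e)" "snd s (\<pi> e) \<in> V"
    "v (snd s (\<pi> e)) = glue bdim (u (\<pi> e)) (\<lambda>a. if a < fdim then ?g a (u (\<pi> e)) else 0)"
    by (rule section_from_coords[OF c fchart(3)[OF c e]])
  have "snd s (\<pi> e) = e" using s(2,3) e chart_inj[OF cE] unfolding ve by (auto dest: inj_onD)
  with s(1) show ?thesis by (rule that)
qed

lemma section_exists:
  assumes "p \<in> points X" obtains s where "s \<in> sec p"
proof -
  have "p \<in> \<pi> ` points E" using assms proj_surj by simp
  then obtain e where e: "e \<in> points E" "p = \<pi> e" by (rule imageE)
  obtain s where "s \<in> sec (\<pi> e)" by (rule section_through[OF e(1)])
  then show ?thesis using that e(2) by simp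
qed

subsection \<open>Taylor polynomials of jets\<close>

text \<open>The \<open>a\<close>-th fiber coordinate of a section whose jet at the point with base coordinates \<open>trunc bdim y\<close> has
  the coordinate vector \<open>y\<close>.\<close>

definition taylor_poly :: "nat \<Rightarrow> (nat \<Rightarrow> real) \<Rightarrow> nat \<Rightarrow> (nat \<Rightarrow> real) \<Rightarrow> real" where
  "taylor_poly k y a x = (\<Sum>j<length (jet_coord_list bdim fdim k).
     (if snd (jet_coord_list bdim fdim k ! j) = a then y (bdim + j) else 0) *
     taylor_monomial bdim (trunc bdim y) (count_list (fst (jet_coord_list bdim fdim k ! j))) x)"

lemma smooth_taylor_poly_joint:
  assumes S: "cart_open N S" and "\<And>j. smooth_real_on N S (\<lambda>z. f z j)" "\<And>i. i < bdim \<Longrightarrow> smooth_real_on N S (\<lambda>z. g z i)"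
  shows "smooth_real_on N S (\<lambda>z. taylor_poly k (f z) a (g z))"
  unfolding taylor_poly_def
proof (intro smooth_real_on_sum[OF S] smooth_real_on_mult[OF S] smooth_taylor_monomial[OF S])
  show "smooth_real_on N S (\<lambda>z. if snd (jet_coord_list bdim fdim k ! j) = a then f z (bdim + j) else 0)" for j
    using assms(2) smooth_real_on_const[OF S] by (cases "snd (jet_coord_list bdim fdim k ! j) = a") simp_all
  show "smooth_real_on N S (\<lambda>z. trunc bdim (f z) i)" if "i < bdim" for i
    using assms(2) that by (simp add: trunc_def)
qed (rule assms(3))

lemma smooth_taylor_poly: "smooth_real_on bdim (cart bdim) (taylor_poly k y a)"
  by (rule smooth_taylor_poly_joint[where f = "\<lambda>_. y" and g = "\<lambda>x. x"])
    (simp_all add: smooth_real_on_const smooth_real_on_coord)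

lemma taylor_poly_derivative:
  assumes j: "j < length (jet_coord_list bdim fdim k)" "jet_coord_list bdim fdim k ! j = (J, a)"
  shows "iterated_partial J (taylor_poly k y a) (trunc bdim y) = y (bdim + j)"
proof -
  let ?L = "jet_coord_list bdim fdim k"
  have oc: "cart_open bdim (cart bdim)" by simp
  note J = jet_coord_list_nth[OF j]
  have "iterated_partial J (taylor_poly k y a) (trunc bdim y) = (\<Sum>l<length ?L. (if snd (?L ! l) = a then y (bdim + l) else 0) *
     iterated_partial J (taylor_monomial bdim (trunc bdim y) (count_list (fst (?L ! l)))) (trunc bdim y))"
    unfolding taylor_poly_def
    by (rule iterated_partial_linear[OF oc _ _ J(1) trunc_cart])
      (auto intro!: smooth_taylor_monomial smooth_real_on_coord smooth_real_on_const)
  also have "\<dots> = (\<Sum>l<length ?L. if l = j then y (bdim + l) else 0)"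
  proof (rule sum.cong[OF refl])
    fix l assume "l \<in> {..<length ?L}"
    then have l: "l < length ?L" by simp
    obtain I b where Ib: "?L ! l = (I, b)" by fastforce
    note I = jet_coord_list_nth[OF l Ib]
    have "l = j \<longleftrightarrow> I = J \<and> b = a"
      using nth_eq_iff_index_eq[OF distinct_jet_coord_list l j(1)] Ib j(2) by auto
    then show "(if snd (?L ! l) = a then y (bdim + l) else 0) *
       iterated_partial J (taylor_monomial bdim (trunc bdim y) (count_list (fst (?L ! l)))) (trunc bdim y) = (if l = j then y (bdim + l) else 0)"
      using taylor_monomial_derivative[OF I(1,2) J(1,2), of "trunc bdim y"] Ib by simp
  qed
  also have "\<dots> = y (bdim + j)" using j(1) by simp
  finally show ?thesis .
qed

lemma taylor_poly_value:
  "glue bdim (trunc bdim y) (\<lambda>a. if a < fdim then taylor_poly k y a (trunc bdim y) else 0) = trunc (bdim + fdim) y"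
proof -
  have "taylor_poly k y a (trunc bdim y) = y (bdim + a)" if "a < fdim" for a
    using jet_coord_list_low[OF that, of bdim k] taylor_poly_derivative[of a k "[]" a y] by simp
  then show ?thesis by (auto simp: glue_def trunc_def fun_eq_iff)
qed

text \<open>Every coordinate vector over the chart domain belongs to a jet, namely to the jet of the section
  whose fiber coordinates are given functions with these derivatives.\<close>

lemma jet_from_coords:
  assumes c: "(U, u, V, v) \<in> fcharts" and y: "y \<in> cart (jet_dim E X k)" and in_V: "trunc (bdim + fdim) y \<in> v ` V"
  obtains p s T where "s \<in> sec p" "snd s p \<in> V" "p \<in> U" "u p = trunc bdim y" "jcoord k (U, u, V, v) p s = y"
    "cart_open bdim T" "u p \<in> T" "T \<subseteq> u ` U"
    "\<forall>x\<in>T. \<forall>a<fdim. scoord (U, u, V, v) s a x = taylor_poly k y a x"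
proof -
  obtain e where e: "e \<in> V" "trunc (bdim + fdim) y = v e" using in_V by blast
  have p: "\<pi> e \<in> U" by (rule fchart(3)[OF c e(1)])
  have up: "u (\<pi> e) = trunc bdim y"
  proof -
    have "trunc bdim y = trunc bdim (trunc (bdim + fdim) y)" by (auto simp: trunc_def fun_eq_iff)
    then show ?thesis using fchart(4)[OF c e(1)] e(2) by simp
  qed
  have "glue bdim (u (\<pi> e)) (\<lambda>a. if a < fdim then taylor_poly k y a (u (\<pi> e)) else 0) \<in> v ` V"
    unfolding up taylor_poly_value by (rule in_V)
  then obtain s T where s: "s \<in> sec (\<pi> e)" "snd s (\<pi> e) \<in> V"
      "v (snd s (\<pi> e)) = glue bdim (u (\<pi> e)) (\<lambda>a. if a < fdim then taylor_poly k y a (u (\<pi> e)) else 0)"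
    and T: "cart_open bdim T" "u (\<pi> e) \<in> T" "T \<subseteq> u ` U"
    "\<forall>x\<in>T. \<forall>a<fdim. scoord (U, u, V, v) s a x = taylor_poly k y a x"
    by (rule section_from_coords[OF c p smooth_taylor_poly])
  have "jcoord k (U, u, V, v) (\<pi> e) s = y"
  proof
    fix i
    consider "i < bdim" | j where "i = bdim + j" "j < length (jet_coord_list bdim fdim k)" | "i \<ge> jet_dim E X k"
      unfolding jet_dim_def by (metis add_less_cancel_left le_add_diff_inverse not_less)
    then show "jcoord k (U, u, V, v) (\<pi> e) s i = y i"
    proof cases
      case 1
      then show ?thesis using up by (simp add: jcoord_simps trunc_def)
    next
      case (2 j)
      obtain J a where Ja: "jet_coord_list bdim fdim k ! j = (J, a)" by fastforce
      note J = jet_coord_list_nth[OF 2(2) Ja]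
      have "iterated_partial J (scoord (U, u, V, v) s a) (u (\<pi> e)) = iterated_partial J (taylor_poly k y a) (u (\<pi> e))"
        by (rule iterated_partial_cong[OF T(1) J(1) _ T(2)]) (use T(4) J(4) in blast)
      then show ?thesis unfolding 2(1) jcoord_simps(2)[OF 2(2) Ja] using taylor_poly_derivative[OF 2(2) Ja] up by simp
    next
      case 3
      then show ?thesis using y jcoord_simps(3)[of k U u V v "\<pi> e" s] by (simp add: cart_iff)
    qed
  qed
  then show ?thesis by (rule that[OF s(1,2) p up _ T])
qed

subsection \<open>The manifold of \<open>k\<close>-jets\<close>

text \<open>The jets of sections with values in \<open>A\<close>. For the domain \<open>A\<close> of a fibered chart these are the
  domains of the charts of the jet manifold.\<close>

definition jet_region :: "nat \<Rightarrow> 'e set \<Rightarrow> ('x, 'e) jet set" where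
  "jet_region k A = {jet_at E X \<pi> (int k) p s |p s. s \<in> sec p \<and> snd s p \<in> A}"

lemma jet_chart_domain_eq: "jet_chart_domain E X \<pi> k (U, u, V, v) = jet_region k V"
  unfolding jet_chart_domain_def jet_region_def prod.case using sec(6) by blast

lemma jet_regionI: "s \<in> sec p \<Longrightarrow> snd s p \<in> A \<Longrightarrow> jet_at E X \<pi> (int k) p s \<in> jet_region k A"
  unfolding jet_region_def by blast

lemma jet_regionE:
  assumes "z \<in> jet_region k A" obtains p s where "s \<in> sec p" "snd s p \<in> A" "z = jet_at E X \<pi> (int k) p s"
  using assms unfolding jet_region_def by blast

lemma jet_region_value: "jet_at E X \<pi> (int k) p s \<in> jet_region k A \<Longrightarrow> s \<in> sec p \<Longrightarrow> snd s p \<in> A"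
  by (metis jet_at_value(2) jet_regionE)

lemma jet_region_Int: "jet_region k A \<inter> jet_region k B = jet_region k (A \<inter> B)"
proof
  show "jet_region k A \<inter> jet_region k B \<subseteq> jet_region k (A \<inter> B)"
  proof
    fix z assume z: "z \<in> jet_region k A \<inter> jet_region k B"
    then obtain p s where s: "s \<in> sec p" "snd s p \<in> A" "z = jet_at E X \<pi> (int k) p s" by (metis IntD1 jet_regionE)
    have "jet_at E X \<pi> (int k) p s \<in> jet_region k B" using z s(3) by simp
    then have "snd s p \<in> B" by (rule jet_region_value[OF _ s(1)])
    then show "z \<in> jet_region k (A \<inter> B)" using s jet_regionI by simp
  qed
  show "jet_region k (A \<inter> B) \<subseteq> jet_region k A \<inter> jet_region k B" unfolding jet_region_def by blast
qed

lemma jet_chart_map_eq: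
  assumes c: "(U, u, V, v) \<in> fcharts" and s: "s \<in> sec p" "snd s p \<in> V"
  shows "jet_chart_map E X \<pi> k (U, u, V, v) (jet_at E X \<pi> (int k) p s) = jcoord k (U, u, V, v) p s"
proof -
  let ?P = "\<lambda>(p', s'). p' \<in> points X \<and> s' \<in> sec p' \<and> jet_at E X \<pi> (int k) p s = jet_at E X \<pi> (int k) p' s'"
  obtain p' s' where ps: "(SOME r. ?P r) = (p', s')" by (rule prod.exhaust)
  have "?P (p, s)" using s sec(6) by simp
  then have "?P (SOME r. ?P r)" by (rule someI)
  then have s': "s' \<in> sec p'" "jet_at E X \<pi> (int k) p s = jet_at E X \<pi> (int k) p' s'" unfolding ps by auto
  have "snd s' p' \<in> V" using jet_at_value[OF s(1) s'] s(2) by simp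
  then have "jcoord k (U, u, V, v) p s = jcoord k (U, u, V, v) p' s'"
    using jcoord_eq_iff[OF c s s'(1)] s'(2) by blast
  moreover have "jet_chart_map E X \<pi> k (U, u, V, v) (jet_at E X \<pi> (int k) p s) = jcoord k (U, u, V, v) p' s'"
    unfolding jet_chart_map_def prod.case ps by (simp add: jcoord_def)
  ultimately show ?thesis by simp
qed

lemma jet_chart_inj:
  assumes c: "(U, u, V, v) \<in> fcharts" shows "inj_on (jet_chart_map E X \<pi> k (U, u, V, v)) (jet_region k V)"
proof (rule inj_onI)
  fix z z' assume "z \<in> jet_region k V" "z' \<in> jet_region k V"
    and eq: "jet_chart_map E X \<pi> k (U, u, V, v) z = jet_chart_map E X \<pi> k (U, u, V, v) z'"
  then obtain p s q t where s: "s \<in> sec p" "snd s p \<in> V" "z = jet_at E X \<pi> (int k) p s"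
    and t: "t \<in> sec q" "snd t q \<in> V" "z' = jet_at E X \<pi> (int k) q t" by (metis jet_regionE)
  then show "z = z'" using eq jet_chart_map_eq[OF c] jcoord_eq_iff[OF c s(1,2) t(1,2)] by simp
qed

text \<open>The image of a chart is restricted in the coordinates of order \<open>0\<close> only: derivatives can be prescribed
  arbitrarily.\<close>

lemma jet_chart_image:
  assumes c: "(U, u, V, v) \<in> fcharts" and A: "A \<subseteq> V"
  shows "jet_chart_map E X \<pi> k (U, u, V, v) ` jet_region k A = {y \<in> cart (jet_dim E X k). trunc (bdim + fdim) y \<in> v ` A}"
proof safe
  fix z assume "z \<in> jet_region k A"
  then obtain p s where s: "s \<in> sec p" "snd s p \<in> A" and z: "z = jet_at E X \<pi> (int k) p s" by (rule jet_regionE)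
  have V: "snd s p \<in> V" using s A by blast
  show "jet_chart_map E X \<pi> k (U, u, V, v) z \<in> cart (jet_dim E X k)"
    "trunc (bdim + fdim) (jet_chart_map E X \<pi> k (U, u, V, v) z) \<in> v ` A"
    unfolding z jet_chart_map_eq[OF c s(1) V] jcoord_low[OF c s(1) V] using jcoord_simps(3) s(2) by auto
next
  fix y e assume y: "y \<in> cart (jet_dim E X k)" "trunc (bdim + fdim) y = v e" "e \<in> A"
  then have "trunc (bdim + fdim) y \<in> v ` V" using A by blast
  then obtain p s where s: "s \<in> sec p" "snd s p \<in> V" "jcoord k (U, u, V, v) p s = y"
    by (rule jet_from_coords[OF c y(1)]) blast
  have "v (snd s p) = v e" using jcoord_low[OF c s(1,2), of k] s(3) y(2) by simp
  then have "snd s p = e" using chart_inj[OF fchart(2)[OF c]] s(2) y(3) A by (auto dest: inj_onD)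
  then have "jet_at E X \<pi> (int k) p s \<in> jet_region k A" using s(1) y(3) by (simp add: jet_regionI)
  moreover have "y = jet_chart_map E X \<pi> k (U, u, V, v) (jet_at E X \<pi> (int k) p s)"
    using jet_chart_map_eq[OF c s(1,2)] s(3) by simp
  ultimately show "y \<in> jet_chart_map E X \<pi> k (U, u, V, v) ` jet_region k A" by blast
qed

lemma jet_chart_image_open:
  assumes c: "(U, u, V, v) \<in> fcharts" and A: "openin (mtop E) A"
  shows "cart_open (jet_dim E X k) (jet_chart_map E X \<pi> k (U, u, V, v) ` jet_region k (V \<inter> A))"
proof (cases "V \<inter> A = {}")
  case True
  then show ?thesis by (simp add: jet_region_def)
next
  case False
  then obtain e where "e \<in> V" by blast
  then have "cart_open (bdim + fdim) (v ` (V \<inter> A))"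
    using chart_open_image[OF fchart(2)[OF c] A] fchart(5)[OF c] by simp
  then have "cart_open (jet_dim E X k) {y \<in> cart (jet_dim E X k). trunc (bdim + fdim) y \<in> v ` (V \<inter> A)}"
    by (rule cart_open_trunc_vimage[OF openin_topspace])
  then show ?thesis using jet_chart_image[OF c, of "V \<inter> A" k] by simp
qed

text \<open>Derivatives in the first directions do not notice the remaining variables, which act as parameters.\<close>

lemma iterated_partial_glue:
  "set I \<subseteq> {..<m} \<Longrightarrow> iterated_partial I (\<lambda>x. f (glue m x y)) x = iterated_partial I f (glue m x y)"
proof (induction I arbitrary: x)
  case (Cons i I)
  then have i: "i < m" and IH: "iterated_partial I (\<lambda>x. f (glue m x y)) = (\<lambda>x. iterated_partial I f (glue m x y))"
    by auto
  have "glue m (x(i := t)) y = (glue m x y)(i := t)" for t using i by (auto simp: glue_def)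
  moreover have "glue m x y i = x i" using i by (simp add: glue_def)
  ultimately show ?case unfolding iterated_partial_Cons IH by (simp add: partial_deriv_def)
qed simp

text \<open>Coordinate changes of jets are smooth. The new coordinates of a jet with coordinates \<open>y\<close> are the
  derivatives of the section whose old fiber coordinates are Taylor polynomials with coefficients
  \<open>y\<close>. In the new chart this section depends smoothly on the base point and \<open>y\<close> jointly, so that its
  derivatives with respect to the base point are smooth functions of \<open>y\<close>, too.\<close>

lemma jet_transition_smooth:
  assumes c: "(U, u, V, v) \<in> fcharts" and d: "(U', u', V', v') \<in> fcharts" and i: "i < jet_dim E X k"
  shows "smooth_real_on (jet_dim E X k) (jet_chart_map E X \<pi> k (U, u, V, v) ` jet_region k (V \<inter> V'))
    (\<lambda>y. jet_chart_map E X \<pi> k (U', u', V', v') (inv_into (jet_region k V) (jet_chart_map E X \<pi> k (U, u, V, v)) y) i)"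
proof (cases "V \<inter> V' = {}")
  case True
  then have "jet_region k (V \<inter> V') = {}" by (simp add: jet_region_def)
  then show ?thesis by (simp add: smooth_real_on_def continuous_map_cart_iff)
next
  case False
  let ?N = "jet_dim E X k" and ?\<phi> = "jet_chart_map E X \<pi> k (U, u, V, v)" and ?\<psi> = "jet_chart_map E X \<pi> k (U', u', V', v')"
  have cX: "(U, u) \<in> charts X" and cE: "(V, v) \<in> charts E" by (rule fchart[OF c])+
  have dX: "(U', u') \<in> charts X" and dE: "(V', v') \<in> charts E" by (rule fchart[OF d])+
  have dim: "mdim E = bdim + fdim" using False fchart(5)[OF c] by blast
  define Y where "Y = ?\<phi> ` jet_region k (V \<inter> V')"
  have Y: "cart_open ?N Y" unfolding Y_def by (rule jet_chart_image_open[OF c chart_openin[OF dE]])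
  have Y_mem: "y \<in> cart ?N" "trunc (bdim + fdim) y \<in> v ` (V \<inter> V')" if "y \<in> Y" for y
    using that jet_chart_image[OF c, of "V \<inter> V'" k] unfolding Y_def by auto
  have rep: "\<exists>p s T. s \<in> sec p \<and> snd s p \<in> V \<inter> V' \<and> p \<in> U \<and> u p = trunc bdim y \<and>
      inv_into (jet_region k V) ?\<phi> y = jet_at E X \<pi> (int k) p s \<and> cart_open bdim T \<and> u p \<in> T \<and>
      (\<forall>x\<in>T. \<forall>a<fdim. scoord (U, u, V, v) s a x = taylor_poly k y a x)" if y: "y \<in> Y" for y
  proof -
    have "trunc (bdim + fdim) y \<in> v ` V" using Y_mem(2)[OF y] by blast
    then obtain p s T where s: "s \<in> sec p" "snd s p \<in> V" "p \<in> U"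
      "u p = trunc bdim y" "jcoord k (U, u, V, v) p s = y"
      and T: "cart_open bdim T" "u p \<in> T" "T \<subseteq> u ` U"
      "\<forall>x\<in>T. \<forall>a<fdim. scoord (U, u, V, v) s a x = taylor_poly k y a x"
      by (rule jet_from_coords[OF c Y_mem(1)[OF y]])
    have "v (snd s p) \<in> v ` (V \<inter> V')" using jcoord_low[OF c s(1,2), of k] s(5) Y_mem(2)[OF y] by simp
    then have "snd s p \<in> V \<inter> V'" using chart_inj[OF cE] s(2) by (auto dest: inj_onD)
    moreover have "inv_into (jet_region k V) ?\<phi> y = jet_at E X \<pi> (int k) p s"
      by (rule inv_into_f_eq[OF jet_chart_inj[OF c] jet_regionI[OF s(1,2)]]) (simp add: jet_chart_map_eq[OF c s(1,2)] s(5))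
    ultimately show ?thesis using s T by blast
  qed
  have base: "u' (inv_into U u (trunc bdim y)) = u' p" "trunc bdim y \<in> u ` (U \<inter> U')"
    if "y \<in> Y" "s \<in> sec p" "snd s p \<in> V \<inter> V'" "p \<in> U" "u p = trunc bdim y" for y p s
  proof -
    show "u' (inv_into U u (trunc bdim y)) = u' p" using chart_inv(1)[OF cX that(4)] that(5) by simp
    have "p \<in> U'" using fchart(3)[OF d, of "snd s p"] sec_proj[OF that(2)] that(3) by simp
    then show "trunc bdim y \<in> u ` (U \<inter> U')" using that(4,5) by (metis IntI imageI)
  qed
  have base_in: "trunc bdim y \<in> u ` (U \<inter> U')" if "y \<in> Y" for y
    using rep[OF that] base(2)[OF that] by metis
  have base_smooth: "smooth_real_on ?N Y (\<lambda>y. u' (inv_into U u (trunc bdim y)) i)" if "i < bdim" for i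
    by (rule smooth_real_on_compose[OF Y chart_open_image[OF cX chart_openin[OF dX]] base_in transition_smooth[OF X cX dX that] smooth_trunc[OF Y]])
  have "smooth_real_on ?N Y (\<lambda>y. ?\<psi> (inv_into (jet_region k V) ?\<phi> y) i)"
  proof (cases "i < bdim")
    case True
    show ?thesis
    proof (rule smooth_real_on_cong[OF Y _ base_smooth[OF True]])
      fix y assume y: "y \<in> Y"
      obtain p s where s: "s \<in> sec p" "snd s p \<in> V \<inter> V'" "p \<in> U" "u p = trunc bdim y"
        "inv_into (jet_region k V) ?\<phi> y = jet_at E X \<pi> (int k) p s" using rep[OF y] by blast
      then show "u' (inv_into U u (trunc bdim y)) i = ?\<psi> (inv_into (jet_region k V) ?\<phi> y) i"
        using base(1)[OF y s(1-4)] jet_chart_map_eq[OF d s(1), of k] jcoord_simps(1)[OF True] by simp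
    qed
  next
    case False
    define j where "j = i - bdim"
    have ij: "i = bdim + j" and j: "j < length (jet_coord_list bdim fdim k)"
      using False i by (auto simp: j_def jet_dim_def)
    obtain I a where Ia: "jet_coord_list bdim fdim k ! j = (I, a)" by fastforce
    note I = jet_coord_list_nth[OF j Ia]
    define \<theta> where "\<theta> = (\<lambda>x. u (inv_into U' u' x))"
    define A where "A = u' ` (U' \<inter> U)"
    have A: "cart_open bdim A" unfolding A_def by (rule chart_open_image[OF dX chart_openin[OF cX]])
    \<comment> \<open>A point of \<open>\<Omega>0\<close> is a pair of new base coordinates \<open>x\<close> and old jet coordinates \<open>y\<close>, joined to one tuple.\<close>
    define \<Omega>0 where "\<Omega>0 = {z \<in> cart (bdim + ?N). trunc bdim z \<in> A}"
    have \<Omega>0: "cart_open (bdim + ?N) \<Omega>0" unfolding \<Omega>0_def by (rule cart_open_trunc_vimage[OF openin_topspace A])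
    have \<theta>s: "smooth_real_on (bdim + ?N) \<Omega>0 (\<lambda>z. \<theta> (trunc bdim z) l)" if "l < bdim" for l
      by (rule smooth_real_on_compose[OF \<Omega>0 A, where f = "\<lambda>x. \<theta> x l"])
        (use transition_smooth[OF X dX cX that] smooth_trunc[OF \<Omega>0] in \<open>auto simp: A_def \<theta>_def \<Omega>0_def\<close>)
    \<comment> \<open>The point of the section with jet coordinates \<open>y\<close> over the base point \<open>x\<close>, in the old chart of \<open>E\<close>.\<close>
    define G where "G = (\<lambda>z. glue bdim (\<theta> (trunc bdim z)) (\<lambda>b. if b < fdim then taylor_poly k (shift bdim z) b (\<theta> (trunc bdim z)) else 0))"
    have tp: "smooth_real_on (bdim + ?N) \<Omega>0 (\<lambda>z. if b < fdim then taylor_poly k (shift bdim z) b (\<theta> (trunc bdim z)) else 0)"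
      if "b < fdim" for b
      using smooth_taylor_poly_joint[OF \<Omega>0 smooth_shift[OF \<Omega>0] \<theta>s] that by simp
    have Gs: "smooth_real_on (bdim + ?N) \<Omega>0 (\<lambda>z. G z l)" if "l < bdim + fdim" for l
      unfolding G_def by (rule smooth_glue[OF \<theta>s tp that])
    have Gc: "G z \<in> cart (bdim + fdim)" for z
      unfolding G_def by (rule glue_cart) (simp add: cart_iff)
    have oV: "cart_open (bdim + fdim) (v ` (V \<inter> V'))" using chart_open_image[OF cE chart_openin[OF dE]] dim by simp
    define \<Omega> where "\<Omega> = \<Omega>0 \<inter> G -` (v ` (V \<inter> V'))"
    have \<Omega>: "cart_open (bdim + ?N) \<Omega>" unfolding \<Omega>_def
      by (rule cart_open_preimage[OF \<Omega>0 continuous_smooth_vector[OF \<Omega>0 Gc Gs] Gc oV])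
    have Gs': "smooth_real_on (bdim + ?N) \<Omega> (\<lambda>z. G z l)" if "l < bdim + fdim" for l
      by (rule smooth_real_on_subset[OF cart_open_subset[OF \<Omega>0] Gs[OF that]]) (simp add: \<Omega>_def)
    \<comment> \<open>Its fiber coordinate \<open>a\<close> in the new chart. The new jet coordinates are derivatives of \<open>K\<close> in the first variables.\<close>
    define K where "K = (\<lambda>z. v' (inv_into V v (G z)) (bdim + a))"
    have H: "smooth_real_on (bdim + fdim) (v ` (V \<inter> V')) (\<lambda>y. v' (inv_into V v y) (bdim + a))"
      using transition_smooth[OF E cE dE, of "bdim + a"] I(4) dim by simp
    have K: "smooth_real_on (bdim + ?N) \<Omega> K"
      unfolding K_def by (rule smooth_real_on_compose[OF \<Omega> oV _ H Gs']) (auto simp: \<Omega>_def)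
    have I': "set I \<subseteq> {..<bdim + ?N}" using I(1) by auto
    \<comment> \<open>The pair of the new base coordinates of the jet \<open>y\<close> and \<open>y\<close> itself.\<close>
    define \<iota> where "\<iota> = (\<lambda>y. glue bdim (u' (inv_into U u (trunc bdim y))) y)"
    have ucart: "u' q \<in> cart bdim" if "q \<in> U'" for q by (rule chart_inv(4)[OF dX that])
    have G_eq: "G (glue bdim (u' q) y) = glue bdim (u q) (\<lambda>b. if b < fdim then taylor_poly k y b (u q) else 0)" if "q \<in> U'" for q y
      unfolding G_def trunc_glue[OF ucart[OF that]] shift_glue \<theta>_def chart_inv(1)[OF dX that] ..
    have \<iota>\<Omega>: "\<iota> y \<in> \<Omega>" if y: "y \<in> Y" for y
    proof -
      obtain p s where s: "s \<in> sec p" "snd s p \<in> V \<inter> V'" "p \<in> U" "u p = trunc bdim y" using rep[OF y] by blast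
      have pU': "p \<in> U'" using fchart(3)[OF d, of "snd s p"] sec_proj[OF s(1)] s(2) by simp
      have \<iota>y: "\<iota> y = glue bdim (u' p) y" unfolding \<iota>_def base(1)[OF y s] ..
      have "G (\<iota> y) = trunc (bdim + fdim) y" unfolding \<iota>y G_eq[OF pU'] s(4) by (rule taylor_poly_value)
      moreover have "\<iota> y \<in> cart (bdim + ?N)" unfolding \<iota>_def by (rule glue_cart[OF Y_mem(1)[OF y]])
      moreover have "trunc bdim (\<iota> y) \<in> A" unfolding \<iota>y trunc_glue[OF ucart[OF pU']] A_def using pU' s(3) by blast
      ultimately show ?thesis using Y_mem(2)[OF y] by (simp add: \<Omega>_def \<Omega>0_def)
    qed
    have "smooth_real_on ?N Y (\<lambda>y. iterated_partial I K (\<iota> y))"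
    proof (rule smooth_real_on_compose[OF Y \<Omega> \<iota>\<Omega> smooth_real_on_iterated[OF K I']])
      show "smooth_real_on ?N Y (\<lambda>y. \<iota> y l)" if "l < bdim + ?N" for l
        unfolding \<iota>_def by (rule smooth_glue[OF base_smooth smooth_real_on_coord[OF Y] that])
    qed
    then show ?thesis
    proof (rule smooth_real_on_cong[OF Y, rotated])
      fix y assume y: "y \<in> Y"
      obtain p s T where s: "s \<in> sec p" "snd s p \<in> V \<inter> V'" "p \<in> U" "u p = trunc bdim y"
        and inv: "inv_into (jet_region k V) ?\<phi> y = jet_at E X \<pi> (int k) p s"
        and T: "cart_open bdim T" "u p \<in> T" "\<forall>x\<in>T. \<forall>a<fdim. scoord (U, u, V, v) s a x = taylor_poly k y a x"
        using rep[OF y] by blast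
      have pU': "p \<in> U'" using fchart(3)[OF d, of "snd s p"] sec_proj[OF s(1)] s(2) by simp
      define R where "R = sdom (U, u, V, v) V' s \<inter> (U \<inter> u -` T)"
      have "openin (mtop X) R" unfolding R_def
        using sdom_open[OF c s(1) chart_openin[OF dE]] chart_preimage_open[OF cX T(1)] by (rule openin_Int)
      then have S: "cart_open bdim (u' ` (U' \<inter> R))" by (rule chart_open_image[OF dX])
      have pS: "u' p \<in> u' ` (U' \<inter> R)" using pU' sdom_mem[OF c s(1,2)] s(3) T(2) by (simp add: R_def)
      have "iterated_partial I (scoord (U', u', V', v') s a) (u' p) = iterated_partial I (\<lambda>x. K (glue bdim x y)) (u' p)"
      proof (rule iterated_partial_cong[OF S I(1) _ pS])
        fix x assume "x \<in> u' ` (U' \<inter> R)"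
        then obtain q where q: "q \<in> U'" "q \<in> R" and x: "x = u' q" by blast
        have qs: "q \<in> sdom (U, u, V, v) V' s" and qT: "u q \<in> T" using q(2) by (simp_all add: R_def)
        have "(\<lambda>b. if b < fdim then taylor_poly k y b (u q) else 0) = (\<lambda>b. if b < fdim then scoord (U, u, V, v) s b (u q) else 0)"
          using T(3) qT by auto
        then show "scoord (U', u', V', v') s a x = K (glue bdim x y)"
          unfolding x K_def G_eq[OF q(1)] scoord_change[OF c d s(1) q(1) qs] chart_inv(1)[OF dX q(1)] by simp
      qed
      also have "\<dots> = iterated_partial I K (glue bdim (u' p) y)" by (rule iterated_partial_glue[OF I(1)])
      also have "glue bdim (u' p) y = \<iota> y" unfolding \<iota>_def base(1)[OF y s] ..
      finally show "iterated_partial I K (\<iota> y) = ?\<psi> (inv_into (jet_region k V) ?\<phi> y) i"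
        unfolding inv ij using jet_chart_map_eq[OF d s(1), of k] s(2) jcoord_simps(2)[OF j Ia] by simp
    qed
  qed
  then show ?thesis unfolding Y_def .
qed

definition jman :: "nat \<Rightarrow> ('x, 'e) jet manifold" where
  "jman k = \<lparr>mdim = jet_dim E X k, mtop = atlas_topology (jet_dim E X k) (jet_atlas E X \<pi> k), atlas = jet_atlas E X \<pi> k\<rparr>"

lemma jman_simps [simp]: "mdim (jman k) = jet_dim E X k" "atlas (jman k) = jet_atlas E X \<pi> k"
  "mtop (jman k) = atlas_topology (jet_dim E X k) (jet_atlas E X \<pi> k)"
  by (simp_all add: jman_def)

lemma jet_atlasE:
  assumes "(W, \<phi>) \<in> jet_atlas E X \<pi> k"
  obtains U u V v where "(U, u, V, v) \<in> fcharts" "W = jet_region k V" "\<phi> = jet_chart_map E X \<pi> k (U, u, V, v)"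
proof -
  obtain c where c: "W = jet_chart_domain E X \<pi> k c" "\<phi> = jet_chart_map E X \<pi> k c" "c \<in> fcharts"
    using assms unfolding jet_atlas_def by blast
  obtain U u V v where "c = (U, u, V, v)" by (cases c)
  then show ?thesis using that[of U u V v] c jet_chart_domain_eq by simp
qed

lemma jet_atlasI: "(U, u, V, v) \<in> fcharts \<Longrightarrow> (jet_region k V, jet_chart_map E X \<pi> k (U, u, V, v)) \<in> jet_atlas E X \<pi> k"
  unfolding jet_atlas_def using jet_chart_domain_eq by blast

lemma jet_atlas_chart:
  assumes "(W, \<phi>) \<in> jet_atlas E X \<pi> k" shows "inj_on \<phi> W \<and> cart_open (jet_dim E X k) (\<phi> ` W)"
proof -
  obtain U u V v where c: "(U, u, V, v) \<in> fcharts" "W = jet_region k V" "\<phi> = jet_chart_map E X \<pi> k (U, u, V, v)"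
    using assms by (rule jet_atlasE)
  have "V \<inter> points E = V" using chart_subset[OF fchart(2)[OF c(1)]] by blast
  then show ?thesis using c jet_chart_inj[OF c(1)] jet_chart_image_open[OF c(1), of "points E"] by simp
qed

lemma jet_atlas_transition:
  assumes "(W, \<phi>) \<in> jet_atlas E X \<pi> k" "(W', \<phi>') \<in> jet_atlas E X \<pi> k"
  shows "cart_open (jet_dim E X k) (\<phi> ` (W \<inter> W')) \<and> smooth_transition (jet_dim E X k) (W, \<phi>) (W', \<phi>')"
proof -
  obtain U u V v where c: "(U, u, V, v) \<in> fcharts" "W = jet_region k V" "\<phi> = jet_chart_map E X \<pi> k (U, u, V, v)"
    using assms(1) by (rule jet_atlasE)
  obtain U' u' V' v' where d: "(U', u', V', v') \<in> fcharts" "W' = jet_region k V'" "\<phi>' = jet_chart_map E X \<pi> k (U', u', V', v')"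
    using assms(2) by (rule jet_atlasE)
  show ?thesis
    unfolding smooth_transition_def prod.case c(2,3) d(2,3) jet_region_Int
    using jet_chart_image_open[OF c(1) chart_openin[OF fchart(2)[OF d(1)]]] jet_transition_smooth[OF c(1) d(1)] by blast
qed

lemma jet_atlas_charts: "jet_atlas E X \<pi> k \<subseteq> charts (jman k)"
  by (rule atlas_topology_charts[OF jet_atlas_chart jet_atlas_transition jman_def])

lemma jet_chart:
  "(U, u, V, v) \<in> fcharts \<Longrightarrow> (jet_region k V, jet_chart_map E X \<pi> k (U, u, V, v)) \<in> charts (jman k)"
  using jet_atlas_charts jet_atlasI by blast

lemma fst_jet_atlas: "\<Union> (fst ` jet_atlas E X \<pi> k) = jet_region k (points E)"
proof
  show "\<Union> (fst ` jet_atlas E X \<pi> k) \<subseteq> jet_region k (points E)"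
  proof
    fix z assume "z \<in> \<Union> (fst ` jet_atlas E X \<pi> k)"
    then obtain c where "c \<in> jet_atlas E X \<pi> k" "z \<in> fst c" by blast
    then obtain U u V v where "(U, u, V, v) \<in> fcharts" "z \<in> jet_region k V" by (metis jet_atlasE prod.collapse)
    then show "z \<in> jet_region k (points E)" using sec_points by (auto elim!: jet_regionE intro!: jet_regionI)
  qed
  show "jet_region k (points E) \<subseteq> \<Union> (fst ` jet_atlas E X \<pi> k)"
  proof
    fix z assume "z \<in> jet_region k (points E)"
    then obtain p s where s: "s \<in> sec p" "snd s p \<in> points E" "z = jet_at E X \<pi> (int k) p s" by (rule jet_regionE)
    obtain U u V v where c: "(U, u, V, v) \<in> fcharts" "snd s p \<in> V" using fibered_chart[OF s(2)] by blast
    then have "z \<in> fst (jet_region k V, jet_chart_map E X \<pi> k (U, u, V, v))" using s jet_regionI by simp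
    then show "z \<in> \<Union> (fst ` jet_atlas E X \<pi> k)" using jet_atlasI[OF c(1)] by blast
  qed
qed

lemma openin_jman:
  "openin (mtop (jman k)) S \<longleftrightarrow> S \<subseteq> jet_region k (points E) \<and>
    (\<forall>W \<phi>. (W, \<phi>) \<in> jet_atlas E X \<pi> k \<longrightarrow> cart_open (jet_dim E X k) (\<phi> ` (S \<inter> W)))"
  unfolding jman_simps fst_jet_atlas[symmetric]
  by (rule openin_atlas_topology[OF jet_atlas_chart jet_atlas_transition])

lemma jet_region_open:
  assumes "openin (mtop E) A" shows "openin (mtop (jman k)) (jet_region k A)"
  unfolding openin_jman
proof (intro conjI allI impI)
  show "jet_region k A \<subseteq> jet_region k (points E)" using openin_subset[OF assms] unfolding jet_region_def by blast
  fix W \<phi> assume "(W, \<phi>) \<in> jet_atlas E X \<pi> k"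
  then obtain U u V v where c: "(U, u, V, v) \<in> fcharts" "W = jet_region k V" "\<phi> = jet_chart_map E X \<pi> k (U, u, V, v)"
    by (rule jet_atlasE)
  show "cart_open (jet_dim E X k) (\<phi> ` (jet_region k A \<inter> W))"
    unfolding c(2,3) jet_region_Int Int_commute[of A V] by (rule jet_chart_image_open[OF c(1) assms])
qed

lemma points_jman: "points (jman k) = jet_region k (points E)"
proof
  show "points (jman k) \<subseteq> jet_region k (points E)" using openin_jman[of k "points (jman k)"] by simp
  show "jet_region k (points E) \<subseteq> points (jman k)" using openin_subset[OF jet_region_open[of "points E"]] by simp
qed

text \<open>Jets with different values are separated by open sets of the total space, jets with the same value
  lie in a common chart.\<close>

lemma Hausdorff_jman: "Hausdorff_space (mtop (jman k))"
  unfolding Hausdorff_space_def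
proof (intro allI impI)
  fix z z' assume "z \<in> points (jman k) \<and> z' \<in> points (jman k) \<and> z \<noteq> z'"
  then have z: "z \<in> jet_region k (points E)" "z' \<in> jet_region k (points E)" and ne: "z \<noteq> z'" unfolding points_jman by auto
  obtain p s where s: "s \<in> sec p" "snd s p \<in> points E" "z = jet_at E X \<pi> (int k) p s" using z(1) by (rule jet_regionE)
  obtain q t where t: "t \<in> sec q" "snd t q \<in> points E" "z' = jet_at E X \<pi> (int k) q t" using z(2) by (rule jet_regionE)
  show "\<exists>A B. openin (mtop (jman k)) A \<and> openin (mtop (jman k)) B \<and> z \<in> A \<and> z' \<in> B \<and> disjnt A B"
  proof (cases "snd s p = snd t q")
    case False
    have "Hausdorff_space (mtop E)" using E by (simp add: smooth_manifold_def)
    then obtain A B where AB: "openin (mtop E) A" "openin (mtop E) B" "snd s p \<in> A" "snd t q \<in> B" "disjnt A B"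
      using s(2) t(2) False unfolding Hausdorff_space_def by meson
    have "jet_region k A \<inter> jet_region k B = {}"
      unfolding jet_region_Int using AB(5) by (simp add: disjnt_def jet_region_def)
    then have "disjnt (jet_region k A) (jet_region k B)" unfolding disjnt_def .
    moreover have "z \<in> jet_region k A" "z' \<in> jet_region k B"
      using jet_regionI[OF s(1) AB(3)] jet_regionI[OF t(1) AB(4)] s(3) t(3) by simp_all
    ultimately show ?thesis using jet_region_open[OF AB(1)] jet_region_open[OF AB(2)] by blast
  next
    case True
    obtain U u V v where c: "(U, u, V, v) \<in> fcharts" "snd s p \<in> V" using fibered_chart[OF s(2)] by blast
    let ?\<phi> = "jet_chart_map E X \<pi> k (U, u, V, v)"
    have zV: "z \<in> jet_region k V" "z' \<in> jet_region k V" using s t c(2) True jet_regionI by auto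
    note ch = jet_chart[OF c(1), of k]
    have "?\<phi> z \<noteq> ?\<phi> z'" using jet_chart_inj[OF c(1), of k] zV ne by (auto dest: inj_onD)
    moreover have "?\<phi> z \<in> cart (jet_dim E X k)" "?\<phi> z' \<in> cart (jet_dim E X k)"
      using chart_inv(4)[OF ch] zV by auto
    ultimately obtain A B where AB: "cart_open (jet_dim E X k) A" "cart_open (jet_dim E X k) B" "?\<phi> z \<in> A" "?\<phi> z' \<in> B" "disjnt A B"
      using Hausdorff_Euclidean_space[of "jet_dim E X k"] unfolding Hausdorff_space_def by meson
    let ?P = "\<lambda>A. jet_region k V \<inter> ?\<phi> -` A"
    have "openin (mtop (jman k)) (?P A)" "openin (mtop (jman k)) (?P B)"
      using chart_preimage_open[OF ch] AB(1,2) by simp_all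
    moreover have "disjnt (?P A) (?P B)" using AB(5) by (auto simp: disjnt_iff)
    moreover have "z \<in> ?P A" "z' \<in> ?P B" using zV AB(3,4) by auto
    ultimately show ?thesis by blast
  qed
qed

text \<open>The atlas consists of all fibered charts and is uncountable. The total space is second countable,
  hence Lindelof, and already covered by countably many of them.\<close>

lemma second_countable_jman: "second_countable (mtop (jman k))"
proof -
  have "second_countable (mtop E)" using E by (simp add: smooth_manifold_def)
  then have "Lindelof_space (mtop E)" by (rule second_countable_imp_Lindelof_space)
  moreover define \<V> where "\<V> = {V. \<exists>U u v. (U, u, V, v) \<in> fcharts}"
  have o: "openin (mtop E) V" if "V \<in> \<V>" for V
    using that chart_openin fchart(2) unfolding \<V>_def by blast
  moreover have "\<Union>\<V> = points E"
  proof
    show "\<Union>\<V> \<subseteq> points E" using openin_subset[OF o] by (rule Sup_least)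
    show "points E \<subseteq> \<Union>\<V>"
    proof
      fix e assume "e \<in> points E"
      from fibered_chart[OF this] show "e \<in> \<Union>\<V>" unfolding \<V>_def by blast
    qed
  qed
  ultimately have "\<exists>\<W>. countable \<W> \<and> \<W> \<subseteq> \<V> \<and> \<Union>\<W> = points E"
    by (intro Lindelof_spaceD)
  then obtain \<W> where "countable \<W> \<and> \<W> \<subseteq> \<V> \<and> \<Union>\<W> = points E" ..
  then have \<W>: "countable \<W>" "\<W> \<subseteq> \<V>" "\<Union>\<W> = points E" by simp_all
  have "\<forall>V\<in>\<W>. \<exists>\<phi>. (jet_region k V, \<phi>) \<in> jet_atlas E X \<pi> k"
  proof
    fix V assume "V \<in> \<W>"
    then obtain U u v where "(U, u, V, v) \<in> fcharts" using \<W>(2) unfolding \<V>_def by blast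
    then have "(jet_region k V, jet_chart_map E X \<pi> k (U, u, V, v)) \<in> jet_atlas E X \<pi> k" by (rule jet_atlasI)
    then show "\<exists>\<phi>. (jet_region k V, \<phi>) \<in> jet_atlas E X \<pi> k" by - (rule exI)
  qed
  then obtain \<phi> where \<phi>: "\<And>V. V \<in> \<W> \<Longrightarrow> (jet_region k V, \<phi> V) \<in> jet_atlas E X \<pi> k" by metis
  show ?thesis
  proof (rule second_countable_charts[where C = "(\<lambda>V. (jet_region k V, \<phi> V)) ` \<W>"])
    show "countable ((\<lambda>V. (jet_region k V, \<phi> V)) ` \<W>)" using \<W>(1) by simp
    show "topological_chart (jman k) c" if "c \<in> (\<lambda>V. (jet_region k V, \<phi> V)) ` \<W>" for c
      using that \<phi> jet_atlas_charts[of k] by (intro chart_topological) blast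
    show "points (jman k) \<subseteq> \<Union> (fst ` (\<lambda>V. (jet_region k V, \<phi> V)) ` \<W>)"
    proof
      fix z assume "z \<in> points (jman k)"
      then have "z \<in> jet_region k (points E)" unfolding points_jman .
      then obtain p s where s: "s \<in> sec p" "snd s p \<in> points E" "z = jet_at E X \<pi> (int k) p s" by (rule jet_regionE)
      then obtain V where "V \<in> \<W>" "snd s p \<in> V" using \<W>(3) by blast
      then have "z \<in> jet_region k V" using s jet_regionI by simp
      then show "z \<in> \<Union> (fst ` (\<lambda>V. (jet_region k V, \<phi> V)) ` \<W>)" using \<open>V \<in> \<W>\<close> by (auto simp: image_image)
    qed
  qed
qed

lemma smooth_manifold_jman: "smooth_manifold (jman k)"
proof (rule smooth_manifoldI[OF Hausdorff_jman second_countable_jman])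
  show "atlas (jman k) \<subseteq> charts (jman k)" using jet_atlas_charts by simp
  show "\<exists>c\<in>atlas (jman k). z \<in> fst c" if "z \<in> points (jman k)" for z
  proof -
    have "z \<in> \<Union> (fst ` jet_atlas E X \<pi> k)" using that by (simp only: points_jman fst_jet_atlas)
    then show ?thesis unfolding jman_simps by blast
  qed
qed

subsection \<open>All orders at once\<close>

abbreviation "J \<equiv> jet_manifold E X \<pi>"

lemma J_cases: "i < 0 \<Longrightarrow> J i = transport_manifold Base X" "J 0 = transport_manifold Total E"
  "i > 0 \<Longrightarrow> J i = jman (nat i)"
  by (simp_all add: jet_manifold_def jman_def)

lemma inj_Base: "inj Base" and inj_Total: "inj Total"
  by (auto simp: inj_def)

lemma smooth_manifold_J: "smooth_manifold (J i)"
  using smooth_manifold_transport[OF X inj_Base] smooth_manifold_transport[OF E inj_Total] smooth_manifold_jman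
  by (cases i "0::int" rule: linorder_cases) (simp_all add: J_cases)

lemma points_J: "points (J i) = {jet_at E X \<pi> i p s |p s. s \<in> sec p}"
proof (cases i "0::int" rule: linorder_cases)
  case less
  have "Base p \<in> {jet_at E X \<pi> i p s |p s. s \<in> sec p}" if "p \<in> points X" for p
    using section_exists[OF that] less by (auto simp: jet_at_def) metis
  then show ?thesis using less sec(6) by (auto simp: J_cases points_transport[OF inj_Base] jet_at_def)
next
  case equal
  have "Total e \<in> {jet_at E X \<pi> i p s |p s. s \<in> sec p}" if "e \<in> points E" for e
    using section_through[OF that] equal by (auto simp: jet_at_def) metis
  then show ?thesis using equal sec_points by (auto simp: J_cases points_transport[OF inj_Total] jet_at_def)
next
  case greater
  then have "points (J i) = jet_region (nat i) (points E)" by (simp only: J_cases points_jman)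
  also have "\<dots> = {jet_at E X \<pi> i p s |p s. s \<in> sec p}"
    unfolding jet_region_def using greater sec_points by fastforce
  finally show ?thesis .
qed

lemma points_JI: "s \<in> sec p \<Longrightarrow> jet_at E X \<pi> i p s \<in> points (J i)"
  unfolding points_J by blast

lemma points_JE:
  assumes "z \<in> points (J i)"
  obtains p s where "s \<in> sec p" "z = jet_at E X \<pi> i p s"
  using assms unfolding points_J by blast

text \<open>Charts of the jet spaces of all orders induced by one fibered chart, including the orders \<open>-1\<close> and \<open>0\<close>,
  at which the manifolds are \<open>X\<close> and \<open>E\<close>.\<close>

definition lev_dom :: "int \<Rightarrow> ('x, 'e) fchart \<Rightarrow> ('x, 'e) jet set" where
  "lev_dom i = (\<lambda>(U, u, V, v). if i < 0 then Base ` U else if i = 0 then Total ` V else jet_region (nat i) V)"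

definition lev_map :: "int \<Rightarrow> ('x, 'e) fchart \<Rightarrow> ('x, 'e) jet \<Rightarrow> nat \<Rightarrow> real" where
  "lev_map i = (\<lambda>(U, u, V, v). if i < 0 then u \<circ> inv_into UNIV Base else if i = 0 then v \<circ> inv_into UNIV Total
     else jet_chart_map E X \<pi> (nat i) (U, u, V, v))"

lemma lev_chart:
  assumes c: "(U, u, V, v) \<in> fcharts"
  shows "(lev_dom i (U, u, V, v), lev_map i (U, u, V, v)) \<in> charts (J i)"
  using chart_transport[OF X inj_Base fchart(1)[OF c]] chart_transport[OF E inj_Total fchart(2)[OF c]] jet_chart[OF c]
  by (cases i "0::int" rule: linorder_cases) (simp_all add: J_cases lev_dom_def lev_map_def)

lemma jet_dim_mono: "k \<le> l \<Longrightarrow> jet_dim E X k \<le> jet_dim E X l"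
  using jet_coord_list_prefix[of k l bdim fdim] by (auto simp: jet_dim_def)

lemma jet_dim_0: "jet_dim E X 0 = bdim + fdim"
  by (simp add: jet_dim_def jet_coord_list_0)

lemma jcoord_trunc:
  assumes "l \<le> k" shows "trunc (jet_dim E X l) (jcoord k (U, u, V, v) p s) = jcoord l (U, u, V, v) p s"
proof
  fix i
  obtain ys where ys: "jet_coord_list bdim fdim k = jet_coord_list bdim fdim l @ ys" using jet_coord_list_prefix[OF assms] by blast
  have "jcoord k (U, u, V, v) p s i = jcoord l (U, u, V, v) p s i" if "i < jet_dim E X l"
  proof (cases "i < bdim")
    case False
    then have "i - bdim < length (jet_coord_list bdim fdim l)" using that by (simp add: jet_dim_def)
    then have "jet_coord_list bdim fdim k ! (i - bdim) = jet_coord_list bdim fdim l ! (i - bdim)" using ys by (simp add: nth_append)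
    moreover have "i < jet_dim E X k" using that jet_dim_mono[OF assms] by simp
    ultimately show ?thesis using that False by (simp add: jcoord_def)
  qed (simp add: jcoord_simps)
  moreover have "jcoord l (U, u, V, v) p s i = 0" if "\<not> i < jet_dim E X l"
    using jcoord_simps(3)[of l U u V v p s] that by (simp add: cart_iff)
  ultimately show "trunc (jet_dim E X l) (jcoord k (U, u, V, v) p s) i = jcoord l (U, u, V, v) p s i"
    by (simp add: trunc_def)
qed

lemma mdim_J:
  assumes c: "(U, u, V, v) \<in> fcharts" and "e \<in> V"
  shows "mdim (J i) = (if i < 0 then bdim else jet_dim E X (nat i))"
  using fchart(5)[OF c assms(2)] by (cases i "0::int" rule: linorder_cases) (simp_all add: J_cases jet_dim_0)

lemma mdim_J_mono:
  assumes c: "(U, u, V, v) \<in> fcharts" and "e \<in> V" and "i \<le> j" shows "mdim (J i) \<le> mdim (J j)"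
  unfolding mdim_J[OF c assms(2)] using assms(3) jet_dim_mono[of "nat i" "nat j"] jet_dim_mono[of 0 "nat j"] jet_dim_0
  by auto

lemma lev_value:
  assumes c: "(U, u, V, v) \<in> fcharts" and s: "s \<in> sec p" "snd s p \<in> V" and k: "i \<le> int k"
  shows "jet_at E X \<pi> i p s \<in> lev_dom i (U, u, V, v)"
    and "lev_map i (U, u, V, v) (jet_at E X \<pi> i p s) = trunc (mdim (J i)) (jcoord k (U, u, V, v) p s)"
proof -
  have pU: "p \<in> U" using fchart(3)[OF c s(2)] sec_proj[OF s(1)] by simp
  have "jet_at E X \<pi> i p s \<in> lev_dom i (U, u, V, v) \<and>
    lev_map i (U, u, V, v) (jet_at E X \<pi> i p s) = trunc (mdim (J i)) (jcoord k (U, u, V, v) p s)"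
  proof (cases i "0::int" rule: linorder_cases)
    case less
    have "u p = trunc bdim (jcoord k (U, u, V, v) p s)"
      using chart_inv(4)[OF fchart(1)[OF c] pU] by (auto simp: trunc_def jcoord_simps cart_iff fun_eq_iff)
    then show ?thesis using less pU by (simp add: lev_dom_def lev_map_def jet_at_def J_cases inv_f_f[OF inj_Base])
  next
    case equal
    then show ?thesis using s jcoord_low[OF c s, of k] fchart(5)[OF c s(2)]
      by (simp add: lev_dom_def lev_map_def jet_at_def J_cases inv_f_f[OF inj_Total])
  next
    case greater
    then have i: "int (nat i) = i" "nat i \<le> k" using k by auto
    have "jet_chart_map E X \<pi> (nat i) (U, u, V, v) (jet_at E X \<pi> i p s) = jcoord (nat i) (U, u, V, v) p s"
      using jet_chart_map_eq[OF c s, of "nat i"] i(1) by simp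
    moreover have "jet_at E X \<pi> i p s \<in> jet_region (nat i) V" using jet_regionI[OF s, of "nat i"] i(1) by simp
    ultimately show ?thesis using greater jcoord_trunc[OF i(2)] by (simp add: lev_dom_def lev_map_def J_cases)
  qed
  then show "jet_at E X \<pi> i p s \<in> lev_dom i (U, u, V, v)"
    "lev_map i (U, u, V, v) (jet_at E X \<pi> i p s) = trunc (mdim (J i)) (jcoord k (U, u, V, v) p s)" by auto
qed

lemma lev_value_same:
  assumes c: "(U, u, V, v) \<in> fcharts" and s: "s \<in> sec p" "snd s p \<in> V"
  shows "lev_map (int k) (U, u, V, v) (jet_at E X \<pi> (int k) p s) = jcoord k (U, u, V, v) p s"
  using lev_value(2)[OF c s order_refl] jcoord_trunc[OF order_refl] mdim_J[OF c s(2), of "int k"] by simp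

lemma lev_domE:
  assumes c: "(U, u, V, v) \<in> fcharts" and z: "z \<in> lev_dom (int k) (U, u, V, v)"
  obtains p s where "s \<in> sec p" "snd s p \<in> V" "z = jet_at E X \<pi> (int k) p s"
proof (cases "k = 0")
  case True
  then obtain e where e: "e \<in> V" "z = Total e" using z by (auto simp: lev_dom_def)
  have eE: "e \<in> points E" using e(1) chart_subset[OF fchart(2)[OF c]] by blast
  obtain s where "s \<in> sec (\<pi> e)" "snd s (\<pi> e) = e" by (rule section_through[OF eE])
  then show ?thesis using that[of s "\<pi> e"] e True by (simp add: jet_at_def)
next
  case False
  then have "z \<in> jet_region k V" using z by (simp add: lev_dom_def)
  then show ?thesis using that by (rule jet_regionE)
qed

subsection \<open>Projections between jet spaces\<close>

lemma jet_at_project: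
  assumes s: "s \<in> sec p" and t: "t \<in> sec q" and ij: "i \<le> j" and eq: "jet_at E X \<pi> j p s = jet_at E X \<pi> j q t"
  shows "p = q \<and> jet_at E X \<pi> i p s = jet_at E X \<pi> i q t"
proof (cases "j < 0")
  case True
  then show ?thesis using eq ij by (simp add: jet_at_def)
next
  case False
  define k where "k = nat j"
  have k: "j = int k" using False by (simp add: k_def)
  have pq: "p = q" using jet_at_value[OF s t] eq k by simp
  have e: "jet_equivalent E X \<pi> (enat k) p s t" using jet_at_eq_iff[OF s t, of k] eq unfolding k by blast
  show ?thesis
  proof (cases "i < 0")
    case True
    then show ?thesis using pq by (simp add: jet_at_def)
  next
    case False
    then have "jet_equivalent E X \<pi> (enat (nat i)) p s t" using jet_equivalent_mono[OF e] ij k by simp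
    then have "jet_at E X \<pi> (int (nat i)) p s = jet_at E X \<pi> (int (nat i)) q t"
      using jet_at_eq_iff[OF s t, of "nat i"] pq by blast
    then show ?thesis using pq False by simp
  qed
qed

lemma jet_projection_jet_at:
  assumes s: "s \<in> sec p" and ij: "i \<le> j"
  shows "jet_projection E X \<pi> i j (jet_at E X \<pi> j p s) = jet_at E X \<pi> i p s"
proof -
  let ?P = "\<lambda>(q, t). q \<in> points X \<and> t \<in> sec q \<and> jet_at E X \<pi> j p s = jet_at E X \<pi> j q t"
  obtain q t where qt: "(SOME r. ?P r) = (q, t)" by (rule prod.exhaust)
  have "?P (p, s)" using s sec(6) by simp
  then have "?P (SOME r. ?P r)" by (rule someI)
  then have t: "t \<in> sec q" "jet_at E X \<pi> j p s = jet_at E X \<pi> j q t" unfolding qt by auto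
  have "jet_projection E X \<pi> i j (jet_at E X \<pi> j p s) = jet_at E X \<pi> i q t"
    unfolding jet_projection_def qt Let_def prod.case ..
  moreover have "jet_at E X \<pi> i p s = jet_at E X \<pi> i q t" using jet_at_project[OF s t(1) ij t(2)] by blast
  ultimately show ?thesis by (rule trans[OF _ sym])
qed

text \<open>The choice of a representative in the definition is harmless, because sections that are equivalent
  to infinite order have the same jets of finite order.\<close>

lemma infinite_jet_projection_class:
  assumes s: "s \<in> sec p"
  shows "infinite_jet_projection E X \<pi> i (jet_class E X \<pi> \<infinity> p s) = jet_at E X \<pi> i p s"
proof -
  let ?P = "\<lambda>(q, t). q \<in> points X \<and> t \<in> sec q \<and> jet_class E X \<pi> \<infinity> p s = jet_class E X \<pi> \<infinity> q t"
  obtain q t where qt: "(SOME r. ?P r) = (q, t)" by (rule prod.exhaust)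
  have "?P (p, s)" using s sec(6) by simp
  then have "?P (SOME r. ?P r)" by (rule someI)
  then have t: "t \<in> sec q" "jet_class E X \<pi> \<infinity> p s = jet_class E X \<pi> \<infinity> q t" unfolding qt by auto
  then have pq: "p = q" and e: "jet_equivalent E X \<pi> \<infinity> p s t" using jet_class_eq_iff[OF s] by auto
  have "jet_equivalent E X \<pi> (enat (nat i)) p s t" by (rule jet_equivalent_mono[OF e]) simp
  then have "jet_at E X \<pi> (int (nat i)) p s = jet_at E X \<pi> (int (nat i)) q t"
    using jet_at_eq_iff[OF s t(1), of "nat i"] pq by blast
  moreover have "i \<le> int (nat i)" by simp
  ultimately have "jet_at E X \<pi> i p s = jet_at E X \<pi> i q t" using jet_at_project[OF s t(1)] by blast
  moreover have "infinite_jet_projection E X \<pi> i (jet_class E X \<pi> \<infinity> p s) = jet_at E X \<pi> i q t"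
    unfolding infinite_jet_projection_def qt Let_def prod.case ..
  ultimately show ?thesis by metis
qed

lemma jet_projection_id: "z \<in> points (J i) \<Longrightarrow> jet_projection E X \<pi> i i z = z"
  using jet_projection_jet_at by (auto elim!: points_JE)

text \<open>In the charts induced by a fibered chart, a projection forgets the last coordinates.\<close>

lemma smooth_at_jet_projection:
  assumes ij: "i < j" "0 \<le> j" and z: "z \<in> points (J j)"
  shows "smooth_at (J j) (J i) (jet_projection E X \<pi> i j) z"
proof -
  obtain p s where s: "s \<in> sec p" "z = jet_at E X \<pi> j p s" using z by (rule points_JE)
  obtain U u V v where c: "(U, u, V, v) \<in> fcharts" "snd s p \<in> V" using fibered_chart[OF sec_points[OF s(1)]] by blast
  define k where "k = nat j"
  have k: "j = int k" using ij by (simp add: k_def)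
  note cj = lev_chart[OF c(1), of j] and ci = lev_chart[OF c(1), of i]
  let ?T = "lev_map j (U, u, V, v) ` lev_dom j (U, u, V, v)"
  have T: "cart_open (mdim (J j)) ?T" by (rule chart_image_open[OF cj])
  have zj: "z \<in> lev_dom j (U, u, V, v)" using lev_value(1)[OF c(1) s(1) c(2), of j k] s(2) k by simp
  have rep: "jet_projection E X \<pi> i j (inv_into (lev_dom j (U, u, V, v)) (lev_map j (U, u, V, v)) y) \<in> lev_dom i (U, u, V, v) \<and>
    lev_map i (U, u, V, v) (jet_projection E X \<pi> i j (inv_into (lev_dom j (U, u, V, v)) (lev_map j (U, u, V, v)) y)) = trunc (mdim (J i)) y"
    if y: "y \<in> ?T" for y
  proof -
    let ?w = "inv_into (lev_dom j (U, u, V, v)) (lev_map j (U, u, V, v)) y"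
    have "?w \<in> lev_dom (int k) (U, u, V, v)" using chart_inv(2)[OF cj y] k by simp
    then obtain q t where t: "t \<in> sec q" "snd t q \<in> V" "?w = jet_at E X \<pi> (int k) q t" by (rule lev_domE[OF c(1)])
    have "y = jcoord k (U, u, V, v) q t" using chart_inv(3)[OF cj y] t(3) lev_value_same[OF c(1) t(1,2)] k by simp
    then show ?thesis
      using lev_value[OF c(1) t(1,2), of i k] jet_projection_jet_at[OF t(1), of i j] t(3) ij k by simp
  qed
  show ?thesis
  proof (rule smooth_atI[OF cj ci zj T])
    show "smooth_real_on (mdim (J j)) ?T (\<lambda>y. lev_map i (U, u, V, v) (jet_projection E X \<pi> i j
        (inv_into (lev_dom j (U, u, V, v)) (lev_map j (U, u, V, v)) y)) l)" for l
      by (rule smooth_real_on_cong[OF T _ smooth_trunc[OF T, of "mdim (J i)" l]]) (simp add: rep)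
  qed (use rep zj in auto)
qed

lemma smooth_map_jet_projection:
  assumes "-1 \<le> i" "i \<le> j" shows "smooth_map (J j) (J i) (jet_projection E X \<pi> i j)"
  unfolding smooth_map_iff[OF smooth_manifold_J smooth_manifold_J]
proof
  fix z assume z: "z \<in> points (J j)"
  show "smooth_at (J j) (J i) (jet_projection E X \<pi> i j) z"
  proof (cases "i = j")
    case True
    have "smooth_at (J i) (J i) (jet_projection E X \<pi> i i) z" if "z \<in> points (J i)"
      by (rule smooth_at_cong[OF smooth_at_id[OF smooth_manifold_J that] openin_topspace that])
        (simp add: jet_projection_id)
    then show ?thesis using z True by simp
  qed (use assms smooth_at_jet_projection z in auto)
qed

text \<open>The remaining coordinates are frozen at their values at \<open>z\<close>. This is a smooth right inverse of the
  projection near the image of \<open>z\<close>.\<close>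

lemma jet_projection_local_section:
  assumes ij: "i < j" "0 \<le> j" and z: "z \<in> points (J j)"
  shows "\<exists>g B. smooth_at (J i) (J j) g (jet_projection E X \<pi> i j z) \<and> g (jet_projection E X \<pi> i j z) = z \<and>
    openin (mtop (J i)) B \<and> jet_projection E X \<pi> i j z \<in> B \<and> (\<forall>w\<in>B. jet_projection E X \<pi> i j (g w) = w)"
proof -
  obtain p s where s: "s \<in> sec p" "z = jet_at E X \<pi> j p s" using z by (rule points_JE)
  obtain U u V v where c: "(U, u, V, v) \<in> fcharts" "snd s p \<in> V" using fibered_chart[OF sec_points[OF s(1)]] by blast
  define k where "k = nat j"
  have k: "j = int k" using ij by (simp add: k_def)
  let ?c = "(U, u, V, v)"
  note cj = lev_chart[OF c(1), of j] and ci = lev_chart[OF c(1), of i]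
  let ?Dj = "lev_dom j ?c" and ?\<phi>j = "lev_map j ?c" and ?Di = "lev_dom i ?c" and ?\<phi>i = "lev_map i ?c"
  let ?m = "mdim (J i)" and ?n = "mdim (J j)"
  define y0 where "y0 = jcoord k ?c p s"
  have mn: "?m \<le> ?n" using mdim_J_mono[OF c] ij by simp
  have zj: "z \<in> ?Dj" using lev_value(1)[OF c(1) s(1) c(2), of j k] s(2) k by simp
  have y0: "?\<phi>j z = y0" using lev_value_same[OF c(1) s(1) c(2), of k] s(2) k by (simp add: y0_def)
  have y0c: "y0 \<in> cart ?n" using chart_inv(4)[OF cj zj] y0 by simp
  let ?w = "jet_projection E X \<pi> i j z"
  have w: "?w = jet_at E X \<pi> i p s" using jet_projection_jet_at[OF s(1), of i j] s(2) ij by simp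
  have wi: "?w \<in> ?Di" "?\<phi>i ?w = trunc ?m y0"
    unfolding w y0_def using lev_value[OF c(1) s(1) c(2), of i k] ij k by simp_all
  define G where "G y = (\<lambda>l. if l < ?m then y l else y0 l)" for y
  have Gc: "G y \<in> cart ?n" for y using y0c mn by (auto simp: G_def cart_iff)
  have oi: "cart_open ?m (?\<phi>i ` ?Di)" by (rule chart_image_open[OF ci])
  have Gs: "smooth_real_on ?m S (\<lambda>y. G y l)" if "cart_open ?m S" for S l
    using that by (cases "l < ?m") (simp_all add: G_def smooth_real_on_coord smooth_real_on_const)
  define T where "T = ?\<phi>i ` ?Di \<inter> G -` (?\<phi>j ` ?Dj)"
  have T: "cart_open ?m T" unfolding T_def
    by (rule cart_open_preimage[OF oi continuous_smooth_vector[OF oi Gc Gs[OF oi]] Gc chart_image_open[OF cj]])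
  have G0: "G (trunc ?m y0) = y0" by (auto simp: G_def trunc_def)
  have wT: "?\<phi>i ?w \<in> T" using wi G0 zj y0 unfolding T_def by (metis IntI imageI vimageI)
  define g where "g w = inv_into ?Dj ?\<phi>j (G (?\<phi>i w))" for w
  have gD: "g w \<in> ?Dj" "?\<phi>j (g w) = G (?\<phi>i w)" if "?\<phi>i w \<in> T" for w
    using that chart_inv(2,3)[OF cj, of "G (?\<phi>i w)"] by (simp_all add: T_def g_def)
  have inv: "?\<phi>i (inv_into ?Di ?\<phi>i y) = y" if "y \<in> T" for y
    using that chart_inv(3)[OF ci, of y] by (simp add: T_def)
  have 1: "smooth_at (J i) (J j) g ?w"
  proof (rule smooth_atI[OF ci cj wi(1) T wT])
    show "T \<subseteq> ?\<phi>i ` ?Di" by (simp add: T_def)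
    show "g (inv_into ?Di ?\<phi>i y) \<in> ?Dj" if "y \<in> T" for y using gD(1) inv[OF that] that by simp
    show "smooth_real_on ?m T (\<lambda>y. ?\<phi>j (g (inv_into ?Di ?\<phi>i y)) l)" for l
      by (rule smooth_real_on_cong[OF T _ Gs[OF T, of l]]) (simp add: gD(2) inv)
  qed
  have "g ?w = inv_into ?Dj ?\<phi>j (?\<phi>j z)" unfolding g_def wi(2) G0 y0 ..
  then have 2: "g ?w = z" using chart_inv(1)[OF cj zj] by simp
  let ?B = "?Di \<inter> ?\<phi>i -` T"
  have 3: "openin (mtop (J i)) ?B" by (rule chart_preimage_open[OF ci T])
  have 4: "jet_projection E X \<pi> i j (g w) = w" if w: "w \<in> ?B" for w
  proof -
    have "g w \<in> lev_dom (int k) ?c" using gD(1)[of w] w k by simp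
    then obtain q t where t: "t \<in> sec q" "snd t q \<in> V" "g w = jet_at E X \<pi> (int k) q t" by (rule lev_domE[OF c(1)])
    have "G (?\<phi>i w) = jcoord k ?c q t" using gD(2)[of w] w t(3) lev_value_same[OF c(1) t(1,2)] k by simp
    moreover have "trunc ?m (G (?\<phi>i w)) = ?\<phi>i w"
      using chart_inv(4)[OF ci, of w] w by (auto simp: G_def trunc_def cart_iff fun_eq_iff)
    moreover have "jet_projection E X \<pi> i j (g w) = jet_at E X \<pi> i q t"
      using jet_projection_jet_at[OF t(1), of i j] t(3) ij k by simp
    ultimately have "jet_projection E X \<pi> i j (g w) \<in> ?Di" "?\<phi>i (jet_projection E X \<pi> i j (g w)) = ?\<phi>i w"
      using lev_value[OF c(1) t(1,2), of i k] ij k by simp_all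
    then show ?thesis using chart_inj[OF ci] w by (auto dest: inj_onD)
  qed
  show ?thesis using 1 2 3 4 wi(1) wT by blast
qed

lemma surjective_submersion_jet_projection:
  assumes ij: "-1 \<le> i" "i \<le> j" shows "surjective_submersion (J j) (J i) (jet_projection E X \<pi> i j)"
  unfolding surjective_submersion_def
proof
  show "submersion (J j) (J i) (jet_projection E X \<pi> i j)"
  proof (rule submersionI[OF smooth_manifold_J smooth_manifold_J smooth_map_jet_projection[OF ij]])
    fix z assume z: "z \<in> points (J j)"
    show "\<exists>g B. smooth_at (J i) (J j) g (jet_projection E X \<pi> i j z) \<and> g (jet_projection E X \<pi> i j z) = z \<and>
      openin (mtop (J i)) B \<and> jet_projection E X \<pi> i j z \<in> B \<and> (\<forall>y\<in>B. jet_projection E X \<pi> i j (g y) = y)"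
    proof (cases "i = j")
      case True
      then show ?thesis using z jet_projection_id smooth_at_id[OF smooth_manifold_J z]
        by (intro exI[of _ "\<lambda>x. x"] exI[of _ "points (J i)"]) auto
    next
      case False
      then show ?thesis using jet_projection_local_section[of i j z] ij z by auto
    qed
  qed
  show "jet_projection E X \<pi> i j ` points (J j) = points (J i)"
  proof
    show "jet_projection E X \<pi> i j ` points (J j) \<subseteq> points (J i)"
      using jet_projection_jet_at ij(2) points_JI by (auto elim!: points_JE)
    show "points (J i) \<subseteq> jet_projection E X \<pi> i j ` points (J j)"
    proof
      fix w assume "w \<in> points (J i)"
      then obtain p s where s: "s \<in> sec p" "w = jet_at E X \<pi> i p s" by (rule points_JE)
      then have "w = jet_projection E X \<pi> i j (jet_at E X \<pi> j p s)" using jet_projection_jet_at ij(2) by simp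
      then show "w \<in> jet_projection E X \<pi> i j ` points (J j)" using points_JI[OF s(1)] by blast
    qed
  qed
qed

lemma jet_projection_compose:
  assumes "i \<le> j" "j \<le> k" "z \<in> points (J k)"
  shows "jet_projection E X \<pi> i j (jet_projection E X \<pi> j k z) = jet_projection E X \<pi> i k z"
proof -
  obtain p s where "s \<in> sec p" "z = jet_at E X \<pi> k p s" using assms(3) by (rule points_JE)
  then show ?thesis using jet_projection_jet_at assms(1,2) by simp
qed

lemma smooth_projective_system_jets:
  "smooth_projective_system {-1..} J (jet_projection E X \<pi>)"
  unfolding smooth_projective_system_def
proof (intro conjI ballI allI impI)
  show "order_isomorphic_to_nat ({-1..} :: int set)"
    unfolding order_isomorphic_to_nat_def
  proof (intro exI[of _ "\<lambda>n. int n - 1"] conjI)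
    show "range (\<lambda>n. int n - 1) = {-1..}"
    proof
      show "{-1..} \<subseteq> range (\<lambda>n. int n - 1)"
      proof
        fix x :: int assume "x \<in> {-1..}"
        then have "x = int (nat (x + 1)) - 1" by simp
        then show "x \<in> range (\<lambda>n. int n - 1)" by (rule range_eqI)
      qed
    qed auto
  qed (simp add: strict_mono_def)
  show "surjective_submersion (J j) (J i) (jet_projection E X \<pi> i j)" if "i \<in> {-1..}" "i \<le> j" for i j
    using that by (intro surjective_submersion_jet_projection) auto
qed (use smooth_manifold_J jet_projection_id jet_projection_compose in auto)

end

section \<open>Locally ringed spaces of functions\<close>

lemma function_algebra_simps [simp]:
  "carrier (function_algebra U A) = A"
  "f \<otimes>\<^bsub>function_algebra U A\<^esub> g = (\<lambda>x\<in>U. f x * g x)"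
  "f \<oplus>\<^bsub>function_algebra U A\<^esub> g = (\<lambda>x\<in>U. f x + g x)"
  "\<one>\<^bsub>function_algebra U A\<^esub> = (\<lambda>x\<in>U. 1)" "\<zero>\<^bsub>function_algebra U A\<^esub> = (\<lambda>x\<in>U. 0)"
  "c \<odot>\<^bsub>function_algebra U A\<^esub> f = (\<lambda>x\<in>U. c * f x)"
  by (simp_all add: function_algebra_def)

text \<open>Functions on \<open>U\<close> are represented by extensional functions, and all operations restrict to \<open>U\<close>. Thus the
  ring axioms reduce to those of the real numbers.\<close>

lemma cring_function_algebra:
  assumes ext: "A \<subseteq> extensional U" and const: "\<And>c. (\<lambda>x\<in>U. c) \<in> A"
    and add: "\<And>f g. f \<in> A \<Longrightarrow> g \<in> A \<Longrightarrow> (\<lambda>x\<in>U. f x + g x) \<in> A"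
    and mult: "\<And>f g. f \<in> A \<Longrightarrow> g \<in> A \<Longrightarrow> (\<lambda>x\<in>U. f x * g x) \<in> A"
  shows "cring (function_algebra U A)"
proof -
  have r: "(\<lambda>x\<in>U. f x) = f" if "f \<in> A" for f using that ext by (simp add: extensional_restrict subset_iff)
  have zero: "(\<lambda>x\<in>U. (\<lambda>x\<in>U. 0) x + f x) = f" "(\<lambda>x\<in>U. (\<lambda>x\<in>U. 1) x * f x) = f" if "f \<in> A" for f
    using that ext by (auto simp: restrict_def fun_eq_iff extensional_def)
  have neg: "\<exists>y\<in>carrier (function_algebra U A). y \<oplus>\<^bsub>function_algebra U A\<^esub> f = \<zero>\<^bsub>function_algebra U A\<^esub>"
    if "f \<in> carrier (function_algebra U A)" for f
  proof (rule bexI)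
    show "(\<lambda>x\<in>U. (\<lambda>x\<in>U. -1) x * f x) \<in> carrier (function_algebra U A)"
      using mult[OF const] that by simp
  qed (auto simp: restrict_def)
  have "abelian_group (function_algebra U A)"
  proof (rule abelian_groupI[OF _ _ _ _ _ neg], unfold function_algebra_simps)
    show "(\<lambda>x\<in>U. f x + g x) \<in> A" if "f \<in> A" "g \<in> A" for f g using that by (rule add)
    show "(\<lambda>x\<in>U. 0) \<in> A" by (rule const)
    show "(\<lambda>x\<in>U. (\<lambda>x\<in>U. 0) x + f x) = f" if "f \<in> A" for f using that by (rule zero)
  qed (auto simp: restrict_def fun_eq_iff)
  moreover have "comm_monoid (function_algebra U A)"
  proof (rule comm_monoidI, unfold function_algebra_simps)
    show "(\<lambda>x\<in>U. f x * g x) \<in> A" if "f \<in> A" "g \<in> A" for f g using that by (rule mult)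
    show "(\<lambda>x\<in>U. 1) \<in> A" by (rule const)
    show "(\<lambda>x\<in>U. (\<lambda>x\<in>U. 1) x * f x) = f" if "f \<in> A" for f using that by (rule zero)
  qed (auto simp: restrict_def fun_eq_iff)
  ultimately show ?thesis
    by (rule cringI) (auto simp: restrict_def fun_eq_iff algebra_simps)
qed

lemma cring_real_field: "cring real_field"
proof (rule cringI)
  show "abelian_group real_field"
    by (rule abelian_groupI) (auto simp: real_field_def intro: exI[of _ "- _"])
  show "comm_monoid real_field" by (rule comm_monoidI) (auto simp: real_field_def)
qed (auto simp: real_field_def algebra_simps)

lemma algebra_function_algebra:
  assumes "cring (function_algebra U A)" "A \<subseteq> extensional U" "\<And>c f. f \<in> A \<Longrightarrow> (\<lambda>x\<in>U. c * f x) \<in> A"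
  shows "Module.algebra real_field (function_algebra U A)"
proof -
  have r: "(\<lambda>x\<in>U. f x) = f" if "f \<in> A" for f using that assms(2) by (simp add: extensional_restrict subset_iff)
  have one: "(\<lambda>x\<in>U. 1 * f x) = f" if "f \<in> A" for f using r[OF that] by simp
  show ?thesis
  proof (rule algebraI[OF cring_real_field assms(1)], unfold function_algebra_simps)
    show "(\<lambda>x\<in>U. c * f x) \<in> A" if "f \<in> A" for c f using that by (rule assms(3))
    show "(\<lambda>x\<in>U. \<one>\<^bsub>real_field\<^esub> * f x) = f" if "f \<in> A" for f
      using r[OF that] by (simp add: real_field_def)
  qed (auto simp: real_field_def restrict_def fun_eq_iff algebra_simps)
qed

text \<open>A sheaf of real functions that is defined by a property of germs. It consists of local rings as
  soon as a function with that property can be inverted near each point where it does not vanish.\<close>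

locale function_sheaf =
  fixes M :: "('p, 'p \<Rightarrow> real) ringed_space" and P :: "'p topology" and L :: "'p \<Rightarrow> ('p \<Rightarrow> real) \<Rightarrow> bool"
  assumes space: "space_top M = P"
    and sections: "\<And>U. openin P U \<Longrightarrow> sections M U = function_algebra U {f \<in> extensional U. \<forall>x\<in>U. L x f}"
    and restr: "restr M = (\<lambda>U V f. restrict f V)"
    and cong: "\<And>W x f g. openin P W \<Longrightarrow> x \<in> W \<Longrightarrow> (\<And>y. y \<in> W \<Longrightarrow> f y = g y) \<Longrightarrow> L x f \<Longrightarrow> L x g"
    and const: "\<And>x c. x \<in> topspace P \<Longrightarrow> L x (\<lambda>_. c)"
    and add: "\<And>x f g. L x f \<Longrightarrow> L x g \<Longrightarrow> L x (\<lambda>y. f y + g y)"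
    and mult: "\<And>x f g. L x f \<Longrightarrow> L x g \<Longrightarrow> L x (\<lambda>y. f y * g y)"
    and inverse: "\<And>x f. L x f \<Longrightarrow> f x \<noteq> 0 \<Longrightarrow> L x (\<lambda>y. inverse (f y))"
    and nonzero: "\<And>x f. L x f \<Longrightarrow> f x \<noteq> 0 \<Longrightarrow> \<exists>W. openin P W \<and> x \<in> W \<and> (\<forall>y\<in>W. f y \<noteq> 0)"
begin

definition loc :: "'p set \<Rightarrow> ('p \<Rightarrow> real) set" where
  "loc U = {f \<in> extensional U. \<forall>x\<in>U. L x f}"

lemma restrict_loc:
  assumes "openin P U" "\<And>x. x \<in> U \<Longrightarrow> L x f" shows "(\<lambda>x\<in>U. f x) \<in> loc U"
  using assms cong[OF assms(1), of _ f "\<lambda>x\<in>U. f x"] by (simp add: loc_def)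

lemma sections_loc: "openin P U \<Longrightarrow> sections M U = function_algebra U (loc U)"
  using sections by (simp add: loc_def)

lemma loc_extensional: "loc U \<subseteq> extensional U"
  by (auto simp: loc_def)

lemma loc_const: "openin P U \<Longrightarrow> (\<lambda>x\<in>U. c) \<in> loc U"
  using openin_subset const by (intro restrict_loc) blast+

lemma loc_add: "openin P U \<Longrightarrow> f \<in> loc U \<Longrightarrow> g \<in> loc U \<Longrightarrow> (\<lambda>x\<in>U. f x + g x) \<in> loc U"
  by (intro restrict_loc add) (auto simp: loc_def)

lemma loc_mult: "openin P U \<Longrightarrow> f \<in> loc U \<Longrightarrow> g \<in> loc U \<Longrightarrow> (\<lambda>x\<in>U. f x * g x) \<in> loc U"
  by (intro restrict_loc mult) (auto simp: loc_def)

lemma loc_restrict: "openin P V \<Longrightarrow> V \<subseteq> U \<Longrightarrow> f \<in> loc U \<Longrightarrow> restrict f V \<in> loc V"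
  using restrict_loc[of V f] by (auto simp: loc_def)

lemma loc_restrict_self: "f \<in> loc U \<Longrightarrow> restrict f U = f"
  by (simp add: loc_def extensional_restrict)

lemma presheaf: "presheaf_of_algebras M"
  unfolding presheaf_of_algebras_def space restr
proof (intro conjI allI impI)
  fix U assume U: "openin P U"
  have "cring (function_algebra U (loc U))"
    by (rule cring_function_algebra[OF loc_extensional loc_const[OF U] loc_add[OF U] loc_mult[OF U]])
  then show "Module.algebra real_field (sections M U)"
    unfolding sections_loc[OF U]
  proof (rule algebra_function_algebra[OF _ loc_extensional])
    fix c f assume "f \<in> loc U"
    from loc_mult[OF U loc_const[OF U] this, of c] show "(\<lambda>x\<in>U. c * f x) \<in> loc U"
      by (simp add: restrict_def cong: if_cong)
  qed
  show "\<forall>s\<in>carrier (sections M U). restrict s U = s" using loc_restrict_self by (simp add: sections_loc[OF U])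
next
  fix U V assume a: "openin P U \<and> openin P V \<and> V \<subseteq> U"
  then have U: "openin P U" and V: "openin P V" and VU: "V \<subseteq> U" by auto
  show "(\<lambda>f. restrict f V) \<in> ring_hom (sections M U) (sections M V)"
    unfolding sections_loc[OF U] sections_loc[OF V]
    using VU loc_restrict[OF V VU] by (intro ring_hom_memI) (auto simp: restrict_def fun_eq_iff)
  show "\<forall>s\<in>carrier (sections M U). restrict (c \<odot>\<^bsub>sections M U\<^esub> s) V = c \<odot>\<^bsub>sections M V\<^esub> restrict s V" for c
    unfolding sections_loc[OF U] sections_loc[OF V] using VU by (auto simp: restrict_def fun_eq_iff)
next
  fix U V W assume a: "openin P U \<and> openin P V \<and> openin P W \<and> W \<subseteq> V \<and> V \<subseteq> U"
  then show "\<forall>s\<in>carrier (sections M U). restrict (restrict s V) W = restrict s W"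
    by (auto simp: restrict_def fun_eq_iff)
qed

lemma sheaf: "sheaf_of_algebras M"
  unfolding sheaf_of_algebras_def space restr
proof (intro conjI presheaf allI impI)
  fix \<U> :: "'p set set" and s :: "'p set \<Rightarrow> 'p \<Rightarrow> real"
  assume a: "(\<forall>U\<in>\<U>. openin P U \<and> s U \<in> carrier (sections M U)) \<and>
    (\<forall>U\<in>\<U>. \<forall>V\<in>\<U>. restrict (s U) (U \<inter> V) = restrict (s V) (U \<inter> V))"
  have o: "openin P U" and sU: "s U \<in> loc U" if "U \<in> \<U>" for U
    using a that sections_loc by auto
  have agr: "s U x = s V x" if "U \<in> \<U>" "V \<in> \<U>" "x \<in> U" "x \<in> V" for U V x
  proof -
    have "restrict (s U) (U \<inter> V) x = restrict (s V) (U \<inter> V) x" using a that by metis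
    then show ?thesis using that by simp
  qed
  have oU: "openin P (\<Union>\<U>)" using o by blast
  define t where "t = (\<lambda>x\<in>\<Union>\<U>. s (SOME U. U \<in> \<U> \<and> x \<in> U) x)"
  have t: "t x = s U x" if "U \<in> \<U>" "x \<in> U" for U x
  proof -
    have "(SOME U. U \<in> \<U> \<and> x \<in> U) \<in> \<U> \<and> x \<in> (SOME U. U \<in> \<U> \<and> x \<in> U)"
      by (rule someI[of _ U]) (use that in simp)
    then show ?thesis using that agr[of "SOME U. U \<in> \<U> \<and> x \<in> U" U x] by (auto simp: t_def)
  qed
  show "\<exists>!t. t \<in> carrier (sections M (\<Union>\<U>)) \<and> (\<forall>U\<in>\<U>. restrict t U = s U)"
  proof (rule ex1I)
    have "L x t" if x: "x \<in> \<Union>\<U>" for x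
    proof -
      obtain U where U: "U \<in> \<U>" "x \<in> U" using x by blast
      then have "L x (s U)" using sU[OF U(1)] by (simp add: loc_def)
      then show ?thesis by (rule cong[OF o[OF U(1)] U(2), rotated]) (simp add: t[OF U(1)])
    qed
    moreover have "t \<in> extensional (\<Union>\<U>)" by (simp add: t_def)
    ultimately have "t \<in> loc (\<Union>\<U>)" unfolding loc_def by blast
    moreover have "restrict t U = s U" if "U \<in> \<U>" for U
    proof
      fix x show "restrict t U x = s U x"
        using t[OF that, of x] sU[OF that] by (cases "x \<in> U") (auto simp: loc_def extensional_def)
    qed
    ultimately show "t \<in> carrier (sections M (\<Union>\<U>)) \<and> (\<forall>U\<in>\<U>. restrict t U = s U)"
      by (simp add: sections_loc[OF oU])
    fix t' assume t': "t' \<in> carrier (sections M (\<Union>\<U>)) \<and> (\<forall>U\<in>\<U>. restrict t' U = s U)"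
    show "t' = t"
    proof
      fix x
      show "t' x = t x"
      proof (cases "x \<in> \<Union>\<U>")
        case True
        then obtain U where U: "U \<in> \<U>" "x \<in> U" by blast
        then have "restrict t' U x = s U x" using t' by simp
        then show ?thesis using t[OF U] U by simp
      next
        case False
        then show ?thesis using t' by (auto simp: sections_loc[OF oU] loc_def extensional_def t_def)
      qed
    qed
  qed
qed

subsection \<open>Stalks\<close>

text \<open>The stalk at \<open>p\<close> is the homomorphic image of the ring of all functions that are sections near \<open>p\<close>,
  which saves handling domains of definition.\<close>

definition near :: "'p \<Rightarrow> ('p \<Rightarrow> real) set" where
  "near p = {f. \<exists>U. openin P U \<and> p \<in> U \<and> (\<forall>x\<in>U. L x f)}"

definition germ_of :: "'p \<Rightarrow> ('p \<Rightarrow> real) \<Rightarrow> ('p set \<times> ('p \<Rightarrow> real)) set" where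
  "germ_of p f = {(V, t) \<in> local_sections_at M p. \<exists>W. openin P W \<and> p \<in> W \<and> W \<subseteq> V \<and> (\<forall>x\<in>W. f x = t x)}"

lemma local_sections_iff: "(U, s) \<in> local_sections_at M p \<longleftrightarrow> openin P U \<and> p \<in> U \<and> s \<in> loc U"
  by (auto simp: local_sections_at_def space sections_loc)

lemma restrict_eq_iff: "restrict s W = restrict t W \<longleftrightarrow> (\<forall>x\<in>W. s x = t x)"
  by (metis restrict_apply' restrict_ext)

lemma germ_eq:
  assumes "(U, s) \<in> local_sections_at M p" shows "germ M p U s = germ_of p s"
proof -
  have U: "openin P U" "p \<in> U" using assms local_sections_iff by auto
  have "(\<exists>W. openin P W \<and> p \<in> W \<and> W \<subseteq> U \<inter> V \<and> restrict s W = restrict t W) \<longleftrightarrow>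
    (\<exists>W. openin P W \<and> p \<in> W \<and> W \<subseteq> V \<and> (\<forall>x\<in>W. s x = t x))" (is "?A \<longleftrightarrow> ?B") for V t
  proof
    assume ?A then show ?B unfolding restrict_eq_iff by blast
  next
    assume ?B
    then obtain W where W: "openin P W" "p \<in> W" "W \<subseteq> V" "\<forall>x\<in>W. s x = t x" by blast
    then have "openin P (W \<inter> U) \<and> p \<in> W \<inter> U \<and> W \<inter> U \<subseteq> U \<inter> V \<and> restrict s (W \<inter> U) = restrict t (W \<inter> U)"
      using U unfolding restrict_eq_iff by auto
    then show ?A by blast
  qed
  then show ?thesis unfolding germ_def germ_of_def space restr by simp
qed

lemma germ_of_cong:
  assumes "openin P W" "p \<in> W" "\<And>x. x \<in> W \<Longrightarrow> f x = g x"
  shows "germ_of p f = germ_of p g"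
proof -
  have "germ_of p f \<subseteq> germ_of p g" if fg: "\<forall>x\<in>W. f x = g x" for f g
  proof
    fix z assume z: "z \<in> germ_of p f"
    obtain V t where Vt: "z = (V, t)" by (rule prod.exhaust)
    obtain W' where W': "openin P W'" "p \<in> W'" "W' \<subseteq> V" "\<forall>x\<in>W'. f x = t x" and l: "(V, t) \<in> local_sections_at M p"
      using z unfolding Vt germ_of_def by blast
    have "openin P (W' \<inter> W) \<and> p \<in> W' \<inter> W \<and> W' \<inter> W \<subseteq> V \<and> (\<forall>x\<in>W' \<inter> W. g x = t x)"
      using W' fg assms(1,2) by auto
    then show "z \<in> germ_of p g" using l unfolding Vt germ_of_def by blast
  qed
  then show ?thesis using assms(3) by (metis subset_antisym)
qed

lemma near_section:
  assumes "f \<in> near p" obtains U where "openin P U" "p \<in> U" "(U, restrict f U) \<in> germ_of p f"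
    "(U, restrict f U) \<in> local_sections_at M p"
proof -
  obtain U where U: "openin P U" "p \<in> U" "\<forall>x\<in>U. L x f" using assms unfolding near_def by blast
  have l: "(U, restrict f U) \<in> local_sections_at M p" using restrict_loc[OF U(1)] U local_sections_iff by blast
  moreover from l have "(U, restrict f U) \<in> germ_of p f"
    unfolding germ_of_def using U(1,2) by auto
  ultimately show ?thesis using that U by blast
qed

lemma germ_of_eq_iff:
  assumes "f \<in> near p" "g \<in> near p"
  shows "germ_of p f = germ_of p g \<longleftrightarrow> (\<exists>W. openin P W \<and> p \<in> W \<and> (\<forall>x\<in>W. f x = g x))"
proof
  assume eq: "germ_of p f = germ_of p g"
  obtain U where U: "openin P U" "p \<in> U" "(U, restrict f U) \<in> germ_of p f" using assms(1) by (rule near_section)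
  then have "(U, restrict f U) \<in> germ_of p g" using eq by simp
  then obtain W where W: "openin P W" "p \<in> W" "W \<subseteq> U" "\<forall>x\<in>W. g x = restrict f U x" unfolding germ_of_def by blast
  then have "\<forall>x\<in>W. f x = g x" by auto
  then show "\<exists>W. openin P W \<and> p \<in> W \<and> (\<forall>x\<in>W. f x = g x)" using W by blast
next
  assume "\<exists>W. openin P W \<and> p \<in> W \<and> (\<forall>x\<in>W. f x = g x)"
  then show "germ_of p f = germ_of p g" using germ_of_cong by blast
qed

lemma local_section_near: "(U, s) \<in> local_sections_at M p \<Longrightarrow> s \<in> near p"
  unfolding local_sections_iff near_def loc_def by blast

lemma carrier_stalk: "carrier (stalk M p) = germ_of p ` near p"
proof
  show "carrier (stalk M p) \<subseteq> germ_of p ` near p"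
    unfolding stalk_def using germ_eq local_section_near by auto
  show "germ_of p ` near p \<subseteq> carrier (stalk M p)"
  proof
    fix z assume "z \<in> germ_of p ` near p"
    then obtain f where f: "f \<in> near p" "z = germ_of p f" by blast
    obtain U where U: "openin P U" "p \<in> U" "(U, restrict f U) \<in> local_sections_at M p" using f(1) by (rule near_section)
    have "germ_of p f = germ_of p (restrict f U)" by (rule germ_of_cong[OF U(1,2)]) simp
    then have "z = germ M p U (restrict f U)" using germ_eq[OF U(3)] f(2) by simp
    then show "z \<in> carrier (stalk M p)" unfolding stalk_def using U(3) by auto
  qed
qed

text \<open>All members of the union that defines an operation of the stalk are equal, since two
  representatives of a germ agree near \<open>p\<close>. It remains to exhibit one member, for which a restriction
  of the given functions serves.\<close>

lemma stalk_operation: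
  assumes f: "f \<in> near p" and g: "g \<in> near p"
    and h: "\<And>U V s t. openin P U \<Longrightarrow> openin P V \<Longrightarrow> s \<in> loc U \<Longrightarrow> t \<in> loc V \<Longrightarrow>
      h U V s t \<in> loc (U \<inter> V) \<and> (\<forall>x\<in>U \<inter> V. h U V s t x = k (s x) (t x))"
  shows "(\<Union>(U, s)\<in>germ_of p f. \<Union>(V, t)\<in>germ_of p g. germ M p (U \<inter> V) (h U V s t)) = germ_of p (\<lambda>x. k (f x) (g x))"
proof -
  have *: "germ M p (U \<inter> V) (h U V s t) = germ_of p (\<lambda>x. k (f x) (g x))"
    if s: "(U, s) \<in> germ_of p f" and t: "(V, t) \<in> germ_of p g" for U s V t
  proof -
    obtain W where W: "openin P W" "p \<in> W" "W \<subseteq> U" "\<forall>x\<in>W. f x = s x" and ls: "openin P U" "p \<in> U" "s \<in> loc U"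
      using s unfolding germ_of_def local_sections_iff by blast
    obtain W' where W': "openin P W'" "p \<in> W'" "W' \<subseteq> V" "\<forall>x\<in>W'. g x = t x" and lt: "openin P V" "p \<in> V" "t \<in> loc V"
      using t unfolding germ_of_def local_sections_iff by blast
    note h = h[OF ls(1) lt(1) ls(3) lt(3)]
    have "(U \<inter> V, h U V s t) \<in> local_sections_at M p"
      unfolding local_sections_iff using h ls lt by auto
    then have "germ M p (U \<inter> V) (h U V s t) = germ_of p (h U V s t)" by (rule germ_eq)
    also have "\<dots> = germ_of p (\<lambda>x. k (f x) (g x))"
    proof (rule germ_of_cong)
      show "openin P (W \<inter> W')" "p \<in> W \<inter> W'" using W W' by auto
      fix x assume "x \<in> W \<inter> W'"
      then have "x \<in> U \<inter> V" "f x = s x" "g x = t x" using W W' by auto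
      then show "h U V s t x = k (f x) (g x)" using h by simp
    qed
    finally show ?thesis .
  qed
  obtain U where U: "(U, restrict f U) \<in> germ_of p f" using f by (rule near_section)
  obtain V where V: "(V, restrict g V) \<in> germ_of p g" using g by (rule near_section)
  show ?thesis
  proof
    show "(\<Union>(U, s)\<in>germ_of p f. \<Union>(V, t)\<in>germ_of p g. germ M p (U \<inter> V) (h U V s t)) \<subseteq> germ_of p (\<lambda>x. k (f x) (g x))"
      using * by auto
    show "germ_of p (\<lambda>x. k (f x) (g x)) \<subseteq> (\<Union>(U, s)\<in>germ_of p f. \<Union>(V, t)\<in>germ_of p g. germ M p (U \<inter> V) (h U V s t))"
    proof
      fix z assume "z \<in> germ_of p (\<lambda>x. k (f x) (g x))"
      then have "z \<in> germ M p (U \<inter> V) (h U V (restrict f U) (restrict g V))" using *[OF U V] by simp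
      then show "z \<in> (\<Union>(U, s)\<in>germ_of p f. \<Union>(V, t)\<in>germ_of p g. germ M p (U \<inter> V) (h U V s t))"
        by (rule_tac UN_I[OF U], simp only: prod.case, rule_tac UN_I[OF V], simp only: prod.case)
    qed
  qed
qed

lemma stalk_mult:
  assumes "f \<in> near p" "g \<in> near p"
  shows "germ_of p f \<otimes>\<^bsub>stalk M p\<^esub> germ_of p g = germ_of p (\<lambda>x. f x * g x)"
  unfolding stalk_def monoid.simps restr
proof (rule stalk_operation[OF assms, where k = "(*)"])
  fix U V s t assume U: "openin P U" "openin P V" "s \<in> loc U" "t \<in> loc V"
  have UV: "openin P (U \<inter> V)" using U(1,2) by (rule openin_Int)
  have "(\<lambda>x\<in>U \<inter> V. restrict s (U \<inter> V) x * restrict t (U \<inter> V) x) \<in> loc (U \<inter> V)"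
    by (rule loc_mult[OF UV loc_restrict[OF UV _ U(3)] loc_restrict[OF UV _ U(4)]]) auto
  then show "restrict s (U \<inter> V) \<otimes>\<^bsub>sections M (U \<inter> V)\<^esub> restrict t (U \<inter> V) \<in> loc (U \<inter> V) \<and>
    (\<forall>x\<in>U \<inter> V. (restrict s (U \<inter> V) \<otimes>\<^bsub>sections M (U \<inter> V)\<^esub> restrict t (U \<inter> V)) x = s x * t x)"
    unfolding sections_loc[OF UV] function_algebra_simps by simp
qed

lemma stalk_add:
  assumes "f \<in> near p" "g \<in> near p"
  shows "germ_of p f \<oplus>\<^bsub>stalk M p\<^esub> germ_of p g = germ_of p (\<lambda>x. f x + g x)"
  unfolding stalk_def ring.simps restr
proof (rule stalk_operation[OF assms, where k = "(+)"])
  fix U V s t assume U: "openin P U" "openin P V" "s \<in> loc U" "t \<in> loc V"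
  have UV: "openin P (U \<inter> V)" using U(1,2) by (rule openin_Int)
  have "(\<lambda>x\<in>U \<inter> V. restrict s (U \<inter> V) x + restrict t (U \<inter> V) x) \<in> loc (U \<inter> V)"
    by (rule loc_add[OF UV loc_restrict[OF UV _ U(3)] loc_restrict[OF UV _ U(4)]]) auto
  then show "restrict s (U \<inter> V) \<oplus>\<^bsub>sections M (U \<inter> V)\<^esub> restrict t (U \<inter> V) \<in> loc (U \<inter> V) \<and>
    (\<forall>x\<in>U \<inter> V. (restrict s (U \<inter> V) \<oplus>\<^bsub>sections M (U \<inter> V)\<^esub> restrict t (U \<inter> V)) x = s x + t x)"
    unfolding sections_loc[OF UV] function_algebra_simps by simp
qed

lemma germ_of_const:
  assumes p: "p \<in> topspace P" shows "germ M p (topspace P) (\<lambda>x\<in>topspace P. c) = germ_of p (\<lambda>_. c)"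
proof -
  have "(topspace P, \<lambda>x\<in>topspace P. c) \<in> local_sections_at M p"
    unfolding local_sections_iff using loc_const[OF openin_topspace] p by simp
  from germ_eq[OF this] show ?thesis by (rule trans) (rule germ_of_cong[OF openin_topspace p], simp)
qed

lemma stalk_one: "p \<in> topspace P \<Longrightarrow> \<one>\<^bsub>stalk M p\<^esub> = germ_of p (\<lambda>_. 1)"
  and stalk_zero: "p \<in> topspace P \<Longrightarrow> \<zero>\<^bsub>stalk M p\<^esub> = germ_of p (\<lambda>_. 0)"
  unfolding stalk_def monoid.simps ring.simps space sections_loc[OF openin_topspace] function_algebra_simps
  by (erule germ_of_const)+

lemma near_const: "p \<in> topspace P \<Longrightarrow> (\<lambda>_. c) \<in> near p"
  unfolding near_def using const by blast

lemma near_binary: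
  assumes "f \<in> near p" "g \<in> near p" "\<And>x. L x f \<Longrightarrow> L x g \<Longrightarrow> L x (\<lambda>y. k (f y) (g y))"
  shows "(\<lambda>x. k (f x) (g x)) \<in> near p"
proof -
  obtain U V where "openin P U" "p \<in> U" "\<forall>x\<in>U. L x f" "openin P V" "p \<in> V" "\<forall>x\<in>V. L x g"
    using assms(1,2) unfolding near_def by blast
  then have "openin P (U \<inter> V) \<and> p \<in> U \<inter> V \<and> (\<forall>x\<in>U \<inter> V. L x (\<lambda>y. k (f y) (g y)))"
    using assms(3) by auto
  then show ?thesis unfolding near_def by blast
qed

lemma near_add: "f \<in> near p \<Longrightarrow> g \<in> near p \<Longrightarrow> (\<lambda>x. f x + g x) \<in> near p"
  by (rule near_binary) (auto intro: add)

lemma near_mult: "f \<in> near p \<Longrightarrow> g \<in> near p \<Longrightarrow> (\<lambda>x. f x * g x) \<in> near p"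
  by (rule near_binary) (auto intro: mult)

lemma near_inverse:
  assumes "f \<in> near p" "f p \<noteq> 0" shows "(\<lambda>x. inverse (f x)) \<in> near p"
proof -
  obtain U where U: "openin P U" "p \<in> U" "\<forall>x\<in>U. L x f" using assms unfolding near_def by blast
  then obtain W where "openin P W" "p \<in> W" "\<forall>y\<in>W. f y \<noteq> 0" using nonzero[of p f] assms(2) by blast
  then have "openin P (U \<inter> W) \<and> p \<in> U \<inter> W \<and> (\<forall>x\<in>U \<inter> W. L x (\<lambda>x. inverse (f x)))" using U inverse by auto
  then show ?thesis unfolding near_def by blast
qed

lemma cring_stalk:
  assumes p: "p \<in> topspace P" shows "cring (stalk M p)"
proof (rule cringI)
  note simps = carrier_stalk stalk_add stalk_mult stalk_one[OF p] stalk_zero[OF p] near_add near_mult near_const[OF p]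
  have neg: "\<exists>y\<in>carrier (stalk M p). y \<oplus>\<^bsub>stalk M p\<^esub> x = \<zero>\<^bsub>stalk M p\<^esub>" if x: "x \<in> carrier (stalk M p)" for x
  proof -
    obtain f where f: "f \<in> near p" "x = germ_of p f" using x[unfolded carrier_stalk] by blast
    have "(\<lambda>x. (-1) * f x) \<in> near p" by (rule near_mult[OF near_const[OF p] f(1)])
    then show ?thesis using f by (intro bexI[of _ "germ_of p (\<lambda>x. (-1) * f x)"]) (auto simp: simps)
  qed
  show "abelian_group (stalk M p)"
    by (rule abelian_groupI[OF _ _ _ _ _ neg]) (auto simp: simps ac_simps)
  show "comm_monoid (stalk M p)"
    by (rule comm_monoidI) (auto simp: simps ac_simps)
qed (auto simp: carrier_stalk stalk_add stalk_mult near_add near_mult algebra_simps)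

text \<open>The germs of functions that vanish at \<open>p\<close> are the only maximal ideal, because all other germs are
  invertible.\<close>

lemma local_ring_stalk:
  assumes p: "p \<in> topspace P" shows "local_ring (stalk M p)"
proof -
  let ?R = "stalk M p"
  interpret R: cring ?R by (rule cring_stalk[OF p])
  note simps = carrier_stalk stalk_add stalk_mult stalk_one[OF p] stalk_zero[OF p] near_add near_mult near_const[OF p]
  define I where "I = germ_of p ` {f \<in> near p. f p = 0}"
  have in_I: "germ_of p f \<in> I \<longleftrightarrow> f p = 0" if f: "f \<in> near p" for f
  proof
    assume "germ_of p f \<in> I"
    then obtain g where g: "g \<in> near p" "g p = 0" "germ_of p f = germ_of p g" unfolding I_def by blast
    then obtain W where "p \<in> W" "\<forall>x\<in>W. f x = g x" using germ_of_eq_iff[OF f g(1)] by blast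
    then show "f p = 0" using g(2) by simp
  qed (use f I_def in blast)
  have IR: "I \<subseteq> carrier ?R" unfolding I_def carrier_stalk by blast
  have id: "ideal I ?R"
  proof (rule idealI[OF R.ring_axioms])
    show "subgroup I (add_monoid ?R)"
    proof (rule R.add.subgroupI)
      show "I \<subseteq> carrier ?R" by (rule IR)
      show "I \<noteq> {}" using in_I[OF near_const[OF p, of 0]] by blast
      show "a \<oplus>\<^bsub>?R\<^esub> b \<in> I" if "a \<in> I" "b \<in> I" for a b
      proof -
        obtain f g where fg: "f \<in> near p" "f p = 0" "a = germ_of p f" "g \<in> near p" "g p = 0" "b = germ_of p g"
          using \<open>a \<in> I\<close> \<open>b \<in> I\<close> unfolding I_def by blast
        then show ?thesis using in_I[OF near_add[OF fg(1,4)]] by (simp add: stalk_add)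
      qed
      show "\<ominus>\<^bsub>?R\<^esub> a \<in> I" if "a \<in> I" for a
      proof -
        obtain f where f: "f \<in> near p" "f p = 0" "a = germ_of p f" using \<open>a \<in> I\<close> unfolding I_def by blast
        have m: "(\<lambda>x. (-1) * f x) \<in> near p" by (rule near_mult[OF near_const[OF p] f(1)])
        have "germ_of p (\<lambda>x. (-1) * f x) \<oplus>\<^bsub>?R\<^esub> a = \<zero>\<^bsub>?R\<^esub>" using m f by (simp add: simps)
        then have "\<ominus>\<^bsub>?R\<^esub> a = germ_of p (\<lambda>x. (-1) * f x)"
          using m f by (intro R.minus_equality) (auto simp: carrier_stalk)
        then show ?thesis using in_I[OF m] f(2) by simp
      qed
    qed
    fix a x assume ax: "a \<in> I" "x \<in> carrier ?R"
    then obtain f g where fg: "f \<in> near p" "f p = 0" "a = germ_of p f" "g \<in> near p" "x = germ_of p g"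
      unfolding I_def carrier_stalk by blast
    show "x \<otimes>\<^bsub>?R\<^esub> a \<in> I" "a \<otimes>\<^bsub>?R\<^esub> x \<in> I"
      using fg in_I[OF near_mult[OF fg(4,1)]] in_I[OF near_mult[OF fg(1,4)]] by (simp_all add: stalk_mult)
  qed
  have one: "\<one>\<^bsub>?R\<^esub> \<notin> I" using in_I[OF near_const[OF p, of 1]] by (simp add: stalk_one[OF p])
  have unit: "J = carrier ?R" if J: "ideal J ?R" and a: "a \<in> J" "a \<notin> I" for J a
  proof -
    interpret J: ideal J ?R by (rule J)
    obtain f where f: "f \<in> near p" "a = germ_of p f" using a(1) J.Icarr by (auto simp: carrier_stalk)
    have fp: "f p \<noteq> 0" using in_I[OF f(1)] a(2) f(2) by simp
    have i: "(\<lambda>x. inverse (f x)) \<in> near p" by (rule near_inverse[OF f(1) fp])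
    obtain U where U: "openin P U" "p \<in> U" "\<forall>x\<in>U. L x f" using f(1) unfolding near_def by blast
    obtain W where W: "openin P W" "p \<in> W" "\<forall>y\<in>W. f y \<noteq> 0" using nonzero[of p f] U fp by blast
    have "a \<otimes>\<^bsub>?R\<^esub> germ_of p (\<lambda>x. inverse (f x)) = germ_of p (\<lambda>x. f x * inverse (f x))"
      unfolding f(2) by (rule stalk_mult[OF f(1) i])
    also have "\<dots> = \<one>\<^bsub>?R\<^esub>" unfolding stalk_one[OF p] by (rule germ_of_cong[OF W(1,2)]) (use W(3) in simp)
    finally have "\<one>\<^bsub>?R\<^esub> = a \<otimes>\<^bsub>?R\<^esub> germ_of p (\<lambda>x. inverse (f x))" ..
    also have "\<dots> \<in> J" by (rule J.I_r_closed[OF a(1)]) (use i in \<open>simp add: carrier_stalk\<close>)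
    finally show ?thesis by (rule J.one_imp_carrier)
  qed
  have max: "maximalideal I ?R"
  proof (rule maximalidealI[OF id])
    show "carrier ?R \<noteq> I" using one R.one_closed by blast
    show "J = I \<or> J = carrier ?R" if "ideal J ?R" "I \<subseteq> J" for J using unit[OF that(1)] that(2) by blast
  qed
  moreover have "I' = I" if I': "maximalideal I' ?R" for I'
  proof -
    interpret I': maximalideal I' ?R by (rule I')
    have "I' \<subseteq> I" using unit[OF I'.is_ideal] I'.I_notcarr by blast
    then show ?thesis using I'.I_maximal[OF id _ IR] one R.one_closed by blast
  qed
  ultimately show ?thesis unfolding local_ring_def using R.cring_axioms by blast
qed

lemma locally_ringed: "locally_ringed_space M"
  unfolding locally_ringed_space_def using sheaf local_ring_stalk by (simp add: space)

end

section \<open>The space of infinite jets\<close>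

context jet_bundle
begin

abbreviation "P \<equiv> infinite_jet_topology E X \<pi>"
abbreviation "Jinf \<equiv> infinite_jets E X \<pi>"
abbreviation "q \<equiv> infinite_jet_projection E X \<pi>"

lemma infinite_jetE:
  assumes "z \<in> Jinf" obtains p s where "s \<in> sec p" "z = jet_class E X \<pi> \<infinity> p s"
  using assms unfolding infinite_jets_def by blast

lemma infinite_jetI: "s \<in> sec p \<Longrightarrow> jet_class E X \<pi> \<infinity> p s \<in> Jinf"
  unfolding infinite_jets_def using sec(6) by blast

lemma infinite_jet_projection_points: "z \<in> Jinf \<Longrightarrow> q i z \<in> points (J i)"
  using infinite_jetE[of z] infinite_jet_projection_class points_JI by metis

lemma jet_projection_infinite:
  assumes "i \<le> j" "z \<in> Jinf" shows "jet_projection E X \<pi> i j (q j z) = q i z"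
  using infinite_jetE[OF assms(2)] infinite_jet_projection_class jet_projection_jet_at[OF _ assms(1)] by metis

text \<open>An infinite jet is determined by its finite order jets, because two sections are equivalent to
  infinite order if they are equivalent to every finite order.\<close>

lemma infinite_jet_eqI:
  assumes z: "z \<in> Jinf" and w: "w \<in> Jinf" and eq: "\<And>k. q (int k) z = q (int k) w"
  shows "z = w"
proof -
  obtain p s where s: "s \<in> sec p" and zs: "z = jet_class E X \<pi> \<infinity> p s" using z by (rule infinite_jetE)
  obtain r t where t: "t \<in> sec r" and wt: "w = jet_class E X \<pi> \<infinity> r t" using w by (rule infinite_jetE)
  have "jet_at E X \<pi> (int k) p s = jet_at E X \<pi> (int k) r t" for k
    using eq[of k] unfolding zs wt infinite_jet_projection_class[OF s] infinite_jet_projection_class[OF t] .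
  then have "p = r \<and> jet_equivalent E X \<pi> (enat k) p s t" for k using jet_at_eq_iff[OF s t] by blast
  then show ?thesis unfolding zs wt jet_class_eq_iff[OF s t] jet_equivalent_infinity by blast
qed

text \<open>Conversely, every compatible family of finite order jets comes from an infinite jet. In a fibered
  chart around the underlying point of \<open>E\<close> the family prescribes all partial derivatives of the fiber
  coordinates at one point, and by Borel's lemma some smooth functions have these derivatives; they
  are the coordinates of a section.\<close>

lemma infinite_jet_exists:
  assumes x: "\<And>i. -1 \<le> i \<Longrightarrow> x i \<in> points (J i)"
    and comp: "\<And>i j. -1 \<le> i \<Longrightarrow> i \<le> j \<Longrightarrow> jet_projection E X \<pi> i j (x j) = x i"
  shows "\<exists>z\<in>Jinf. \<forall>i\<ge>-1. q i z = x i"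
proof -
  have "\<forall>k. \<exists>ps. snd ps \<in> sec (fst ps) \<and> x (int k) = jet_at E X \<pi> (int k) (fst ps) (snd ps)"
  proof
    fix k
    have "x (int k) \<in> points (J (int k))" by (rule x) simp
    then obtain p s where "s \<in> sec p" "x (int k) = jet_at E X \<pi> (int k) p s" by (rule points_JE)
    then show "\<exists>ps. snd ps \<in> sec (fst ps) \<and> x (int k) = jet_at E X \<pi> (int k) (fst ps) (snd ps)"
      by (intro exI[of _ "(p, s)"]) simp
  qed
  then obtain ps where ps: "\<forall>k. snd (ps k) \<in> sec (fst (ps k)) \<and> x (int k) = jet_at E X \<pi> (int k) (fst (ps k)) (snd (ps k))"
    by (rule choice[THEN exE])
  define p where "p = fst (ps 0)"
  define t where "t k = snd (ps k)" for k
  have low: "jet_at E X \<pi> (int l) (fst (ps k)) (t k) = jet_at E X \<pi> (int l) (fst (ps l)) (t l)" if lk: "l \<le> k" for l k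
  proof -
    have "jet_projection E X \<pi> (int l) (int k) (x (int k)) = x (int l)" by (rule comp) (use lk in simp_all)
    then show ?thesis using jet_projection_jet_at[of "t k" "fst (ps k)" "int l" "int k"] ps lk by (simp add: t_def)
  qed
  have t': "t k \<in> sec (fst (ps k))" for k using ps by (simp add: t_def)
  have val: "fst (ps k) = p" "snd (t k) p = snd (t 0) p" for k
    using jet_at_value[OF t' t' low[of 0 k]] by (simp_all add: p_def)
  have t: "t k \<in> sec p" for k using t'[of k] val(1) by simp
  have xt: "x (int k) = jet_at E X \<pi> (int k) p (t k)" for k using ps val(1) by (simp add: t_def)
  have low: "jet_at E X \<pi> (int l) p (t k) = jet_at E X \<pi> (int l) p (t l)" if "l \<le> k" for l k
    using low[OF that] val(1) by simp
  obtain U u V v where c: "(U, u, V, v) \<in> fcharts" and e0: "snd (t 0) p \<in> V"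
    using fibered_chart[OF sec_points[OF t[of 0]]] by blast
  have e: "snd (t k) p \<in> V" for k using e0 val(2)[of k] by simp
  have pU: "p \<in> U" using fchart(3)[OF c e0] sec_proj[OF t[of 0]] by simp
  have up: "u p \<in> cart bdim" by (rule chart_inv(4)[OF fchart(1)[OF c] pU])
  \<comment> \<open>A derivative of order \<open>length I\<close> is read off from the jet of that order.\<close>
  define c0 where "c0 a I = iterated_partial I (scoord (U, u, V, v) (t (length I)) a) (u p)" for a I
  have "\<forall>a. \<exists>g. smooth_real_on bdim (cart bdim) g \<and>
    (\<forall>I. set I \<subseteq> {..<bdim} \<and> sorted I \<longrightarrow> iterated_partial I g (u p) = c0 a I)"
    by (intro allI borel_lemma up)
  then obtain g where g: "\<forall>a. smooth_real_on bdim (cart bdim) (g a) \<and>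
    (\<forall>I. set I \<subseteq> {..<bdim} \<and> sorted I \<longrightarrow> iterated_partial I (g a) (u p) = c0 a I)"
    by (rule choice[THEN exE])
  have g0: "g a (u p) = scoord (U, u, V, v) (t 0) a (u p)" for a
    using spec[OF conjunct2[OF spec[OF g, of a]], of "[]"] by (simp add: c0_def)
  have "v (snd (t 0) p) = glue bdim (u p) (\<lambda>a. if a < fdim then scoord (U, u, V, v) (t 0) a (u p) else 0)"
    by (rule section_in_chart[OF c t, of p V]) (rule sdom_mem[OF c t], use e0 in simp)
  then have in_V: "glue bdim (u p) (\<lambda>a. if a < fdim then g a (u p) else 0) \<in> v ` V"
    using e0 unfolding g0 by (metis imageI)
  have gs: "smooth_real_on bdim (cart bdim) (g a)" for a using g by blast
  obtain s T where s: "s \<in> sec p" "snd s p \<in> V"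
    and "v (snd s p) = glue bdim (u p) (\<lambda>a. if a < fdim then g a (u p) else 0)"
    and T: "cart_open bdim T" "u p \<in> T" and "T \<subseteq> u ` U" and Tg: "\<forall>x\<in>T. \<forall>a<fdim. scoord (U, u, V, v) s a x = g a x"
    by (rule section_from_coords[OF c pU, where g = g]) (rule gs, rule in_V)
  have "jcoord k (U, u, V, v) p s = jcoord k (U, u, V, v) p (t k)" for k
  proof
    fix i
    show "jcoord k (U, u, V, v) p s i = jcoord k (U, u, V, v) p (t k) i"
    proof (cases "bdim \<le> i \<and> i < jet_dim E X k")
      case False
      then show ?thesis by (auto simp: jcoord_def)
    next
      case True
      define j where "j = i - bdim"
      have j: "i = bdim + j" "j < length (jet_coord_list bdim fdim k)"
        using True by (auto simp: j_def jet_dim_def)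
      obtain I a where Ia: "jet_coord_list bdim fdim k ! j = (I, a)" by (rule prod.exhaust)
      note I = jet_coord_list_nth[OF j(2) Ia]
      have "iterated_partial I (scoord (U, u, V, v) s a) (u p) = iterated_partial I (g a) (u p)"
        by (rule iterated_partial_cong[OF T(1) I(1) _ T(2)]) (use Tg I(4) in simp)
      also have "\<dots> = iterated_partial I (scoord (U, u, V, v) (t (length I)) a) (u p)"
        using g I(1,2) by (simp add: c0_def)
      also have "\<dots> = iterated_partial I (scoord (U, u, V, v) (t k) a) (u p)"
      proof -
        have "jet_equivalent E X \<pi> (enat (length I)) p (t (length I)) (t k)"
          using low[OF I(3)] jet_at_eq_iff[OF t t] by metis
        then have "agree (length I) bdim (u p) (scoord (U, u, V, v) (t (length I)) a) (scoord (U, u, V, v) (t k) a)"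
          using jet_equivalent_iff[OF c t t e] I(4) by blast
        then show ?thesis using I(1) unfolding agree_iff_iterated by blast
      qed
      finally show ?thesis unfolding j(1) jcoord_simps(2)[OF j(2) Ia] .
    qed
  qed
  then have all: "q (int k) (jet_class E X \<pi> \<infinity> p s) = x (int k)" for k
    using jcoord_eq_iff[OF c s t e] xt infinite_jet_projection_class[OF s(1)] by metis
  have "q i (jet_class E X \<pi> \<infinity> p s) = x i" if i: "-1 \<le> i" for i
  proof (cases "0 \<le> i")
    case True
    then show ?thesis using all[of "nat i"] by simp
  next
    case False
    then have i1: "i = -1" using i by simp
    have "q (-1) (jet_class E X \<pi> \<infinity> p s) = jet_projection E X \<pi> (-1) 0 (q 0 (jet_class E X \<pi> \<infinity> p s))"
      by (rule jet_projection_infinite[symmetric]) (simp_all add: infinite_jetI[OF s(1)])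
    also have "\<dots> = x (-1)" using all[of 0] comp[of "-1" 0] by simp
    finally show ?thesis unfolding i1 .
  qed
  then show ?thesis using infinite_jetI[OF s(1)] by blast
qed

lemma topspace_P: "topspace P = Jinf"
  unfolding infinite_jet_topology_def initial_topology_def by auto

lemma open_preimage:
  assumes "-1 \<le> i" "openin (mtop (J i)) V" shows "openin P {x \<in> Jinf. q i x \<in> V}"
  unfolding infinite_jet_topology_def initial_topology_def
  by (rule topology_generated_by_Basis) (use assms in auto)

lemma open_level_preimage:
  assumes "-1 \<le> i" "i \<le> j" "openin (mtop (J i)) V"
  shows "openin (mtop (J j)) {z \<in> points (J j). jet_projection E X \<pi> i j z \<in> V}"
  using smooth_map_jet_projection[OF assms(1,2)] assms(3) unfolding smooth_map_def
  by (intro openin_continuous_map_preimage) auto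

text \<open>The levels are directed, so that the preimages of open sets of single levels, which generate the
  topology, are even a basis.\<close>

lemma infinite_jet_basis:
  assumes "openin P A" "x \<in> A"
  shows "\<exists>i\<ge>-1. \<exists>V. openin (mtop (J i)) V \<and> q i x \<in> V \<and> {y \<in> Jinf. q i y \<in> V} \<subseteq> A"
proof -
  define B where "B = insert Jinf {{x \<in> Jinf. q i x \<in> V} |i V. i \<in> {-1..} \<and> openin (mtop (J i)) V}"
  have "generate_topology_on B A"
    using assms(1) unfolding infinite_jet_topology_def initial_topology_def B_def
    by (rule openin_topology_generated_by)
  then have "A \<subseteq> Jinf \<and> (\<forall>x\<in>A. \<exists>i\<ge>-1. \<exists>V. openin (mtop (J i)) V \<and> q i x \<in> V \<and> {y \<in> Jinf. q i y \<in> V} \<subseteq> A)"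
  proof induction
    case (Int A A')
    show ?case
    proof (intro conjI ballI)
      show "A \<inter> A' \<subseteq> Jinf" using Int.IH by blast
      fix x assume x: "x \<in> A \<inter> A'"
      then have xJ: "x \<in> Jinf" using Int.IH by blast
      obtain i V where i: "-1 \<le> i" "openin (mtop (J i)) V" "q i x \<in> V" "{y \<in> Jinf. q i y \<in> V} \<subseteq> A"
        using Int.IH(1) x by blast
      obtain j W where j: "-1 \<le> j" "openin (mtop (J j)) W" "q j x \<in> W" "{y \<in> Jinf. q j y \<in> W} \<subseteq> A'"
        using Int.IH(2) x by blast
      define k where "k = max i j"
      have k: "i \<le> k" "j \<le> k" "-1 \<le> k" using i(1) by (auto simp: k_def)
      let ?V = "{z \<in> points (J k). jet_projection E X \<pi> i k z \<in> V} \<inter> {z \<in> points (J k). jet_projection E X \<pi> j k z \<in> W}"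
      have m: "q k y \<in> ?V \<longleftrightarrow> q i y \<in> V \<and> q j y \<in> W" if "y \<in> Jinf" for y
        using infinite_jet_projection_points[OF that] jet_projection_infinite[OF k(1) that] jet_projection_infinite[OF k(2) that]
        by simp
      have "openin (mtop (J k)) ?V"
        by (intro openin_Int open_level_preimage i j k)
      moreover have "q k x \<in> ?V" using m[OF xJ] i(3) j(3) by blast
      moreover have "{y \<in> Jinf. q k y \<in> ?V} \<subseteq> A \<inter> A'"
      proof
        fix y assume y: "y \<in> {y \<in> Jinf. q k y \<in> ?V}"
        then have yJ: "y \<in> Jinf" and "q k y \<in> ?V" by blast+
        then have "q i y \<in> V" "q j y \<in> W" using m[OF yJ] by blast+
        then show "y \<in> A \<inter> A'" using yJ i(4) j(4) by blast
      qed
      ultimately show "\<exists>i\<ge>-1. \<exists>V. openin (mtop (J i)) V \<and> q i x \<in> V \<and> {y \<in> Jinf. q i y \<in> V} \<subseteq> A \<inter> A'"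
        using k(3) by blast
    qed
  next
    case (UN K)
    show ?case
    proof (intro conjI ballI)
      show "\<Union>K \<subseteq> Jinf" using UN.IH by blast
      fix x assume "x \<in> \<Union>K"
      then obtain A where A: "A \<in> K" "x \<in> A" by blast
      then obtain i V where "-1 \<le> i" "openin (mtop (J i)) V" "q i x \<in> V" "{y \<in> Jinf. q i y \<in> V} \<subseteq> A"
        using UN.IH[OF A(1)] by blast
      then show "\<exists>i\<ge>-1. \<exists>V. openin (mtop (J i)) V \<and> q i x \<in> V \<and> {y \<in> Jinf. q i y \<in> V} \<subseteq> \<Union>K" using A(1) by blast
    qed
  next
    case (Basis A)
    then consider "A = Jinf" | i V where "-1 \<le> i" "openin (mtop (J i)) V" "A = {x \<in> Jinf. q i x \<in> V}"
      unfolding B_def by auto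
    then show ?case
    proof cases
      case 1
      have "\<exists>i\<ge>-1. \<exists>V. openin (mtop (J i)) V \<and> q i x \<in> V \<and> {y \<in> Jinf. q i y \<in> V} \<subseteq> A" if "x \<in> Jinf" for x
        using infinite_jet_projection_points[OF that, of 0] 1 by (intro exI[of _ 0] conjI exI[of _ "points (J 0)"]) auto
      then show ?thesis using 1 by blast
    next
      case 2
      then show ?thesis by blast
    qed
  qed simp
  then show ?thesis using assms(2) by blast
qed

lemma projective_cone_infinite: "projective_cone {-1..} (\<lambda>i. mtop (J i)) (jet_projection E X \<pi>) P q"
  unfolding projective_cone_def topspace_P
proof (intro conjI ballI impI)
  show "continuous_map P (mtop (J i)) (q i)" if "i \<in> {-1..}" for i
    unfolding continuous_map_def topspace_P using open_preimage infinite_jet_projection_points that by auto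
qed (rule jet_projection_infinite)

text \<open>Existence and uniqueness of the mediating map hold pointwise, by \<open>infinite_jet_exists\<close> and
  \<open>infinite_jet_eqI\<close>. It is continuous, because the topology on infinite jets is the initial one.\<close>

lemma projective_limit_infinite: "projective_limit {-1..} (\<lambda>i. mtop (J i)) (jet_projection E X \<pi>) P q"
  unfolding projective_limit_def
proof (intro conjI projective_cone_infinite allI impI)
  fix Z :: "(int \<Rightarrow> ('x, 'e) jet) topology" and \<nu>
  assume cone: "projective_cone {-1..} (\<lambda>i. mtop (J i)) (jet_projection E X \<pi>) Z \<nu>"
  have cont: "continuous_map Z (mtop (J i)) (\<nu> i)" if "-1 \<le> i" for i
    using cone that by (simp add: projective_cone_def)
  have "\<exists>w\<in>Jinf. \<forall>i\<ge>-1. q i w = \<nu> i z" if z: "z \<in> topspace Z" for z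
  proof (rule infinite_jet_exists)
    show "\<nu> i z \<in> points (J i)" if "-1 \<le> i" for i using cont[OF that] z by (auto simp: continuous_map_def)
    show "jet_projection E X \<pi> i j (\<nu> j z) = \<nu> i z" if "-1 \<le> i" "i \<le> j" for i j
      using cone that z by (simp add: projective_cone_def)
  qed
  then have "\<forall>z\<in>topspace Z. \<exists>w. w \<in> Jinf \<and> (\<forall>i\<ge>-1. q i w = \<nu> i z)" by blast
  then obtain h where h: "\<forall>z\<in>topspace Z. h z \<in> Jinf \<and> (\<forall>i\<ge>-1. q i (h z) = \<nu> i z)" by (rule bchoice[THEN exE])
  show "\<exists>!h. mediating_map {-1..} P q Z \<nu> h"
  proof (rule ex1I)
    have "continuous_map Z P (restrict h (topspace Z))"
      unfolding infinite_jet_topology_def initial_topology_def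
    proof (rule continuous_on_generated_topo)
      fix A assume "A \<in> insert Jinf {{x \<in> Jinf. q i x \<in> V} |i V. i \<in> {-1..} \<and> openin (mtop (J i)) V}"
      then consider "A = Jinf" | i V where "-1 \<le> i" "openin (mtop (J i)) V" "A = {x \<in> Jinf. q i x \<in> V}"
        by auto
      then show "openin Z (restrict h (topspace Z) -` A \<inter> topspace Z)"
      proof cases
        case 1
        then have "restrict h (topspace Z) -` A \<inter> topspace Z = topspace Z" using h by auto
        then show ?thesis by simp
      next
        case 2
        then have "restrict h (topspace Z) -` A \<inter> topspace Z = {z \<in> topspace Z. \<nu> i z \<in> V}" using h by auto
        then show ?thesis using openin_continuous_map_preimage[OF cont[OF 2(1)] 2(2)] by simp
      qed
    qed (use h in auto)
    then show "mediating_map {-1..} P q Z \<nu> (restrict h (topspace Z))"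
      unfolding mediating_map_def using h by simp
    fix h' assume h': "mediating_map {-1..} P q Z \<nu> h'"
    show "h' = restrict h (topspace Z)"
    proof (rule extensionalityI[of _ "topspace Z"])
      show "h' \<in> extensional (topspace Z)" using h' by (simp add: mediating_map_def)
      fix z assume z: "z \<in> topspace Z"
      have "h' z \<in> Jinf" using h' z unfolding mediating_map_def continuous_map_def topspace_P by blast
      moreover have "q (int k) (h' z) = q (int k) (h z)" for k
        using h' z h unfolding mediating_map_def by simp
      ultimately have "h' z = h z" using h z by (intro infinite_jet_eqI) auto
      then show "h' z = restrict h (topspace Z) z" using z by simp
    qed simp
  qed
qed

subsection \<open>Local functions of finite order\<close>

text \<open>Membership of \<open>f\<close> in the structure sheaf near \<open>x\<close>, with the equation \<open>f = g \<circ> q i\<close> on a neighbourhood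
  \<open>A\<close> of \<open>x\<close> that need not come from level \<open>i\<close>. In this form the condition is invariant under
  shrinking \<open>A\<close>.\<close>

definition finite_order :: "('x, 'e) jet_class \<Rightarrow> (('x, 'e) jet_class \<Rightarrow> real) \<Rightarrow> int \<Rightarrow> bool" where
  "finite_order x f i \<longleftrightarrow> (\<exists>V g A. openin (mtop (J i)) V \<and> q i x \<in> V \<and> (\<forall>z\<in>V. smooth_fun_at (J i) g z) \<and>
     openin P A \<and> x \<in> A \<and> (\<forall>y\<in>A. f y = g (q i y)))"

text \<open>A function that is smooth on one level is smooth on all higher levels; functions of different
  orders can therefore be compared on a common level.\<close>

lemma finite_order_mono:
  assumes f: "finite_order x f i" and ij: "-1 \<le> i" "i \<le> j" shows "finite_order x f j"
proof -
  obtain V g A where V: "openin (mtop (J i)) V" "q i x \<in> V" "\<forall>z\<in>V. smooth_fun_at (J i) g z"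
    and A: "openin P A" "x \<in> A" "\<forall>y\<in>A. f y = g (q i y)"
    using f unfolding finite_order_def by blast
  have AJ: "A \<subseteq> Jinf" using openin_subset[OF A(1)] by (simp add: topspace_P)
  let ?p = "jet_projection E X \<pi> i j"
  let ?V = "{z \<in> points (J j). ?p z \<in> V}"
  have "openin (mtop (J j)) ?V" by (rule open_level_preimage[OF ij V(1)])
  moreover have "q j x \<in> ?V"
    using infinite_jet_projection_points[OF subsetD[OF AJ A(2)]] jet_projection_infinite[OF ij(2) subsetD[OF AJ A(2)]] V(2)
    by simp
  moreover have "\<forall>z\<in>?V. smooth_fun_at (J j) (\<lambda>z. g (?p z)) z"
  proof
    fix z assume z: "z \<in> ?V"
    then have "smooth_at (J j) (J i) ?p z"
      using smooth_map_jet_projection[OF ij] smooth_map_iff[OF smooth_manifold_J smooth_manifold_J] by blast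
    then show "smooth_fun_at (J j) (\<lambda>z. g (?p z)) z"
      by (rule smooth_fun_at_compose[OF smooth_manifold_J smooth_manifold_J]) (use V(3) z in blast)
  qed
  moreover have "\<forall>y\<in>A. f y = g (?p (q j y))" using A(3) AJ jet_projection_infinite[OF ij(2)] by (metis subsetD)
  ultimately show ?thesis unfolding finite_order_def using A(1,2) by blast
qed

lemma finite_order_binary:
  assumes f: "finite_order x f i" and g: "finite_order x g i"
    and op: "\<And>a b z. smooth_fun_at (J i) a z \<Longrightarrow> smooth_fun_at (J i) b z \<Longrightarrow> smooth_fun_at (J i) (\<lambda>z. h (a z) (b z)) z"
  shows "finite_order x (\<lambda>y. h (f y) (g y)) i"
proof -
  obtain V a A where V: "openin (mtop (J i)) V" "q i x \<in> V" "\<forall>z\<in>V. smooth_fun_at (J i) a z"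
    and A: "openin P A" "x \<in> A" "\<forall>y\<in>A. f y = a (q i y)"
    using f unfolding finite_order_def by blast
  obtain W b B where W: "openin (mtop (J i)) W" "q i x \<in> W" "\<forall>z\<in>W. smooth_fun_at (J i) b z"
    and B: "openin P B" "x \<in> B" "\<forall>y\<in>B. g y = b (q i y)"
    using g unfolding finite_order_def by blast
  have "openin (mtop (J i)) (V \<inter> W) \<and> q i x \<in> V \<inter> W \<and> (\<forall>z\<in>V \<inter> W. smooth_fun_at (J i) (\<lambda>z. h (a z) (b z)) z) \<and>
    openin P (A \<inter> B) \<and> x \<in> A \<inter> B \<and> (\<forall>y\<in>A \<inter> B. h (f y) (g y) = h (a (q i y)) (b (q i y)))"
    using V W A B op by auto
  then show ?thesis unfolding finite_order_def by (intro exI)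
qed

definition local_order :: "('x, 'e) jet_class \<Rightarrow> (('x, 'e) jet_class \<Rightarrow> real) \<Rightarrow> bool" where
  "local_order x f \<longleftrightarrow> (\<exists>i\<ge>-1. finite_order x f i)"

lemma local_order_binary:
  assumes f: "local_order x f" and g: "local_order x g"
    and op: "\<And>i a b z. smooth_fun_at (J i) a z \<Longrightarrow> smooth_fun_at (J i) b z \<Longrightarrow> smooth_fun_at (J i) (\<lambda>z. h (a z) (b z)) z"
  shows "local_order x (\<lambda>y. h (f y) (g y))"
proof -
  obtain i j where i: "-1 \<le> i" "finite_order x f i" and j: "-1 \<le> j" "finite_order x g j"
    using f g unfolding local_order_def by blast
  have "finite_order x (\<lambda>y. h (f y) (g y)) (max i j)"
    by (rule finite_order_binary[OF finite_order_mono[OF i(2,1)] finite_order_mono[OF j(2,1)] op]) auto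
  then show ?thesis unfolding local_order_def using i(1) by (intro exI[of _ "max i j"]) simp
qed

lemma local_order_cong:
  assumes W: "openin P W" "x \<in> W" "\<And>y. y \<in> W \<Longrightarrow> f y = g y" and f: "local_order x f"
  shows "local_order x g"
proof -
  obtain i V a A where i: "-1 \<le> i" and V: "openin (mtop (J i)) V" "q i x \<in> V" "\<forall>z\<in>V. smooth_fun_at (J i) a z"
    and A: "openin P A" "x \<in> A" "\<forall>y\<in>A. f y = a (q i y)"
    using f unfolding local_order_def finite_order_def by blast
  have "openin P (A \<inter> W) \<and> x \<in> A \<inter> W \<and> (\<forall>y\<in>A \<inter> W. g y = a (q i y))" using A W by auto
  then show ?thesis unfolding local_order_def finite_order_def using i V by blast
qed

lemma local_order_const:
  assumes "x \<in> Jinf" shows "local_order x (\<lambda>_. c)"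
proof -
  have "openin (mtop (J 0)) (points (J 0)) \<and> q 0 x \<in> points (J 0) \<and> (\<forall>z\<in>points (J 0). smooth_fun_at (J 0) (\<lambda>_. c) z) \<and>
    openin P Jinf \<and> x \<in> Jinf \<and> (\<forall>y\<in>Jinf. c = (\<lambda>_. c) (q 0 y))"
    using infinite_jet_projection_points[OF assms] smooth_fun_at_const[OF smooth_manifold_J] assms openin_topspace[of P]
    unfolding topspace_P by simp
  then have "finite_order x (\<lambda>_. c) 0" unfolding finite_order_def by (intro exI)
  then show ?thesis unfolding local_order_def by (intro exI[of _ 0]) simp
qed

text \<open>Continuity, which the definition of the structure sheaf demands separately, follows from
  smoothness on a level.\<close>

lemma local_order_continuous:
  assumes f: "local_order x f" and W: "open W" "f x \<in> W"
  shows "\<exists>B. openin P B \<and> x \<in> B \<and> f ` B \<subseteq> W"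
proof -
  obtain i V a A where i: "-1 \<le> i" and V: "openin (mtop (J i)) V" "q i x \<in> V" "\<forall>z\<in>V. smooth_fun_at (J i) a z"
    and A: "openin P A" "x \<in> A" "\<forall>y\<in>A. f y = a (q i y)"
    using f unfolding local_order_def finite_order_def by blast
  obtain B where B: "openin (mtop (J i)) B" "q i x \<in> B" "a ` B \<subseteq> W"
    using smooth_fun_at_continuous[OF smooth_manifold_J bspec[OF V(3,2)] W(1)] A(2,3) W(2) by auto
  have "openin P (A \<inter> {y \<in> Jinf. q i y \<in> B})" by (rule openin_Int[OF A(1) open_preimage[OF i B(1)]])
  moreover have "x \<in> A \<inter> {y \<in> Jinf. q i y \<in> B}" using A(2) B(2) openin_subset[OF A(1)] by (auto simp: topspace_P)
  moreover have "f ` (A \<inter> {y \<in> Jinf. q i y \<in> B}) \<subseteq> W" using A(3) B(3) by auto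
  ultimately show ?thesis by blast
qed

lemma local_order_inverse:
  assumes f: "local_order x f" and nz: "f x \<noteq> 0" shows "local_order x (\<lambda>y. inverse (f y))"
proof -
  obtain i V a A where i: "-1 \<le> i" and V: "openin (mtop (J i)) V" "q i x \<in> V" "\<forall>z\<in>V. smooth_fun_at (J i) a z"
    and A: "openin P A" "x \<in> A" "\<forall>y\<in>A. f y = a (q i y)"
    using f unfolding local_order_def finite_order_def by blast
  have "open (- {0::real})" by (simp add: open_Compl)
  then obtain B where B: "openin (mtop (J i)) B" "q i x \<in> B" "a ` B \<subseteq> - {0}"
    using smooth_fun_at_continuous[OF smooth_manifold_J bspec[OF V(3,2)]] A(2,3) nz by (metis ComplI singletonD)
  have "openin (mtop (J i)) (V \<inter> B) \<and> q i x \<in> V \<inter> B" using V B by auto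
  moreover have "\<forall>z\<in>V \<inter> B. smooth_fun_at (J i) (\<lambda>z. inverse (a z)) z"
    using V(3) B(3) by (intro ballI smooth_fun_at_inverse[OF smooth_manifold_J]) auto
  moreover have "\<forall>y\<in>A. inverse (f y) = inverse (a (q i y))" using A(3) by simp
  ultimately show ?thesis unfolding local_order_def finite_order_def using i A(1,2) by blast
qed

text \<open>Shrinking \<open>A\<close> to the preimage of an open set of a single level, and passing to a common level,
  turns the local condition into the one that defines the structure sheaf.\<close>

lemma locally_level_smooth_iff:
  assumes A: "openin P A"
  shows "locally_level_smooth P {-1..} J q A = {f \<in> extensional A. \<forall>x\<in>A. local_order x f}"
proof -
  have AJ: "A \<subseteq> Jinf" using openin_subset[OF A] by (simp add: topspace_P)
  let ?Q = "\<lambda>f x i V g. openin (mtop (J i)) V \<and> smooth_function_on (J i) V g \<and>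
    x \<in> topspace P \<inter> q i -` V \<and> topspace P \<inter> q i -` V \<subseteq> A \<and> (\<forall>y\<in>topspace P \<inter> q i -` V. f y = g (q i y))"
  have of_level: "local_order x f" if i: "-1 \<le> i" and Q: "?Q f x i V g" for f x i V g
  proof -
    have V: "openin (mtop (J i)) V" "smooth_function_on (J i) V g" "x \<in> Jinf" "q i x \<in> V"
      "\<forall>y\<in>topspace P \<inter> q i -` V. f y = g (q i y)"
      using Q by (auto simp: topspace_P)
    have "\<forall>z\<in>V. smooth_fun_at (J i) g z" using V(1,2) smooth_function_on_iff[OF smooth_manifold_J V(1)] by blast
    moreover have "openin P {y \<in> Jinf. q i y \<in> V} \<and> x \<in> {y \<in> Jinf. q i y \<in> V} \<and> (\<forall>y\<in>{y \<in> Jinf. q i y \<in> V}. f y = g (q i y))"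
      using open_preimage[OF i V(1)] V(3-5) by (auto simp: topspace_P)
    ultimately show ?thesis unfolding local_order_def finite_order_def using i V(1,4) by blast
  qed
  have to_level: "\<exists>i\<in>{-1..}. \<exists>V g. ?Q f x i V g" if x: "x \<in> A" and f: "local_order x f" for f x
  proof -
    obtain i0 where i0: "-1 \<le> i0" "finite_order x f i0" using f unfolding local_order_def by blast
    obtain V g B where V: "openin (mtop (J i0)) V" "q i0 x \<in> V" "\<forall>z\<in>V. smooth_fun_at (J i0) g z"
      and B: "openin P B" "x \<in> B" "\<forall>y\<in>B. f y = g (q i0 y)"
      using i0(2) unfolding finite_order_def by blast
    obtain j W where j: "-1 \<le> j" "openin (mtop (J j)) W" "q j x \<in> W" "{y \<in> Jinf. q j y \<in> W} \<subseteq> A \<inter> B"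
      using infinite_jet_basis[OF openin_Int[OF A B(1)]] x B(2) by blast
    define k where "k = max i0 j"
    have k: "i0 \<le> k" "j \<le> k" "-1 \<le> k" using j(1) by (auto simp: k_def)
    let ?p = "\<lambda>i. jet_projection E X \<pi> i k"
    let ?V = "{z \<in> points (J k). ?p i0 z \<in> V} \<inter> {z \<in> points (J k). ?p j z \<in> W}"
    have m: "q k y \<in> ?V \<longleftrightarrow> q i0 y \<in> V \<and> q j y \<in> W" if "y \<in> Jinf" for y
      using infinite_jet_projection_points[OF that] jet_projection_infinite[OF k(1) that] jet_projection_infinite[OF k(2) that]
      by simp
    have oV: "openin (mtop (J k)) ?V" by (intro openin_Int open_level_preimage V(1) j(1,2) i0 k)
    have sub: "y \<in> A \<inter> B" if "y \<in> topspace P \<inter> q k -` ?V" for y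
      using that m[of y] j(4) unfolding topspace_P by blast
    have "\<forall>z\<in>?V. smooth_fun_at (J k) (\<lambda>z. g (?p i0 z)) z"
    proof
      fix z assume z: "z \<in> ?V"
      then have "smooth_at (J k) (J i0) (?p i0) z"
        using smooth_map_jet_projection[OF i0(1) k(1)] smooth_map_iff[OF smooth_manifold_J smooth_manifold_J] by blast
      then show "smooth_fun_at (J k) (\<lambda>z. g (?p i0 z)) z"
        by (rule smooth_fun_at_compose[OF smooth_manifold_J smooth_manifold_J]) (use V(3) z in blast)
    qed
    then have "smooth_function_on (J k) ?V (\<lambda>z. g (?p i0 z))"
      using smooth_function_on_iff[OF smooth_manifold_J oV] by blast
    moreover have "x \<in> topspace P \<inter> q k -` ?V" using m[of x] V(2) j(3) x AJ unfolding topspace_P by blast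
    moreover have "\<forall>y\<in>topspace P \<inter> q k -` ?V. f y = g (?p i0 (q k y))"
    proof
      fix y assume y: "y \<in> topspace P \<inter> q k -` ?V"
      then have "y \<in> Jinf" by (simp add: topspace_P)
      then show "f y = g (?p i0 (q k y))" using B(3) sub[OF y] jet_projection_infinite[OF k(1)] by simp
    qed
    moreover have "topspace P \<inter> q k -` ?V \<subseteq> A" using sub by blast
    ultimately have "?Q f x k ?V (\<lambda>z. g (?p i0 z))" using oV by blast
    then have "\<exists>V g. ?Q f x k V g" by (intro exI)
    then show ?thesis by (rule bexI) (use k(3) in simp)
  qed
  have cont: "continuous_map (subtopology P A) euclideanreal f" if f: "\<forall>x\<in>A. local_order x f" for f
  proof -
    have "openin (subtopology P A) {x \<in> topspace (subtopology P A). f x \<in> W}" if W: "open W" for W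
    proof (subst openin_subopen, intro ballI)
      fix x assume "x \<in> {x \<in> topspace (subtopology P A). f x \<in> W}"
      then have x: "x \<in> A" "f x \<in> W" using AJ by (auto simp: topspace_P)
      obtain B where B: "openin P B" "x \<in> B" "f ` B \<subseteq> W"
        using local_order_continuous[OF bspec[OF f x(1)] W x(2)] by blast
      have "openin (subtopology P A) (B \<inter> A)" using B(1) by (rule openin_subtopology_Int)
      moreover have "B \<inter> A \<subseteq> {x \<in> topspace (subtopology P A). f x \<in> W}"
        using B(3) AJ by (auto simp: topspace_P)
      ultimately show "\<exists>T. openin (subtopology P A) T \<and> x \<in> T \<and> T \<subseteq> {x \<in> topspace (subtopology P A). f x \<in> W}"
        using B(2) x(1) by blast
    qed
    then show ?thesis unfolding continuous_map_def by simp
  qed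
  show ?thesis
  proof (intro equalityI subsetI)
    fix f assume f: "f \<in> locally_level_smooth P {-1..} J q A"
    have "local_order x f" if x: "x \<in> A" for x
    proof -
      obtain i V g where i: "i \<in> {-1..}" and Q: "?Q f x i V g"
        using f x unfolding locally_level_smooth_def by blast
      then show ?thesis by (intro of_level[OF _ Q]) (use i in simp)
    qed
    then show "f \<in> {f \<in> extensional A. \<forall>x\<in>A. local_order x f}"
      using f unfolding locally_level_smooth_def by blast
  next
    fix f assume f: "f \<in> {f \<in> extensional A. \<forall>x\<in>A. local_order x f}"
    then have l: "\<forall>x\<in>A. local_order x f" and e: "f \<in> extensional A" by blast+
    have "\<forall>x\<in>A. \<exists>i\<in>{-1..}. \<exists>V g. ?Q f x i V g" using to_level l by blast
    with cont[OF l] e show "f \<in> locally_level_smooth P {-1..} J q A"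
      unfolding locally_level_smooth_def by (intro CollectI conjI)
  qed
qed

lemma locally_ringed_infinite_jets: "locally_ringed_space (infinite_jet_space E X \<pi>)"
proof -
  interpret function_sheaf "infinite_jet_space E X \<pi>" P local_order
  proof
    show "sections (infinite_jet_space E X \<pi>) A = function_algebra A {f \<in> extensional A. \<forall>x\<in>A. local_order x f}"
      if "openin P A" for A
      using locally_level_smooth_iff[OF that] by (simp add: infinite_jet_space_def)
    show "local_order x (\<lambda>y. f y + g y)" if "local_order x f" "local_order x g" for x f g
      using that by (rule local_order_binary) (rule smooth_fun_at_add[OF smooth_manifold_J])
    show "local_order x (\<lambda>y. f y * g y)" if "local_order x f" "local_order x g" for x f g
      using that by (rule local_order_binary) (rule smooth_fun_at_mult[OF smooth_manifold_J])
    show "\<exists>W. openin P W \<and> x \<in> W \<and> (\<forall>y\<in>W. f y \<noteq> 0)" if f: "local_order x f" "f x \<noteq> 0" for x f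
    proof -
      have "open (- {0::real})" by (simp add: open_Compl)
      then obtain B where "openin P B" "x \<in> B" "f ` B \<subseteq> - {0}" using local_order_continuous[OF f(1)] f(2) by blast
      then show ?thesis by blast
    qed
    show "local_order x g" if "openin P W" "x \<in> W" "\<And>y. y \<in> W \<Longrightarrow> f y = g y" "local_order x f" for W x f g
      using that by (rule local_order_cong)
    show "local_order x (\<lambda>_. c)" if "x \<in> topspace P" for x c
      using that local_order_const by (simp add: topspace_P)
    show "local_order x (\<lambda>y. inverse (f y))" if "local_order x f" "f x \<noteq> 0" for x f
      using that by (rule local_order_inverse)
  qed (simp_all add: infinite_jet_space_def)
  show ?thesis by (rule locally_ringed)
qed

lemma smooth_projective_representation_jets:
  "smooth_projective_representation (infinite_jet_space E X \<pi>) (jet_representation E X \<pi>)"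
  unfolding smooth_projective_representation_def
  using locally_ringed_infinite_jets smooth_projective_system_jets projective_limit_infinite
  by (simp add: jet_representation_def infinite_jet_space_def)

end

text \<open>The transition maps \<open>trans_map R i i\<close>, which are the identity on points, serve as the maps
  between the levels of the two representations.\<close>

lemma equivalent_representations_refl:
  assumes "smooth_projective_representation M R"
  shows "equivalent_representations (topspace (space_top M)) R R"
proof -
  have sys: "smooth_projective_system (index R) (level R) (trans_map R)"
    and cone: "projective_cone (index R) (\<lambda>i. mtop (level R i)) (trans_map R) (space_top M) (proj_map R)"
    using assms by (auto simp: smooth_projective_representation_def projective_limit_def)
  note sys = sys[unfolded smooth_projective_system_def]
  have sub: "surjective_submersion (level R i) (level R i) (trans_map R i i)" if "i \<in> index R" for i
    using conjunct1[OF conjunct2[OF conjunct2[OF sys]]] that by simp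
  have comp: "trans_map R i j (trans_map R j k x) = trans_map R i k x"
    if "i \<in> index R" "j \<in> index R" "k \<in> index R" "i \<le> j" "j \<le> k" "x \<in> points (level R k)" for i j k x
    using conjunct2[OF conjunct2[OF conjunct2[OF conjunct2[OF sys]]]] that by simp
  have proj: "trans_map R i i (proj_map R i p) = proj_map R i p" if "i \<in> index R" "p \<in> topspace (space_top M)" for i p
    using conjunct2[OF cone[unfolded projective_cone_def]] that by simp
  show ?thesis
    unfolding equivalent_representations_def
    by (rule exI[of _ id], rule exI[of _ id], rule exI[of _ "\<lambda>a. trans_map R a a"], rule exI[of _ "\<lambda>a. trans_map R a a"])
      (simp add: strict_mono_on_def sub comp proj)
qed

theorem mainTheorem3:
  fixes E :: "'e manifold" and X :: "'x manifold" and F :: "'f manifold" and \<pi> :: "'e \<Rightarrow> 'x"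
  assumes "smooth_fiber_bundle E X F \<pi>"
  shows "smooth_projective_representation (infinite_jet_space E X \<pi>) (jet_representation E X \<pi>) \<and>
    jet_representation E X \<pi>
      \<in> representation_equivalence (infinite_jet_space E X \<pi>) `` {jet_representation E X \<pi>} \<and>
    pfd_manifold (infinite_jet_space E X \<pi>)
      (representation_equivalence (infinite_jet_space E X \<pi>) `` {jet_representation E X \<pi>})"
proof -
  interpret jet_bundle E X \<pi>
  proof
    show "mdim X \<le> mdim E" if ne: "points E \<noteq> {}"
    proof -
      obtain e where "e \<in> points E" using ne by blast
      then show ?thesis using fibered_chart_exists(1)[OF assms] by simp
    qed
    show "\<exists>U u V v. (U, u, V, v) \<in> fibered_charts E X \<pi> \<and> e \<in> V" if "e \<in> points E" for e
      using that by (rule fibered_chart_exists(2)[OF assms])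
  qed (use assms in \<open>simp_all add: smooth_fiber_bundle_def\<close>)
  let ?M = "infinite_jet_space E X \<pi>" and ?R = "jet_representation E X \<pi>"
  have R: "?R \<in> representations ?M"
    using smooth_projective_representation_jets by (simp add: representations_def)
  then have "(?R, ?R) \<in> representation_equivalence ?M"
    unfolding representation_equivalence_def
    using equivalent_representations_refl[OF smooth_projective_representation_jets] by blast
  moreover have "pfd_manifold ?M (representation_equivalence ?M `` {?R})"
    unfolding pfd_manifold_def pfd_structures_def using locally_ringed_infinite_jets quotientI[OF R] by blast
  ultimately show ?thesis using smooth_projective_representation_jets by blast
qed

end
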